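(* Let $(\Sigma,E)$ be a symmetric monoidal theory such that $\mathsf{Free}(\Sigma,E)$ is a semicartesian category with cancellative deletions. Then $\mathsf{Free}^{\infty}(\Sigma,E)\simeq \mathsf{Free}(\Sigma,E)^{\otimes\infty}_{\mathrm{expl}}$ via an ITP-preserving symmetric monoidal functor.
   Context: A semicartesian category is a symmetric monoidal category $(\mathsf{C},\otimes,I)$ whose unit $I$ is terminal; $\mathrm{del}_X\colon X\to I$ is the unique morphism. It has cancellative deletions if $f\otimes\mathrm{del}_X=g\otimes \mathrm{del}_X$ implies $f=g$ for all parallel $f,g$ and all objects $X$. Symmetric monoidal functors are always strong. For a countable set $J$, let $\mathsf{FinLO}(J)$ be the category whose objects are finite linearly ordered subsets of $J$, with a morphism $F\to F'$ whenever $F$ is an ordered subset of $F'$ (i.e. $F$ is contained in $F'$ and the inclusion preserves the order); such a morphism is written $F\subseteq F'$. A functor $X\colon \mathsf{FinLO}(J)^{\mathrm{op}}\to\mathsf{C}$ is an abstract infinite tensor product of the family $(X_j)_{j\in J}$ if it sends $F$ to $X_F:=\bigotimes_{j\in F}X_j$, and $F\subseteq F'$ to the morphism $\pi_{F',F}\colon X_{F'}\to X_F$ which deletes all factors $j\in F'\setminus F$ and keeps the rest unchanged (up to permutation, $\mathrm{id}_{X_F}\otimes\mathrm{del}_{X_{F'\setminus F}}$). One writes $J_X$ for $J$. A (concrete) infinite tensor product $\bigotimes_{j\in J}X_j$ is a limit of the abstract one, provided it is preserved by $-\otimes Y$ for all $Y$. A semicartesian category has infinite tensor products if every abstract infinite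 tensor product (with $J$ countable) has a concrete one. A symmetric monoidal functor $\phi$ between such categories is ITP-preserving if $\phi(\bigotimes_{j}X_j)$ is an infinite tensor product of $(\phi(X_j))_{j}$ (in particular, limit projections are preserved). Let $\mathsf{C}$ be semicartesian with cancellative deletions. A finite approximation family $f\colon X\to Y$ between abstract infinite tensor products consists of an index set $\Lambda_f\subseteq \mathsf{FinLO}(J_X)\times\mathsf{FinLO}(J_Y)$ (pairs of objects) and morphisms $(f_{F,G}\colon X_F\to Y_G)_{(F,G)\in\Lambda_f}$ such that: (Naturality) for $F'\supseteq F$, $G'\supseteq G$ with $(F,G),(F',G')\in\Lambda_f$, $\pi_{G',G}f_{F',G'}=f_{F,G}\pi_{F',F}$; (Covering) for every $G$ there is $F$ with $(F,G)\in\Lambda_f$; (Hereditariness) if $(F,G)\in\Lambda_f$ then $(F',G)\in\Lambda_f$ for every $F'\supseteq F$. Two families $f,f'\colon X\to Y$ are equivalent if they agree on $\Lambda_f\cap\Lambda_{f'}$. Fix an element $*$. $\mathsf{C}^{\otimes\infty}_{\mathrm{expl}}$ has as objects the abstract infinite tensor products $X$ with $*\in J_X$; morphisms are equivalence classes of finite approximation families; composition is $(gf)_{F,H}:=g_{G,H}f_{F,G}$ whenever $(F,G)\in\Lambda_f$, $(G,H)\in\Lambda_g$ for some $G$; $X\otimes Y$ is indexed by $J_X\cup J_Y$ and given by $F\mapsto X_{F\cap J_X}\otimes Y_{F\cap J_Y}$, with $(f\otimes g)_{F,G}:=f_{F\cap J_X,G\cap J_Z}\otimes g_{F\cap J_Y,G\cap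 J_W}$ for $f\colon X\to Z$, $g\colon Y\to W$; the unit is $\{*\}\mapsto I$ on $\mathsf{FinLO}(\{*\})$. A symmetric monoidal theory (SMT) $(\Sigma,E)$ is a signature $\Sigma$ of generators $o\colon m\to n$ ($m,n\in\mathbb{N}$) with a set $E$ of equations between $\Sigma$-terms (terms freely obtained by sequential and parallel composition from generators, identity $1\to1$, symmetry $2\to2$ and the empty diagram $0\to0$). $\mathsf{Free}(\Sigma,E)$ is the symmetric strict monoidal category with objects the natural numbers (tensor is addition) and morphisms $m\to n$ the $\Sigma$-terms of that type modulo $E$ and the laws of symmetric strict monoidal categories. For $(\Sigma,E)$ such that $\mathsf{Free}(\Sigma,E)$ is semicartesian with cancellative deletions, $\mathsf{Free}^\infty(\Sigma,E)$ is the category (with infinite tensor products) whose objects are the natural numbers together with one additional object $\infty$, and whose morphisms are (equivalence classes of) finite approximation families of $\Sigma$-terms modulo $E$, where $n\in\mathbb{N}$ is regarded as the abstract infinite tensor product indexed by $\{*\}$ with value $n$ at $*$, and $\infty$ as the abstract infinite tensor product indexed by $\mathbb{N}$ of the constant family $1$; families between natural numbers $m\to n$ are identified with the morphisms $m\to n$ of $\mathsf{Free}(\Sigma,E)$. Composition is computed pointwise as in $\mathsf{C}^{\otimes\infty}_{\mathrm{expl}}$. The tensor product is addition on natural numbers, $\infty\otimes N=N\otimes\infty=\infty$ for $N\in\mathbb{N}\cup\{\infty\}$, and on morphisms it is the pointwise tensor of families, reindexed along fixed chosen bijections $\mathbb{N}\sqcup\{0,\dots,n-1\}\cong\mathbb{N}$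 and $\mathbb{N}\sqcup\mathbb{N}\cong\mathbb{N}$ (associators, unitors and symmetries are the corresponding reindexings).
   Formalization: FinLO(J) has a morphism F→F' whenever F is contained in F' as a set, reorderings included; with order-preserving inclusions only, agreement of families on the common index set is not transitive, so morphisms of the explicit category are undefined. *)

theory Defs
  imports
    "HOL-Library.FuncSet"
    "HOL-Library.Countable_Set"
    "HOL-Library.Extended_Nat"
begin

section \<open>Categories and symmetric monoidal categories\<close>

record ('o, 'm) category =
  obj :: "'o set"
  hom :: "'o \<Rightarrow> 'o \<Rightarrow> 'm set"
  ide :: "'o \<Rightarrow> 'm"
  comp :: "'m \<Rightarrow> 'm \<Rightarrow> 'm" (infixr "\<cdot>\<index>" 70)

record ('o, 'm) smc = "('o, 'm) category" +
  munit :: "'o"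
  tenO :: "'o \<Rightarrow> 'o \<Rightarrow> 'o" (infixr "\<odot>\<index>" 75)
  tenM :: "'m \<Rightarrow> 'm \<Rightarrow> 'm" (infixr "\<otimes>\<index>" 75)
  assoc :: "'o \<Rightarrow> 'o \<Rightarrow> 'o \<Rightarrow> 'm"
  lunit :: "'o \<Rightarrow> 'm"
  runit :: "'o \<Rightarrow> 'm"
  braid :: "'o \<Rightarrow> 'o \<Rightarrow> 'm"

locale category =
  fixes C :: "('o, 'm, 'x) category_scheme" (structure)
  assumes ide_hom: "A \<in> obj C \<Longrightarrow> ide C A \<in> hom C A A"
    and comp_hom: "\<lbrakk>A \<in> obj C; B \<in> obj C; D \<in> obj C; f \<in> hom C A B; g \<in> hom C B D\<rbrakk>
      \<Longrightarrow> g \<cdot> f \<in> hom C A D"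
    and ide_left: "\<lbrakk>A \<in> obj C; B \<in> obj C; f \<in> hom C A B\<rbrakk> \<Longrightarrow> ide C B \<cdot> f = f"
    and ide_right: "\<lbrakk>A \<in> obj C; B \<in> obj C; f \<in> hom C A B\<rbrakk> \<Longrightarrow> f \<cdot> ide C A = f"
    and comp_assoc: "\<lbrakk>A \<in> obj C; B \<in> obj C; D \<in> obj C; K \<in> obj C;
        f \<in> hom C A B; g \<in> hom C B D; h \<in> hom C D K\<rbrakk> \<Longrightarrow> (h \<cdot> g) \<cdot> f = h \<cdot> (g \<cdot> f)"

definition inverse_in :: "('o, 'm, 'x) category_scheme \<Rightarrow> 'o \<Rightarrow> 'o \<Rightarrow> 'm \<Rightarrow> 'm \<Rightarrow> bool" where
  "inverse_in C A B f g \<longleftrightarrow> f \<in> hom C A B \<and> g \<in> hom C B A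
     \<and> g \<cdot>\<^bsub>C\<^esub> f = ide C A \<and> f \<cdot>\<^bsub>C\<^esub> g = ide C B"

definition iso_in :: "('o, 'm, 'x) category_scheme \<Rightarrow> 'o \<Rightarrow> 'o \<Rightarrow> 'm \<Rightarrow> bool" where
  "iso_in C A B f \<longleftrightarrow> (\<exists>g. inverse_in C A B f g)"

definition inv_of :: "('o, 'm, 'x) category_scheme \<Rightarrow> 'o \<Rightarrow> 'o \<Rightarrow> 'm \<Rightarrow> 'm" where
  "inv_of C A B f = (THE g. inverse_in C A B f g)"

text \<open>\<^term>\<open>assoc C A B D\<close> goes from \<^term>\<open>(A \<odot>\<^bsub>C\<^esub> B) \<odot>\<^bsub>C\<^esub> D\<close> to \<^term>\<open>A \<odot>\<^bsub>C\<^esub> (B \<odot>\<^bsub>C\<^esub> D)\<close>.\<close>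

locale symmetric_monoidal = category C
  for C :: "('o, 'm, 'x) smc_scheme" (structure) +
  assumes munit_obj: "munit C \<in> obj C"
    and tenO_obj: "\<lbrakk>A \<in> obj C; B \<in> obj C\<rbrakk> \<Longrightarrow> A \<odot> B \<in> obj C"
    and tenM_hom: "\<lbrakk>A \<in> obj C; B \<in> obj C; A' \<in> obj C; B' \<in> obj C; f \<in> hom C A B; g \<in> hom C A' B'\<rbrakk>
      \<Longrightarrow> f \<otimes> g \<in> hom C (A \<odot> A') (B \<odot> B')"
    and tenM_ide: "\<lbrakk>A \<in> obj C; B \<in> obj C\<rbrakk> \<Longrightarrow> ide C A \<otimes> ide C B = ide C (A \<odot> B)"
    and tenM_comp: "\<lbrakk>A \<in> obj C; B \<in> obj C; D \<in> obj C; A' \<in> obj C; B' \<in> obj C; D' \<in> obj C;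
        f \<in> hom C A B; g \<in> hom C B D; f' \<in> hom C A' B'; g' \<in> hom C B' D'\<rbrakk>
      \<Longrightarrow> (g \<cdot> f) \<otimes> (g' \<cdot> f') = (g \<otimes> g') \<cdot> (f \<otimes> f')"
    and assoc_iso: "\<lbrakk>A \<in> obj C; B \<in> obj C; D \<in> obj C\<rbrakk>
      \<Longrightarrow> iso_in C ((A \<odot> B) \<odot> D) (A \<odot> (B \<odot> D)) (assoc C A B D)"
    and assoc_nat: "\<lbrakk>A \<in> obj C; B \<in> obj C; D \<in> obj C; A' \<in> obj C; B' \<in> obj C; D' \<in> obj C;
        f \<in> hom C A A'; g \<in> hom C B B'; h \<in> hom C D D'\<rbrakk>
      \<Longrightarrow> assoc C A' B' D' \<cdot> ((f \<otimes> g) \<otimes> h) = (f \<otimes> (g \<otimes> h)) \<cdot> assoc C A B D"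
    and lunit_iso: "A \<in> obj C \<Longrightarrow> iso_in C (munit C \<odot> A) A (lunit C A)"
    and lunit_nat: "\<lbrakk>A \<in> obj C; B \<in> obj C; f \<in> hom C A B\<rbrakk>
      \<Longrightarrow> lunit C B \<cdot> (ide C (munit C) \<otimes> f) = f \<cdot> lunit C A"
    and runit_iso: "A \<in> obj C \<Longrightarrow> iso_in C (A \<odot> munit C) A (runit C A)"
    and runit_nat: "\<lbrakk>A \<in> obj C; B \<in> obj C; f \<in> hom C A B\<rbrakk>
      \<Longrightarrow> runit C B \<cdot> (f \<otimes> ide C (munit C)) = f \<cdot> runit C A"
    and braid_hom: "\<lbrakk>A \<in> obj C; B \<in> obj C\<rbrakk> \<Longrightarrow> braid C A B \<in> hom C (A \<odot> B) (B \<odot> A)"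
    and braid_nat: "\<lbrakk>A \<in> obj C; B \<in> obj C; A' \<in> obj C; B' \<in> obj C; f \<in> hom C A A'; g \<in> hom C B B'\<rbrakk>
      \<Longrightarrow> braid C A' B' \<cdot> (f \<otimes> g) = (g \<otimes> f) \<cdot> braid C A B"
    and braid_braid: "\<lbrakk>A \<in> obj C; B \<in> obj C\<rbrakk> \<Longrightarrow> braid C B A \<cdot> braid C A B = ide C (A \<odot> B)"
    and pentagon: "\<lbrakk>A \<in> obj C; B \<in> obj C; D \<in> obj C; K \<in> obj C\<rbrakk>
      \<Longrightarrow> assoc C A B (D \<odot> K) \<cdot> assoc C (A \<odot> B) D K
        = (ide C A \<otimes> assoc C B D K) \<cdot> assoc C A (B \<odot> D) K \<cdot> (assoc C A B D \<otimes> ide C K)"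
    and triangle: "\<lbrakk>A \<in> obj C; B \<in> obj C\<rbrakk>
      \<Longrightarrow> (ide C A \<otimes> lunit C B) \<cdot> assoc C A (munit C) B = runit C A \<otimes> ide C B"
    and hexagon: "\<lbrakk>A \<in> obj C; B \<in> obj C; D \<in> obj C\<rbrakk>
      \<Longrightarrow> assoc C B D A \<cdot> braid C A (B \<odot> D) \<cdot> assoc C A B D
        = (ide C B \<otimes> braid C A D) \<cdot> assoc C B A D \<cdot> (braid C A B \<otimes> ide C D)"

locale semicartesian = symmetric_monoidal +
  assumes munit_terminal: "A \<in> obj C \<Longrightarrow> \<exists>!f. f \<in> hom C A (munit C)"

definition del :: "('o, 'm, 'x) smc_scheme \<Rightarrow> 'o \<Rightarrow> 'm" where
  "del C A = (THE f. f \<in> hom C A (munit C))"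

definition cancellative_deletions :: "('o, 'm, 'x) smc_scheme \<Rightarrow> bool" where
  "cancellative_deletions C \<longleftrightarrow>
     (\<forall>A\<in>obj C. \<forall>B\<in>obj C. \<forall>X\<in>obj C. \<forall>f\<in>hom C A B. \<forall>g\<in>hom C A B.
        f \<otimes>\<^bsub>C\<^esub> del C X = g \<otimes>\<^bsub>C\<^esub> del C X \<longrightarrow> f = g)"


section \<open>Functors, equivalences, strong symmetric monoidal functors\<close>

definition is_functor :: "('o, 'm, 'x) category_scheme \<Rightarrow> ('p, 'n, 'y) category_scheme
    \<Rightarrow> ('o \<Rightarrow> 'p) \<Rightarrow> ('m \<Rightarrow> 'n) \<Rightarrow> bool" where
  "is_functor C D Fo Fm \<longleftrightarrow> category C \<and> category D
     \<and> (\<forall>A\<in>obj C. Fo A \<in> obj D)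
     \<and> (\<forall>A\<in>obj C. \<forall>B\<in>obj C. \<forall>f\<in>hom C A B. Fm f \<in> hom D (Fo A) (Fo B))
     \<and> (\<forall>A\<in>obj C. Fm (ide C A) = ide D (Fo A))
     \<and> (\<forall>A\<in>obj C. \<forall>B\<in>obj C. \<forall>K\<in>obj C. \<forall>f\<in>hom C A B. \<forall>g\<in>hom C B K.
          Fm (g \<cdot>\<^bsub>C\<^esub> f) = Fm g \<cdot>\<^bsub>D\<^esub> Fm f)"

definition nat_iso :: "('o, 'm, 'x) category_scheme \<Rightarrow> ('p, 'n, 'y) category_scheme
    \<Rightarrow> ('o \<Rightarrow> 'p) \<Rightarrow> ('m \<Rightarrow> 'n) \<Rightarrow> ('o \<Rightarrow> 'p) \<Rightarrow> ('m \<Rightarrow> 'n) \<Rightarrow> ('o \<Rightarrow> 'n) \<Rightarrow> bool" where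
  "nat_iso C D Fo Fm Go Gm \<tau> \<longleftrightarrow>
     (\<forall>A\<in>obj C. iso_in D (Fo A) (Go A) (\<tau> A))
     \<and> (\<forall>A\<in>obj C. \<forall>B\<in>obj C. \<forall>f\<in>hom C A B. \<tau> B \<cdot>\<^bsub>D\<^esub> Fm f = Gm f \<cdot>\<^bsub>D\<^esub> \<tau> A)"

definition is_equivalence :: "('o, 'm, 'x) category_scheme \<Rightarrow> ('p, 'n, 'y) category_scheme
    \<Rightarrow> ('o \<Rightarrow> 'p) \<Rightarrow> ('m \<Rightarrow> 'n) \<Rightarrow> bool" where
  "is_equivalence C D Fo Fm \<longleftrightarrow> is_functor C D Fo Fm
     \<and> (\<exists>Go Gm \<eta> \<epsilon>. is_functor D C Go Gm
          \<and> nat_iso C C id id (Go \<circ> Fo) (Gm \<circ> Fm) \<eta>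
          \<and> nat_iso D D (Fo \<circ> Go) (Fm \<circ> Gm) id id \<epsilon>)"

record ('o, 'm, 'p, 'n) smfunctor =
  fobj :: "'o \<Rightarrow> 'p"
  fmor :: "'m \<Rightarrow> 'n"
  fmul :: "'o \<Rightarrow> 'o \<Rightarrow> 'n"
  funit :: "'n"

locale symmetric_monoidal_functor =
  S: symmetric_monoidal C + T: symmetric_monoidal D
  for C :: "('o, 'm, 'x) smc_scheme" (structure)
    and D :: "('p, 'n, 'y) smc_scheme" (structure)
    and \<phi> :: "('o, 'm, 'p, 'n) smfunctor" +
  assumes underlying: "is_functor C D (fobj \<phi>) (fmor \<phi>)"
    and funit_iso: "iso_in D (munit D) (fobj \<phi> (munit C)) (funit \<phi>)"
    and fmul_iso: "\<lbrakk>A \<in> obj C; B \<in> obj C\<rbrakk>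
      \<Longrightarrow> iso_in D (fobj \<phi> A \<odot>\<^bsub>D\<^esub> fobj \<phi> B) (fobj \<phi> (A \<odot>\<^bsub>C\<^esub> B)) (fmul \<phi> A B)"
    and fmul_nat: "\<lbrakk>A \<in> obj C; B \<in> obj C; A' \<in> obj C; B' \<in> obj C; f \<in> hom C A A'; g \<in> hom C B B'\<rbrakk>
      \<Longrightarrow> fmul \<phi> A' B' \<cdot>\<^bsub>D\<^esub> (fmor \<phi> f \<otimes>\<^bsub>D\<^esub> fmor \<phi> g) = fmor \<phi> (f \<otimes>\<^bsub>C\<^esub> g) \<cdot>\<^bsub>D\<^esub> fmul \<phi> A B"
    and fmul_assoc: "\<lbrakk>A \<in> obj C; B \<in> obj C; K \<in> obj C\<rbrakk>
      \<Longrightarrow> fmor \<phi> (assoc C A B K) \<cdot>\<^bsub>D\<^esub> fmul \<phi> (A \<odot>\<^bsub>C\<^esub> B) K \<cdot>\<^bsub>D\<^esub> (fmul \<phi> A B \<otimes>\<^bsub>D\<^esub> ide D (fobj \<phi> K))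
        = fmul \<phi> A (B \<odot>\<^bsub>C\<^esub> K) \<cdot>\<^bsub>D\<^esub> (ide D (fobj \<phi> A) \<otimes>\<^bsub>D\<^esub> fmul \<phi> B K)
            \<cdot>\<^bsub>D\<^esub> assoc D (fobj \<phi> A) (fobj \<phi> B) (fobj \<phi> K)"
    and fmul_lunit: "A \<in> obj C
      \<Longrightarrow> fmor \<phi> (lunit C A) \<cdot>\<^bsub>D\<^esub> fmul \<phi> (munit C) A \<cdot>\<^bsub>D\<^esub> (funit \<phi> \<otimes>\<^bsub>D\<^esub> ide D (fobj \<phi> A))
        = lunit D (fobj \<phi> A)"
    and fmul_runit: "A \<in> obj C
      \<Longrightarrow> fmor \<phi> (runit C A) \<cdot>\<^bsub>D\<^esub> fmul \<phi> A (munit C) \<cdot>\<^bsub>D\<^esub> (ide D (fobj \<phi> A) \<otimes>\<^bsub>D\<^esub> funit \<phi>)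
        = runit D (fobj \<phi> A)"
    and fmul_braid: "\<lbrakk>A \<in> obj C; B \<in> obj C\<rbrakk>
      \<Longrightarrow> fmor \<phi> (braid C A B) \<cdot>\<^bsub>D\<^esub> fmul \<phi> A B = fmul \<phi> B A \<cdot>\<^bsub>D\<^esub> braid D (fobj \<phi> A) (fobj \<phi> B)"


section \<open>Infinite tensor products\<close>

text \<open>
  A finite linearly ordered subset of \<open>J\<close> is a repetition-free list of elements of \<open>J\<close>.
  There is an arrow between \<open>F\<close> and \<open>F'\<close> as soon as \<open>F\<close> is contained in \<open>F'\<close>: besides the
  order-preserving inclusions this includes the canonical permutation between two orderings
  of the same finite set.  With order-preserving inclusions only, \<open>[a, b]\<close> and \<open>[b, a]\<close> have
  no common upper bound, so that agreement of finite approximation families on the common part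
  of their index sets is not transitive, and already \<open>X\<^sub>a \<otimes> X\<^sub>b\<close> fails to be the limit of the
  diagram over \<open>{a, b}\<close>.  Pairs in \<open>FinLO_arr J\<close> are written \<open>(F', F)\<close>, larger set first.
\<close>

definition FinLO :: "'j set \<Rightarrow> 'j list set" where
  "FinLO J = {F. distinct F \<and> set F \<subseteq> J}"

definition FinLO_arr :: "'j set \<Rightarrow> ('j list \<times> 'j list) set" where
  "FinLO_arr J = {(F', F). F' \<in> FinLO J \<and> F \<in> FinLO J \<and> set F \<subseteq> set F'}"

text \<open>The data of a functor on the opposite of \<open>FinLO(J)\<close>; \<open>prj X (F', F)\<close> goes from
  \<open>ob X F'\<close> to \<open>ob X F\<close>.\<close>

record ('j, 'o, 'm) diagram =
  idx :: "'j set"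
  ob :: "'j list \<Rightarrow> 'o"
  prj :: "'j list \<times> 'j list \<Rightarrow> 'm"

definition is_cone :: "('o, 'm, 'x) category_scheme \<Rightarrow> ('j, 'o, 'm) diagram \<Rightarrow> 'o \<Rightarrow> ('j list \<Rightarrow> 'm) \<Rightarrow> bool"
  where "is_cone C X L p \<longleftrightarrow> L \<in> obj C
     \<and> (\<forall>F\<in>FinLO (idx X). p F \<in> hom C L (ob X F))
     \<and> (\<forall>(F', F)\<in>FinLO_arr (idx X). prj X (F', F) \<cdot>\<^bsub>C\<^esub> p F' = p F)"

definition is_limit :: "('o, 'm, 'x) category_scheme \<Rightarrow> ('j, 'o, 'm) diagram \<Rightarrow> 'o \<Rightarrow> ('j list \<Rightarrow> 'm) \<Rightarrow> bool"
  where "is_limit C X L p \<longleftrightarrow> is_cone C X L p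
     \<and> (\<forall>A q. is_cone C X A q \<longrightarrow>
          (\<exists>!u. u \<in> hom C A L \<and> (\<forall>F\<in>FinLO (idx X). p F \<cdot>\<^bsub>C\<^esub> u = q F)))"

fun big_tensor :: "('o, 'm, 'x) smc_scheme \<Rightarrow> ('j \<Rightarrow> 'o) \<Rightarrow> 'j list \<Rightarrow> 'o" where
  "big_tensor C X [] = munit C"
| "big_tensor C X (j # F) = X j \<odot>\<^bsub>C\<^esub> big_tensor C X F"

text \<open>The permutation moving the factor \<open>j\<close> of a repetition-free list to the front.\<close>

fun to_front :: "('o, 'm, 'x) smc_scheme \<Rightarrow> ('j \<Rightarrow> 'o) \<Rightarrow> 'j \<Rightarrow> 'j list \<Rightarrow> 'm" where
  "to_front C X j [] = undefined"
| "to_front C X j (i # F) =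
     (if i = j then ide C (big_tensor C X (i # F))
      else let R = big_tensor C X (remove1 j F) in
        assoc C (X j) (X i) R \<cdot>\<^bsub>C\<^esub> (braid C (X i) (X j) \<otimes>\<^bsub>C\<^esub> ide C R)
        \<cdot>\<^bsub>C\<^esub> inv_of C ((X i \<odot>\<^bsub>C\<^esub> X j) \<odot>\<^bsub>C\<^esub> R) (X i \<odot>\<^bsub>C\<^esub> (X j \<odot>\<^bsub>C\<^esub> R)) (assoc C (X i) (X j) R)
        \<cdot>\<^bsub>C\<^esub> (ide C (X i) \<otimes>\<^bsub>C\<^esub> to_front C X j F))"

text \<open>Move the factors in \<open>F\<close> to the front, in the order prescribed by \<open>F\<close>, and delete the rest.\<close>

fun proj :: "('o, 'm, 'x) smc_scheme \<Rightarrow> ('j \<Rightarrow> 'o) \<Rightarrow> 'j list \<Rightarrow> 'j list \<Rightarrow> 'm" where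
  "proj C X F' [] = del C (big_tensor C X F')"
| "proj C X F' (j # F) = (ide C (X j) \<otimes>\<^bsub>C\<^esub> proj C X (remove1 j F') F) \<cdot>\<^bsub>C\<^esub> to_front C X j F'"

definition std_itp :: "('o, 'm, 'x) smc_scheme \<Rightarrow> 'j set \<Rightarrow> ('j \<Rightarrow> 'o) \<Rightarrow> ('j, 'o, 'm) diagram" where
  "std_itp C J X = \<lparr> idx = J,
     ob = (\<lambda>F\<in>FinLO J. big_tensor C X F),
     prj = (\<lambda>(F', F)\<in>FinLO_arr J. proj C X F' F) \<rparr>"

text \<open>Finite tensor products are only determined up to bracketing and permutation, so an abstract
  infinite tensor product is a diagram naturally isomorphic to the standard one.  This makes
  them closed under \<open>F \<mapsto> X\<^sub>F \<otimes> Y\<^sub>F\<close>.\<close>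

definition abstract_itp_of :: "('o, 'm, 'x) smc_scheme \<Rightarrow> 'j set \<Rightarrow> ('j \<Rightarrow> 'o) \<Rightarrow> ('j, 'o, 'm) diagram \<Rightarrow> bool"
  where "abstract_itp_of C J X D \<longleftrightarrow> countable J \<and> (\<forall>j\<in>J. X j \<in> obj C)
     \<and> idx D = J \<and> ob D \<in> extensional (FinLO J) \<and> prj D \<in> extensional (FinLO_arr J)
     \<and> (\<forall>F\<in>FinLO J. ob D F \<in> obj C)
     \<and> (\<forall>(F', F)\<in>FinLO_arr J. prj D (F', F) \<in> hom C (ob D F') (ob D F))
     \<and> (\<exists>\<theta>. (\<forall>F\<in>FinLO J. iso_in C (ob D F) (ob (std_itp C J X) F) (\<theta> F))
          \<and> (\<forall>(F', F)\<in>FinLO_arr J.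
               \<theta> F \<cdot>\<^bsub>C\<^esub> prj D (F', F) = prj (std_itp C J X) (F', F) \<cdot>\<^bsub>C\<^esub> \<theta> F'))"

definition tensor_right :: "('o, 'm, 'x) smc_scheme \<Rightarrow> ('j, 'o, 'm) diagram \<Rightarrow> 'o \<Rightarrow> ('j, 'o, 'm) diagram" where
  "tensor_right C D Y = \<lparr> idx = idx D,
     ob = (\<lambda>F\<in>FinLO (idx D). ob D F \<odot>\<^bsub>C\<^esub> Y),
     prj = (\<lambda>x\<in>FinLO_arr (idx D). prj D x \<otimes>\<^bsub>C\<^esub> ide C Y) \<rparr>"

text \<open>\<open>L\<close> with projections \<open>p F\<close> to the finite tensor products is a (concrete) infinite tensor
  product of the family \<open>X\<close>.\<close>

definition is_itp :: "('o, 'm, 'x) smc_scheme \<Rightarrow> 'j set \<Rightarrow> ('j \<Rightarrow> 'o) \<Rightarrow> 'o \<Rightarrow> ('j list \<Rightarrow> 'm) \<Rightarrow> bool" where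
  "is_itp C J X L p \<longleftrightarrow> is_limit C (std_itp C J X) L p
     \<and> (\<forall>Y\<in>obj C. is_limit C (tensor_right C (std_itp C J X) Y) (L \<odot>\<^bsub>C\<^esub> Y) (\<lambda>F. p F \<otimes>\<^bsub>C\<^esub> ide C Y))"

text \<open>The index sets are drawn from the type \<open>'j\<close>, which serves as the universe of index elements;
  it has to be infinite for all countable index sets to be covered.\<close>

definition has_itps :: "'j itself \<Rightarrow> ('o, 'm, 'x) smc_scheme \<Rightarrow> bool" where
  "has_itps _ C \<longleftrightarrow> semicartesian C
     \<and> (\<forall>(J :: 'j set) X. countable J \<and> (\<forall>j\<in>J. X j \<in> obj C) \<longrightarrow> (\<exists>L p. is_itp C J X L p))"

text \<open>The comparison isomorphism from the tensor product of the \<open>\<phi>(X\<^sub>j)\<close> to \<open>\<phi>(X\<^sub>F)\<close>.\<close>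

fun fmul_list :: "('o, 'm, 'x) smc_scheme \<Rightarrow> ('p, 'n, 'y) smc_scheme \<Rightarrow> ('o, 'm, 'p, 'n) smfunctor
    \<Rightarrow> ('j \<Rightarrow> 'o) \<Rightarrow> 'j list \<Rightarrow> 'n" where
  "fmul_list C D \<phi> X [] = funit \<phi>"
| "fmul_list C D \<phi> X (j # F) =
     fmul \<phi> (X j) (big_tensor C X F) \<cdot>\<^bsub>D\<^esub> (ide D (fobj \<phi> (X j)) \<otimes>\<^bsub>D\<^esub> fmul_list C D \<phi> X F)"

definition itp_preserving :: "'j itself \<Rightarrow> ('o, 'm, 'x) smc_scheme \<Rightarrow> ('p, 'n, 'y) smc_scheme
    \<Rightarrow> ('o, 'm, 'p, 'n) smfunctor \<Rightarrow> bool" where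
  "itp_preserving _ C D \<phi> \<longleftrightarrow>
     (\<forall>(J :: 'j set) X L p. countable J \<and> (\<forall>j\<in>J. X j \<in> obj C) \<and> is_itp C J X L p \<longrightarrow>
        (\<exists>q. is_itp D J (fobj \<phi> \<circ> X) (fobj \<phi> L) q
           \<and> (\<forall>F\<in>FinLO J. fmul_list C D \<phi> X F \<cdot>\<^bsub>D\<^esub> q F = fmor \<phi> (p F))))"


section \<open>Finite approximation families\<close>

record ('j, 'o, 'm) fam =
  src :: "('j, 'o, 'm) diagram"
  tgt :: "('j, 'o, 'm) diagram"
  Lam :: "('j list \<times> 'j list) set"
  cpt :: "'j list \<times> 'j list \<Rightarrow> 'm"

definition fin_approx :: "('o, 'm, 'x) smc_scheme \<Rightarrow> ('j, 'o, 'm) fam \<Rightarrow> bool" where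
  "fin_approx C f \<longleftrightarrow>
     Lam f \<subseteq> FinLO (idx (src f)) \<times> FinLO (idx (tgt f))
     \<and> (\<forall>(F, G)\<in>Lam f. cpt f (F, G) \<in> hom C (ob (src f) F) (ob (tgt f) G))
     \<and> (\<forall>(F, G)\<in>Lam f. \<forall>(F', G')\<in>Lam f.
          (F', F) \<in> FinLO_arr (idx (src f)) \<and> (G', G) \<in> FinLO_arr (idx (tgt f)) \<longrightarrow>
          prj (tgt f) (G', G) \<cdot>\<^bsub>C\<^esub> cpt f (F', G') = cpt f (F, G) \<cdot>\<^bsub>C\<^esub> prj (src f) (F', F))
     \<and> (\<forall>G\<in>FinLO (idx (tgt f)). \<exists>F. (F, G) \<in> Lam f)
     \<and> (\<forall>(F, G)\<in>Lam f. \<forall>F'. (F', F) \<in> FinLO_arr (idx (src f)) \<longrightarrow> (F', G) \<in> Lam f)"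

definition fam_equiv :: "('o, 'm, 'x) smc_scheme \<Rightarrow> ('j, 'o, 'm) fam \<Rightarrow> ('j, 'o, 'm) fam \<Rightarrow> bool" where
  "fam_equiv C f f' \<longleftrightarrow> fin_approx C f \<and> fin_approx C f' \<and> src f = src f' \<and> tgt f = tgt f'
     \<and> (\<forall>x\<in>Lam f \<inter> Lam f'. cpt f x = cpt f' x)"

definition fam_class :: "('o, 'm, 'x) smc_scheme \<Rightarrow> ('j, 'o, 'm) fam \<Rightarrow> ('j, 'o, 'm) fam set" where
  "fam_class C f = {f'. fam_equiv C f f'}"

definition fam_comp :: "('o, 'm, 'x) smc_scheme \<Rightarrow> ('j, 'o, 'm) fam \<Rightarrow> ('j, 'o, 'm) fam \<Rightarrow> ('j, 'o, 'm) fam"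
  where "fam_comp C g f = \<lparr> src = src f, tgt = tgt g,
     Lam = {(F, H). \<exists>G. (F, G) \<in> Lam f \<and> (G, H) \<in> Lam g},
     cpt = (\<lambda>(F, H). let G = (SOME G. (F, G) \<in> Lam f \<and> (G, H) \<in> Lam g)
                     in cpt g (G, H) \<cdot>\<^bsub>C\<^esub> cpt f (F, G)) \<rparr>"

text \<open>The intersection of a linearly ordered set with \<open>J\<close>.\<close>

abbreviation cut :: "'j list \<Rightarrow> 'j set \<Rightarrow> 'j list" where
  "cut F J \<equiv> filter (\<lambda>j. j \<in> J) F"

definition diag_tensor :: "('o, 'm, 'x) smc_scheme \<Rightarrow> ('j, 'o, 'm) diagram \<Rightarrow> ('j, 'o, 'm) diagram
    \<Rightarrow> ('j, 'o, 'm) diagram" where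
  "diag_tensor C X Y = \<lparr> idx = idx X \<union> idx Y,
     ob = (\<lambda>F\<in>FinLO (idx X \<union> idx Y). ob X (cut F (idx X)) \<odot>\<^bsub>C\<^esub> ob Y (cut F (idx Y))),
     prj = (\<lambda>(F', F)\<in>FinLO_arr (idx X \<union> idx Y).
       prj X (cut F' (idx X), cut F (idx X)) \<otimes>\<^bsub>C\<^esub> prj Y (cut F' (idx Y), cut F (idx Y))) \<rparr>"

definition diag_unit :: "('o, 'm, 'x) smc_scheme \<Rightarrow> 'j \<Rightarrow> ('j, 'o, 'm) diagram" where
  "diag_unit C star = \<lparr> idx = {star},
     ob = (\<lambda>F\<in>FinLO {star}. munit C),
     prj = (\<lambda>x\<in>FinLO_arr {star}. ide C (munit C)) \<rparr>"

definition fam_tensor :: "('o, 'm, 'x) smc_scheme \<Rightarrow> ('j, 'o, 'm) fam \<Rightarrow> ('j, 'o, 'm) fam \<Rightarrow> ('j, 'o, 'm) fam"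
  where "fam_tensor C f g =
    (let X = src f; Y = src g; Z = tgt f; W = tgt g in
     \<lparr> src = diag_tensor C X Y, tgt = diag_tensor C Z W,
       Lam = {(F, G). F \<in> FinLO (idx X \<union> idx Y) \<and> G \<in> FinLO (idx Z \<union> idx W)
                \<and> (cut F (idx X), cut G (idx Z)) \<in> Lam f \<and> (cut F (idx Y), cut G (idx W)) \<in> Lam g},
       cpt = (\<lambda>(F, G). cpt f (cut F (idx X), cut G (idx Z)) \<otimes>\<^bsub>C\<^esub> cpt g (cut F (idx Y), cut G (idx W))) \<rparr>)"

text \<open>The family of a natural transformation \<open>\<theta>\<close> between diagrams over the same index set;
  hereditariness forces its index set to contain all \<open>(F, G)\<close> with \<open>G \<subseteq> F\<close>.\<close>

definition fam_of_nat :: "('o, 'm, 'x) smc_scheme \<Rightarrow> ('j, 'o, 'm) diagram \<Rightarrow> ('j, 'o, 'm) diagram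
    \<Rightarrow> ('j list \<Rightarrow> 'm) \<Rightarrow> ('j, 'o, 'm) fam" where
  "fam_of_nat C X Y \<theta> = \<lparr> src = X, tgt = Y, Lam = FinLO_arr (idx X),
     cpt = (\<lambda>(F, G). prj Y (F, G) \<cdot>\<^bsub>C\<^esub> \<theta> F) \<rparr>"


section \<open>The explicit category of abstract infinite tensor products\<close>

definition expl :: "'j \<Rightarrow> ('o, 'm, 'x) smc_scheme
    \<Rightarrow> (('j, 'o, 'm) diagram, ('j, 'o, 'm) fam set) smc" where
  "expl star C = \<lparr>
     obj = {D. star \<in> idx D \<and> (\<exists>X. abstract_itp_of C (idx D) X D)},
     hom = (\<lambda>X Y. {fam_class C f | f. fin_approx C f \<and> src f = X \<and> tgt f = Y}),
     ide = (\<lambda>X. fam_class C (fam_of_nat C X X (\<lambda>F. ide C (ob X F)))),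
     comp = (\<lambda>b a. {h. \<exists>f\<in>a. \<exists>g\<in>b. fam_equiv C (fam_comp C g f) h}),
     munit = diag_unit C star,
     tenO = diag_tensor C,
     tenM = (\<lambda>a b. {h. \<exists>f\<in>a. \<exists>g\<in>b. fam_equiv C (fam_tensor C f g) h}),
     assoc = (\<lambda>X Y Z. fam_class C (fam_of_nat C
        (diag_tensor C (diag_tensor C X Y) Z) (diag_tensor C X (diag_tensor C Y Z))
        (\<lambda>F. assoc C (ob X (cut F (idx X))) (ob Y (cut F (idx Y))) (ob Z (cut F (idx Z)))))),
     lunit = (\<lambda>X. fam_class C (fam_of_nat C (diag_tensor C (diag_unit C star) X) X
        (\<lambda>F. lunit C (ob X F)))),
     runit = (\<lambda>X. fam_class C (fam_of_nat C (diag_tensor C X (diag_unit C star)) X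
        (\<lambda>F. runit C (ob X F)))),
     braid = (\<lambda>X Y. fam_class C (fam_of_nat C (diag_tensor C X Y) (diag_tensor C Y X)
        (\<lambda>F. braid C (ob X (cut F (idx X))) (ob Y (cut F (idx Y)))))) \<rparr>"


section \<open>Symmetric monoidal theories\<close>

text \<open>A signature is a partial map assigning to each generator its type \<open>m \<rightarrow> n\<close>.
  \<open>Seq s t\<close> is \<open>s\<close> followed by \<open>t\<close>.\<close>

type_synonym 'g signature = "'g \<rightharpoonup> nat \<times> nat"

datatype 'g tm = Gen 'g | Id1 | Swap | Emp | Seq "'g tm" "'g tm" | Par "'g tm" "'g tm"

inductive wt :: "'g signature \<Rightarrow> 'g tm \<Rightarrow> nat \<Rightarrow> nat \<Rightarrow> bool" for \<Sigma> where
  "\<Sigma> c = Some (m, n) \<Longrightarrow> wt \<Sigma> (Gen c) m n"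
| "wt \<Sigma> Id1 1 1"
| "wt \<Sigma> Swap 2 2"
| "wt \<Sigma> Emp 0 0"
| "\<lbrakk>wt \<Sigma> s l m; wt \<Sigma> t m n\<rbrakk> \<Longrightarrow> wt \<Sigma> (Seq s t) l n"
| "\<lbrakk>wt \<Sigma> s m n; wt \<Sigma> t m' n'\<rbrakk> \<Longrightarrow> wt \<Sigma> (Par s t) (m + m') (n + n')"

fun id_tm :: "nat \<Rightarrow> 'g tm" where
  "id_tm 0 = Emp"
| "id_tm (Suc n) = Par Id1 (id_tm n)"

text \<open>The symmetries \<open>1 + n \<rightarrow> n + 1\<close> and \<open>m + n \<rightarrow> n + m\<close>.\<close>

fun swap1_tm :: "nat \<Rightarrow> 'g tm" where
  "swap1_tm 0 = Id1"
| "swap1_tm (Suc n) = Seq (Par Swap (id_tm n)) (Par Id1 (swap1_tm n))"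

fun swap_tm :: "nat \<Rightarrow> nat \<Rightarrow> 'g tm" where
  "swap_tm 0 n = id_tm n"
| "swap_tm (Suc m) n = Seq (Par Id1 (swap_tm m n)) (Par (swap1_tm n) (id_tm m))"

definition smt :: "'g signature \<Rightarrow> ('g tm \<times> 'g tm) set \<Rightarrow> bool" where
  "smt \<Sigma> E \<longleftrightarrow> (\<forall>(s, t)\<in>E. \<exists>m n. wt \<Sigma> s m n \<and> wt \<Sigma> t m n)"

inductive tm_eq :: "'g signature \<Rightarrow> ('g tm \<times> 'g tm) set \<Rightarrow> 'g tm \<Rightarrow> 'g tm \<Rightarrow> bool" for \<Sigma> E where
  refl: "wt \<Sigma> s m n \<Longrightarrow> tm_eq \<Sigma> E s s"
| sym: "tm_eq \<Sigma> E s t \<Longrightarrow> tm_eq \<Sigma> E t s"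
| trans: "\<lbrakk>tm_eq \<Sigma> E s t; tm_eq \<Sigma> E t u\<rbrakk> \<Longrightarrow> tm_eq \<Sigma> E s u"
| ax: "\<lbrakk>(s, t) \<in> E; wt \<Sigma> s m n; wt \<Sigma> t m n\<rbrakk> \<Longrightarrow> tm_eq \<Sigma> E s t"
| seq_cong: "\<lbrakk>wt \<Sigma> s l m; wt \<Sigma> t m n; tm_eq \<Sigma> E s s'; tm_eq \<Sigma> E t t'\<rbrakk>
    \<Longrightarrow> tm_eq \<Sigma> E (Seq s t) (Seq s' t')"
| par_cong: "\<lbrakk>tm_eq \<Sigma> E s s'; tm_eq \<Sigma> E t t'\<rbrakk> \<Longrightarrow> tm_eq \<Sigma> E (Par s t) (Par s' t')"
| seq_assoc: "\<lbrakk>wt \<Sigma> s k l; wt \<Sigma> t l m; wt \<Sigma> u m n\<rbrakk>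
    \<Longrightarrow> tm_eq \<Sigma> E (Seq (Seq s t) u) (Seq s (Seq t u))"
| seq_id_left: "wt \<Sigma> s m n \<Longrightarrow> tm_eq \<Sigma> E (Seq (id_tm m) s) s"
| seq_id_right: "wt \<Sigma> s m n \<Longrightarrow> tm_eq \<Sigma> E (Seq s (id_tm n)) s"
| par_assoc: "\<lbrakk>wt \<Sigma> s m n; wt \<Sigma> t m' n'; wt \<Sigma> u m'' n''\<rbrakk>
    \<Longrightarrow> tm_eq \<Sigma> E (Par (Par s t) u) (Par s (Par t u))"
| par_emp_left: "wt \<Sigma> s m n \<Longrightarrow> tm_eq \<Sigma> E (Par Emp s) s"
| par_emp_right: "wt \<Sigma> s m n \<Longrightarrow> tm_eq \<Sigma> E (Par s Emp) s"
| interchange: "\<lbrakk>wt \<Sigma> s l m; wt \<Sigma> t m n; wt \<Sigma> s' l' m'; wt \<Sigma> t' m' n'\<rbrakk>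
    \<Longrightarrow> tm_eq \<Sigma> E (Par (Seq s t) (Seq s' t')) (Seq (Par s s') (Par t t'))"
| swap_nat: "\<lbrakk>wt \<Sigma> s m n; wt \<Sigma> t m' n'\<rbrakk>
    \<Longrightarrow> tm_eq \<Sigma> E (Seq (Par s t) (swap_tm n n')) (Seq (swap_tm m m') (Par t s))"
| swap_swap: "tm_eq \<Sigma> E (Seq (swap_tm m n) (swap_tm n m)) (id_tm (m + n))"
| swap_hexagon: "tm_eq \<Sigma> E (swap_tm m (n + k))
    (Seq (Par (swap_tm m n) (id_tm k)) (Par (id_tm n) (swap_tm m k)))"

definition tm_class :: "'g signature \<Rightarrow> ('g tm \<times> 'g tm) set \<Rightarrow> 'g tm \<Rightarrow> 'g tm set" where
  "tm_class \<Sigma> E s = {t. tm_eq \<Sigma> E s t}"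

definition Free :: "'g signature \<Rightarrow> ('g tm \<times> 'g tm) set \<Rightarrow> (nat, 'g tm set) smc" where
  "Free \<Sigma> E = \<lparr>
     obj = UNIV,
     hom = (\<lambda>m n. {tm_class \<Sigma> E s | s. wt \<Sigma> s m n}),
     ide = (\<lambda>n. tm_class \<Sigma> E (id_tm n)),
     comp = (\<lambda>b a. {u. \<exists>s\<in>a. \<exists>t\<in>b. tm_eq \<Sigma> E (Seq s t) u}),
     munit = 0,
     tenO = (+),
     tenM = (\<lambda>a b. {u. \<exists>s\<in>a. \<exists>t\<in>b. tm_eq \<Sigma> E (Par s t) u}),
     assoc = (\<lambda>l m n. tm_class \<Sigma> E (id_tm (l + m + n))),
     lunit = (\<lambda>n. tm_class \<Sigma> E (id_tm n)),
     runit = (\<lambda>n. tm_class \<Sigma> E (id_tm n)),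
     braid = (\<lambda>m n. tm_class \<Sigma> E (swap_tm m n)) \<rparr>"


section \<open>The category of possibly infinite string diagrams\<close>

text \<open>Objects are extended naturals.  The distinguished index element is \<open>0\<close>, so that the index set
  of \<open>\<infinity>\<close> contains it as well.\<close>

definition inf_ob :: "'g signature \<Rightarrow> ('g tm \<times> 'g tm) set \<Rightarrow> enat \<Rightarrow> (nat, nat, 'g tm set) diagram" where
  "inf_ob \<Sigma> E N = (case N of
     enat n \<Rightarrow> std_itp (Free \<Sigma> E) {0} (\<lambda>_. n)
   | \<infinity> \<Rightarrow> std_itp (Free \<Sigma> E) UNIV (\<lambda>_. 1))"

definition wires :: "enat \<Rightarrow> nat set" where
  "wires N = {i. enat i < N}"

text \<open>The wires, in order, of which the value of \<^term>\<open>inf_ob \<Sigma> E N\<close> at \<open>F\<close> consists.\<close>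

definition wire_list :: "enat \<Rightarrow> nat list \<Rightarrow> nat list" where
  "wire_list N F = (case N of enat n \<Rightarrow> (if F = [] then [] else [0..<n]) | \<infinity> \<Rightarrow> F)"

text \<open>A choice of bijections between the wires of \<open>M + N\<close> and the disjoint union of those of
  \<open>M\<close> and \<open>N\<close>; it is the evident one if both are finite and arbitrary otherwise.\<close>

definition wire_splitting :: "(enat \<Rightarrow> enat \<Rightarrow> nat \<Rightarrow> nat + nat) \<Rightarrow> bool" where
  "wire_splitting split \<longleftrightarrow>
     (\<forall>m n i. split (enat m) (enat n) i = (if i < m then Inl i else Inr (i - m)))
     \<and> (\<forall>M N. M = \<infinity> \<or> N = \<infinity> \<longrightarrow> bij_betw (split M N) (wires (M + N)) (wires M <+> wires N))"

text \<open>Reindexing: given names \<open>v F\<close> and \<open>w G\<close> for the wires of \<open>ob X F\<close> and \<open>ob Y G\<close>, the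
  component at \<open>(F, G)\<close> connects wires of equal name and deletes the remaining wires of \<open>X\<close>.\<close>

definition reindex :: "'g signature \<Rightarrow> ('g tm \<times> 'g tm) set
    \<Rightarrow> (nat, nat, 'g tm set) diagram \<Rightarrow> (nat list \<Rightarrow> 'w list)
    \<Rightarrow> (nat, nat, 'g tm set) diagram \<Rightarrow> (nat list \<Rightarrow> 'w list)
    \<Rightarrow> (nat, nat, 'g tm set) fam set" where
  "reindex \<Sigma> E X v Y w = fam_class (Free \<Sigma> E) \<lparr> src = X, tgt = Y,
     Lam = {(F, G). F \<in> FinLO (idx X) \<and> G \<in> FinLO (idx Y) \<and> set (w G) \<subseteq> set (v F)},
     cpt = (\<lambda>(F, G). proj (Free \<Sigma> E) (\<lambda>_. 1) (v F) (w G)) \<rparr>"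

definition pair_ob :: "'g signature \<Rightarrow> ('g tm \<times> 'g tm) set \<Rightarrow> enat \<Rightarrow> enat \<Rightarrow> (nat, nat, 'g tm set) diagram"
  where "pair_ob \<Sigma> E M N = diag_tensor (Free \<Sigma> E) (inf_ob \<Sigma> E M) (inf_ob \<Sigma> E N)"

definition pair_wires :: "'g signature \<Rightarrow> ('g tm \<times> 'g tm) set \<Rightarrow> enat \<Rightarrow> enat \<Rightarrow> nat list \<Rightarrow> (nat + nat) list"
  where "pair_wires \<Sigma> E M N F =
    map Inl (wire_list M (cut F (idx (inf_ob \<Sigma> E M)))) @ map Inr (wire_list N (cut F (idx (inf_ob \<Sigma> E N))))"

text \<open>The reindexings between \<open>M + N\<close> and the pointwise tensor product of \<open>M\<close> and \<open>N\<close>.\<close>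

definition join :: "(enat \<Rightarrow> enat \<Rightarrow> nat \<Rightarrow> nat + nat) \<Rightarrow> 'g signature \<Rightarrow> ('g tm \<times> 'g tm) set
    \<Rightarrow> enat \<Rightarrow> enat \<Rightarrow> (nat, nat, 'g tm set) fam set" where
  "join split \<Sigma> E M N = reindex \<Sigma> E (pair_ob \<Sigma> E M N) (pair_wires \<Sigma> E M N)
     (inf_ob \<Sigma> E (M + N)) (map (split M N) \<circ> wire_list (M + N))"

definition unjoin :: "(enat \<Rightarrow> enat \<Rightarrow> nat \<Rightarrow> nat + nat) \<Rightarrow> 'g signature \<Rightarrow> ('g tm \<times> 'g tm) set
    \<Rightarrow> enat \<Rightarrow> enat \<Rightarrow> (nat, nat, 'g tm set) fam set" where
  "unjoin split \<Sigma> E M N = reindex \<Sigma> E (inf_ob \<Sigma> E (M + N)) (map (split M N) \<circ> wire_list (M + N))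
     (pair_ob \<Sigma> E M N) (pair_wires \<Sigma> E M N)"

type_synonym 'g inf_mor = "enat \<times> enat \<times> (nat, nat, 'g tm set) fam set"

text \<open>The reindexing \<open>M \<rightarrow> N\<close> connecting wires \<open>i\<close> and \<open>j\<close> with \<open>v i = w j\<close>.\<close>

definition relabel :: "'g signature \<Rightarrow> ('g tm \<times> 'g tm) set \<Rightarrow> enat \<Rightarrow> (nat \<Rightarrow> 'w) \<Rightarrow> enat \<Rightarrow> (nat \<Rightarrow> 'w)
    \<Rightarrow> 'g inf_mor" where
  "relabel \<Sigma> E M v N w = (M, N,
     reindex \<Sigma> E (inf_ob \<Sigma> E M) (map v \<circ> wire_list M) (inf_ob \<Sigma> E N) (map w \<circ> wire_list N))"

definition Free_inf :: "(enat \<Rightarrow> enat \<Rightarrow> nat \<Rightarrow> nat + nat) \<Rightarrow> 'g signature \<Rightarrow> ('g tm \<times> 'g tm) set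
    \<Rightarrow> (enat, 'g inf_mor) smc" where
  "Free_inf split \<Sigma> E = (let K = expl 0 (Free \<Sigma> E); X = inf_ob \<Sigma> E in \<lparr>
     obj = UNIV,
     hom = (\<lambda>M N. {(M, N, a) | a. a \<in> hom K (X M) (X N)}),
     ide = (\<lambda>N. (N, N, ide K (X N))),
     comp = (\<lambda>(_, N, b) (M, _, a). (M, N, b \<cdot>\<^bsub>K\<^esub> a)),
     munit = 0,
     tenO = (+),
     tenM = (\<lambda>(M, N, a) (M', N', a').
       (M + M', N + N', join split \<Sigma> E N N' \<cdot>\<^bsub>K\<^esub> (a \<otimes>\<^bsub>K\<^esub> a') \<cdot>\<^bsub>K\<^esub> unjoin split \<Sigma> E M M')),
     assoc = (\<lambda>L M N. relabel \<Sigma> E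
       (L + M + N) (\<lambda>i. case split (L + M) N i of
            Inl u \<Rightarrow> (case split L M u of Inl x \<Rightarrow> Inl x | Inr y \<Rightarrow> Inr (Inl y))
          | Inr z \<Rightarrow> Inr (Inr z))
       (L + (M + N)) (\<lambda>i. map_sum id (split M N) (split L (M + N) i))),
     lunit = (\<lambda>N. relabel \<Sigma> E (0 + N) (split 0 N) N Inr),
     runit = (\<lambda>N. relabel \<Sigma> E (N + 0) (split N 0) N Inl),
     braid = (\<lambda>M N. relabel \<Sigma> E
       (M + N) (split M N)
       (N + M) (\<lambda>i. case split N M i of Inl y \<Rightarrow> Inr y | Inr x \<Rightarrow> Inl x)) \<rparr>)"

end

theory Submission imports Defs
begin

text \<open>In a prop every object is a finite bundle of wires, so an abstract infinite tensor product is, up to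
isomorphism, nothing but the countable set of its wires: the wires of the factor \<open>X\<^sub>j\<close> are named
\<open>(j, 0), \<dots>, (j, X\<^sub>j - 1)\<close>, and every projection keeps some of the wires and deletes the others.
Cancellativity of deletions makes all projections epimorphisms (\<open>proj_epi\<close>), so that a family is
determined by any single component over each index of its target.  This has two consequences.

First, names suffice to define morphisms.  An inclusion of the set of wires of \<open>Y\<close> in that of \<open>X\<close>
determines a morphism from \<open>X\<close> to \<open>Y\<close>, its rewiring, which joins wires of equal name; rewirings
compose and tensor as the inclusions do (\<open>rewire_comp\<close>, \<open>rewire_tensor\<close>), and a bijection of wires gives
an isomorphism.  All coherence isomorphisms, of the explicit category and of \<open>Free_inf\<close>, are rewirings,
so the coherence laws of \<open>Free_inf\<close> and of the comparison functor become equations between bijections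
of sets of names.  A countable set of names can be numbered by the wires of some \<open>n\<close> or of \<open>\<infinity>\<close>;
therefore every object of the explicit category is isomorphic to the image of an object of \<open>Free_inf\<close>
(\<open>\<phi>_surjective\<close>).  The comparison functor is full and faithful since the morphisms of \<open>Free_inf\<close> are by
definition those of the explicit category.  The one difference is that the indices of the former are
natural numbers while those of the latter come from an arbitrary infinite type; an injection of the
naturals into this type which sends \<open>0\<close> to the distinguished index renames the former to the latter.

Secondly, infinite tensor products exist in \<open>Free_inf\<close>.  A morphism into an object \<open>L\<close> is the same as a
compatible family of morphisms into the finite lists of wires of \<open>L\<close>, by \<open>picks_faithful\<close> and
\<open>picks_glue\<close>.  So the limit of the finite tensor products of a countable family is the object whose
wires are all the wires of its members, and it remains a limit after tensoring with any object, which
only adds finitely or countably many wires (\<open>relabel_limit\<close>, \<open>FI_itp\<close>).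

Finally, an equivalence carries limits to limits (\<open>limit_transport\<close>), and the comparison between the
tensor product of the images and the image of the tensor product is compatible with the projections
(\<open>compare_proj\<close>).  Hence infinite tensor products are preserved, and those of the explicit category are
obtained from those of \<open>Free_inf\<close>.\<close>

section \<open>Typed symmetric monoidal categories\<close>

text \<open>The hom-sets of a category may overlap.  Where they are disjoint, a morphism determines its source and
its target, and the side conditions of equational reasoning become equations for the simplifier.\<close>

definition arr :: "('o, 'm, 'x) category_scheme \<Rightarrow> 'm \<Rightarrow> bool" where
  "arr C f \<longleftrightarrow> (\<exists>A\<in>obj C. \<exists>B\<in>obj C. f \<in> hom C A B)"

definition source :: "('o, 'm, 'x) category_scheme \<Rightarrow> 'm \<Rightarrow> 'o" where
  "source C f = (THE A. A \<in> obj C \<and> (\<exists>B\<in>obj C. f \<in> hom C A B))"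

definition target :: "('o, 'm, 'x) category_scheme \<Rightarrow> 'm \<Rightarrow> 'o" where
  "target C f = (THE B. B \<in> obj C \<and> (\<exists>A\<in>obj C. f \<in> hom C A B))"

locale typed_category = category C
  for C :: "('o, 'm, 'x) category_scheme" (structure) +
  assumes hom_disjoint: "\<lbrakk>A \<in> obj C; B \<in> obj C; A' \<in> obj C; B' \<in> obj C; f \<in> hom C A B; f \<in> hom C A' B'\<rbrakk>
    \<Longrightarrow> A = A' \<and> B = B'"
begin

lemma typed: assumes "f \<in> hom C A B" "A \<in> obj C" "B \<in> obj C"
  shows "arr C f" "source C f = A" "target C f = B"
proof -
  show "arr C f" using assms by (auto simp: arr_def)
  show "source C f = A" unfolding source_def using assms hom_disjoint by blast
  show "target C f = B" unfolding target_def using assms hom_disjoint by blast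
qed

lemma arr_typed: assumes "arr C f"
  shows "f \<in> hom C (source C f) (target C f)" "source C f \<in> obj C" "target C f \<in> obj C"
  using assms typed unfolding arr_def by blast+

lemma hom_iff: "A \<in> obj C \<Longrightarrow> B \<in> obj C \<Longrightarrow> f \<in> hom C A B \<longleftrightarrow> arr C f \<and> source C f = A \<and> target C f = B"
  using typed arr_typed by metis

lemma arr_objs [simp]: "arr C f \<Longrightarrow> source C f \<in> obj C" "arr C f \<Longrightarrow> target C f \<in> obj C"
  using arr_typed by auto

lemma ide_typed [simp]: assumes "A \<in> obj C"
  shows "arr C (ide C A)" "source C (ide C A) = A" "target C (ide C A) = A"
  using typed[OF ide_hom[OF assms]] assms by auto

lemma comp_typed [simp]: assumes "arr C f" "arr C g" "target C f = source C g"
  shows "arr C (g \<cdot> f)" "source C (g \<cdot> f) = source C f" "target C (g \<cdot> f) = target C g"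
proof -
  have "g \<cdot> f \<in> hom C (source C f) (target C g)"
    using comp_hom arr_typed assms by metis
  then show "arr C (g \<cdot> f)" "source C (g \<cdot> f) = source C f" "target C (g \<cdot> f) = target C g"
    using typed assms arr_typed by auto
qed

lemma ide_comp [simp]:
  "arr C f \<Longrightarrow> target C f = B \<Longrightarrow> ide C B \<cdot> f = f"
  "arr C f \<Longrightarrow> source C f = A \<Longrightarrow> f \<cdot> ide C A = f"
  using ide_left ide_right arr_typed by metis+

lemma comp_assoc' [simp]: assumes "arr C f" "arr C g" "arr C h" "target C f = source C g" "target C g = source C h"
  shows "(h \<cdot> g) \<cdot> f = h \<cdot> (g \<cdot> f)"
  using assms comp_assoc arr_typed by metis

lemma inverse_unique: assumes "arr C f" "arr C g" "arr C h" "target C f = source C g" "target C g = source C f"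
    "target C f = source C h" "h \<cdot> f = ide C (source C f)" "f \<cdot> g = ide C (target C f)"
  shows "h = g"
proof -
  have "h = h \<cdot> (f \<cdot> g)" using assms by simp
  also have "\<dots> = (h \<cdot> f) \<cdot> g" by (rule comp_assoc'[symmetric]) (use assms in auto)
  also have "\<dots> = g" using assms by simp
  finally show ?thesis .
qed

lemma iso_in_typed: assumes "iso_in C A B f" "A \<in> obj C" "B \<in> obj C"
  shows "arr C f" "source C f = A" "target C f = B"
    "arr C (inv_of C A B f)" "source C (inv_of C A B f) = B" "target C (inv_of C A B f) = A"
    "inv_of C A B f \<cdot> f = ide C A" "f \<cdot> inv_of C A B f = ide C B"
proof -
  obtain g where g: "inverse_in C A B f g" using assms by (auto simp: iso_in_def)
  have "h = g" if h: "inverse_in C A B f h" for h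
    by (rule inverse_unique[of f]) (use g h assms typed in \<open>auto simp: inverse_in_def\<close>)
  then have "inv_of C A B f = g" unfolding inv_of_def using g by blast
  then show "arr C f" "source C f = A" "target C f = B"
    "arr C (inv_of C A B f)" "source C (inv_of C A B f) = B" "target C (inv_of C A B f) = A"
    "inv_of C A B f \<cdot> f = ide C A" "f \<cdot> inv_of C A B f = ide C B"
    using g assms typed by (auto simp: inverse_in_def)
qed

lemma iso_inI: assumes "arr C f" "arr C g" "source C f = A" "target C f = B" "source C g = B" "target C g = A"
    "g \<cdot> f = ide C A" "f \<cdot> g = ide C B"
  shows "iso_in C A B f"
  using assms arr_typed unfolding iso_in_def inverse_in_def by metis

lemma inv_of_eqI: assumes "arr C f" "arr C g" "source C f = A" "target C f = B" "source C g = B" "target C g = A"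
    "g \<cdot> f = ide C A" "f \<cdot> g = ide C B"
  shows "inv_of C A B f = g"
proof -
  have iso: "iso_in C A B f" using iso_inI assms by blast
  have ob: "A \<in> obj C" "B \<in> obj C" using assms by auto
  note t = iso_in_typed[OF iso ob]
  show ?thesis by (rule inverse_unique[of f]) (use t assms in auto)
qed

end

locale typed_smc = symmetric_monoidal C + typed_category C
  for C :: "('o, 'm, 'x) smc_scheme" (structure)
begin

lemma tensor_obj [simp]: "A \<in> obj C \<Longrightarrow> B \<in> obj C \<Longrightarrow> A \<odot> B \<in> obj C" "munit C \<in> obj C"
  using tenO_obj munit_obj by auto

lemma tensor_typed [simp]: assumes "arr C f" "arr C g"
  shows "arr C (f \<otimes> g)" "source C (f \<otimes> g) = source C f \<odot> source C g"
    "target C (f \<otimes> g) = target C f \<odot> target C g"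
proof -
  have "f \<otimes> g \<in> hom C (source C f \<odot> source C g) (target C f \<odot> target C g)"
    using tenM_hom assms arr_typed by auto
  then show "arr C (f \<otimes> g)" "source C (f \<otimes> g) = source C f \<odot> source C g"
    "target C (f \<otimes> g) = target C f \<odot> target C g" using typed assms by auto
qed

lemma tensor_ide [simp]: "A \<in> obj C \<Longrightarrow> B \<in> obj C \<Longrightarrow> ide C A \<otimes> ide C B = ide C (A \<odot> B)"
  using tenM_ide .

lemma interchange: assumes "arr C f" "arr C g" "arr C f'" "arr C g'" "target C f = source C g" "target C f' = source C g'"
  shows "(g \<otimes> g') \<cdot> (f \<otimes> f') = (g \<cdot> f) \<otimes> (g' \<cdot> f')"
  using tenM_comp[of "source C f" "source C g" "target C g" "source C f'" "source C g'" "target C g'" f g f' g']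
    assms arr_typed by metis

lemma interchange_tail: assumes "arr C f" "arr C g" "arr C f'" "arr C g'" "target C f = source C g" "target C f' = source C g'"
   "arr C k" "target C k = source C f \<odot> source C f'"
  shows "(g \<otimes> g') \<cdot> ((f \<otimes> f') \<cdot> k) = ((g \<cdot> f) \<otimes> (g' \<cdot> f')) \<cdot> k"
  using assms interchange[of f g f' g'] comp_assoc'[of k "f \<otimes> f'" "g \<otimes> g'"] by simp

lemma braid_typed [simp]: assumes "A \<in> obj C" "B \<in> obj C"
  shows "arr C (braid C A B)" "source C (braid C A B) = A \<odot> B" "target C (braid C A B) = B \<odot> A"
  using typed[OF braid_hom[OF assms]] assms by auto

lemma braid_natural: assumes "arr C f" "arr C g"
  shows "braid C (target C f) (target C g) \<cdot> (f \<otimes> g) = (g \<otimes> f) \<cdot> braid C (source C f) (source C g)"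
  using braid_nat[of "source C f" "source C g" "target C f" "target C g"] assms arr_typed by auto

abbreviation assoc_inv where "assoc_inv A B D \<equiv> inv_of C ((A \<odot> B) \<odot> D) (A \<odot> (B \<odot> D)) (assoc C A B D)"

lemma assoc_typed [simp]: assumes "A \<in> obj C" "B \<in> obj C" "D \<in> obj C"
  shows "arr C (assoc C A B D)" "source C (assoc C A B D) = (A \<odot> B) \<odot> D" "target C (assoc C A B D) = A \<odot> (B \<odot> D)"
    "arr C (assoc_inv A B D)" "source C (assoc_inv A B D) = A \<odot> (B \<odot> D)" "target C (assoc_inv A B D) = (A \<odot> B) \<odot> D"
    "assoc_inv A B D \<cdot> assoc C A B D = ide C ((A \<odot> B) \<odot> D)" "assoc C A B D \<cdot> assoc_inv A B D = ide C (A \<odot> (B \<odot> D))"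
  using iso_in_typed[OF assoc_iso[OF assms]] assms by auto

lemma assoc_natural: assumes "arr C f" "arr C g" "arr C h"
  shows "assoc C (target C f) (target C g) (target C h) \<cdot> ((f \<otimes> g) \<otimes> h)
    = (f \<otimes> (g \<otimes> h)) \<cdot> assoc C (source C f) (source C g) (source C h)"
  using assoc_nat assms arr_typed by auto

lemma unit_typed [simp]: assumes "A \<in> obj C"
  shows "arr C (lunit C A)" "source C (lunit C A) = munit C \<odot> A" "target C (lunit C A) = A"
    "arr C (runit C A)" "source C (runit C A) = A \<odot> munit C" "target C (runit C A) = A"
  using iso_in_typed[OF lunit_iso[OF assms]] iso_in_typed[OF runit_iso[OF assms]] assms by auto

end

locale typed_semicartesian = typed_smc C + semicartesian C
  for C :: "('o, 'm, 'x) smc_scheme" (structure)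
begin

lemma del_typed [simp]: assumes "A \<in> obj C"
  shows "arr C (del C A)" "source C (del C A) = A" "target C (del C A) = munit C"
proof -
  have "del C A \<in> hom C A (munit C)" unfolding del_def by (rule theI'[OF munit_terminal[OF assms]])
  then show "arr C (del C A)" "source C (del C A) = A" "target C (del C A) = munit C" using typed assms by auto
qed

lemma terminal_eq: assumes "arr C f" "arr C g" "source C f = source C g" "target C f = munit C" "target C g = munit C"
  shows "f = g"
  using munit_terminal[of "source C f"] assms arr_typed by metis

end

section \<open>Permutations and deletions in a semicartesian prop\<close>

locale semicartesian_prop = typed_semicartesian C
  for C :: "(nat, 'm, 'x) smc_scheme" (structure) +
  assumes obj_UNIV [simp]: "obj C = UNIV"
    and munit_0 [simp]: "munit C = 0"
    and tenO_add [simp]: "tenO C = (+)"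
    and assoc_ide [simp]: "assoc C l m n = ide C (l + m + n)"
    and lunit_ide [simp]: "lunit C n = ide C n"
    and runit_ide [simp]: "runit C n = ide C n"
    and cancellative: "cancellative_deletions C"
begin

lemma obj_iff [simp]: "A \<in> obj C" by simp

lemma inv_ide [simp]: "inv_of C A A (ide C A) = ide C A"
  by (rule inv_of_eqI) auto

lemma tensor_assoc [simp]: "arr C f \<Longrightarrow> arr C g \<Longrightarrow> arr C h \<Longrightarrow> (f \<otimes> g) \<otimes> h = f \<otimes> (g \<otimes> h)"
  using assoc_natural[of f g h] by (simp add: add.assoc)

lemma tensor_ide_0 [simp]: assumes "arr C f" shows "ide C 0 \<otimes> f = f" "f \<otimes> ide C 0 = f"
  using lunit_nat[of "source C f" "target C f" f] runit_nat[of "source C f" "target C f" f] assms arr_typed by simp_all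

lemma ide_tensor_tail [simp]: "arr C f \<Longrightarrow> ide C m \<otimes> (ide C n \<otimes> f) = ide C (m + n) \<otimes> f"
  using tensor_assoc[of "ide C m" "ide C n" f] by simp

lemma del_tensor: "del C m \<otimes> del C n = del C (m + n)"
  by (rule terminal_eq) auto

lemma del_0 [simp]: "del C 0 = ide C 0"
  by (rule terminal_eq) auto

text \<open>With two trivial factors the hexagon says that the symmetry is idempotent; as it is also invertible, it
is the identity.\<close>

lemma braid_0 [simp]: "braid C 0 n = ide C n" "braid C n 0 = ide C n"
proof -
  have *: "braid C n 0 = ide C n" for n
  proof -
    have h: "(braid C n 0) \<cdot> (braid C n 0) = braid C n 0"
      using hexagon[of n 0 0] by simp
    have b: "braid C 0 n \<cdot> braid C n 0 = ide C n" using braid_braid[of n 0] by simp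
    have "braid C n 0 = (braid C 0 n \<cdot> braid C n 0) \<cdot> braid C n 0" by (simp add: b)
    also have "\<dots> = braid C 0 n \<cdot> (braid C n 0 \<cdot> braid C n 0)" by simp
    also have "\<dots> = ide C n" by (simp add: h b)
    finally show ?thesis .
  qed
  show "braid C n 0 = ide C n" by (rule *)
  show "braid C 0 n = ide C n" using braid_braid[of n 0] * by simp
qed

lemma braid_hexagon: "(ide C b \<otimes> braid C a c) \<cdot> (braid C a b \<otimes> ide C c) = braid C a (b + c)"
  using hexagon[of a b c] by (simp add: add.assoc add.commute[of _ a] add.left_commute[of _ a])

text \<open>The Yang--Baxter equation is the naturality of the symmetry with respect to another symmetry.\<close>

lemma braid_braid_braid:
  "(braid C b c \<otimes> ide C a) \<cdot> ((ide C b \<otimes> braid C a c) \<cdot> (braid C a b \<otimes> ide C c))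
    = (ide C c \<otimes> braid C a b) \<cdot> ((braid C a c \<otimes> ide C b) \<cdot> (ide C a \<otimes> braid C b c))"
proof -
  have "(braid C b c \<otimes> ide C a) \<cdot> ((ide C b \<otimes> braid C a c) \<cdot> (braid C a b \<otimes> ide C c))
     = (braid C b c \<otimes> ide C a) \<cdot> braid C a (b + c)" by (simp add: braid_hexagon)
  also have "\<dots> = braid C a (c + b) \<cdot> (ide C a \<otimes> braid C b c)"
    using braid_natural[of "ide C a" "braid C b c"] by simp
  also have "\<dots> = ((ide C c \<otimes> braid C a b) \<cdot> (braid C a c \<otimes> ide C b)) \<cdot> (ide C a \<otimes> braid C b c)"
    by (simp only: braid_hexagon)
  also have "\<dots> = (ide C c \<otimes> braid C a b) \<cdot> ((braid C a c \<otimes> ide C b) \<cdot> (ide C a \<otimes> braid C b c))"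
    by (simp add: add_ac)
  finally show ?thesis .
qed

abbreviation size_of :: "('j \<Rightarrow> nat) \<Rightarrow> 'j list \<Rightarrow> nat" where "size_of X F \<equiv> sum_list (map X F)"

lemma big_tensor_eq [simp]: "big_tensor C X F = size_of X F"
  by (induction F) auto

lemma size_remove1: "j \<in> set F \<Longrightarrow> X j + size_of X (remove1 j F) = size_of X F"
  by (induction F) auto

lemma to_front_simps [simp]:
  "to_front C X j (j # F) = ide C (X j + size_of X F)"
  "i \<noteq> j \<Longrightarrow> arr C (to_front C X j F) \<Longrightarrow> target C (to_front C X j F) = size_of X F \<Longrightarrow> j \<in> set F \<Longrightarrow>
   to_front C X j (i # F) = (braid C (X i) (X j) \<otimes> ide C (size_of X (remove1 j F))) \<cdot> (ide C (X i) \<otimes> to_front C X j F)"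
  using size_remove1[of j F X]
  by (auto simp: Let_def add.commute[of "X j" "X i"] add.assoc)

lemma to_front_typed [simp]: assumes "j \<in> set F"
  shows "arr C (to_front C X j F)" "source C (to_front C X j F) = size_of X F"
    "target C (to_front C X j F) = size_of X F"
proof -
  have "arr C (to_front C X j F) \<and> source C (to_front C X j F) = size_of X F \<and> target C (to_front C X j F) = size_of X F"
    using assms
  proof (induction F)
    case (Cons i F)
    show ?case
    proof (cases "i = j")
      case False
      then show ?thesis using Cons size_remove1[of j F X] by (auto simp: add_ac)
    qed simp
  qed simp
  then show "arr C (to_front C X j F)" "source C (to_front C X j F) = size_of X F"
    "target C (to_front C X j F) = size_of X F" by auto
qed

lemma to_front_Cons: "i \<noteq> j \<Longrightarrow> j \<in> set F \<Longrightarrow>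
   to_front C X j (i # F) = (braid C (X i) (X j) \<otimes> ide C (size_of X (remove1 j F))) \<cdot> (ide C (X i) \<otimes> to_front C X j F)"
  by (rule to_front_simps(2)) auto

declare to_front.simps(2) [simp del] to_front_simps(2) [simp del] proj.simps(1,2) [simp del]
declare to_front_Cons [simp]

lemma proj_simps [simp]:
  "proj C X F [] = del C (size_of X F)"
  "proj C X F (j # G) = (ide C (X j) \<otimes> proj C X (remove1 j F) G) \<cdot> to_front C X j F"
  by (auto simp: proj.simps)

lemma proj_typed [simp]: assumes "set G \<subseteq> set F" "distinct F" "distinct G"
  shows "arr C (proj C X F G)" "source C (proj C X F G) = size_of X F" "target C (proj C X F G) = size_of X G"
proof -
  have "arr C (proj C X F G) \<and> source C (proj C X F G) = size_of X F \<and> target C (proj C X F G) = size_of X G"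
    using assms
  proof (induction G arbitrary: F)
    case (Cons j G)
    have s: "set G \<subseteq> set (remove1 j F)" using Cons.prems by auto
    show ?case using Cons.IH[OF s] Cons.prems size_remove1[of j F X] by simp
  qed simp
  then show "arr C (proj C X F G)" "source C (proj C X F G) = size_of X F" "target C (proj C X F G) = size_of X G"
    by auto
qed

lemma proj_ide [simp]: "proj C X F F = ide C (size_of X F)"
  by (induction F) auto

text \<open>By induction on \<open>F\<close>.  If the first factor is neither \<open>y\<close> nor \<open>z\<close>, both have to pass it, and the two
orders in which they can do so are related by the Yang--Baxter equation.\<close>

lemma to_front_to_front: assumes "y \<noteq> z" "y \<in> set F" "z \<in> set F" "distinct F"
  shows "(braid C (X y) (X z) \<otimes> ide C (size_of X (remove1 z (remove1 y F))))
      \<cdot> ((ide C (X y) \<otimes> to_front C X z (remove1 y F)) \<cdot> to_front C X y F)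
    = (ide C (X z) \<otimes> to_front C X y (remove1 z F)) \<cdot> to_front C X z F"
  using assms
proof (induction F)
  case (Cons x F)
  consider "x = y" | "x = z" | "x \<noteq> y" "x \<noteq> z" by blast
  then show ?case
  proof cases
    case 1
    have "X z + size_of X (remove1 z F) = size_of X F" using Cons 1 size_remove1 by fastforce
    then show ?thesis using 1 Cons.prems by (simp add: add_ac)
  next
    case 2
    let ?n = "size_of X (remove1 y F)"
    have s: "X y + ?n = size_of X F" using Cons 2 size_remove1[of y F X] by simp
    have "(braid C (X y) (X z) \<otimes> ide C ?n)
        \<cdot> ((braid C (X z) (X y) \<otimes> ide C ?n) \<cdot> (ide C (X z) \<otimes> to_front C X y F))
      = (ide C (X z + X y) \<otimes> ide C ?n) \<cdot> (ide C (X z) \<otimes> to_front C X y F)"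
      using 2 Cons.prems s by (subst interchange_tail) (auto simp: braid_braid)
    also have "\<dots> = ide C (X z) \<otimes> to_front C X y F" using 2 Cons.prems s by (simp add: add.assoc)
    finally show ?thesis using 2 Cons.prems s by simp
  next
    case 3
    let ?n = "size_of X (remove1 z (remove1 y F))"
    have yz: "y \<in> set F" "z \<in> set F" "y \<in> set (remove1 z F)" "z \<in> set (remove1 y F)" "distinct F"
      using 3 Cons.prems by auto
    have s: "X z + ?n = size_of X (remove1 y F)" "X y + ?n = size_of X (remove1 z F)"
       "X y + (X z + ?n) = size_of X F" "X z + (X y + ?n) = size_of X F"
       "size_of X (remove1 y (remove1 z F)) = ?n"
      using size_remove1[OF yz(1), of X] size_remove1[OF yz(2), of X] size_remove1[OF yz(3), of X]
        size_remove1[OF yz(4), of X] remove1_commute[of y z F] by auto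
    let ?ty = "to_front C X y F" and ?tz = "to_front C X z F"
    let ?tzy = "to_front C X z (remove1 y F)" and ?tyz = "to_front C X y (remove1 z F)"
    have IH: "(braid C (X y) (X z) \<otimes> ide C ?n) \<cdot> ((ide C (X y) \<otimes> ?tzy) \<cdot> ?ty) = (ide C (X z) \<otimes> ?tyz) \<cdot> ?tz"
      using Cons.IH 3 Cons.prems by auto
    let ?bxy = "braid C (X x) (X y)" and ?bxz = "braid C (X x) (X z)" and ?byz = "braid C (X y) (X z)"
    have "(?byz \<otimes> ide C (X x + ?n)) \<cdot> ((ide C (X y) \<otimes> ((?bxz \<otimes> ide C ?n) \<cdot> (ide C (X x) \<otimes> ?tzy)))
        \<cdot> ((?bxy \<otimes> ide C (X z + ?n)) \<cdot> (ide C (X x) \<otimes> ?ty)))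
       = (?byz \<otimes> ide C (X x + ?n)) \<cdot> ((ide C (X y) \<otimes> (?bxz \<otimes> ide C ?n)) \<cdot> ((ide C (X y + X x) \<otimes> ?tzy)
        \<cdot> ((?bxy \<otimes> ide C (X z + ?n)) \<cdot> (ide C (X x) \<otimes> ?ty))))"
    proof -
      have "ide C (X y) \<otimes> ((?bxz \<otimes> ide C ?n) \<cdot> (ide C (X x) \<otimes> ?tzy))
        = (ide C (X y) \<otimes> (?bxz \<otimes> ide C ?n)) \<cdot> (ide C (X y) \<otimes> (ide C (X x) \<otimes> ?tzy))"
        using yz s by (subst interchange) (auto simp: add_ac)
      then show ?thesis using yz s by (simp add: add_ac)
    qed
    also have "(ide C (X y + X x) \<otimes> ?tzy) \<cdot> ((?bxy \<otimes> ide C (X z + ?n)) \<cdot> (ide C (X x) \<otimes> ?ty))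
        = (?bxy \<otimes> ide C (X z + ?n)) \<cdot> ((ide C (X x + X y) \<otimes> ?tzy) \<cdot> (ide C (X x) \<otimes> ?ty))"
      using yz s by (subst (1 2) interchange_tail) (auto simp: add_ac)
    also have "(ide C (X x + X y) \<otimes> ?tzy) \<cdot> (ide C (X x) \<otimes> ?ty) = ide C (X x) \<otimes> ((ide C (X y) \<otimes> ?tzy) \<cdot> ?ty)"
    proof -
      have "ide C (X x + X y) \<otimes> ?tzy = ide C (X x) \<otimes> (ide C (X y) \<otimes> ?tzy)" using yz by simp
      then show ?thesis using yz s by (simp only:) (subst interchange, auto)
    qed
    also have "(?byz \<otimes> ide C (X x + ?n)) \<cdot> ((ide C (X y) \<otimes> (?bxz \<otimes> ide C ?n))
         \<cdot> ((?bxy \<otimes> ide C (X z + ?n)) \<cdot> (ide C (X x) \<otimes> ((ide C (X y) \<otimes> ?tzy) \<cdot> ?ty))))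
      = (((?byz \<otimes> ide C (X x)) \<cdot> ((ide C (X y) \<otimes> ?bxz) \<cdot> (?bxy \<otimes> ide C (X z)))) \<otimes> ide C ?n)
         \<cdot> (ide C (X x) \<otimes> ((ide C (X y) \<otimes> ?tzy) \<cdot> ?ty))"
    proof -
      have 1: "?byz \<otimes> ide C (X x + ?n) = (?byz \<otimes> ide C (X x)) \<otimes> ide C ?n"
        "ide C (X y) \<otimes> (?bxz \<otimes> ide C ?n) = (ide C (X y) \<otimes> ?bxz) \<otimes> ide C ?n"
        "?bxy \<otimes> ide C (X z + ?n) = (?bxy \<otimes> ide C (X z)) \<otimes> ide C ?n" by simp_all
      show ?thesis unfolding 1 using yz s
        by (subst interchange_tail, auto simp: add_ac simp del: tensor_assoc)
          (subst interchange_tail, auto simp: add_ac simp del: tensor_assoc)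
    qed
    also have "\<dots> = (((ide C (X z) \<otimes> ?bxy) \<cdot> ((?bxz \<otimes> ide C (X y)) \<cdot> (ide C (X x) \<otimes> ?byz))) \<otimes> ide C ?n)
         \<cdot> (ide C (X x) \<otimes> ((ide C (X y) \<otimes> ?tzy) \<cdot> ?ty))"
      by (simp only: braid_braid_braid)
    also have "\<dots> = (ide C (X z) \<otimes> (?bxy \<otimes> ide C ?n)) \<cdot> ((?bxz \<otimes> ide C (X y + ?n)) \<cdot>
         (ide C (X x) \<otimes> ((?byz \<otimes> ide C ?n) \<cdot> ((ide C (X y) \<otimes> ?tzy) \<cdot> ?ty))))"
    proof -
      have 1: "ide C (X z) \<otimes> (?bxy \<otimes> ide C ?n) = (ide C (X z) \<otimes> ?bxy) \<otimes> ide C ?n"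
        "?bxz \<otimes> ide C (X y + ?n) = (?bxz \<otimes> ide C (X y)) \<otimes> ide C ?n" by simp_all
      have 2: "ide C (X x) \<otimes> ((?byz \<otimes> ide C ?n) \<cdot> ((ide C (X y) \<otimes> ?tzy) \<cdot> ?ty))
         = ((ide C (X x) \<otimes> ?byz) \<otimes> ide C ?n) \<cdot> (ide C (X x) \<otimes> ((ide C (X y) \<otimes> ?tzy) \<cdot> ?ty))"
        using yz s by (simp add: interchange add_ac)
      show ?thesis unfolding 1 2 using yz s
        by (subst interchange_tail, auto simp: add_ac simp del: tensor_assoc)
          (subst interchange_tail, auto simp: add_ac simp del: tensor_assoc)
    qed
    also have "\<dots> = (ide C (X z) \<otimes> (?bxy \<otimes> ide C ?n)) \<cdot> ((?bxz \<otimes> ide C (X y + ?n)) \<cdot>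
         (ide C (X x) \<otimes> ((ide C (X z) \<otimes> ?tyz) \<cdot> ?tz)))" by (simp only: IH)
    also have "\<dots> = (ide C (X z) \<otimes> (?bxy \<otimes> ide C ?n)) \<cdot> ((ide C (X z + X x) \<otimes> ?tyz) \<cdot>
         ((?bxz \<otimes> ide C (X y + ?n)) \<cdot> (ide C (X x) \<otimes> ?tz)))"
    proof -
      have "ide C (X x) \<otimes> ((ide C (X z) \<otimes> ?tyz) \<cdot> ?tz) = (ide C (X x + X z) \<otimes> ?tyz) \<cdot> (ide C (X x) \<otimes> ?tz)"
        using yz s interchange[of "ide C (X x)" "ide C (X x)" ?tz "ide C (X z) \<otimes> ?tyz"] by simp
      moreover have "(?bxz \<otimes> ide C (X y + ?n)) \<cdot> ((ide C (X x + X z) \<otimes> ?tyz) \<cdot> (ide C (X x) \<otimes> ?tz))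
         = (ide C (X z + X x) \<otimes> ?tyz) \<cdot> ((?bxz \<otimes> ide C (X y + ?n)) \<cdot> (ide C (X x) \<otimes> ?tz))"
        using yz s by (subst (1 2) interchange_tail) (auto simp: add_ac)
      ultimately show ?thesis by simp
    qed
    also have "\<dots> = (ide C (X z) \<otimes> ((?bxy \<otimes> ide C ?n) \<cdot> (ide C (X x) \<otimes> ?tyz))) \<cdot>
         ((?bxz \<otimes> ide C (X y + ?n)) \<cdot> (ide C (X x) \<otimes> ?tz))"
    proof -
      have "ide C (X z) \<otimes> ((?bxy \<otimes> ide C ?n) \<cdot> (ide C (X x) \<otimes> ?tyz))
        = (ide C (X z) \<otimes> (?bxy \<otimes> ide C ?n)) \<cdot> (ide C (X z) \<otimes> (ide C (X x) \<otimes> ?tyz))"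
        using yz s by (subst interchange) (auto simp: add_ac)
      then show ?thesis using yz s by (simp add: add_ac)
    qed
    finally show ?thesis using 3 yz s by simp
  qed
qed simp

text \<open>The inductive step exchanges \<open>j\<close> with the first of the factors that are kept, so it rests on
\<open>to_front_to_front\<close>.  This is the step from which functoriality of \<open>proj\<close> follows.\<close>

lemma to_front_proj: assumes "j \<in> set G" "set G \<subseteq> set F" "distinct F" "distinct G"
  shows "to_front C X j G \<cdot> proj C X F G = (ide C (X j) \<otimes> proj C X (remove1 j F) (remove1 j G)) \<cdot> to_front C X j F"
  using assms
proof (induction G arbitrary: F)
  case (Cons i G)
  have sub: "set G \<subseteq> set (remove1 i F)" "i \<in> set F" "distinct (remove1 i F)" using Cons.prems by auto
  have sF: "X i + size_of X (remove1 i F) = size_of X F" using size_remove1 sub by fastforce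
  show ?case
  proof (cases "i = j")
    case True
    then show ?thesis using Cons.prems sub sF by simp
  next
    case False
    let ?F = "remove1 i F" and ?n = "size_of X (remove1 j G)"
    have j: "j \<in> set G" "j \<in> set ?F" "i \<in> set (remove1 j F)" "j \<in> set F" using False Cons.prems by auto
    have sub': "set (remove1 j G) \<subseteq> set (remove1 j ?F)" "distinct (remove1 j ?F)" "distinct (remove1 j G)"
      using Cons.prems by auto
    have s: "X j + ?n = size_of X G" "X j + size_of X (remove1 j ?F) = size_of X ?F"
      "X i + size_of X (remove1 i (remove1 j F)) = size_of X (remove1 j F)"
      "X j + size_of X (remove1 j F) = size_of X F"
      using size_remove1[OF j(1), of X] size_remove1[OF j(2), of X] size_remove1[OF j(3), of X] size_remove1[OF j(4), of X] by auto
    have c: "remove1 j ?F = remove1 i (remove1 j F)" by (rule remove1_commute)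
    let ?p = "proj C X (remove1 j ?F) (remove1 j G)"
    have "to_front C X j (i # G) \<cdot> proj C X F (i # G)
       = ((braid C (X i) (X j) \<otimes> ide C ?n) \<cdot> (ide C (X i) \<otimes> to_front C X j G)) \<cdot> ((ide C (X i) \<otimes> proj C X ?F G) \<cdot> to_front C X i F)"
      using False j by simp
    also have "\<dots> = (braid C (X i) (X j) \<otimes> ide C ?n) \<cdot> ((ide C (X i) \<otimes> (to_front C X j G \<cdot> proj C X ?F G)) \<cdot> to_front C X i F)"
      using sub Cons.prems j s sF by (simp add: interchange_tail)
    also have "\<dots> = (braid C (X i) (X j) \<otimes> ide C ?n) \<cdot> ((ide C (X i) \<otimes> ((ide C (X j) \<otimes> ?p) \<cdot> to_front C X j ?F)) \<cdot> to_front C X i F)"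
      using Cons.IH[of ?F] j sub Cons.prems by simp
    also have "ide C (X i) \<otimes> ((ide C (X j) \<otimes> ?p) \<cdot> to_front C X j ?F) = (ide C (X i + X j) \<otimes> ?p) \<cdot> (ide C (X i) \<otimes> to_front C X j ?F)"
      using j s sub' interchange[of "ide C (X i)" "ide C (X i)" "to_front C X j ?F" "ide C (X j) \<otimes> ?p"] by simp
    also have "(braid C (X i) (X j) \<otimes> ide C ?n) \<cdot> (((ide C (X i + X j) \<otimes> ?p) \<cdot> (ide C (X i) \<otimes> to_front C X j ?F)) \<cdot> to_front C X i F)
       = (ide C (X j + X i) \<otimes> ?p) \<cdot> ((braid C (X i) (X j) \<otimes> ide C (size_of X (remove1 j ?F))) \<cdot> ((ide C (X i) \<otimes> to_front C X j ?F) \<cdot> to_front C X i F))"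
      using j s sub sub' sF Cons.prems by (simp add: interchange_tail add_ac)
    also have "(braid C (X i) (X j) \<otimes> ide C (size_of X (remove1 j ?F))) \<cdot> ((ide C (X i) \<otimes> to_front C X j ?F) \<cdot> to_front C X i F)
       = (ide C (X j) \<otimes> to_front C X i (remove1 j F)) \<cdot> to_front C X j F"
      using to_front_to_front[of i j F X] False j sub Cons.prems by simp
    also have "(ide C (X j + X i) \<otimes> ?p) \<cdot> ((ide C (X j) \<otimes> to_front C X i (remove1 j F)) \<cdot> to_front C X j F)
       = (ide C (X j) \<otimes> ((ide C (X i) \<otimes> ?p) \<cdot> to_front C X i (remove1 j F))) \<cdot> to_front C X j F"
    proof -
      have "ide C (X j + X i) \<otimes> ?p = ide C (X j) \<otimes> (ide C (X i) \<otimes> ?p)" using sub' by simp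
      then show ?thesis using j s sub sub' sF c by (simp only:) (subst interchange_tail, auto)
    qed
    finally show ?thesis using False c by simp
  qed
qed simp

lemma proj_comp: assumes "set H \<subseteq> set G" "set G \<subseteq> set F" "distinct F" "distinct G" "distinct H"
  shows "proj C X G H \<cdot> proj C X F G = proj C X F H"
  using assms
proof (induction H arbitrary: F G)
  case Nil
  then show ?case by (auto intro!: terminal_eq)
next
  case (Cons j H)
  have m: "j \<in> set G" "j \<in> set F" "set H \<subseteq> set (remove1 j G)" "set (remove1 j G) \<subseteq> set (remove1 j F)"
    using Cons.prems by auto
  have s: "X j + size_of X (remove1 j F) = size_of X F" "X j + size_of X (remove1 j G) = size_of X G"
    using m size_remove1 by fastforce+
  have "proj C X G (j # H) \<cdot> proj C X F G
     = (ide C (X j) \<otimes> proj C X (remove1 j G) H) \<cdot> (to_front C X j G \<cdot> proj C X F G)"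
    using m s Cons.prems by simp
  also have "\<dots> = (ide C (X j) \<otimes> (proj C X (remove1 j G) H \<cdot> proj C X (remove1 j F) (remove1 j G))) \<cdot> to_front C X j F"
    using m s Cons.prems by (simp add: to_front_proj interchange_tail)
  finally show ?case using m Cons by simp
qed

lemma braid_hexagon': "(braid C a c \<otimes> ide C b) \<cdot> (ide C a \<otimes> braid C b c) = braid C (a + b) c"
proof (rule inverse_unique[of "braid C c (a + b)"])
  show "((braid C a c \<otimes> ide C b) \<cdot> (ide C a \<otimes> braid C b c)) \<cdot> braid C c (a + b) = ide C (source C (braid C c (a + b)))"
    unfolding braid_hexagon[symmetric]
    by (simp add: add_ac interchange_tail interchange braid_braid)
qed (auto simp: add_ac braid_braid)

lemma to_front_append1: assumes "j \<in> set F"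
  shows "to_front C X j (F @ G) = to_front C X j F \<otimes> ide C (size_of X G)"
  using assms
proof (induction F)
  case (Cons i F)
  show ?case
  proof (cases "i = j")
    case False
    then have j: "j \<in> set F" using Cons by auto
    have s: "X j + size_of X (remove1 j F) = size_of X F" using size_remove1[OF j] .
    have "to_front C X j ((i # F) @ G) = ((braid C (X i) (X j) \<otimes> ide C (size_of X (remove1 j F))) \<otimes> ide C (size_of X G))
        \<cdot> ((ide C (X i) \<otimes> to_front C X j F) \<otimes> ide C (size_of X G))"
      using False j Cons by (simp add: remove1_append)
    also have "\<dots> = to_front C X j (i # F) \<otimes> ide C (size_of X G)"
      using False j s by (subst interchange) (auto simp: add_ac)
    finally show ?thesis .
  qed (simp add: add_ac)
qed simp

lemma to_front_append2: assumes "j \<notin> set F" "j \<in> set G"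
  shows "to_front C X j (F @ G)
    = (braid C (size_of X F) (X j) \<otimes> ide C (size_of X (remove1 j G))) \<cdot> (ide C (size_of X F) \<otimes> to_front C X j G)"
  using assms
proof (induction F)
  case Nil
  then show ?case using size_remove1[of j G X] by simp
next
  case (Cons i F)
  let ?n = "size_of X (remove1 j G)" and ?f = "size_of X F"
  have s: "X j + ?n = size_of X G" using size_remove1 Cons by fastforce
  have r: "remove1 j (F @ G) = F @ remove1 j G" "i \<noteq> j" using Cons by (auto simp: remove1_append)
  have "to_front C X j ((i # F) @ G) = (braid C (X i) (X j) \<otimes> ide C (?f + ?n))
     \<cdot> (ide C (X i) \<otimes> ((braid C ?f (X j) \<otimes> ide C ?n) \<cdot> (ide C ?f \<otimes> to_front C X j G)))"
    using Cons r by simp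
  also have "ide C (X i) \<otimes> ((braid C ?f (X j) \<otimes> ide C ?n) \<cdot> (ide C ?f \<otimes> to_front C X j G))
     = ((ide C (X i) \<otimes> braid C ?f (X j)) \<otimes> ide C ?n) \<cdot> (ide C (X i + ?f) \<otimes> to_front C X j G)"
    using Cons s interchange[of "ide C (X i)" "ide C (X i)" "ide C ?f \<otimes> to_front C X j G" "braid C ?f (X j) \<otimes> ide C ?n"]
    by (simp add: add_ac)
  also have "(braid C (X i) (X j) \<otimes> ide C (?f + ?n)) \<cdot> \<dots>
     = (((braid C (X i) (X j) \<otimes> ide C ?f) \<cdot> (ide C (X i) \<otimes> braid C ?f (X j))) \<otimes> ide C ?n) \<cdot> (ide C (X i + ?f) \<otimes> to_front C X j G)"
  proof -
    have 1: "braid C (X i) (X j) \<otimes> ide C (?f + ?n) = (braid C (X i) (X j) \<otimes> ide C ?f) \<otimes> ide C ?n" by simp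
    show ?thesis unfolding 1 using Cons s by (subst interchange_tail) (auto simp: add_ac simp del: tensor_assoc)
  qed
  also have "\<dots> = (braid C (X i + ?f) (X j) \<otimes> ide C ?n) \<cdot> (ide C (X i + ?f) \<otimes> to_front C X j G)"
    by (simp only: braid_hexagon')
  finally show ?case by simp
qed

lemma del_braid: "(ide C n \<otimes> del C m) \<cdot> braid C m n = del C m \<otimes> ide C n"
  using braid_natural[of "del C m" "ide C n"] by simp

text \<open>While the factors in \<open>F'\<close> are moved to the front they pass all of \<open>F\<close>; by naturality of the symmetry
it makes no difference whether what they pass is deleted before or after (\<open>del_braid\<close>).\<close>

lemma proj_append: assumes "set G \<subseteq> set F" "set G' \<subseteq> set F'" "distinct (F @ F')" "distinct G" "distinct G'"
  shows "proj C X (F @ F') (G @ G') = proj C X F G \<otimes> proj C X F' G'"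
  using assms
proof (induction G arbitrary: F)
  case (Cons j G)
  have j: "j \<in> set F" "set G \<subseteq> set (remove1 j F)" using Cons.prems by auto
  have s: "X j + size_of X (remove1 j F) = size_of X F" using j size_remove1 by fastforce
  have IH: "proj C X (remove1 j F @ F') (G @ G') = proj C X (remove1 j F) G \<otimes> proj C X F' G'"
    using Cons.IH[of "remove1 j F"] Cons.prems j by auto
  have "proj C X (F @ F') ((j # G) @ G') = (ide C (X j) \<otimes> (proj C X (remove1 j F) G \<otimes> proj C X F' G'))
      \<cdot> (to_front C X j F \<otimes> ide C (size_of X F'))"
    using j IH by (simp add: remove1_append to_front_append1)
  also have "\<dots> = ((ide C (X j) \<otimes> proj C X (remove1 j F) G) \<otimes> proj C X F' G')
      \<cdot> (to_front C X j F \<otimes> ide C (size_of X F'))" using Cons.prems j by simp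
  also have "\<dots> = proj C X F (j # G) \<otimes> proj C X F' G'"
    using Cons.prems j s by (subst interchange) (auto simp del: tensor_assoc)
  finally show ?case .
next
  case Nil
  then show ?case
  proof (induction G' arbitrary: F')
    case Nil
    then show ?case by (simp add: del_tensor)
  next
    case (Cons j G)
    have j: "j \<in> set F'" "j \<notin> set F" "set G \<subseteq> set (remove1 j F')" "distinct F'" using Cons.prems by auto
    have s: "X j + size_of X (remove1 j F') = size_of X F'" using j size_remove1 by fastforce
    have IH: "proj C X (F @ remove1 j F') G = del C (size_of X F) \<otimes> proj C X (remove1 j F') G"
      using Cons.IH[of "remove1 j F'"] Cons.prems j by auto
    let ?p = "proj C X (remove1 j F') G"
    have "proj C X (F @ F') (j # G) = (ide C (X j) \<otimes> (del C (size_of X F) \<otimes> ?p)) \<cdot>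
       ((braid C (size_of X F) (X j) \<otimes> ide C (size_of X (remove1 j F'))) \<cdot> (ide C (size_of X F) \<otimes> to_front C X j F'))"
      using j IH by (simp add: remove1_append to_front_append2)
    also have "\<dots> = ((ide C (X j) \<otimes> del C (size_of X F)) \<otimes> ?p) \<cdot>
       ((braid C (size_of X F) (X j) \<otimes> ide C (size_of X (remove1 j F'))) \<cdot> (ide C (size_of X F) \<otimes> to_front C X j F'))"
      using Cons.prems j by simp
    also have "\<dots> = ((del C (size_of X F) \<otimes> ide C (X j)) \<otimes> ?p) \<cdot> (ide C (size_of X F) \<otimes> to_front C X j F')"
      using Cons.prems j s by (subst interchange_tail) (auto simp: del_braid add_ac simp del: tensor_assoc)
    also have "\<dots> = (del C (size_of X F) \<otimes> (ide C (X j) \<otimes> ?p)) \<cdot> (ide C (size_of X F) \<otimes> to_front C X j F')"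
      using Cons.prems j by simp
    also have "\<dots> = del C (size_of X F) \<otimes> proj C X F' (j # G)"
      using Cons.prems j s by (subst interchange) auto
    finally show ?case by simp
  qed
qed

lemma proj_swap: assumes "distinct (F @ G)"
  shows "proj C X (F @ G) (G @ F) = braid C (size_of X F) (size_of X G)"
  using assms
proof (induction G)
  case (Cons j G)
  have IH: "proj C X (F @ G) (G @ F) = braid C (size_of X F) (size_of X G)" using Cons by auto
  have "proj C X (F @ j # G) ((j # G) @ F) = (ide C (X j) \<otimes> braid C (size_of X F) (size_of X G))
      \<cdot> (braid C (size_of X F) (X j) \<otimes> ide C (size_of X G))"
    using Cons.prems IH by (simp add: remove1_append to_front_append2 add_ac)
  then show ?case by (simp add: braid_hexagon)
qed simp

lemma remove1_map: "inj_on h (insert j (set F)) \<Longrightarrow> remove1 (h j) (map h F) = map h (remove1 j F)"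
  by (induction F) (auto simp: inj_on_def)

lemma to_front_map: assumes "inj_on h (insert j (set F))" "\<And>i. i \<in> insert j (set F) \<Longrightarrow> Y (h i) = X i" "j \<in> set F"
  shows "to_front C Y (h j) (map h F) = to_front C X j F"
  using assms
proof (induction F)
  case (Cons i F)
  have r: "remove1 (h j) (map h F) = map h (remove1 j F)"
    by (rule remove1_map) (use Cons.prems(1) in \<open>auto simp: inj_on_def\<close>)
  have "map (Y \<circ> h) F = map X F" "map (Y \<circ> h) (remove1 j F) = map X (remove1 j F)"
    using Cons.prems(2) by (auto dest: notin_set_remove1)
  then have m: "sum_list (map (Y \<circ> h) F) = size_of X F"
    "sum_list (map (Y \<circ> h) (remove1 j F)) = size_of X (remove1 j F)" by metis+
  show ?case
  proof (cases "i = j")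
    case False
    then have "h i \<noteq> h j" "j \<in> set F" using Cons.prems by (auto simp: inj_on_def)
    moreover from this have "to_front C Y (h j) (map h F) = to_front C X j F"
      by (intro Cons.IH) (use Cons.prems in \<open>auto simp: inj_on_def\<close>)
    ultimately show ?thesis using False Cons.prems(2) r m by simp
  qed (use Cons m in auto)
qed simp

lemma proj_map: assumes "inj_on h (set F)" "\<And>i. i \<in> set F \<Longrightarrow> Y (h i) = X i" "set G \<subseteq> set F" "distinct F" "distinct G"
  shows "proj C Y (map h F) (map h G) = proj C X F G"
  using assms
proof (induction G arbitrary: F)
  case Nil
  then have "map (Y \<circ> h) F = map X F" by auto
  then have "sum_list (map (Y \<circ> h) F) = size_of X F" by metis
  then show ?case by simp
next
  case (Cons j G)
  have r: "remove1 (h j) (map h F) = map h (remove1 j F)"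
    by (rule remove1_map) (use Cons.prems in \<open>auto simp: insert_absorb\<close>)
  have "proj C Y (map h (remove1 j F)) (map h G) = proj C X (remove1 j F) G"
    by (rule Cons.IH) (use Cons.prems in \<open>auto intro: inj_on_subset\<close>)
  moreover have "to_front C Y (h j) (map h F) = to_front C X j F"
    by (rule to_front_map) (use Cons.prems in \<open>auto simp: insert_absorb\<close>)
  ultimately show ?case using r Cons.prems by simp
qed

text \<open>Up to a permutation a projection is a deletion, and permutations are invertible; so this is where
cancellativity of deletions enters.\<close>

lemma proj_epi: assumes "arr C f" "arr C g" "source C f = size_of X G" "source C g = size_of X G"
    "f \<cdot> proj C X F G = g \<cdot> proj C X F G" "set G \<subseteq> set F" "distinct F" "distinct G"
  shows "f = g"
proof -
  \<comment> \<open>Precomposition with the permutation \<open>?r\<close> turns the projection into the deletion of \<open>?H\<close>.\<close>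
  let ?H = "filter (\<lambda>j. j \<notin> set G) F"
  let ?r = "proj C X (G @ ?H) F" and ?d = "del C (size_of X ?H)"
  have d: "distinct (G @ ?H)" "set F \<subseteq> set (G @ ?H)" using assms by auto
  have 1: "k \<cdot> proj C X F G \<cdot> ?r = k \<otimes> ?d" if "arr C k" "source C k = size_of X G" for k
  proof -
    have "proj C X F G \<cdot> ?r = proj C X (G @ ?H) G" using d assms by (intro proj_comp) auto
    also have "\<dots> = ide C (size_of X G) \<otimes> ?d" using proj_append[of G G "[]" ?H X] assms by auto
    finally show ?thesis using interchange[of "ide C (size_of X G)" k "?d" "ide C 0"] that by simp
  qed
  note t = assms(1-4,6-8)
  have "target C (f \<cdot> proj C X F G) = target C f" "target C (g \<cdot> proj C X F G) = target C g"
    using t by auto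
  then have tgt: "target C f = target C g" unfolding assms(5) by simp
  have "f \<cdot> proj C X F G \<cdot> ?r = (f \<cdot> proj C X F G) \<cdot> ?r" using t d by simp
  also have "\<dots> = g \<cdot> proj C X F G \<cdot> ?r" unfolding assms(5) using t d by simp
  finally have e: "f \<otimes> ?d = g \<otimes> ?d" using 1 t by simp
  have "f \<in> hom C (source C f) (target C f)" "g \<in> hom C (source C f) (target C f)"
    using arr_typed(1)[of f] arr_typed(1)[of g] t tgt by simp_all
  then show ?thesis
    using cancellative[unfolded cancellative_deletions_def, rule_format, OF obj_iff obj_iff obj_iff _ _ e] by blast
qed

text \<open>Splitting every factor into single wires turns all projections into those of a constant family, where
only names of wires matter.\<close>

abbreviation wproj :: "'w list \<Rightarrow> 'w list \<Rightarrow> 'm" where "wproj \<equiv> proj C (\<lambda>_. 1)"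

lemma size_of_1 [simp]: "size_of (\<lambda>_. 1) F = length F" "size_of (\<lambda>_. Suc 0) F = length F"
  by (simp_all add: sum_list_triv)

lemma wproj_map: assumes "inj_on h (set F)" "set G \<subseteq> set F" "distinct F" "distinct G"
  shows "wproj (map h F) (map h G) = wproj F G"
  by (rule proj_map) (use assms in auto)

definition wires_of :: "('j \<Rightarrow> nat) \<Rightarrow> 'j list \<Rightarrow> ('j \<times> nat) list" where
  "wires_of X F = concat (map (\<lambda>j. map (Pair j) [0..<X j]) F)"

lemma wires_of_simps [simp]: "wires_of X [] = []" "wires_of X (j # F) = map (Pair j) [0..<X j] @ wires_of X F"
  by (auto simp: wires_of_def)

lemma set_wires_of: "set (wires_of X F) = Sigma (set F) (\<lambda>j. {..<X j})"
  unfolding wires_of_def by auto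

lemma length_wires_of [simp]: "length (wires_of X F) = size_of X F"
  by (induction F) simp_all

lemma distinct_wires_of: "distinct F \<Longrightarrow> distinct (wires_of X F)"
  by (induction F) (auto simp: set_wires_of distinct_map inj_on_def)

lemma to_front_wires: assumes "j \<in> set F" "distinct F"
  shows "to_front C X j F = wproj (wires_of X F) (wires_of X (j # remove1 j F))"
  using assms
proof (induction F)
  case (Cons i F)
  show ?case
  proof (cases "i = j")
    case True
    then show ?thesis by (simp add: o_def)
  next
    case False
    then have j: "j \<in> set F" "distinct F" "i \<notin> set F" using Cons.prems by auto
    let ?i = "map (Pair i) [0..<X i]" and ?j = "map (Pair j) [0..<X j]" and ?R = "wires_of X (remove1 j F)"
    have d: "distinct (?i @ ?j @ ?R)" "distinct (?j @ ?i @ ?R)" "set (?j @ ?R) = set (wires_of X F)"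
      "distinct (?i @ wires_of X F)" "distinct (?i @ ?j)"
      using j False by (auto simp: set_wires_of distinct_wires_of distinct_map inj_on_def dest: notin_set_remove1)
    have "to_front C X j (i # F) = (wproj (?i @ ?j) (?j @ ?i) \<otimes> wproj ?R ?R) \<cdot> (wproj ?i ?i \<otimes> wproj (wires_of X F) (?j @ ?R))"
      using False j Cons.IH d(5) by (simp add: proj_swap o_def)
    also have "\<dots> = wproj (?i @ ?j @ ?R) (?j @ ?i @ ?R) \<cdot> wproj (?i @ wires_of X F) (?i @ ?j @ ?R)"
    proof -
      have "wproj ((?i @ ?j) @ ?R) ((?j @ ?i) @ ?R) = wproj (?i @ ?j) (?j @ ?i) \<otimes> wproj ?R ?R"
        by (rule proj_append) (use d in auto)
      moreover have "wproj (?i @ wires_of X F) (?i @ (?j @ ?R)) = wproj ?i ?i \<otimes> wproj (wires_of X F) (?j @ ?R)"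
        by (rule proj_append) (use d in auto)
      ultimately show ?thesis by (simp only: append_assoc)
    qed
    also have "\<dots> = wproj (?i @ wires_of X F) (?j @ ?i @ ?R)"
      by (rule proj_comp) (use d in auto)
    finally show ?thesis using False by simp
  qed
qed simp

lemma proj_wires: assumes "set G \<subseteq> set F" "distinct F" "distinct G"
  shows "proj C X F G = wproj (wires_of X F) (wires_of X G)"
  using assms
proof (induction G arbitrary: F)
  case (Cons j G)
  let ?j = "map (Pair j) [0..<X j]" and ?R = "wires_of X (remove1 j F)"
  have j: "j \<in> set F" "set G \<subseteq> set (remove1 j F)" "distinct F" "distinct G" "j \<notin> set G" "distinct (remove1 j F)"
    using Cons.prems by auto
  have d: "distinct (?j @ ?R)" "set (wires_of X G) \<subseteq> set ?R" "distinct (wires_of X G)" "distinct (?j @ wires_of X G)"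
    "distinct (wires_of X F)" "set (?j @ ?R) \<subseteq> set (wires_of X F)"
    using j by (auto simp: set_wires_of distinct_wires_of distinct_map inj_on_def dest: notin_set_remove1)
  have "proj C X F (j # G) = (wproj ?j ?j \<otimes> wproj ?R (wires_of X G)) \<cdot> wproj (wires_of X F) (?j @ ?R)"
    using j Cons.IH[of "remove1 j F"] by (simp add: to_front_wires o_def)
  also have "\<dots> = wproj (?j @ ?R) (?j @ wires_of X G) \<cdot> wproj (wires_of X F) (?j @ ?R)"
    using proj_append[of ?j ?j "wires_of X G" ?R "\<lambda>_. 1"] d by (simp del: proj_ide)
  also have "\<dots> = wproj (wires_of X F) (?j @ wires_of X G)"
    by (rule proj_comp) (use d in auto)
  finally show ?case by simp
qed simp

end

section \<open>Abstract infinite tensor products and families\<close>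

lemma FinLO_arr_iff: "(F', F) \<in> FinLO_arr J \<longleftrightarrow> F' \<in> FinLO J \<and> F \<in> FinLO J \<and> set F \<subseteq> set F'"
  by (auto simp: FinLO_arr_def)

lemma FinLO_union: assumes "F \<in> FinLO J" "F' \<in> FinLO J"
  obtains F'' where "(F'', F) \<in> FinLO_arr J" "(F'', F') \<in> FinLO_arr J"
proof
  show "(remdups (F @ F'), F) \<in> FinLO_arr J" "(remdups (F @ F'), F') \<in> FinLO_arr J"
    using assms by (auto simp: FinLO_def FinLO_arr_def)
qed

lemma FinLO_arr_refl: "F \<in> FinLO J \<Longrightarrow> (F, F) \<in> FinLO_arr J"
  by (simp add: FinLO_arr_iff)

lemma FinLO_arr_trans: "(F'', F') \<in> FinLO_arr J \<Longrightarrow> (F', F) \<in> FinLO_arr J \<Longrightarrow> (F'', F) \<in> FinLO_arr J"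
  by (auto simp: FinLO_arr_iff)

lemma FinLO_distinct: "F \<in> FinLO J \<Longrightarrow> distinct F" by (simp add: FinLO_def)

lemma FinLO_cut: "F \<in> FinLO (J \<union> J') \<Longrightarrow> cut F J \<in> FinLO J" "F \<in> FinLO (J \<union> J') \<Longrightarrow> cut F J' \<in> FinLO J'"
  by (auto simp: FinLO_def)

lemma FinLO_arr_cut: "(F', F) \<in> FinLO_arr (J \<union> J') \<Longrightarrow> (cut F' J, cut F J) \<in> FinLO_arr J"
  "(F', F) \<in> FinLO_arr (J \<union> J') \<Longrightarrow> (cut F' J', cut F J') \<in> FinLO_arr J'"
  by (auto simp: FinLO_arr_iff FinLO_cut)

context semicartesian_prop begin

definition aitp :: "('j, nat, 'm) diagram \<Rightarrow> bool" where
  "aitp X \<longleftrightarrow> (\<exists>n. abstract_itp_of C (idx X) n X)"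

lemma std_itp_prj: "(F', F) \<in> FinLO_arr J \<Longrightarrow> prj (std_itp C J n) (F', F) = proj C n F' F"
  "F \<in> FinLO J \<Longrightarrow> ob (std_itp C J n) F = size_of n F" "idx (std_itp C J n) = J"
  by (auto simp: std_itp_def)

text \<open>\<open>\<theta>\<close> and \<open>\<tau>\<close> are mutually inverse isomorphisms between the values of \<open>X\<close> and the
  finite tensor products of the objects \<open>n j\<close>, and identify the projections of \<open>X\<close> with \<open>proj\<close>.\<close>

definition standard_iso :: "('j, nat, 'm) diagram \<Rightarrow> ('j \<Rightarrow> nat) \<Rightarrow> ('j list \<Rightarrow> 'm) \<Rightarrow> ('j list \<Rightarrow> 'm) \<Rightarrow> bool" where
  "standard_iso X n \<theta> \<tau> \<longleftrightarrow>
     (\<forall>F\<in>FinLO (idx X). (arr C (\<theta> F) \<and> source C (\<theta> F) = ob X F \<and> target C (\<theta> F) = size_of n F)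
       \<and> (arr C (\<tau> F) \<and> source C (\<tau> F) = size_of n F \<and> target C (\<tau> F) = ob X F)
       \<and> (\<theta> F \<cdot> \<tau> F = ide C (size_of n F) \<and> \<tau> F \<cdot> \<theta> F = ide C (ob X F)))
     \<and> (\<forall>F' F. (F', F) \<in> FinLO_arr (idx X) \<longrightarrow> \<theta> F \<cdot> prj X (F', F) = proj C n F' F \<cdot> \<theta> F'
       \<and> prj X (F', F) = \<tau> F \<cdot> (proj C n F' F \<cdot> \<theta> F'))"

lemma standard_isoD: assumes "standard_iso X n \<theta> \<tau>"
  shows "F \<in> FinLO (idx X) \<Longrightarrow> arr C (\<theta> F) \<and> source C (\<theta> F) = ob X F \<and> target C (\<theta> F) = size_of n F"
    "F \<in> FinLO (idx X) \<Longrightarrow> arr C (\<tau> F) \<and> source C (\<tau> F) = size_of n F \<and> target C (\<tau> F) = ob X F"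
    "F \<in> FinLO (idx X) \<Longrightarrow> \<theta> F \<cdot> \<tau> F = ide C (size_of n F) \<and> \<tau> F \<cdot> \<theta> F = ide C (ob X F)"
    "(F', F) \<in> FinLO_arr (idx X) \<Longrightarrow> \<theta> F \<cdot> prj X (F', F) = proj C n F' F \<cdot> \<theta> F'"
    "(F', F) \<in> FinLO_arr (idx X) \<Longrightarrow> prj X (F', F) = \<tau> F \<cdot> (proj C n F' F \<cdot> \<theta> F')"
  using assms unfolding standard_iso_def by blast+

lemma aitpE: assumes "aitp X" obtains n \<theta> \<tau> where "countable (idx X)" "standard_iso X n \<theta> \<tau>"
proof -
  obtain n \<theta> where h: "countable (idx X)"
    "\<And>F. F\<in>FinLO (idx X) \<Longrightarrow> iso_in C (ob X F) (ob (std_itp C (idx X) n) F) (\<theta> F)"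
    "\<And>F' F. (F', F)\<in>FinLO_arr (idx X) \<Longrightarrow> prj X (F', F) \<in> hom C (ob X F') (ob X F)
      \<and> \<theta> F \<cdot> prj X (F', F) = prj (std_itp C (idx X) n) (F', F) \<cdot> \<theta> F'"
    using assms unfolding aitp_def abstract_itp_of_def by blast
  define \<tau> where "\<tau> F = inv_of C (ob X F) (size_of n F) (\<theta> F)" for F
  have t: "arr C (\<theta> F) \<and> source C (\<theta> F) = ob X F \<and> target C (\<theta> F) = size_of n F"
    "arr C (\<tau> F) \<and> source C (\<tau> F) = size_of n F \<and> target C (\<tau> F) = ob X F"
    "\<theta> F \<cdot> \<tau> F = ide C (size_of n F) \<and> \<tau> F \<cdot> \<theta> F = ide C (ob X F)" if "F \<in> FinLO (idx X)" for F
    using iso_in_typed[OF h(2)[OF that]] that by (simp_all add: \<tau>_def std_itp_prj)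
  have n: "\<theta> F \<cdot> prj X (F', F) = proj C n F' F \<cdot> \<theta> F'" if "(F', F) \<in> FinLO_arr (idx X)" for F' F
    using h(3)[OF that] that by (simp add: std_itp_prj)
  have p: "prj X (F', F) = \<tau> F \<cdot> (proj C n F' F \<cdot> \<theta> F')" if "(F', F) \<in> FinLO_arr (idx X)" for F' F
  proof -
    have F: "F \<in> FinLO (idx X)" using that by (simp add: FinLO_arr_iff)
    note q = conjunct1[OF h(3)[OF that], simplified hom_iff[OF obj_iff obj_iff]]
    have "prj X (F', F) = (\<tau> F \<cdot> \<theta> F) \<cdot> prj X (F', F)"
      using q t(3)[OF F] by simp
    also have "\<dots> = \<tau> F \<cdot> (\<theta> F \<cdot> prj X (F', F))"
      by (rule comp_assoc') (use q t[OF F] in auto)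
    finally show ?thesis using n[OF that] by simp
  qed
  have "standard_iso X n \<theta> \<tau>" unfolding standard_iso_def using t n p by blast
  then show thesis by (rule that[OF h(1)])
qed

lemma aitpI: assumes "countable (idx X)" "ob X \<in> extensional (FinLO (idx X))" "prj X \<in> extensional (FinLO_arr (idx X))"
    "\<And>F' F. (F', F) \<in> FinLO_arr (idx X) \<Longrightarrow> arr C (prj X (F', F)) \<and> source C (prj X (F', F)) = ob X F' \<and> target C (prj X (F', F)) = ob X F"
    "\<And>F. F \<in> FinLO (idx X) \<Longrightarrow> iso_in C (ob X F) (size_of n F) (\<theta> F)"
    "\<And>F' F. (F', F) \<in> FinLO_arr (idx X) \<Longrightarrow> \<theta> F \<cdot> prj X (F', F) = proj C n F' F \<cdot> \<theta> F'"
  shows "aitp X"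
  unfolding aitp_def abstract_itp_of_def using assms hom_iff
  by (intro exI[of _ n] conjI exI[of _ \<theta>]) (auto simp: std_itp_prj)

lemma aitp_prj: assumes "aitp X" "(F', F) \<in> FinLO_arr (idx X)"
  shows "arr C (prj X (F', F))" "source C (prj X (F', F)) = ob X F'" "target C (prj X (F', F)) = ob X F"
proof -
  obtain n \<theta> \<tau> where "standard_iso X n \<theta> \<tau>" by (rule aitpE[OF assms(1)])
  note h = standard_isoD[OF this]
  have F: "F \<in> FinLO (idx X)" "F' \<in> FinLO (idx X)" "set F \<subseteq> set F'" "distinct F" "distinct F'"
    using assms FinLO_distinct by (auto simp: FinLO_arr_iff)
  show "arr C (prj X (F', F))" "source C (prj X (F', F)) = ob X F'" "target C (prj X (F', F)) = ob X F"
    using F h(1)[OF F(2)] h(2)[OF F(1)] h(5)[OF assms(2)] by auto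
qed

lemma aitp_prj_ide: assumes "aitp X" "F \<in> FinLO (idx X)" shows "prj X (F, F) = ide C (ob X F)"
proof -
  obtain n \<theta> \<tau> where "standard_iso X n \<theta> \<tau>" by (rule aitpE[OF assms(1)])
  note h = standard_isoD[OF this]
  show ?thesis using h(1,3)[OF assms(2)] h(5)[OF FinLO_arr_refl[OF assms(2)]] by simp
qed

lemma aitp_prj_comp: assumes "aitp X" "(F'', F') \<in> FinLO_arr (idx X)" "(F', F) \<in> FinLO_arr (idx X)"
  shows "prj X (F', F) \<cdot> prj X (F'', F') = prj X (F'', F)"
proof -
  obtain n \<theta> \<tau> where "standard_iso X n \<theta> \<tau>" by (rule aitpE[OF assms(1)])
  note h = standard_isoD[OF this]
  have F: "F \<in> FinLO (idx X)" "F' \<in> FinLO (idx X)" "F'' \<in> FinLO (idx X)" "set F \<subseteq> set F'" "set F' \<subseteq> set F''"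
     "distinct F" "distinct F'" "distinct F''"
    using assms FinLO_distinct by (auto simp: FinLO_arr_iff)
  note t = aitp_prj[OF assms(1,2)] aitp_prj[OF assms(1,3)] h(1)[OF F(1)] h(1)[OF F(2)] h(1)[OF F(3)] h(2)[OF F(1)]
  have "prj X (F', F) \<cdot> prj X (F'', F') = (\<tau> F \<cdot> (proj C n F' F \<cdot> \<theta> F')) \<cdot> prj X (F'', F')"
    using h(5)[OF assms(3)] by simp
  also have "\<dots> = \<tau> F \<cdot> (proj C n F' F \<cdot> (\<theta> F' \<cdot> prj X (F'', F')))" using t F by simp
  also have "\<dots> = \<tau> F \<cdot> ((proj C n F' F \<cdot> proj C n F'' F') \<cdot> \<theta> F'')" using h(4)[OF assms(2)] t F by simp
  also have "\<dots> = prj X (F'', F)" using h(5) assms(2,3) F proj_comp[of F F' F'' n] by (metis FinLO_arr_trans)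
  finally show ?thesis .
qed

text \<open>Transported from \<open>proj_epi\<close> along the isomorphism with the standard diagram.\<close>

lemma aitp_epi: assumes "aitp X" "(F', F) \<in> FinLO_arr (idx X)" "arr C f" "arr C g" "source C f = ob X F" "source C g = ob X F"
    and e: "f \<cdot> prj X (F', F) = g \<cdot> prj X (F', F)"
  shows "f = g"
proof -
  obtain n \<theta> \<tau> where "standard_iso X n \<theta> \<tau>" by (rule aitpE[OF assms(1)])
  note h = standard_isoD[OF this]
  have F: "F \<in> FinLO (idx X)" "F' \<in> FinLO (idx X)" "set F \<subseteq> set F'" "distinct F" "distinct F'"
    using assms FinLO_distinct by (auto simp: FinLO_arr_iff)
  note t = h(1)[OF F(1)] h(1)[OF F(2)] h(2)[OF F(1)] h(2)[OF F(2)] h(3)[OF F(1)] h(3)[OF F(2)]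
  have k: "(k \<cdot> \<tau> F) \<cdot> proj C n F' F = (k \<cdot> prj X (F', F)) \<cdot> \<tau> F'" if "arr C k" "source C k = ob X F" for k
    unfolding h(5)[OF assms(2)] using t F that by simp
  have "(f \<cdot> \<tau> F) \<cdot> proj C n F' F = (g \<cdot> \<tau> F) \<cdot> proj C n F' F"
    using k[OF assms(3,5)] k[OF assms(4,6)] e by simp
  then have "f \<cdot> \<tau> F = g \<cdot> \<tau> F"
    by (rule proj_epi[rotated 4]) (use t F assms(3-6) in auto)
  then have "(f \<cdot> \<tau> F) \<cdot> \<theta> F = (g \<cdot> \<tau> F) \<cdot> \<theta> F" by simp
  then show ?thesis using t assms(3-6) by simp
qed

lemma fam_typed: assumes "fin_approx C f" "(F, G) \<in> Lam f"
  shows "F \<in> FinLO (idx (src f))" "G \<in> FinLO (idx (tgt f))"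
    "arr C (cpt f (F, G))" "source C (cpt f (F, G)) = ob (src f) F" "target C (cpt f (F, G)) = ob (tgt f) G"
proof -
  have "cpt f (F, G) \<in> hom C (ob (src f) F) (ob (tgt f) G)" using assms unfolding fin_approx_def by blast
  then show "arr C (cpt f (F, G))" "source C (cpt f (F, G)) = ob (src f) F" "target C (cpt f (F, G)) = ob (tgt f) G"
    by (simp_all add: hom_iff)
  show "F \<in> FinLO (idx (src f))" "G \<in> FinLO (idx (tgt f))"
    using assms unfolding fin_approx_def by blast+
qed

lemma fam_natural: assumes "fin_approx C f" "(F, G) \<in> Lam f" "(F', G') \<in> Lam f" "(F', F) \<in> FinLO_arr (idx (src f))"
    "(G', G) \<in> FinLO_arr (idx (tgt f))"
  shows "prj (tgt f) (G', G) \<cdot> cpt f (F', G') = cpt f (F, G) \<cdot> prj (src f) (F', F)"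
  using assms unfolding fin_approx_def by blast

lemma fam_cover: assumes "fin_approx C f" "G \<in> FinLO (idx (tgt f))" shows "\<exists>F. (F, G) \<in> Lam f"
  using assms unfolding fin_approx_def by blast

lemma fam_upward: assumes "fin_approx C f" "(F, G) \<in> Lam f" "(F', F) \<in> FinLO_arr (idx (src f))"
  shows "(F', G) \<in> Lam f"
  using assms unfolding fin_approx_def by blast

lemma fam_restrict: assumes "fin_approx C f" "aitp (tgt f)" "(F, G) \<in> Lam f" "(F', F) \<in> FinLO_arr (idx (src f))"
  shows "cpt f (F', G) = cpt f (F, G) \<cdot> prj (src f) (F', F)"
proof -
  have u: "(F', G) \<in> Lam f" by (rule fam_upward[OF assms(1,3,4)])
  note t = fam_typed[OF assms(1) u]
  show ?thesis using fam_natural[OF assms(1,3) u assms(4) FinLO_arr_refl[OF t(2)]] aitp_prj_ide[OF assms(2) t(2)] t by simp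
qed

lemma fin_approxI: assumes
    "\<And>F G. (F, G) \<in> Lam f \<Longrightarrow> F \<in> FinLO (idx (src f)) \<and> G \<in> FinLO (idx (tgt f)) \<and>
      arr C (cpt f (F, G)) \<and> source C (cpt f (F, G)) = ob (src f) F \<and> target C (cpt f (F, G)) = ob (tgt f) G"
    "\<And>F G F' G'. (F, G) \<in> Lam f \<Longrightarrow> (F', G') \<in> Lam f \<Longrightarrow> (F', F) \<in> FinLO_arr (idx (src f)) \<Longrightarrow>
      (G', G) \<in> FinLO_arr (idx (tgt f)) \<Longrightarrow> prj (tgt f) (G', G) \<cdot> cpt f (F', G') = cpt f (F, G) \<cdot> prj (src f) (F', F)"
    "\<And>G. G \<in> FinLO (idx (tgt f)) \<Longrightarrow> \<exists>F. (F, G) \<in> Lam f"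
    "\<And>F G F'. (F, G) \<in> Lam f \<Longrightarrow> (F', F) \<in> FinLO_arr (idx (src f)) \<Longrightarrow> (F', G) \<in> Lam f"
  shows "fin_approx C f"
  unfolding fin_approx_def using assms hom_iff by auto

text \<open>Projections being epimorphisms, it suffices to compare two families at one index over each
  index of the target.\<close>

lemma fam_equivI: assumes "fin_approx C f" "fin_approx C f'" "src f = src f'" "tgt f = tgt f'" "aitp (src f)" "aitp (tgt f)"
    "\<And>G. G \<in> FinLO (idx (tgt f)) \<Longrightarrow> \<exists>F. (F, G) \<in> Lam f \<and> (F, G) \<in> Lam f' \<and> cpt f (F, G) = cpt f' (F, G)"
  shows "fam_equiv C f f'"
proof -
  have "cpt f (F, G) = cpt f' (F, G)" if "(F, G) \<in> Lam f" "(F, G) \<in> Lam f'" for F G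
  proof -
    note t = fam_typed[OF assms(1) that(1)] fam_typed[OF assms(2) that(2)]
    obtain F0 where F0: "(F0, G) \<in> Lam f" "(F0, G) \<in> Lam f'" "cpt f (F0, G) = cpt f' (F0, G)"
      using assms(7)[OF t(2)] by blast
    obtain F' where F': "(F', F) \<in> FinLO_arr (idx (src f))" "(F', F0) \<in> FinLO_arr (idx (src f))"
      using FinLO_union[OF t(1) fam_typed(1)[OF assms(1) F0(1)]] by blast
    have "cpt f (F, G) \<cdot> prj (src f) (F', F) = cpt f (F0, G) \<cdot> prj (src f) (F', F0)"
      using fam_restrict[OF assms(1,6)] that(1) F0(1) F' by metis
    also have "\<dots> = cpt f' (F, G) \<cdot> prj (src f) (F', F)"
      using fam_restrict[OF assms(2)] assms(3,4,6) that(2) F0 F' by metis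
    finally show ?thesis by (rule aitp_epi[OF assms(5) F'(1), rotated 4]) (use t assms(3) in auto)
  qed
  then show ?thesis unfolding fam_equiv_def using assms by auto
qed

lemma fam_equivD: assumes "fam_equiv C f g"
  shows "fin_approx C f" "fin_approx C g" "src f = src g" "tgt f = tgt g"
    "(F, G) \<in> Lam f \<Longrightarrow> (F, G) \<in> Lam g \<Longrightarrow> cpt f (F, G) = cpt g (F, G)"
  using assms unfolding fam_equiv_def by auto

text \<open>Indices of the source are directed, and by hereditariness a family may be evaluated further up.\<close>

lemma fam_common: assumes "fin_approx C f" "fin_approx C g" "src f = src g" "G \<in> FinLO (idx (tgt f))" "H \<in> FinLO (idx (tgt g))"
  obtains F where "(F, G) \<in> Lam f" "(F, H) \<in> Lam g"
proof -
  obtain F F' where "(F, G) \<in> Lam f" "(F', H) \<in> Lam g" using fam_cover assms by metis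
  moreover obtain F'' where "(F'', F) \<in> FinLO_arr (idx (src f))" "(F'', F') \<in> FinLO_arr (idx (src f))"
    using FinLO_union fam_typed(1)[OF assms(1)] fam_typed(1)[OF assms(2)] assms(3) calculation by metis
  ultimately show thesis using fam_upward assms that by metis
qed

lemma fam_equiv_refl: "fin_approx C f \<Longrightarrow> fam_equiv C f f" by (auto simp: fam_equiv_def)

lemma fam_equiv_sym: "fam_equiv C f g \<Longrightarrow> fam_equiv C g f" by (auto simp: fam_equiv_def)

text \<open>The index sets of the first and the last family may meet where the middle one is undefined; but above
any index there is one at which all three are defined, and the projection to the former is epi.\<close>

lemma fam_equiv_trans: assumes "fam_equiv C f g" "fam_equiv C g h" "aitp (src f)" "aitp (tgt f)"
  shows "fam_equiv C f h"
proof (rule fam_equivI)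
  fix G assume G: "G \<in> FinLO (idx (tgt f))"
  note fg = fam_equivD[OF assms(1)] and gh = fam_equivD[OF assms(2)]
  obtain F where F: "(F, G) \<in> Lam f" "(F, G) \<in> Lam g" using fam_common[OF fg(1-3), of G G] G fg by metis
  obtain F' where F': "(F', G) \<in> Lam g" "(F', G) \<in> Lam h" using fam_common[OF gh(1-3), of G G] G fg gh by metis
  obtain F'' where F'': "(F'', F) \<in> FinLO_arr (idx (src f))" "(F'', F') \<in> FinLO_arr (idx (src f))"
    using FinLO_union[OF fam_typed(1)[OF fg(1) F(1)]] fam_typed(1)[OF gh(1) F'(1)] fg(3) by metis
  have "(F'', G) \<in> Lam f" "(F'', G) \<in> Lam g" "(F'', G) \<in> Lam h"
    using fam_upward fg(1-3) gh(1-3) F F' F'' by metis+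
  then show "\<exists>F. (F, G) \<in> Lam f \<and> (F, G) \<in> Lam h \<and> cpt f (F, G) = cpt h (F, G)"
    using fg(5) gh(5) by metis
qed (use assms(3,4) fam_equivD(1-4)[OF assms(1)] fam_equivD(1-4)[OF assms(2)] in auto)

lemma fam_class_eq: assumes "fam_equiv C f g" "aitp (src f)" "aitp (tgt f)"
  shows "fam_class C f = fam_class C g"
proof -
  have g: "aitp (src g)" "aitp (tgt g)" using assms fam_equivD(3,4)[OF assms(1)] by auto
  have "fam_equiv C f h \<longleftrightarrow> fam_equiv C g h" for h
    using fam_equiv_trans[OF assms(1) _ assms(2,3), of h] fam_equiv_trans[OF fam_equiv_sym[OF assms(1)] _ g, of h] by blast
  then show ?thesis unfolding fam_class_def by blast
qed

definition Hom :: "('j, nat, 'm) diagram \<Rightarrow> ('j, nat, 'm) diagram \<Rightarrow> ('j, nat, 'm) fam set set" where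
  "Hom X Y = {fam_class C f | f. fin_approx C f \<and> src f = X \<and> tgt f = Y}"

lemma Hom_classI: "fin_approx C f \<Longrightarrow> src f = X \<Longrightarrow> tgt f = Y \<Longrightarrow> fam_class C f \<in> Hom X Y"
  unfolding Hom_def by blast

lemma Hom_mem: assumes "a \<in> Hom X Y" "aitp X" "aitp Y" "f \<in> a"
  shows "a = fam_class C f" "fin_approx C f" "src f = X" "tgt f = Y"
proof -
  obtain g where g: "a = fam_class C g" "fin_approx C g" "src g = X" "tgt g = Y" using assms Hom_def by blast
  then have gf: "fam_equiv C g f" using assms by (simp add: fam_class_def)
  show "a = fam_class C f" using fam_class_eq[OF gf] g assms by simp
  show "fin_approx C f" "src f = X" "tgt f = Y" using fam_equivD[OF gf] g by auto
qed

lemma Hom_nonempty: assumes "a \<in> Hom X Y" obtains f where "f \<in> a" "fin_approx C f" "src f = X" "tgt f = Y"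
  using assms fam_equiv_refl unfolding Hom_def fam_class_def by blast

text \<open>Calculations with morphisms are done pointwise: \<open>pt a F G c\<close> says that \<open>c\<close> is the component at
  \<open>(F, G)\<close> of some family representing \<open>a\<close>.\<close>

definition pt :: "('j, nat, 'm) fam set \<Rightarrow> 'j list \<Rightarrow> 'j list \<Rightarrow> 'm \<Rightarrow> bool" where
  "pt a F G c \<longleftrightarrow> (\<exists>f\<in>a. (F, G) \<in> Lam f \<and> cpt f (F, G) = c)"

lemma pt_typed: assumes "a \<in> Hom X Y" "aitp X" "aitp Y" "pt a F G c"
  shows "F \<in> FinLO (idx X)" "G \<in> FinLO (idx Y)" "arr C c" "source C c = ob X F" "target C c = ob Y G"
proof -
  obtain f where f: "f \<in> a" "(F, G) \<in> Lam f" "cpt f (F, G) = c" using assms pt_def by metis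
  note h = Hom_mem[OF assms(1-3) f(1)]
  show "F \<in> FinLO (idx X)" "G \<in> FinLO (idx Y)" "arr C c" "source C c = ob X F" "target C c = ob Y G"
    using fam_typed[OF h(2) f(2)] h f by auto
qed

lemma pt_class: "fin_approx C f \<Longrightarrow> (F, G) \<in> Lam f \<Longrightarrow> pt (fam_class C f) F G (cpt f (F, G))"
  unfolding pt_def fam_class_def using fam_equiv_refl by blast

lemma pt_up: assumes "a \<in> Hom X Y" "aitp X" "aitp Y" "pt a F G c" "(F', F) \<in> FinLO_arr (idx X)"
  shows "pt a F' G (c \<cdot> prj X (F', F))"
proof -
  obtain f where f: "f \<in> a" "(F, G) \<in> Lam f" "cpt f (F, G) = c" using assms pt_def by metis
  note h = Hom_mem[OF assms(1-3) f(1)]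
  show ?thesis using fam_restrict[OF h(2) _ f(2)] fam_upward[OF h(2) f(2)] h f assms unfolding pt_def by metis
qed

lemma pt_cover: assumes "a \<in> Hom X Y" "G \<in> FinLO (idx Y)" obtains F c where "pt a F G c"
  using Hom_nonempty[OF assms(1)] fam_cover assms(2) unfolding pt_def by metis

lemma pt_cover2: assumes "a \<in> Hom X Y" "b \<in> Hom X Z" "aitp X" "aitp Y" "aitp Z" "G \<in> FinLO (idx Y)" "H \<in> FinLO (idx Z)"
  obtains F c d where "pt a F G c" "pt b F H d"
proof -
  obtain F c F' d where h: "pt a F G c" "pt b F' H d" using pt_cover assms by metis
  obtain F'' where "(F'', F) \<in> FinLO_arr (idx X)" "(F'', F') \<in> FinLO_arr (idx X)"
    using FinLO_union pt_typed(1) h assms by metis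
  then show thesis using that pt_up h assms by metis
qed

text \<open>Above the given indices there is one at which both representing families are defined and hence agree;
the equation holds after projection from there, which is epi.\<close>

lemma pt_natural: assumes "a \<in> Hom X Y" "aitp X" "aitp Y" "pt a F G c" "pt a F' G' c'" "(F', F) \<in> FinLO_arr (idx X)"
    "(G', G) \<in> FinLO_arr (idx Y)"
  shows "prj Y (G', G) \<cdot> c' = c \<cdot> prj X (F', F)"
proof -
  obtain f where f: "f \<in> a" "(F, G) \<in> Lam f" "cpt f (F, G) = c" using assms pt_def by metis
  obtain f' where f': "f' \<in> a" "(F', G') \<in> Lam f'" "cpt f' (F', G') = c'" using assms pt_def by metis
  note h = Hom_mem[OF assms(1-3) f(1)] and h' = Hom_mem[OF assms(1-3) f'(1)]
  have e: "fam_equiv C f f'" using h f' unfolding fam_class_def by blast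
  obtain K where K: "(K, G') \<in> Lam f" using fam_cover[OF h(2)] h(4) assms(7) by (metis FinLO_arr_iff)
  obtain F'' where F'': "(F'', K) \<in> FinLO_arr (idx X)" "(F'', F') \<in> FinLO_arr (idx X)"
    using FinLO_union fam_typed(1)[OF h(2) K] h(3) assms(6) FinLO_arr_iff by metis
  have F''F: "(F'', F) \<in> FinLO_arr (idx X)" using FinLO_arr_trans F''(2) assms(6) .
  have l: "(F'', G') \<in> Lam f" "(F'', G') \<in> Lam f'" using fam_upward h h' K f' F'' by metis+
  have 1: "cpt f (F'', G') = c' \<cdot> prj X (F'', F')"
    using fam_equivD(5)[OF e l] fam_restrict[OF h'(2) _ f'(2)] h' f'(3) F''(2) assms(3) by metis
  have 2: "prj Y (G', G) \<cdot> cpt f (F'', G') = c \<cdot> prj X (F'', F)"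
    using fam_natural[OF h(2) f(2) l(1)] h f(3) F''F assms(7) by metis
  note t = pt_typed[OF assms(1-4)] pt_typed[OF assms(1-3,5)] aitp_prj[OF assms(3,7)] aitp_prj[OF assms(2,6)] aitp_prj[OF assms(2) F''(2)]
  have "(prj Y (G', G) \<cdot> c') \<cdot> prj X (F'', F') = (c \<cdot> prj X (F', F)) \<cdot> prj X (F'', F')"
    using 1 2 t aitp_prj_comp[OF assms(2) F''(2) assms(6)] by simp
  then show ?thesis by (rule aitp_epi[OF assms(2) F''(2), rotated 4]) (use t in auto)
qed

lemma pt_unique: assumes "a \<in> Hom X Y" "aitp X" "aitp Y" "pt a F G c" "pt a F G c'"
  shows "c = c'"
proof -
  note t = pt_typed[OF assms(1-4)] pt_typed[OF assms(1-3,5)]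
  show ?thesis using pt_natural[OF assms FinLO_arr_refl[OF t(1)] FinLO_arr_refl[OF t(2)]] t
     aitp_prj_ide[OF assms(2) t(1)] aitp_prj_ide[OF assms(3) t(2)] by simp
qed

lemma pt_eqI: assumes "a \<in> Hom X Y" "b \<in> Hom X Y" "aitp X" "aitp Y"
    "\<And>G. G \<in> FinLO (idx Y) \<Longrightarrow> \<exists>F c. pt a F G c \<and> pt b F G c"
  shows "a = b"
proof -
  obtain f g where fg: "f \<in> a" "g \<in> b" using Hom_nonempty assms by metis
  note f = Hom_mem[OF assms(1,3,4) fg(1)] and g = Hom_mem[OF assms(2-4) fg(2)]
  have "fam_equiv C f g"
  proof (rule fam_equivI)
    fix G assume "G \<in> FinLO (idx (tgt f))"
    then have G: "G \<in> FinLO (idx Y)" using f by simp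
    obtain F0 c where F0: "pt a F0 G c" "pt b F0 G c" using assms(5)[OF G] by metis
    obtain F' where F': "(F', G) \<in> Lam f" "(F', G) \<in> Lam g" using fam_common[of f g G G] f g G by metis
    obtain F where F: "(F, F0) \<in> FinLO_arr (idx X)" "(F, F') \<in> FinLO_arr (idx X)"
      using FinLO_union pt_typed(1)[OF assms(1,3,4) F0(1)] fam_typed(1)[OF f(2) F'(1)] f(3) by metis
    have l: "(F, G) \<in> Lam f" "(F, G) \<in> Lam g" using fam_upward f g F' F by metis+
    have "pt a F G (cpt f (F, G))" "pt b F G (cpt g (F, G))" unfolding pt_def using l fg by auto
    moreover have "pt a F G (c \<cdot> prj X (F, F0))" "pt b F G (c \<cdot> prj X (F, F0))" using pt_up F0 F assms by metis+
    ultimately have "cpt f (F, G) = cpt g (F, G)" using pt_unique assms by metis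
    then show "\<exists>F. (F, G) \<in> Lam f \<and> (F, G) \<in> Lam g \<and> cpt f (F, G) = cpt g (F, G)" using l by blast
  qed (use f g assms in auto)
  then show ?thesis using fam_class_eq f g assms by metis
qed

lemma diag_tensor_simps [simp]:
  "idx (diag_tensor C X Y) = idx X \<union> idx Y"
  "F \<in> FinLO (idx X \<union> idx Y) \<Longrightarrow> ob (diag_tensor C X Y) F = ob X (cut F (idx X)) + ob Y (cut F (idx Y))"
  "(F', F) \<in> FinLO_arr (idx X \<union> idx Y) \<Longrightarrow> prj (diag_tensor C X Y) (F', F)
     = prj X (cut F' (idx X), cut F (idx X)) \<otimes> prj Y (cut F' (idx Y), cut F (idx Y))"
  by (auto simp: diag_tensor_def)

text \<open>The \<open>j\<close>-th factor of the tensor product of \<open>X\<close> and \<open>Y\<close> consists of \<open>n j + m j\<close> wires.  The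
isomorphism with the standard diagram is the permutation which sorts single wires by index first, where
the pointwise tensor product lists all wires of \<open>X\<close> before those of \<open>Y\<close>.\<close>

lemma aitp_tensor: fixes X Y :: "('j, nat, 'm) diagram"
  assumes "aitp X" "aitp Y" shows "aitp (diag_tensor C X Y)"
proof -
  let ?J = "idx X \<union> idx Y"
  obtain n \<theta> \<tau> where s: "countable (idx X)" "standard_iso X n \<theta> \<tau>" by (rule aitpE[OF assms(1)])
  obtain m \<theta>' \<tau>' where s': "countable (idx Y)" "standard_iso Y m \<theta>' \<tau>'" by (rule aitpE[OF assms(2)])
  note h = s(1) standard_isoD[OF s(2)] and h' = s'(1) standard_isoD[OF s'(2)]
  define n' where "n' j = (if j \<in> idx X then n j else 0)" for j
  define m' where "m' j = (if j \<in> idx Y then m j else 0)" for j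
  define k where "k j = n' j + m' j" for j
  \<comment> \<open>The wires over \<open>j\<close> of the tensor product are those of \<open>X\<close>, followed by those of \<open>Y\<close>.\<close>
  define nm where "nm = (\<lambda>(j, i). if i < n' j then Inl (j, i) else Inr (j, i - n' j))"
  let ?cX = "\<lambda>F. cut F (idx X)" and ?cY = "\<lambda>F. cut F (idx Y)"
  define A where "A F = map Inl (wires_of n (?cX F)) @ map Inr (wires_of m (?cY F))" for F
  define B where "B F = map nm (wires_of k F)" for F
  have nm: "inj_on nm (Sigma S (\<lambda>j. {..<k j}))" for S
    by (auto simp: inj_on_def nm_def k_def split: if_splits)
  have B: "distinct (B F)" if "distinct F" for F
    using that nm distinct_wires_of[OF that] unfolding B_def by (simp add: distinct_map set_wires_of)
  have A: "distinct (A F)" if "distinct F" for F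
    using that unfolding A_def by (auto simp: distinct_map distinct_wires_of)
  have AB: "set (A F) = set (B F)" if "F \<in> FinLO ?J" for F
  proof -
    have 1: "Inl ` Sigma (set (?cX F)) (\<lambda>j. {..<n j}) \<subseteq> nm ` Sigma (set F) (\<lambda>j. {..<k j})"
      by (force simp: nm_def k_def n'_def image_iff split: if_splits)
    have 2: "Inr ` Sigma (set (?cY F)) (\<lambda>j. {..<m j}) \<subseteq> nm ` Sigma (set F) (\<lambda>j. {..<k j})"
    proof
      fix w :: "('j \<times> nat) + 'j \<times> nat" assume "w \<in> Inr ` Sigma (set (?cY F)) (\<lambda>j. {..<m j})"
      then obtain j i where "w = Inr (j, i)" "j \<in> set F" "j \<in> idx Y" "i < m j" by auto
      then have "w = nm (j, n' j + i)" "(j, n' j + i) \<in> Sigma (set F) (\<lambda>j. {..<k j})"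
        by (auto simp: nm_def k_def m'_def)
      then show "w \<in> nm ` Sigma (set F) (\<lambda>j. {..<k j})" by blast
    qed
    have 3: "nm ` Sigma (set F) (\<lambda>j. {..<k j}) \<subseteq> Inl ` Sigma (set (?cX F)) (\<lambda>j. {..<n j}) \<union> Inr ` Sigma (set (?cY F)) (\<lambda>j. {..<m j})"
    proof
      fix w :: "('j \<times> nat) + 'j \<times> nat" assume "w \<in> nm ` Sigma (set F) (\<lambda>j. {..<k j})"
      then obtain j i where w: "w = nm (j, i)" "j \<in> set F" "i < k j" by auto
      show "w \<in> Inl ` Sigma (set (?cX F)) (\<lambda>j. {..<n j}) \<union> Inr ` Sigma (set (?cY F)) (\<lambda>j. {..<m j})"
      proof (cases "i < n' j")
        case True
        then have "w = Inl (j, i)" "(j, i) \<in> Sigma (set (?cX F)) (\<lambda>j. {..<n j})"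
          using w by (auto simp: nm_def n'_def split: if_splits)
        then show ?thesis by blast
      next
        case False
        then have "w = Inr (j, i - n' j)" "i - n' j < m' j" using w by (auto simp: nm_def k_def)
        moreover have "(j, i - n' j) \<in> Sigma (set (?cY F)) (\<lambda>j. {..<m j})"
          using calculation(2) w by (auto simp: m'_def split: if_splits)
        ultimately show ?thesis by blast
      qed
    qed
    show ?thesis using 1 2 3 unfolding A_def B_def by (auto simp: set_wires_of)
  qed
  have len: "length (A F) = size_of n (?cX F) + size_of m (?cY F)" "length (B F) = size_of k F" for F
    unfolding A_def B_def by simp_all
  have pB: "proj C k F' F = wproj (B F') (B F)" if "set F \<subseteq> set F'" "distinct F" "distinct F'" for F' F
    using proj_wires[OF that(1,3,2), of k] that
    unfolding B_def by (subst wproj_map) (auto simp: set_wires_of nm distinct_wires_of)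
  have pA: "wproj (A F') (A F) = proj C n (?cX F') (?cX F) \<otimes> proj C m (?cY F') (?cY F)"
    if "set F \<subseteq> set F'" "distinct F" "distinct F'" for F' F
  proof -
    let ?L = "\<lambda>F. map Inl (wires_of n (?cX F)) :: (('j \<times> nat) + ('j \<times> nat)) list"
    let ?R = "\<lambda>F. map Inr (wires_of m (?cY F)) :: (('j \<times> nat) + ('j \<times> nat)) list"
    have "wproj (A F') (A F) = wproj (?L F') (?L F) \<otimes> wproj (?R F') (?R F)"
      unfolding A_def by (rule proj_append) (use that in \<open>auto simp: distinct_map distinct_wires_of set_wires_of\<close>)
    also have "wproj (?L F') (?L F) = wproj (wires_of n (?cX F')) (wires_of n (?cX F))"
      by (rule wproj_map) (use that in \<open>auto simp: distinct_wires_of set_wires_of\<close>)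
    also have "wproj (?R F') (?R F) = wproj (wires_of m (?cY F')) (wires_of m (?cY F))"
      by (rule wproj_map) (use that in \<open>auto simp: distinct_wires_of set_wires_of\<close>)
    also have "wproj (wires_of n (?cX F')) (wires_of n (?cX F)) = proj C n (?cX F') (?cX F)"
      by (rule proj_wires[symmetric]) (use that in auto)
    also have "wproj (wires_of m (?cY F')) (wires_of m (?cY F)) = proj C m (?cY F') (?cY F)"
      by (rule proj_wires[symmetric]) (use that in auto)
    finally show ?thesis .
  qed
  define \<phi> where "\<phi> F = wproj (A F) (B F) \<cdot> (\<theta> (?cX F) \<otimes> \<theta>' (?cY F))" for F
  define \<psi> where "\<psi> F = (\<tau> (?cX F) \<otimes> \<tau>' (?cY F)) \<cdot> wproj (B F) (A F)" for F
  have t: "arr C (wproj (A F) (B F))" "source C (wproj (A F) (B F)) = size_of n (?cX F) + size_of m (?cY F)"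
    "target C (wproj (A F) (B F)) = size_of k F" "arr C (wproj (B F) (A F))" "source C (wproj (B F) (A F)) = size_of k F"
    "target C (wproj (B F) (A F)) = size_of n (?cX F) + size_of m (?cY F)"
    "arr C (\<theta> (?cX F))" "source C (\<theta> (?cX F)) = ob X (?cX F)" "target C (\<theta> (?cX F)) = size_of n (?cX F)"
    "arr C (\<tau> (?cX F))" "target C (\<tau> (?cX F)) = ob X (?cX F)" "source C (\<tau> (?cX F)) = size_of n (?cX F)"
    "arr C (\<theta>' (?cY F))" "source C (\<theta>' (?cY F)) = ob Y (?cY F)" "target C (\<theta>' (?cY F)) = size_of m (?cY F)"
    "arr C (\<tau>' (?cY F))" "target C (\<tau>' (?cY F)) = ob Y (?cY F)" "source C (\<tau>' (?cY F)) = size_of m (?cY F)"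
    "wproj (A F) (B F) \<cdot> wproj (B F) (A F) = ide C (size_of k F)"
    "wproj (B F) (A F) \<cdot> wproj (A F) (B F) = ide C (size_of n (?cX F) + size_of m (?cY F))"
    if F: "F \<in> FinLO ?J" for F
  proof -
    have d: "distinct (A F)" "distinct (B F)" "set (A F) = set (B F)" using A[OF FinLO_distinct[OF F]] B[OF FinLO_distinct[OF F]] AB[OF F] by auto
    show "arr C (wproj (A F) (B F))" "source C (wproj (A F) (B F)) = size_of n (?cX F) + size_of m (?cY F)"
      "target C (wproj (A F) (B F)) = size_of k F" "arr C (wproj (B F) (A F))" "source C (wproj (B F) (A F)) = size_of k F"
      "target C (wproj (B F) (A F)) = size_of n (?cX F) + size_of m (?cY F)"
      using d len[of F] by auto
    show "wproj (A F) (B F) \<cdot> wproj (B F) (A F) = ide C (size_of k F)"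
      using proj_comp[of "B F" "A F" "B F" "\<lambda>_. 1"] d len[of F] by simp
    show "wproj (B F) (A F) \<cdot> wproj (A F) (B F) = ide C (size_of n (?cX F) + size_of m (?cY F))"
      using proj_comp[of "A F" "B F" "A F" "\<lambda>_. 1"] d len[of F] by simp
  qed (use h h' FinLO_cut[OF F] in auto)
  show ?thesis
  proof (rule aitpI[where n = k and \<theta> = \<phi>])
    show "countable (idx (diag_tensor C X Y))" using h(1) h'(1) by simp
    show "ob (diag_tensor C X Y) \<in> extensional (FinLO (idx (diag_tensor C X Y)))"
      "prj (diag_tensor C X Y) \<in> extensional (FinLO_arr (idx (diag_tensor C X Y)))"
      by (auto simp: diag_tensor_def)
  next
    fix F assume "F \<in> FinLO (idx (diag_tensor C X Y))"
    then have F: "F \<in> FinLO ?J" by simp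
    note t = t[OF F] and c = FinLO_cut[OF F]
    show "iso_in C (ob (diag_tensor C X Y) F) (size_of k F) (\<phi> F)"
    proof (rule iso_inI[of _ "\<psi> F"])
      have "\<psi> F \<cdot> \<phi> F = (\<tau> (?cX F) \<otimes> \<tau>' (?cY F)) \<cdot> ((wproj (B F) (A F) \<cdot> wproj (A F) (B F)) \<cdot> (\<theta> (?cX F) \<otimes> \<theta>' (?cY F)))"
        unfolding \<phi>_def \<psi>_def using t(1-18) by simp
      also have "\<dots> = ide C (ob X (?cX F) + ob Y (?cY F))"
        using t h(4)[OF c(1)] h'(4)[OF c(2)] by (simp add: interchange)
      finally show "\<psi> F \<cdot> \<phi> F = ide C (ob (diag_tensor C X Y) F)" using F by simp
      have "\<phi> F \<cdot> \<psi> F = wproj (A F) (B F) \<cdot> (((\<theta> (?cX F) \<otimes> \<theta>' (?cY F)) \<cdot> (\<tau> (?cX F) \<otimes> \<tau>' (?cY F))) \<cdot> wproj (B F) (A F))"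
        unfolding \<phi>_def \<psi>_def using t(1-18) by simp
      also have "\<dots> = ide C (size_of k F)"
        using t h(4)[OF c(1)] h'(4)[OF c(2)] by (simp add: interchange)
      finally show "\<phi> F \<cdot> \<psi> F = ide C (size_of k F)" .
    qed (use t F in \<open>simp_all add: \<phi>_def \<psi>_def\<close>)
  next
    fix F' F assume "(F', F) \<in> FinLO_arr (idx (diag_tensor C X Y))"
    then have FF: "(F', F) \<in> FinLO_arr ?J" by simp
    then have F: "F \<in> FinLO ?J" "F' \<in> FinLO ?J" and d: "set F \<subseteq> set F'" "distinct F" "distinct F'"
      using FinLO_distinct by (auto simp: FinLO_arr_iff)
    note c = FinLO_arr_cut[OF FF] and tt = t[OF F(1)] t[OF F(2)]
    note p = aitp_prj[OF assms(1) c(1)] aitp_prj[OF assms(2) c(2)]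
    show "arr C (prj (diag_tensor C X Y) (F', F)) \<and> source C (prj (diag_tensor C X Y) (F', F)) = ob (diag_tensor C X Y) F'
        \<and> target C (prj (diag_tensor C X Y) (F', F)) = ob (diag_tensor C X Y) F"
      using p F FF by simp
    have AB': "set (A F) = set (B F)" "set (A F') = set (B F')" "distinct (A F)" "distinct (B F)" "distinct (A F')"
      "distinct (B F')" "set (B F) \<subseteq> set (B F')"
      using A[OF d(2)] A[OF d(3)] B[OF d(2)] B[OF d(3)] AB[OF F(1)] AB[OF F(2)] d(1)
      by (auto simp: B_def set_wires_of)
    have cs: "set (?cX F) \<subseteq> set (?cX F')" "set (?cY F) \<subseteq> set (?cY F')" "distinct (?cX F)" "distinct (?cX F')"
      "distinct (?cY F)" "distinct (?cY F')" using d by auto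
    note pt = proj_typed[OF cs(1,4,3), of n] proj_typed[OF cs(2,6,5), of m]
    have "\<phi> F \<cdot> prj (diag_tensor C X Y) (F', F)
       = wproj (A F) (B F) \<cdot> ((\<theta> (?cX F) \<cdot> prj X (?cX F', ?cX F)) \<otimes> (\<theta>' (?cY F) \<cdot> prj Y (?cY F', ?cY F)))"
      unfolding \<phi>_def using tt(1-18) p FF by (simp add: interchange)
    also have "\<dots> = wproj (A F) (B F) \<cdot> ((proj C n (?cX F') (?cX F) \<cdot> \<theta> (?cX F')) \<otimes> (proj C m (?cY F') (?cY F) \<cdot> \<theta>' (?cY F')))"
      using h(5)[OF c(1)] h'(5)[OF c(2)] by simp
    also have "\<dots> = wproj (A F) (B F) \<cdot> ((proj C n (?cX F') (?cX F) \<otimes> proj C m (?cY F') (?cY F)) \<cdot> (\<theta> (?cX F') \<otimes> \<theta>' (?cY F')))"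
      using tt pt by (subst interchange) auto
    also have "\<dots> = (wproj (A F) (B F) \<cdot> wproj (A F') (A F)) \<cdot> (\<theta> (?cX F') \<otimes> \<theta>' (?cY F'))"
      unfolding pA[OF d] using tt pt by auto
    also have "wproj (A F) (B F) \<cdot> wproj (A F') (A F) = wproj (A F') (B F)"
      by (rule proj_comp) (use AB' in auto)
    also have "\<dots> = wproj (B F') (B F) \<cdot> wproj (A F') (B F')"
      by (rule proj_comp[symmetric]) (use AB' in auto)
    also have "(wproj (B F') (B F) \<cdot> wproj (A F') (B F')) \<cdot> (\<theta> (?cX F') \<otimes> \<theta>' (?cY F')) = proj C k F' F \<cdot> \<phi> F'"
      unfolding \<phi>_def pB[OF d] using tt AB' len by simp
    finally show "\<phi> F \<cdot> prj (diag_tensor C X Y) (F', F) = proj C k F' F \<cdot> \<phi> F'" .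
  qed
qed

lemma aitp_std_itp: assumes "countable J" shows "aitp (std_itp C J n)"
proof (rule aitpI[where n = n and \<theta> = "\<lambda>F. ide C (size_of n F)"])
  fix F assume "F \<in> FinLO (idx (std_itp C J n))"
  then show "iso_in C (ob (std_itp C J n) F) (size_of n F) (ide C (size_of n F))"
    by (auto intro!: iso_inI[of _ "ide C (size_of n F)"] simp: std_itp_prj)
next
  fix F' F assume "(F', F) \<in> FinLO_arr (idx (std_itp C J n))"
  then have a: "(F', F) \<in> FinLO_arr J" "set F \<subseteq> set F'" "distinct F" "distinct F'" "F \<in> FinLO J" "F' \<in> FinLO J"
    by (auto simp: std_itp_prj FinLO_arr_iff dest: FinLO_distinct)
  show "arr C (prj (std_itp C J n) (F', F)) \<and> source C (prj (std_itp C J n) (F', F)) = ob (std_itp C J n) F'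
      \<and> target C (prj (std_itp C J n) (F', F)) = ob (std_itp C J n) F"
    "ide C (size_of n F) \<cdot> prj (std_itp C J n) (F', F) = proj C n F' F \<cdot> ide C (size_of n F')"
    using a by (simp_all add: std_itp_prj)
qed (use assms in \<open>auto simp: std_itp_def\<close>)

lemma diag_unit_simps [simp]: "idx (diag_unit C s) = {s}" "F \<in> FinLO {s} \<Longrightarrow> ob (diag_unit C s) F = 0"
  "x \<in> FinLO_arr {s} \<Longrightarrow> prj (diag_unit C s) x = ide C 0"
  by (auto simp: diag_unit_def)

lemma aitp_diag_unit: "aitp (diag_unit C s)"
proof (rule aitpI[where n = "\<lambda>_. 0" and \<theta> = "\<lambda>_. ide C 0"])
  fix F assume "F \<in> FinLO (idx (diag_unit C s))"
  then show "iso_in C (ob (diag_unit C s) F) (size_of (\<lambda>_. 0) F) (ide C 0)"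
    by (auto intro!: iso_inI[of _ "ide C 0"])
next
  fix F' F assume "(F', F) \<in> FinLO_arr (idx (diag_unit C s))"
  then have a: "(F', F) \<in> FinLO_arr {s}" "set F \<subseteq> set F'" "distinct F" "distinct F'"
    using FinLO_distinct by (auto simp: FinLO_arr_iff)
  then show "ide C 0 \<cdot> prj (diag_unit C s) (F', F) = proj C (\<lambda>_. 0) F' F \<cdot> ide C 0"
    by (auto intro!: terminal_eq)
qed (auto simp: diag_unit_def FinLO_arr_iff)

text \<open>The middle index in the composite of two families is chosen arbitrarily.  Two choices lie below a common
index, at which naturality compares them.\<close>

lemma fam_comp_simps [simp]: "src (fam_comp C g f) = src f" "tgt (fam_comp C g f) = tgt g"
  "(F, H) \<in> Lam (fam_comp C g f) \<longleftrightarrow> (\<exists>G. (F, G) \<in> Lam f \<and> (G, H) \<in> Lam g)"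
  by (auto simp: fam_comp_def)

context
  fixes f g :: "('j, nat, 'm) fam"
  assumes f: "fin_approx C f" and g: "fin_approx C g" and fg: "tgt f = src g"
    and X: "aitp (src f)" and Y: "aitp (src g)" and Z: "aitp (tgt g)"
begin

lemma fam_comp_restrict:
  assumes "(F, G) \<in> Lam f" "(G, H) \<in> Lam g" "(F', G') \<in> Lam f" "(F', F) \<in> FinLO_arr (idx (src f))" "(G', G) \<in> FinLO_arr (idx (src g))"
  shows "cpt g (G', H) \<cdot> cpt f (F', G') = (cpt g (G, H) \<cdot> cpt f (F, G)) \<cdot> prj (src f) (F', F)"
proof -
  have "cpt g (G', H) = cpt g (G, H) \<cdot> prj (src g) (G', G)" using fam_restrict[OF g Z] assms by blast
  moreover have "prj (src g) (G', G) \<cdot> cpt f (F', G') = cpt f (F, G) \<cdot> prj (src f) (F', F)"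
    using fam_natural[OF f assms(1,3,4)] assms(5) fg by simp
  moreover note fam_typed[OF f assms(1)] fam_typed[OF f assms(3)] fam_typed[OF g assms(2)]
    aitp_prj[OF X assms(4)] aitp_prj[OF Y assms(5)]
  ultimately show ?thesis using fg by simp
qed

lemma fam_above: assumes "F \<in> FinLO (idx (src f))" "G \<in> FinLO (idx (src g))"
  obtains F' where "(F', G) \<in> Lam f" "(F', F) \<in> FinLO_arr (idx (src f))"
proof -
  obtain F0 where F0: "(F0, G) \<in> Lam f" using fam_cover[OF f] assms fg by metis
  then obtain F' where "(F', F0) \<in> FinLO_arr (idx (src f))" "(F', F) \<in> FinLO_arr (idx (src f))"
    using FinLO_union fam_typed(1)[OF f] assms(1) by metis
  then show thesis using that fam_upward[OF f F0] by blast
qed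

lemma fam_comp_cpt: assumes "(F, G) \<in> Lam f" "(G, H) \<in> Lam g"
  shows "cpt (fam_comp C g f) (F, H) = cpt g (G, H) \<cdot> cpt f (F, G)"
proof -
  define G0 where "G0 = (SOME G. (F, G) \<in> Lam f \<and> (G, H) \<in> Lam g)"
  have G0: "(F, G0) \<in> Lam f" "(G0, H) \<in> Lam g"
    using someI[of "\<lambda>G. (F, G) \<in> Lam f \<and> (G, H) \<in> Lam g" G] assms unfolding G0_def by auto
  note t = fam_typed[OF f assms(1)] fam_typed[OF f G0(1)] fam_typed[OF g assms(2)] fam_typed[OF g G0(2)]
  obtain G' where G': "(G', G) \<in> FinLO_arr (idx (src g))" "(G', G0) \<in> FinLO_arr (idx (src g))"
    using FinLO_union t fg by metis
  obtain F' where F': "(F', G') \<in> Lam f" "(F', F) \<in> FinLO_arr (idx (src f))"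
    using fam_above t(1) G'(1) by (metis FinLO_arr_iff)
  have "(cpt g (G0, H) \<cdot> cpt f (F, G0)) \<cdot> prj (src f) (F', F) = (cpt g (G, H) \<cdot> cpt f (F, G)) \<cdot> prj (src f) (F', F)"
    using fam_comp_restrict[OF G0 F' G'(2)] fam_comp_restrict[OF assms F' G'(1)] by simp
  then have "cpt g (G0, H) \<cdot> cpt f (F, G0) = cpt g (G, H) \<cdot> cpt f (F, G)"
    by (rule aitp_epi[OF X F'(2), rotated 4]) (use t fg in auto)
  then show ?thesis by (simp add: fam_comp_def G0_def Let_def)
qed

lemma fin_approx_comp: "fin_approx C (fam_comp C g f)"
proof (rule fin_approxI)
  fix F H assume "(F, H) \<in> Lam (fam_comp C g f)"
  then obtain G where G: "(F, G) \<in> Lam f" "(G, H) \<in> Lam g" by auto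
  show "F \<in> FinLO (idx (src (fam_comp C g f))) \<and> H \<in> FinLO (idx (tgt (fam_comp C g f))) \<and>
      arr C (cpt (fam_comp C g f) (F, H)) \<and> source C (cpt (fam_comp C g f) (F, H)) = ob (src (fam_comp C g f)) F \<and>
      target C (cpt (fam_comp C g f) (F, H)) = ob (tgt (fam_comp C g f)) H"
    using fam_comp_cpt[OF G] fam_typed[OF f G(1)] fam_typed[OF g G(2)] fg by simp
  fix F' assume "(F', F) \<in> FinLO_arr (idx (src (fam_comp C g f)))"
  then show "(F', H) \<in> Lam (fam_comp C g f)" using fam_upward[OF f G(1)] G by auto
next
  fix H assume "H \<in> FinLO (idx (tgt (fam_comp C g f)))"
  then obtain G where G: "(G, H) \<in> Lam g" using fam_cover[OF g] by auto
  then obtain F where "(F, G) \<in> Lam f" using fam_cover[OF f] fam_typed[OF g G] fg by metis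
  then show "\<exists>F. (F, H) \<in> Lam (fam_comp C g f)" using G by auto
next
  fix F H F' H' assume "(F, H) \<in> Lam (fam_comp C g f)" "(F', H') \<in> Lam (fam_comp C g f)"
    "(F', F) \<in> FinLO_arr (idx (src (fam_comp C g f)))" "(H', H) \<in> FinLO_arr (idx (tgt (fam_comp C g f)))"
  then obtain G G' where G: "(F, G) \<in> Lam f" "(G, H) \<in> Lam g" and G': "(F', G') \<in> Lam f" "(G', H') \<in> Lam g"
    and FF: "(F', F) \<in> FinLO_arr (idx (src f))" and HH: "(H', H) \<in> FinLO_arr (idx (tgt g))" by auto
  note t = fam_typed[OF f G(1)] fam_typed[OF f G'(1)] fam_typed[OF g G(2)] fam_typed[OF g G'(2)] aitp_prj[OF Z HH] aitp_prj[OF X FF]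
  obtain K where K: "(K, G) \<in> FinLO_arr (idx (src g))" "(K, G') \<in> FinLO_arr (idx (src g))"
    using FinLO_union t fg by metis
  obtain L where L: "(L, K) \<in> Lam f" "(L, F') \<in> FinLO_arr (idx (src f))"
    using fam_above[of F' K] t(6) K(1) by (metis FinLO_arr_iff)
  have LF: "(L, F) \<in> FinLO_arr (idx (src f))" using FinLO_arr_trans L(2) FF .
  have KH: "(K, H) \<in> Lam g" "(K, H') \<in> Lam g" using fam_upward g G G' K by metis+
  note t = t fam_typed[OF f L(1)] fam_typed[OF g KH(1)] fam_typed[OF g KH(2)] aitp_prj[OF X LF] aitp_prj[OF X L(2)]
  have K1: "K \<in> FinLO (idx (src g))" using K by (simp add: FinLO_arr_iff)
  have n: "prj (tgt g) (H', H) \<cdot> cpt g (K, H') = cpt g (K, H)"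
    using fam_natural[OF g KH(1,2) FinLO_arr_refl[OF K1] HH] aitp_prj_ide[OF Y K1] t by simp
  have "(prj (tgt g) (H', H) \<cdot> (cpt g (G', H') \<cdot> cpt f (F', G'))) \<cdot> prj (src f) (L, F')
      = prj (tgt g) (H', H) \<cdot> ((cpt g (G', H') \<cdot> cpt f (F', G')) \<cdot> prj (src f) (L, F'))"
    using t fg by simp
  also have "\<dots> = prj (tgt g) (H', H) \<cdot> (cpt g (K, H') \<cdot> cpt f (L, K))"
    using fam_comp_restrict[OF G' L K(2)] by simp
  also have "\<dots> = (prj (tgt g) (H', H) \<cdot> cpt g (K, H')) \<cdot> cpt f (L, K)" using t fg by simp
  also have "\<dots> = (cpt g (G, H) \<cdot> cpt f (F, G)) \<cdot> prj (src f) (L, F)"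
    using n fam_comp_restrict[OF G L(1) LF K(1)] by simp
  also have "prj (src f) (L, F) = prj (src f) (F', F) \<cdot> prj (src f) (L, F')"
    using aitp_prj_comp[OF X L(2) FF] by simp
  also have "(cpt g (G, H) \<cdot> cpt f (F, G)) \<cdot> \<dots> = ((cpt g (G, H) \<cdot> cpt f (F, G)) \<cdot> prj (src f) (F', F)) \<cdot> prj (src f) (L, F')"
    using t fg by simp
  finally have "prj (tgt g) (H', H) \<cdot> (cpt g (G', H') \<cdot> cpt f (F', G')) = (cpt g (G, H) \<cdot> cpt f (F, G)) \<cdot> prj (src f) (F', F)"
    by (rule aitp_epi[OF X L(2), rotated 4]) (use t fg in auto)
  then show "prj (tgt (fam_comp C g f)) (H', H) \<cdot> cpt (fam_comp C g f) (F', H')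
       = cpt (fam_comp C g f) (F, H) \<cdot> prj (src (fam_comp C g f)) (F', F)"
    using fam_comp_cpt[OF G] fam_comp_cpt[OF G'] by simp
qed

end

definition fcomp :: "('j, nat, 'm) fam set \<Rightarrow> ('j, nat, 'm) fam set \<Rightarrow> ('j, nat, 'm) fam set" where
  "fcomp b a = {h. \<exists>f\<in>a. \<exists>g\<in>b. fam_equiv C (fam_comp C g f) h}"

lemma fcomp_class: assumes "a \<in> Hom X Y" "b \<in> Hom Y Z" "aitp X" "aitp Y" "aitp Z" "f \<in> a" "g \<in> b"
  shows "fcomp b a = fam_class C (fam_comp C g f)"
proof -
  note f = Hom_mem[OF assms(1,3,4,6)] and g = Hom_mem[OF assms(2,4,5,7)]
  have eq: "fam_equiv C (fam_comp C g f) (fam_comp C g' f')" if "f' \<in> a" "g' \<in> b" for f' g'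
  proof (rule fam_equivI)
    note f' = Hom_mem[OF assms(1,3,4) that(1)] and g' = Hom_mem[OF assms(2,4,5) that(2)]
    show "fin_approx C (fam_comp C g f)" "fin_approx C (fam_comp C g' f')"
      using f g f' g' assms by (auto intro!: fin_approx_comp)
    fix H assume "H \<in> FinLO (idx (tgt (fam_comp C g f)))"
    then have H: "H \<in> FinLO (idx Z)" using g by simp
    obtain G where G: "(G, H) \<in> Lam g" "(G, H) \<in> Lam g'" using fam_common[of g g' H H] H g g' by metis
    then have GY: "G \<in> FinLO (idx Y)" using fam_typed(1)[OF g(2)] g by simp
    obtain F where F: "(F, G) \<in> Lam f" "(F, G) \<in> Lam f'" using fam_common[of f f' G G] GY f f' by metis
    have "fam_equiv C f f'" "fam_equiv C g g'" using f g that unfolding fam_class_def by blast+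
    then have "cpt f (F, G) = cpt f' (F, G)" "cpt g (G, H) = cpt g' (G, H)" using fam_equivD(5) F G by metis+
    then have "cpt (fam_comp C g f) (F, H) = cpt (fam_comp C g' f') (F, H)"
      using fam_comp_cpt[of f g F G H] fam_comp_cpt[of f' g' F G H] F G f g f' g' assms by simp
    then show "\<exists>F. (F, H) \<in> Lam (fam_comp C g f) \<and> (F, H) \<in> Lam (fam_comp C g' f') \<and>
       cpt (fam_comp C g f) (F, H) = cpt (fam_comp C g' f') (F, H)" using F G by auto
  qed (use f g Hom_mem[OF assms(1,3,4) that(1)] Hom_mem[OF assms(2,4,5) that(2)] assms in auto)
  have "aitp (src (fam_comp C g f))" "aitp (tgt (fam_comp C g f))" using f g assms by auto
  then have "fam_equiv C (fam_comp C g f) h" if "f' \<in> a" "g' \<in> b" "fam_equiv C (fam_comp C g' f') h" for f' g' h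
    using fam_equiv_trans[OF eq[OF that(1,2)] that(3)] by simp
  then show ?thesis unfolding fcomp_def fam_class_def using assms(6,7) by blast
qed

lemma fcomp_Hom: assumes "a \<in> Hom X Y" "b \<in> Hom Y Z" "aitp X" "aitp Y" "aitp Z" shows "fcomp b a \<in> Hom X Z"
proof -
  obtain f g where fg: "f \<in> a" "g \<in> b" using Hom_nonempty assms by metis
  note f = Hom_mem[OF assms(1,3,4) fg(1)] and g = Hom_mem[OF assms(2,4,5) fg(2)]
  show ?thesis unfolding fcomp_class[OF assms fg] using f g assms by (auto intro!: Hom_classI fin_approx_comp)
qed

lemma pt_comp: assumes "a \<in> Hom X Y" "b \<in> Hom Y Z" "aitp X" "aitp Y" "aitp Z" "pt a F G c" "pt b G H d"
  shows "pt (fcomp b a) F H (d \<cdot> c)"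
proof -
  obtain f g where fg: "f \<in> a" "(F, G) \<in> Lam f" "cpt f (F, G) = c" "g \<in> b" "(G, H) \<in> Lam g" "cpt g (G, H) = d"
    using assms(6,7) pt_def by metis
  note f = Hom_mem[OF assms(1,3,4) fg(1)] and g = Hom_mem[OF assms(2,4,5) fg(4)]
  have "cpt (fam_comp C g f) (F, H) = d \<cdot> c" using fam_comp_cpt[of f g F G H] f g fg assms by simp
  moreover have "fin_approx C (fam_comp C g f)" "(F, H) \<in> Lam (fam_comp C g f)" using fin_approx_comp[of f g] f g fg assms by auto
  ultimately show ?thesis using pt_class fcomp_class[OF assms(1-5) fg(1,4)] by metis
qed

text \<open>An index of a tensor product is covered by prescribing both of its cuts, which is possible because the
cuts of one list over the union need only contain the given lists.\<close>

lemma fam_tensor_simps [simp]: "src (fam_tensor C f g) = diag_tensor C (src f) (src g)"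
  "tgt (fam_tensor C f g) = diag_tensor C (tgt f) (tgt g)"
  "(F, G) \<in> Lam (fam_tensor C f g) \<longleftrightarrow> F \<in> FinLO (idx (src f) \<union> idx (src g)) \<and> G \<in> FinLO (idx (tgt f) \<union> idx (tgt g))
     \<and> (cut F (idx (src f)), cut G (idx (tgt f))) \<in> Lam f \<and> (cut F (idx (src g)), cut G (idx (tgt g))) \<in> Lam g"
  "cpt (fam_tensor C f g) (F, G) = cpt f (cut F (idx (src f)), cut G (idx (tgt f))) \<otimes> cpt g (cut F (idx (src g)), cut G (idx (tgt g)))"
  by (auto simp: fam_tensor_def Let_def)

lemma FinLO_above_cuts: assumes "F \<in> FinLO J" "F' \<in> FinLO J'"
  obtains K where "K \<in> FinLO (J \<union> J')" "(cut K J, F) \<in> FinLO_arr J" "(cut K J', F') \<in> FinLO_arr J'"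
proof
  show "remdups (F @ F') \<in> FinLO (J \<union> J')" using assms by (auto simp: FinLO_def)
  then show "(cut (remdups (F @ F')) J, F) \<in> FinLO_arr J" "(cut (remdups (F @ F')) J', F') \<in> FinLO_arr J'"
    using assms FinLO_cut by (auto simp: FinLO_arr_iff FinLO_def)
qed

lemma fin_approx_tensor: assumes f: "fin_approx C f" and g: "fin_approx C g"
   and a: "aitp (src f)" "aitp (src g)" "aitp (tgt f)" "aitp (tgt g)"
  shows "fin_approx C (fam_tensor C f g)"
proof (rule fin_approxI)
  fix F G assume l: "(F, G) \<in> Lam (fam_tensor C f g)"
  show "F \<in> FinLO (idx (src (fam_tensor C f g))) \<and> G \<in> FinLO (idx (tgt (fam_tensor C f g))) \<and>
      arr C (cpt (fam_tensor C f g) (F, G)) \<and> source C (cpt (fam_tensor C f g) (F, G)) = ob (src (fam_tensor C f g)) F \<and>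
      target C (cpt (fam_tensor C f g) (F, G)) = ob (tgt (fam_tensor C f g)) G"
    using l fam_typed[OF f, of "cut F (idx (src f))" "cut G (idx (tgt f))"]
      fam_typed[OF g, of "cut F (idx (src g))" "cut G (idx (tgt g))"] by auto
  fix F' assume FF: "(F', F) \<in> FinLO_arr (idx (src (fam_tensor C f g)))"
  then show "(F', G) \<in> Lam (fam_tensor C f g)"
    using l fam_upward[OF f] fam_upward[OF g] FinLO_arr_cut[of F' F "idx (src f)" "idx (src g)"] by (auto simp: FinLO_arr_iff)
next
  fix G assume "G \<in> FinLO (idx (tgt (fam_tensor C f g)))"
  then have G: "G \<in> FinLO (idx (tgt f) \<union> idx (tgt g))" by simp
  obtain F F' where F: "(F, cut G (idx (tgt f))) \<in> Lam f" "(F', cut G (idx (tgt g))) \<in> Lam g"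
    using fam_cover f g FinLO_cut[OF G] by metis
  obtain K where "K \<in> FinLO (idx (src f) \<union> idx (src g))" "(cut K (idx (src f)), F) \<in> FinLO_arr (idx (src f))"
    "(cut K (idx (src g)), F') \<in> FinLO_arr (idx (src g))"
    using FinLO_above_cuts[OF fam_typed(1)[OF f F(1)] fam_typed(1)[OF g F(2)]] by blast
  then show "\<exists>F. (F, G) \<in> Lam (fam_tensor C f g)"
    using fam_upward[OF f F(1)] fam_upward[OF g F(2)] G by auto
next
  fix F G F' G' assume l: "(F, G) \<in> Lam (fam_tensor C f g)" "(F', G') \<in> Lam (fam_tensor C f g)"
    and "(F', F) \<in> FinLO_arr (idx (src (fam_tensor C f g)))" "(G', G) \<in> FinLO_arr (idx (tgt (fam_tensor C f g)))"
  then have FF: "(F', F) \<in> FinLO_arr (idx (src f) \<union> idx (src g))" and GG: "(G', G) \<in> FinLO_arr (idx (tgt f) \<union> idx (tgt g))"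
    by simp_all
  note c = FinLO_arr_cut[OF FF] FinLO_arr_cut[OF GG]
  note lf = l[simplified, THEN conjunct2, THEN conjunct2, THEN conjunct1] and lg = l[simplified, THEN conjunct2, THEN conjunct2, THEN conjunct2]
  note t = fam_typed[OF f lf(1)] fam_typed[OF f lf(2)] fam_typed[OF g lg(1)] fam_typed[OF g lg(2)]
    aitp_prj[OF a(1) c(1)] aitp_prj[OF a(2) c(2)] aitp_prj[OF a(3) c(3)] aitp_prj[OF a(4) c(4)]
  show "prj (tgt (fam_tensor C f g)) (G', G) \<cdot> cpt (fam_tensor C f g) (F', G')
       = cpt (fam_tensor C f g) (F, G) \<cdot> prj (src (fam_tensor C f g)) (F', F)"
    using FF GG t fam_natural[OF f lf c(1,3)] fam_natural[OF g lg c(2,4)] by (simp add: interchange)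
qed

definition ftensor :: "('j, nat, 'm) fam set \<Rightarrow> ('j, nat, 'm) fam set \<Rightarrow> ('j, nat, 'm) fam set" where
  "ftensor a b = {h. \<exists>f\<in>a. \<exists>g\<in>b. fam_equiv C (fam_tensor C f g) h}"

lemma ftensor_class: assumes "a \<in> Hom X Y" "b \<in> Hom X' Y'" "aitp X" "aitp Y" "aitp X'" "aitp Y'" "f \<in> a" "g \<in> b"
  shows "ftensor a b = fam_class C (fam_tensor C f g)"
proof -
  note f = Hom_mem[OF assms(1,3,4,7)] and g = Hom_mem[OF assms(2,5,6,8)]
  have eq: "fam_equiv C (fam_tensor C f g) (fam_tensor C f' g')" if "f' \<in> a" "g' \<in> b" for f' g'
  proof -
    note f' = Hom_mem[OF assms(1,3,4) that(1)] and g' = Hom_mem[OF assms(2,5,6) that(2)]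
    have e: "fam_equiv C f f'" "fam_equiv C g g'" using f g that unfolding fam_class_def by blast+
    have "fin_approx C (fam_tensor C f g)" "fin_approx C (fam_tensor C f' g')"
      using f g f' g' assms by (auto intro!: fin_approx_tensor)
    then show ?thesis using fam_equivD(5)[OF e(1)] fam_equivD(5)[OF e(2)] f(3,4) g(3,4) f'(3,4) g'(3,4)
      unfolding fam_equiv_def[of C "fam_tensor C f g"] by auto
  qed
  have "aitp (src (fam_tensor C f g))" "aitp (tgt (fam_tensor C f g))" using f g assms aitp_tensor by auto
  then have "fam_equiv C (fam_tensor C f g) h" if "f' \<in> a" "g' \<in> b" "fam_equiv C (fam_tensor C f' g') h" for f' g' h
    using fam_equiv_trans[OF eq[OF that(1,2)] that(3)] by simp
  then show ?thesis unfolding ftensor_def fam_class_def using assms(7,8) by blast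
qed

lemma ftensor_Hom: assumes "a \<in> Hom X Y" "b \<in> Hom X' Y'" "aitp X" "aitp Y" "aitp X'" "aitp Y'"
  shows "ftensor a b \<in> Hom (diag_tensor C X X') (diag_tensor C Y Y')"
proof -
  obtain f g where fg: "f \<in> a" "g \<in> b" using Hom_nonempty assms by metis
  note f = Hom_mem[OF assms(1,3,4) fg(1)] and g = Hom_mem[OF assms(2,5,6) fg(2)]
  show ?thesis unfolding ftensor_class[OF assms fg] using f g assms by (auto intro!: Hom_classI fin_approx_tensor)
qed

lemma pt_tensor: assumes "a \<in> Hom X Y" "b \<in> Hom X' Y'" "aitp X" "aitp Y" "aitp X'" "aitp Y'"
    "F \<in> FinLO (idx X \<union> idx X')" "G \<in> FinLO (idx Y \<union> idx Y')"
    "pt a (cut F (idx X)) (cut G (idx Y)) c" "pt b (cut F (idx X')) (cut G (idx Y')) d"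
  shows "pt (ftensor a b) F G (c \<otimes> d)"
proof -
  obtain f g where fg: "f \<in> a" "(cut F (idx X), cut G (idx Y)) \<in> Lam f" "cpt f (cut F (idx X), cut G (idx Y)) = c"
    "g \<in> b" "(cut F (idx X'), cut G (idx Y')) \<in> Lam g" "cpt g (cut F (idx X'), cut G (idx Y')) = d"
    using assms(9,10) pt_def by metis
  note f = Hom_mem[OF assms(1,3,4) fg(1)] and g = Hom_mem[OF assms(2,5,6) fg(4)]
  have "cpt (fam_tensor C f g) (F, G) = c \<otimes> d" "(F, G) \<in> Lam (fam_tensor C f g)" "fin_approx C (fam_tensor C f g)"
    using fin_approx_tensor[of f g] f g fg assms by auto
  then show ?thesis using pt_class ftensor_class[OF assms(1-6) fg(1,4)] by metis
qed

text \<open>Families with a component at each \<open>(F, F)\<close>.  All coherence isomorphisms of the explicit category are of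
this kind, so that equations between them need to be checked only at each \<open>F\<close>.\<close>

definition natural :: "('j, nat, 'm) diagram \<Rightarrow> ('j, nat, 'm) diagram \<Rightarrow> ('j list \<Rightarrow> 'm) \<Rightarrow> bool" where
  "natural X Y \<theta> \<longleftrightarrow> aitp X \<and> aitp Y \<and> idx X = idx Y
     \<and> (\<forall>F\<in>FinLO (idx X). arr C (\<theta> F) \<and> source C (\<theta> F) = ob X F \<and> target C (\<theta> F) = ob Y F)
     \<and> (\<forall>F' F. (F', F) \<in> FinLO_arr (idx X) \<longrightarrow> prj Y (F', F) \<cdot> \<theta> F' = \<theta> F \<cdot> prj X (F', F))"

lemma naturalD: assumes "natural X Y \<theta>"
  shows "aitp X" "aitp Y" "idx Y = idx X"
    "F \<in> FinLO (idx X) \<Longrightarrow> arr C (\<theta> F) \<and> source C (\<theta> F) = ob X F \<and> target C (\<theta> F) = ob Y F"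
    "(F', F) \<in> FinLO_arr (idx X) \<Longrightarrow> prj Y (F', F) \<cdot> \<theta> F' = \<theta> F \<cdot> prj X (F', F)"
  using assms unfolding natural_def by auto

abbreviation fnat where "fnat X Y \<theta> \<equiv> fam_class C (fam_of_nat C X Y \<theta>)"

lemma fam_of_nat_simps [simp]: "src (fam_of_nat C X Y \<theta>) = X" "tgt (fam_of_nat C X Y \<theta>) = Y"
  "Lam (fam_of_nat C X Y \<theta>) = FinLO_arr (idx X)" "cpt (fam_of_nat C X Y \<theta>) (F, G) = prj Y (F, G) \<cdot> \<theta> F"
  by (auto simp: fam_of_nat_def)

lemma fin_approx_of_nat: assumes "natural X Y \<theta>" shows "fin_approx C (fam_of_nat C X Y \<theta>)"
proof (rule fin_approxI)
  note X = naturalD(1)[OF assms] and Y = naturalD(2)[OF assms] and i = naturalD(3)[OF assms] and t = naturalD(4)[OF assms] and n = naturalD(5)[OF assms]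
  let ?f = "fam_of_nat C X Y \<theta>"
  {
    fix F G assume l: "(F, G) \<in> Lam ?f"
    then have "F \<in> FinLO (idx X)" by (simp add: FinLO_arr_iff)
    then show "F \<in> FinLO (idx (src ?f)) \<and> G \<in> FinLO (idx (tgt ?f)) \<and>
      arr C (cpt ?f (F, G)) \<and> source C (cpt ?f (F, G)) = ob (src ?f) F \<and> target C (cpt ?f (F, G)) = ob (tgt ?f) G"
      using l t[of F] aitp_prj[OF Y, of F G] i by (simp add: FinLO_arr_iff)
    fix F' assume "(F', F) \<in> FinLO_arr (idx (src ?f))"
    then show "(F', G) \<in> Lam ?f" using l FinLO_arr_trans by auto
  next
    fix G assume "G \<in> FinLO (idx (tgt ?f))"
    then show "\<exists>F. (F, G) \<in> Lam ?f" using FinLO_arr_refl i by auto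
  next
    fix F G F' G' assume "(F, G) \<in> Lam ?f" "(F', G') \<in> Lam ?f" "(F', F) \<in> FinLO_arr (idx (src ?f))"
        "(G', G) \<in> FinLO_arr (idx (tgt ?f))"
    then have a: "(F, G) \<in> FinLO_arr (idx X)" "(F', G') \<in> FinLO_arr (idx X)" "(F', F) \<in> FinLO_arr (idx X)"
        "(G', G) \<in> FinLO_arr (idx X)" "F \<in> FinLO (idx X)" "F' \<in> FinLO (idx X)" by (auto simp: i FinLO_arr_iff)
    note p = aitp_prj[OF Y, unfolded i] and q = aitp_prj[OF X] and c = aitp_prj_comp[OF Y, unfolded i]
    have "prj Y (G', G) \<cdot> (prj Y (F', G') \<cdot> \<theta> F') = (prj Y (G', G) \<cdot> prj Y (F', G')) \<cdot> \<theta> F'"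
      using p[OF a(2)] p[OF a(4)] t[OF a(6)] by simp
    also have "\<dots> = (prj Y (F, G) \<cdot> prj Y (F', F)) \<cdot> \<theta> F'" using c[OF a(2,4)] c[OF a(3,1)] by simp
    also have "\<dots> = (prj Y (F, G) \<cdot> \<theta> F) \<cdot> prj X (F', F)"
      using n[OF a(3)] p[OF a(1)] p[OF a(3)] q[OF a(3)] t[OF a(5)] t[OF a(6)] by simp
    finally show "prj (tgt ?f) (G', G) \<cdot> cpt ?f (F', G') = cpt ?f (F, G) \<cdot> prj (src ?f) (F', F)" by simp
  }
qed

lemma fnat_Hom: "natural X Y \<theta> \<Longrightarrow> fnat X Y \<theta> \<in> Hom X Y"
  by (intro Hom_classI fin_approx_of_nat) auto

lemma pt_fnat: "natural X Y \<theta> \<Longrightarrow> F \<in> FinLO (idx X) \<Longrightarrow> pt (fnat X Y \<theta>) F F (\<theta> F)"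
  using pt_class[OF fin_approx_of_nat, of X Y \<theta> F F] FinLO_arr_refl[of F "idx X"] aitp_prj_ide[of Y F]
  by (auto simp: natural_def)

definition fide where "fide X = fnat X X (\<lambda>F. ide C (ob X F))"

lemma natural_ide: "aitp X \<Longrightarrow> natural X X (\<lambda>F. ide C (ob X F))"
  unfolding natural_def by (auto simp: aitp_prj)

lemma fide_Hom: "aitp X \<Longrightarrow> fide X \<in> Hom X X" unfolding fide_def by (intro fnat_Hom natural_ide)

lemma pt_fide: "aitp X \<Longrightarrow> F \<in> FinLO (idx X) \<Longrightarrow> pt (fide X) F F (ide C (ob X F))"
  unfolding fide_def using pt_fnat[OF natural_ide] by blast

lemma fcomp_fide: assumes "a \<in> Hom X Y" "aitp X" "aitp Y" shows "fcomp (fide Y) a = a" "fcomp a (fide X) = a"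
proof -
  have 1: "\<exists>F c. pt (fcomp (fide Y) a) F G c \<and> pt a F G c \<and> pt (fcomp a (fide X)) F G c" if G: "G \<in> FinLO (idx Y)" for G
  proof -
    obtain F c where p: "pt a F G c" using pt_cover[OF assms(1) G] .
    note t = pt_typed[OF assms p]
    show ?thesis using pt_comp[OF assms(1) fide_Hom assms(2,3,3) p pt_fide] pt_comp[OF fide_Hom assms(1,2,2,3) pt_fide p] t p assms by auto
  qed
  show "fcomp (fide Y) a = a" "fcomp a (fide X) = a"
    by (rule pt_eqI[OF _ assms]; use 1 fcomp_Hom fide_Hom assms in blast)+
qed

lemma fcomp_assoc: assumes "a \<in> Hom X Y" "b \<in> Hom Y Z" "c \<in> Hom Z W" "aitp X" "aitp Y" "aitp Z" "aitp W"
  shows "fcomp (fcomp c b) a = fcomp c (fcomp b a)"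
proof (rule pt_eqI)
  have ba: "fcomp b a \<in> Hom X Z" and cb: "fcomp c b \<in> Hom Y W" using assms fcomp_Hom by blast+
  then show "fcomp (fcomp c b) a \<in> Hom X W" "fcomp c (fcomp b a) \<in> Hom X W" using assms fcomp_Hom by blast+
  fix K assume K: "K \<in> FinLO (idx W)"
  obtain H z where z: "pt c H K z" using pt_cover[OF assms(3) K] .
  obtain G y where y: "pt b G H y" using pt_cover[OF assms(2)] pt_typed(1)[OF assms(3,6,7) z] by metis
  obtain F x where x: "pt a F G x" using pt_cover[OF assms(1)] pt_typed(1)[OF assms(2,5,6) y] by metis
  note t = pt_typed[OF assms(3,6,7) z] pt_typed[OF assms(2,5,6) y] pt_typed[OF assms(1,4,5) x]
  have "pt (fcomp (fcomp c b) a) F K ((z \<cdot> y) \<cdot> x)"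
    using pt_comp[OF assms(1) cb assms(4,5,7) x pt_comp[OF assms(2,3,5,6,7) y z]] .
  moreover have "pt (fcomp c (fcomp b a)) F K (z \<cdot> (y \<cdot> x))"
    using pt_comp[OF ba assms(3,4,6,7) pt_comp[OF assms(1,2,4,5,6) x y] z] .
  ultimately show "\<exists>F d. pt (fcomp (fcomp c b) a) F K d \<and> pt (fcomp c (fcomp b a)) F K d" using t by auto
qed (use assms in auto)

declare aitp_tensor [simp] aitp_diag_unit [simp]

lemma expl_simps [simp]: "obj (expl s C) = {X. s \<in> idx X \<and> aitp X}" "hom (expl s C) = Hom" "ide (expl s C) = fide"
  "comp (expl s C) = fcomp" "munit (expl s C) = diag_unit C s" "tenO (expl s C) = diag_tensor C" "tenM (expl s C) = ftensor"
  by (auto simp: expl_def aitp_def Hom_def fide_def fcomp_def ftensor_def fun_eq_iff)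

lemma cut_cut [simp]: "J \<subseteq> J' \<Longrightarrow> cut (cut F J') J = cut F J"
  by (auto intro!: filter_cong)

lemma cut_all [simp]: "F \<in> FinLO J \<Longrightarrow> J \<subseteq> J' \<Longrightarrow> cut F J' = F"
  by (auto simp: FinLO_def intro!: filter_True)

lemma fcomp_fnat: assumes "natural X Y \<theta>" "natural Y Z \<theta>'" "natural X Z \<theta>''"
    "\<And>F. F \<in> FinLO (idx X) \<Longrightarrow> \<theta>' F \<cdot> \<theta> F = \<theta>'' F"
  shows "fcomp (fnat Y Z \<theta>') (fnat X Y \<theta>) = fnat X Z \<theta>''"
proof (rule pt_eqI)
  have i: "aitp X" "aitp Y" "aitp Z" "idx X = idx Y" "idx Y = idx Z" using assms unfolding natural_def by auto
  show "aitp X" "aitp Z" by fact+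
  show "fcomp (fnat Y Z \<theta>') (fnat X Y \<theta>) \<in> Hom X Z" "fnat X Z \<theta>'' \<in> Hom X Z" using fnat_Hom assms i fcomp_Hom by blast+
  fix F assume "F \<in> FinLO (idx Z)"
  then have F: "F \<in> FinLO (idx X)" "F \<in> FinLO (idx Y)" using i by auto
  show "\<exists>G c. pt (fcomp (fnat Y Z \<theta>') (fnat X Y \<theta>)) G F c \<and> pt (fnat X Z \<theta>'') G F c"
    using pt_comp[OF fnat_Hom[OF assms(1)] fnat_Hom[OF assms(2)] i(1-3) pt_fnat[OF assms(1) F(1)] pt_fnat[OF assms(2) F(2)]]
      pt_fnat[OF assms(3) F(1)] assms(4)[OF F(1)] by metis
qed

lemma ftensor_fnat: assumes "natural X Y \<theta>" "natural X' Y' \<theta>'"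
    "natural (diag_tensor C X X') (diag_tensor C Y Y') \<theta>''"
    "\<And>F. F \<in> FinLO (idx X \<union> idx X') \<Longrightarrow> \<theta> (cut F (idx X)) \<otimes> \<theta>' (cut F (idx X')) = \<theta>'' F"
  shows "ftensor (fnat X Y \<theta>) (fnat X' Y' \<theta>') = fnat (diag_tensor C X X') (diag_tensor C Y Y') \<theta>''"
proof (rule pt_eqI)
  have i: "aitp X" "aitp Y" "aitp X'" "aitp Y'" "idx X = idx Y" "idx X' = idx Y'" using assms unfolding natural_def by auto
  show "aitp (diag_tensor C X X')" "aitp (diag_tensor C Y Y')" using i aitp_tensor by auto
  show "ftensor (fnat X Y \<theta>) (fnat X' Y' \<theta>') \<in> Hom (diag_tensor C X X') (diag_tensor C Y Y')"
    "fnat (diag_tensor C X X') (diag_tensor C Y Y') \<theta>'' \<in> Hom (diag_tensor C X X') (diag_tensor C Y Y')"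
    using fnat_Hom assms i ftensor_Hom by blast+
  fix F assume "F \<in> FinLO (idx (diag_tensor C Y Y'))"
  then have F: "F \<in> FinLO (idx X \<union> idx X')" "F \<in> FinLO (idx Y \<union> idx Y')" using i by auto
  note c = FinLO_cut[OF F(1)]
  have "pt (ftensor (fnat X Y \<theta>) (fnat X' Y' \<theta>')) F F (\<theta> (cut F (idx X)) \<otimes> \<theta>' (cut F (idx X')))"
    using pt_tensor[OF fnat_Hom[OF assms(1)] fnat_Hom[OF assms(2)] i(1-4) F] pt_fnat[OF assms(1) c(1)] pt_fnat[OF assms(2) c(2)] i
    by simp
  then show "\<exists>G c. pt (ftensor (fnat X Y \<theta>) (fnat X' Y' \<theta>')) G F c \<and> pt (fnat (diag_tensor C X X') (diag_tensor C Y Y') \<theta>'') G F c"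
    using pt_fnat[OF assms(3)] assms(4) F by (metis diag_tensor_simps(1))
qed

lemma natural_tensor: assumes "natural X Y \<theta>" "natural X' Y' \<theta>'"
  shows "natural (diag_tensor C X X') (diag_tensor C Y Y') (\<lambda>F. \<theta> (cut F (idx X)) \<otimes> \<theta>' (cut F (idx X')))"
proof -
  have i: "aitp X" "aitp Y" "aitp X'" "aitp Y'" "idx Y = idx X" "idx Y' = idx X'" using naturalD[OF assms(1)] naturalD[OF assms(2)] by simp_all
  note t = naturalD(4)[OF assms(1)] naturalD(4)[OF assms(2)] and n = naturalD(5)[OF assms(1)] naturalD(5)[OF assms(2)]
  show ?thesis unfolding natural_def
  proof (intro conjI ballI allI impI)
    show "aitp (diag_tensor C X X')" "aitp (diag_tensor C Y Y')" using i aitp_tensor by auto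
    show "idx (diag_tensor C X X') = idx (diag_tensor C Y Y')" using i by simp
  next
    fix F assume "F \<in> FinLO (idx (diag_tensor C X X'))"
    then have F: "F \<in> FinLO (idx X \<union> idx X')" by simp
    show "arr C (\<theta> (cut F (idx X)) \<otimes> \<theta>' (cut F (idx X')))"
      "source C (\<theta> (cut F (idx X)) \<otimes> \<theta>' (cut F (idx X'))) = ob (diag_tensor C X X') F"
      "target C (\<theta> (cut F (idx X)) \<otimes> \<theta>' (cut F (idx X'))) = ob (diag_tensor C Y Y') F"
      using t FinLO_cut[OF F] F by (simp_all add: i)
  next
    fix F' F assume "(F', F) \<in> FinLO_arr (idx (diag_tensor C X X'))"
    then have F: "(F', F) \<in> FinLO_arr (idx X \<union> idx X')" by simp
    note c = FinLO_arr_cut[OF F]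
    have m: "cut F (idx X) \<in> FinLO (idx X)" "cut F' (idx X) \<in> FinLO (idx X)" "cut F (idx X') \<in> FinLO (idx X')" "cut F' (idx X') \<in> FinLO (idx X')"
      using c by (auto simp: FinLO_arr_iff)
    note p = aitp_prj[OF i(1) c(1)] aitp_prj[OF i(3) c(2)] aitp_prj[OF i(2), unfolded i, OF c(1)] aitp_prj[OF i(4), unfolded i, OF c(2)]
    show "prj (diag_tensor C Y Y') (F', F) \<cdot> (\<theta> (cut F' (idx X)) \<otimes> \<theta>' (cut F' (idx X')))
       = (\<theta> (cut F (idx X)) \<otimes> \<theta>' (cut F (idx X'))) \<cdot> prj (diag_tensor C X X') (F', F)"
      using F n(1)[OF c(1)] n(2)[OF c(2)] p t(1)[OF m(1)] t(1)[OF m(2)] t(2)[OF m(3)] t(2)[OF m(4)]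
      by (simp add: i interchange)
  qed
qed

lemma natural_ideI: assumes "aitp X" "aitp Y" "idx X = idx Y" "\<And>F. F \<in> FinLO (idx X) \<Longrightarrow> ob X F = ob Y F"
    "\<And>F' F. (F', F) \<in> FinLO_arr (idx X) \<Longrightarrow> prj X (F', F) = prj Y (F', F)"
    "\<And>F. F \<in> FinLO (idx X) \<Longrightarrow> \<theta> F = ide C (ob X F)"
  shows "natural X Y \<theta>"
  unfolding natural_def using assms aitp_prj[OF assms(1)] by (auto simp: FinLO_arr_iff)

abbreviation fassoc where "fassoc X Y Z \<equiv> fnat (diag_tensor C (diag_tensor C X Y) Z) (diag_tensor C X (diag_tensor C Y Z))
        (\<lambda>F. assoc C (ob X (cut F (idx X))) (ob Y (cut F (idx Y))) (ob Z (cut F (idx Z))))"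
abbreviation flunit where "flunit s X \<equiv> fnat (diag_tensor C (diag_unit C s) X) X (\<lambda>F. lunit C (ob X F))"
abbreviation frunit where "frunit s X \<equiv> fnat (diag_tensor C X (diag_unit C s)) X (\<lambda>F. runit C (ob X F))"
abbreviation fbraid where "fbraid X Y \<equiv> fnat (diag_tensor C X Y) (diag_tensor C Y X)
        (\<lambda>F. braid C (ob X (cut F (idx X))) (ob Y (cut F (idx Y))))"

lemma expl_structure [simp]: "assoc (expl s C) = fassoc" "lunit (expl s C) = flunit s" "runit (expl s C) = frunit s"
    "braid (expl s C) = fbraid"
  by (auto simp: expl_def fun_eq_iff)

lemma disj_absorb: "((P \<or> Q) \<and> P) = P" "((P \<or> Q) \<and> Q) = Q" by blast+

lemma tensor3_simps:
  "F \<in> FinLO (idx X \<union> idx Y \<union> idx Z) \<Longrightarrow> ob (diag_tensor C (diag_tensor C X Y) Z) F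
     = ob X (cut F (idx X)) + ob Y (cut F (idx Y)) + ob Z (cut F (idx Z))"
  "F \<in> FinLO (idx X \<union> idx Y \<union> idx Z) \<Longrightarrow> ob (diag_tensor C X (diag_tensor C Y Z)) F
     = ob X (cut F (idx X)) + ob Y (cut F (idx Y)) + ob Z (cut F (idx Z))"
  "(F', F) \<in> FinLO_arr (idx X \<union> idx Y \<union> idx Z) \<Longrightarrow> prj (diag_tensor C (diag_tensor C X Y) Z) (F', F)
     = (prj X (cut F' (idx X), cut F (idx X)) \<otimes> prj Y (cut F' (idx Y), cut F (idx Y))) \<otimes> prj Z (cut F' (idx Z), cut F (idx Z))"
  "(F', F) \<in> FinLO_arr (idx X \<union> idx Y \<union> idx Z) \<Longrightarrow> prj (diag_tensor C X (diag_tensor C Y Z)) (F', F)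
     = prj X (cut F' (idx X), cut F (idx X)) \<otimes> (prj Y (cut F' (idx Y), cut F (idx Y)) \<otimes> prj Z (cut F' (idx Z), cut F (idx Z)))"
  using FinLO_cut[of F "idx X \<union> idx Y" "idx Z"] FinLO_cut[of F "idx X" "idx Y \<union> idx Z"]
    FinLO_arr_cut[of F' F "idx X \<union> idx Y" "idx Z"] FinLO_arr_cut[of F' F "idx X" "idx Y \<union> idx Z"]
  by (simp_all add: Un_assoc add.assoc disj_absorb)

lemma natural_assoc: assumes "aitp X" "aitp Y" "aitp Z"
  shows "natural (diag_tensor C (diag_tensor C X Y) Z) (diag_tensor C X (diag_tensor C Y Z))
     (\<lambda>F. assoc C (ob X (cut F (idx X))) (ob Y (cut F (idx Y))) (ob Z (cut F (idx Z))))"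
proof (rule natural_ideI)
  fix F' F assume "(F', F) \<in> FinLO_arr (idx (diag_tensor C (diag_tensor C X Y) Z))"
  then have F: "(F', F) \<in> FinLO_arr (idx X \<union> idx Y \<union> idx Z)" by simp
  have c: "(cut F' (idx X), cut F (idx X)) \<in> FinLO_arr (idx X)" "(cut F' (idx Y), cut F (idx Y)) \<in> FinLO_arr (idx Y)"
    "(cut F' (idx Z), cut F (idx Z)) \<in> FinLO_arr (idx Z)"
    using F by (auto simp: FinLO_arr_iff FinLO_def)
  show "prj (diag_tensor C (diag_tensor C X Y) Z) (F', F) = prj (diag_tensor C X (diag_tensor C Y Z)) (F', F)"
    using tensor3_simps(3,4)[OF F] aitp_prj[OF assms(1) c(1)] aitp_prj[OF assms(2) c(2)] aitp_prj[OF assms(3) c(3)] by simp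
qed (use assms aitp_tensor in \<open>auto simp: tensor3_simps Un_assoc[symmetric] simp del: diag_tensor_simps(2)\<close>)

lemma natural_lunit: assumes "aitp X" "s \<in> idx X" shows "natural (diag_tensor C (diag_unit C s) X) X (\<lambda>F. lunit C (ob X F))"
proof (rule natural_ideI)
  have i: "{s} \<union> idx X = idx X" using assms by auto
  fix F' F assume "(F', F) \<in> FinLO_arr (idx (diag_tensor C (diag_unit C s) X))"
  then have F: "(F', F) \<in> FinLO_arr ({s} \<union> idx X)" by simp
  note c = FinLO_arr_cut[OF F]
  show "prj (diag_tensor C (diag_unit C s) X) (F', F) = prj X (F', F)"
  proof -
    have "prj (diag_tensor C (diag_unit C s) X) (F', F) = ide C 0 \<otimes> prj X (cut F' (idx X), cut F (idx X))"
      using F c diag_tensor_simps(3)[of F' F "diag_unit C s" X] by simp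
    moreover have "cut F' (idx X) = F'" "cut F (idx X) = F" using F i by (auto simp: FinLO_arr_iff)
    ultimately show ?thesis using aitp_prj[OF assms(1) c(2)] by simp
  qed
next
  have i: "{s} \<union> idx X = idx X" using assms by auto
  fix F assume "F \<in> FinLO (idx (diag_tensor C (diag_unit C s) X))"
  then have F: "F \<in> FinLO ({s} \<union> idx X)" by simp
  have "ob (diag_tensor C (diag_unit C s) X) F = ob (diag_unit C s) (cut F {s}) + ob X (cut F (idx X))" using F by simp
  moreover have "cut F (idx X) = F" using F unfolding i by simp
  moreover have "cut F {s} \<in> FinLO {s}" using FinLO_cut[OF F] by simp
  ultimately show "ob (diag_tensor C (diag_unit C s) X) F = ob X F" "lunit C (ob X F) = ide C (ob (diag_tensor C (diag_unit C s) X) F)" by simp_all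
qed (use assms in auto)

lemma natural_runit: assumes "aitp X" "s \<in> idx X" shows "natural (diag_tensor C X (diag_unit C s)) X (\<lambda>F. runit C (ob X F))"
proof (rule natural_ideI)
  have i: "idx X \<union> {s} = idx X" using assms by auto
  fix F' F assume "(F', F) \<in> FinLO_arr (idx (diag_tensor C X (diag_unit C s)))"
  then have F: "(F', F) \<in> FinLO_arr (idx X \<union> {s})" by simp
  note c = FinLO_arr_cut[OF F]
  show "prj (diag_tensor C X (diag_unit C s)) (F', F) = prj X (F', F)"
  proof -
    have "prj (diag_tensor C X (diag_unit C s)) (F', F) = prj X (cut F' (idx X), cut F (idx X)) \<otimes> ide C 0"
      using F c diag_tensor_simps(3)[of F' F X "diag_unit C s"] by simp
    moreover have "cut F' (idx X) = F'" "cut F (idx X) = F" using F i by (auto simp: FinLO_arr_iff)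
    ultimately show ?thesis using aitp_prj[OF assms(1) c(1)] by simp
  qed
next
  have i: "idx X \<union> {s} = idx X" using assms by auto
  fix F assume "F \<in> FinLO (idx (diag_tensor C X (diag_unit C s)))"
  then have F: "F \<in> FinLO (idx X \<union> {s})" by simp
  have "ob (diag_tensor C X (diag_unit C s)) F = ob X (cut F (idx X)) + ob (diag_unit C s) (cut F {s})" using F by simp
  moreover have "cut F (idx X) = F" using F unfolding i by simp
  moreover have "cut F {s} \<in> FinLO {s}" using FinLO_cut[OF F] by simp
  ultimately show "ob (diag_tensor C X (diag_unit C s)) F = ob X F" "runit C (ob X F) = ide C (ob (diag_tensor C X (diag_unit C s)) F)" by simp_all
qed (use assms in auto)

lemma natural_braid: assumes "aitp X" "aitp Y" shows "natural (diag_tensor C X Y) (diag_tensor C Y X)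
        (\<lambda>F. braid C (ob X (cut F (idx X))) (ob Y (cut F (idx Y))))"
  unfolding natural_def
proof (intro conjI ballI allI impI)
  fix F' F assume "(F', F) \<in> FinLO_arr (idx (diag_tensor C X Y))"
  then have F: "(F', F) \<in> FinLO_arr (idx X \<union> idx Y)" by simp
  note c = FinLO_arr_cut[OF F]
  show "prj (diag_tensor C Y X) (F', F) \<cdot> braid C (ob X (cut F' (idx X))) (ob Y (cut F' (idx Y)))
     = braid C (ob X (cut F (idx X))) (ob Y (cut F (idx Y))) \<cdot> prj (diag_tensor C X Y) (F', F)"
    using F braid_natural[of "prj X (cut F' (idx X), cut F (idx X))" "prj Y (cut F' (idx Y), cut F (idx Y))"]
      aitp_prj[OF assms(1) c(1)] aitp_prj[OF assms(2) c(2)] by (simp add: Un_commute)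
qed (use assms aitp_tensor in \<open>auto simp: Un_commute\<close>)

lemma expl_category: "typed_category (expl (s :: 'j) C)"
proof (unfold_locales, simp_all only: expl_simps mem_Collect_eq)
  fix A B A' B' :: "('j, nat, 'm) diagram" and f
  assume a: "s \<in> idx A \<and> aitp A" "s \<in> idx B \<and> aitp B" "s \<in> idx A' \<and> aitp A'" "s \<in> idx B' \<and> aitp B'"
    "f \<in> Hom A B" "f \<in> Hom A' B'"
  then obtain g where "g \<in> f" using Hom_nonempty by metis
  then have "src g = A" "src g = A'" "tgt g = B" "tgt g = B'" using Hom_mem a by metis+
  then show "A = A' \<and> B = B'" by simp
qed (simp_all add: fide_Hom fcomp_Hom fcomp_fide fcomp_assoc)

lemma ftensor_fide: assumes "aitp A" "aitp B" shows "ftensor (fide A) (fide B) = fide (diag_tensor C A B)"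
  unfolding fide_def by (rule ftensor_fnat) (use assms aitp_tensor natural_ide in auto)

lemma ftensor_fcomp: assumes "aitp A" "aitp B" "aitp D" "aitp A'" "aitp B'" "aitp D'"
    "f \<in> Hom A B" "g \<in> Hom B D" "f' \<in> Hom A' B'" "g' \<in> Hom B' D'"
  shows "ftensor (fcomp g f) (fcomp g' f') = fcomp (ftensor g g') (ftensor f f')"
proof (rule pt_eqI)
  note gf = fcomp_Hom[OF assms(7,8,1-3)] and gf' = fcomp_Hom[OF assms(9,10,4-6)]
  note ff = ftensor_Hom[OF assms(7,9,1,2,4,5)] and gg = ftensor_Hom[OF assms(8,10,2,3,5,6)]
  have t: "aitp (diag_tensor C A A')" "aitp (diag_tensor C B B')" "aitp (diag_tensor C D D')" using assms by auto
  show "aitp (diag_tensor C A A')" "aitp (diag_tensor C D D')" by fact+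
  show "ftensor (fcomp g f) (fcomp g' f') \<in> Hom (diag_tensor C A A') (diag_tensor C D D')"
    using ftensor_Hom gf gf' assms by blast
  show "fcomp (ftensor g g') (ftensor f f') \<in> Hom (diag_tensor C A A') (diag_tensor C D D')"
    using fcomp_Hom ff gg t by blast
  fix H assume "H \<in> FinLO (idx (diag_tensor C D D'))"
  then have H: "H \<in> FinLO (idx D \<union> idx D')" by simp
  obtain G0 y0 where y0: "pt (ftensor g g') G0 H y0" using pt_cover[OF gg, of H] H by auto
  obtain G1 y1 where y1: "pt g G1 (cut H (idx D)) y1" using pt_cover assms FinLO_cut H by metis
  obtain G2 y2 where y2: "pt g' G2 (cut H (idx D')) y2" using pt_cover assms FinLO_cut H by metis
  obtain G where G: "G \<in> FinLO (idx B \<union> idx B')" "(cut G (idx B), G1) \<in> FinLO_arr (idx B)" "(cut G (idx B'), G2) \<in> FinLO_arr (idx B')"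
    using FinLO_above_cuts pt_typed(1)[OF assms(8,2,3) y1] pt_typed(1)[OF assms(10,5,6) y2] by metis
  obtain y y' where y: "pt g (cut G (idx B)) (cut H (idx D)) y" "pt g' (cut G (idx B')) (cut H (idx D')) y'"
    using pt_up[OF assms(8,2,3) y1 G(2)] pt_up[OF assms(10,5,6) y2 G(3)] by metis
  obtain F1 x1 where x1: "pt f F1 (cut G (idx B)) x1" using pt_cover assms FinLO_cut G by metis
  obtain F2 x2 where x2: "pt f' F2 (cut G (idx B')) x2" using pt_cover assms FinLO_cut G by metis
  obtain F where F: "F \<in> FinLO (idx A \<union> idx A')" "(cut F (idx A), F1) \<in> FinLO_arr (idx A)" "(cut F (idx A'), F2) \<in> FinLO_arr (idx A')"
    using FinLO_above_cuts pt_typed(1)[OF assms(7,1,2) x1] pt_typed(1)[OF assms(9,4,5) x2] by metis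
  obtain x x' where x: "pt f (cut F (idx A)) (cut G (idx B)) x" "pt f' (cut F (idx A')) (cut G (idx B')) x'"
    using pt_up[OF assms(7,1,2) x1 F(2)] pt_up[OF assms(9,4,5) x2 F(3)] by metis
  have "pt (ftensor (fcomp g f) (fcomp g' f')) F H ((y \<cdot> x) \<otimes> (y' \<cdot> x'))"
    using pt_tensor[OF gf gf' assms(1,3,4,6) F(1) H] pt_comp[OF assms(7,8,1-3) x(1) y(1)] pt_comp[OF assms(9,10,4-6) x(2) y(2)] by blast
  moreover have "pt (fcomp (ftensor g g') (ftensor f f')) F H ((y \<otimes> y') \<cdot> (x \<otimes> x'))"
    by (rule pt_comp[OF ff gg t]) (use pt_tensor[OF assms(7,9,1,2,4,5) F(1) G(1) x] pt_tensor[OF assms(8,10,2,3,5,6) G(1) H y] in auto)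
  moreover have "(y \<otimes> y') \<cdot> (x \<otimes> x') = (y \<cdot> x) \<otimes> (y' \<cdot> x')"
    by (rule interchange) (use pt_typed[OF assms(7,1,2) x(1)] pt_typed[OF assms(9,4,5) x(2)] pt_typed[OF assms(8,2,3) y(1)] pt_typed[OF assms(10,5,6) y(2)] in auto)
  ultimately show "\<exists>F c. pt (ftensor (fcomp g f) (fcomp g' f')) F H c \<and> pt (fcomp (ftensor g g') (ftensor f f')) F H c" by metis
qed

lemma fnat_inverse: assumes "natural X Y \<theta>" "natural Y X \<tau>" "\<And>F. F \<in> FinLO (idx X) \<Longrightarrow> \<tau> F \<cdot> \<theta> F = ide C (ob X F)"
  shows "fcomp (fnat Y X \<tau>) (fnat X Y \<theta>) = fide X"
  unfolding fide_def
proof (rule fcomp_fnat[OF assms(1,2) _ assms(3)])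
  show "natural X X (\<lambda>F. ide C (ob X F))" by (rule natural_ide) (use assms(1) in \<open>simp add: natural_def\<close>)
qed

lemma natural_inverse: assumes "natural X Y \<theta>" "\<And>F. F \<in> FinLO (idx X) \<Longrightarrow> arr C (\<tau> F) \<and> source C (\<tau> F) = ob Y F \<and> target C (\<tau> F) = ob X F"
    "\<And>F. F \<in> FinLO (idx X) \<Longrightarrow> \<tau> F \<cdot> \<theta> F = ide C (ob X F) \<and> \<theta> F \<cdot> \<tau> F = ide C (ob Y F)"
  shows "natural Y X \<tau>"
proof -
  have i: "aitp X" "aitp Y" "idx Y = idx X" using naturalD[OF assms(1)] by simp_all
  note t = naturalD(4)[OF assms(1)] and n = naturalD(5)[OF assms(1)]
  have "prj X (F', F) \<cdot> \<tau> F' = \<tau> F \<cdot> prj Y (F', F)" if a: "(F', F) \<in> FinLO_arr (idx X)" for F' F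
  proof -
    have F: "F \<in> FinLO (idx X)" "F' \<in> FinLO (idx X)" using a by (auto simp: FinLO_arr_iff)
    note s = t[OF F(1)] t[OF F(2)] assms(2)[OF F(1)] assms(2)[OF F(2)] aitp_prj[OF i(1) a] aitp_prj[OF i(2), unfolded i, OF a]
    have "prj X (F', F) \<cdot> \<tau> F' = (\<tau> F \<cdot> \<theta> F) \<cdot> (prj X (F', F) \<cdot> \<tau> F')" using s assms(3)[OF F(1)] by simp
    also have "\<dots> = \<tau> F \<cdot> ((\<theta> F \<cdot> prj X (F', F)) \<cdot> \<tau> F')" using s by simp
    also have "\<dots> = \<tau> F \<cdot> (prj Y (F', F) \<cdot> (\<theta> F' \<cdot> \<tau> F'))" using s n[OF a, symmetric] by simp
    finally show ?thesis using s assms(3)[OF F(2)] by simp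
  qed
  then show ?thesis unfolding natural_def using i assms(2) by auto
qed

lemma fnat_iso: assumes "natural X Y \<theta>" "\<And>F. F \<in> FinLO (idx X) \<Longrightarrow> iso_in C (ob X F) (ob Y F) (\<theta> F)"
  shows "iso_in (expl s C) X Y (fnat X Y \<theta>)"
proof -
  define \<tau> where "\<tau> F = inv_of C (ob X F) (ob Y F) (\<theta> F)" for F
  have t: "arr C (\<tau> F) \<and> source C (\<tau> F) = ob Y F \<and> target C (\<tau> F) = ob X F"
    "\<tau> F \<cdot> \<theta> F = ide C (ob X F) \<and> \<theta> F \<cdot> \<tau> F = ide C (ob Y F)" if "F \<in> FinLO (idx X)" for F
    using iso_in_typed[OF assms(2)[OF that]] by (auto simp: \<tau>_def)
  have n: "natural Y X \<tau>" by (rule natural_inverse[OF assms(1) t]) auto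
  have i: "idx Y = idx X" using assms unfolding natural_def by auto
  show ?thesis unfolding iso_in_def inverse_in_def
    by (intro exI[of _ "fnat Y X \<tau>"]) (use fnat_Hom[OF assms(1)] fnat_Hom[OF n] fnat_inverse[OF assms(1) n]
      fnat_inverse[OF n assms(1)] t i in auto)
qed

lemma iso_ide: "A = B \<Longrightarrow> iso_in C A B (ide C A)"
  by (auto intro!: iso_inI[of _ "ide C A"])

lemma fassoc_natural: assumes "f \<in> Hom A A'" "g \<in> Hom B B'" "h \<in> Hom D D'"
    "aitp A" "aitp B" "aitp D" "aitp A'" "aitp B'" "aitp D'"
  shows "fcomp (fassoc A' B' D') (ftensor (ftensor f g) h) = fcomp (ftensor f (ftensor g h)) (fassoc A B D)"
proof (rule pt_eqI)
  let ?L = "diag_tensor C (diag_tensor C A B) D" and ?R = "diag_tensor C A (diag_tensor C B D)"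
  let ?L' = "diag_tensor C (diag_tensor C A' B') D'" and ?R' = "diag_tensor C A' (diag_tensor C B' D')"
  have a: "aitp ?L" "aitp ?R" "aitp ?L'" "aitp ?R'" "aitp (diag_tensor C A B)" "aitp (diag_tensor C B D)"
    "aitp (diag_tensor C A' B')" "aitp (diag_tensor C B' D')" using assms by auto
  note n = natural_assoc[OF assms(4-6)] and n' = natural_assoc[OF assms(7-9)]
  note fg = ftensor_Hom[OF assms(1,2,4,7,5,8)] and gh = ftensor_Hom[OF assms(2,3,5,8,6,9)]
  note fgh = ftensor_Hom[OF fg assms(3) a(5,7) assms(6,9)] and fgh' = ftensor_Hom[OF assms(1) gh assms(4,7) a(6,8)]
  note e = fnat_Hom[OF n] fnat_Hom[OF n']
  show "aitp ?L" "aitp ?R'" by fact+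
  show "fcomp (fassoc A' B' D') (ftensor (ftensor f g) h) \<in> Hom ?L ?R'" "fcomp (ftensor f (ftensor g h)) (fassoc A B D) \<in> Hom ?L ?R'"
    using fcomp_Hom a e fgh fgh' by blast+
  fix G assume "G \<in> FinLO (idx ?R')"
  then have G: "G \<in> FinLO (idx A' \<union> idx B' \<union> idx D')" by (simp add: Un_assoc)
  obtain F0 x0 where "pt (ftensor (ftensor f g) h) F0 G x0" using pt_cover[OF fgh, of G] G by (auto simp: Un_assoc)
  obtain F1 y1 where y1: "pt f F1 (cut G (idx A')) y1" using pt_cover[OF assms(1)] FinLO_cut(1)[of G "idx A'" "idx B' \<union> idx D'"] G by (metis Un_assoc)
  obtain F2 y2 where y2: "pt g F2 (cut G (idx B')) y2"
    using pt_cover[OF assms(2)] FinLO_cut(1)[of G "idx B'" "idx A' \<union> idx D'"] G by (metis Un_assoc Un_commute)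
  obtain F3 y3 where y3: "pt h F3 (cut G (idx D')) y3" using pt_cover[OF assms(3)] FinLO_cut(2)[OF G] by metis
  obtain F4 where F4: "F4 \<in> FinLO (idx A \<union> idx B)" "(cut F4 (idx A), F1) \<in> FinLO_arr (idx A)" "(cut F4 (idx B), F2) \<in> FinLO_arr (idx B)"
    using FinLO_above_cuts pt_typed(1)[OF assms(1,4,7) y1] pt_typed(1)[OF assms(2,5,8) y2] by metis
  obtain F where F: "F \<in> FinLO (idx A \<union> idx B \<union> idx D)" "(cut F (idx A \<union> idx B), F4) \<in> FinLO_arr (idx A \<union> idx B)" "(cut F (idx D), F3) \<in> FinLO_arr (idx D)"
    using FinLO_above_cuts F4(1) pt_typed(1)[OF assms(3,6,9) y3] by metis
  have c: "cut (cut F (idx A \<union> idx B)) (idx A) = cut F (idx A)" "cut (cut F (idx A \<union> idx B)) (idx B) = cut F (idx B)"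
    "cut (cut F (idx B \<union> idx D)) (idx B) = cut F (idx B)" "cut (cut F (idx B \<union> idx D)) (idx D) = cut F (idx D)"
    "cut (cut G (idx A' \<union> idx B')) (idx A') = cut G (idx A')" "cut (cut G (idx A' \<union> idx B')) (idx B') = cut G (idx B')"
    "cut (cut G (idx B' \<union> idx D')) (idx B') = cut G (idx B')" "cut (cut G (idx B' \<union> idx D')) (idx D') = cut G (idx D')"
    by (rule cut_cut, blast)+
  have ca: "(cut F (idx A), F1) \<in> FinLO_arr (idx A)" "(cut F (idx B), F2) \<in> FinLO_arr (idx B)"
    using FinLO_arr_trans[OF FinLO_arr_cut(1)[OF F(2)] F4(2)] FinLO_arr_trans[OF FinLO_arr_cut(2)[OF F(2)] F4(3)] unfolding c by auto
  obtain x where x: "pt f (cut F (idx A)) (cut G (idx A')) x" using pt_up[OF assms(1,4,7) y1 ca(1)] by metis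
  obtain y where y: "pt g (cut F (idx B)) (cut G (idx B')) y" using pt_up[OF assms(2,5,8) y2 ca(2)] by metis
  obtain z where z: "pt h (cut F (idx D)) (cut G (idx D')) z" using pt_up[OF assms(3,6,9) y3 F(3)] by metis
  note t = pt_typed[OF assms(1,4,7) x] pt_typed[OF assms(2,5,8) y] pt_typed[OF assms(3,6,9) z]
  have F': "F \<in> FinLO (idx A \<union> (idx B \<union> idx D))" and G': "G \<in> FinLO (idx A' \<union> (idx B' \<union> idx D'))" using F G by (simp_all add: Un_assoc)
  note cF = FinLO_cut[OF F(1)] FinLO_cut[OF F'] and cG = FinLO_cut[OF G] FinLO_cut[OF G']
  have 1: "pt (ftensor (ftensor f g) h) F G ((x \<otimes> y) \<otimes> z)"
    by (rule pt_tensor[OF fg assms(3) a(5,7) assms(6,9)], simp_all only: diag_tensor_simps F(1) G z)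
      (rule pt_tensor[OF assms(1,2,4,7,5,8)], simp_all only: cF cG c x y)
  have 2: "pt (ftensor f (ftensor g h)) F G (x \<otimes> (y \<otimes> z))"
    by (rule pt_tensor[OF assms(1) gh assms(4,7) a(6,8)], simp_all only: diag_tensor_simps F' G' x)
      (rule pt_tensor[OF assms(2,3,5,8,6,9)], simp_all only: cF cG c y z)
  have 3: "pt (fassoc A B D) F F (ide C (ob A (cut F (idx A)) + ob B (cut F (idx B)) + ob D (cut F (idx D))))"
    using pt_fnat[OF n, of F] F(1) by simp
  have 4: "pt (fassoc A' B' D') G G (ide C (ob A' (cut G (idx A')) + ob B' (cut G (idx B')) + ob D' (cut G (idx D'))))"
    using pt_fnat[OF n', of G] G by simp
  show "\<exists>F c. pt (fcomp (fassoc A' B' D') (ftensor (ftensor f g) h)) F G c \<and> pt (fcomp (ftensor f (ftensor g h)) (fassoc A B D)) F G c"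
    using pt_comp[OF fgh e(2) a(1,3,4) 1 4] pt_comp[OF e(1) fgh' a(1,2,4) 3 2] t by (auto simp: add.assoc)
qed

lemma fbraid_natural: assumes "f \<in> Hom A A'" "g \<in> Hom B B'" "aitp A" "aitp B" "aitp A'" "aitp B'"
  shows "fcomp (fbraid A' B') (ftensor f g) = fcomp (ftensor g f) (fbraid A B)"
proof (rule pt_eqI)
  have a: "aitp (diag_tensor C A B)" "aitp (diag_tensor C B A)" "aitp (diag_tensor C A' B')" "aitp (diag_tensor C B' A')"
    using assms by auto
  note n = natural_braid[OF assms(3,4)] natural_braid[OF assms(5,6)]
  note e = fnat_Hom[OF n(1)] fnat_Hom[OF n(2)]
  note fg = ftensor_Hom[OF assms(1,2,3,5,4,6)] ftensor_Hom[OF assms(2,1,4,6,3,5)]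
  show "aitp (diag_tensor C A B)" "aitp (diag_tensor C B' A')" by fact+
  show "fcomp (fbraid A' B') (ftensor f g) \<in> Hom (diag_tensor C A B) (diag_tensor C B' A')"
    "fcomp (ftensor g f) (fbraid A B) \<in> Hom (diag_tensor C A B) (diag_tensor C B' A')"
    using fcomp_Hom a e fg by blast+
  fix G assume "G \<in> FinLO (idx (diag_tensor C B' A'))"
  then have G: "G \<in> FinLO (idx B' \<union> idx A')" "G \<in> FinLO (idx A' \<union> idx B')" by (simp_all add: Un_commute)
  obtain F1 y1 where y1: "pt f F1 (cut G (idx A')) y1" using pt_cover[OF assms(1)] FinLO_cut G by metis
  obtain F2 y2 where y2: "pt g F2 (cut G (idx B')) y2" using pt_cover[OF assms(2)] FinLO_cut G by metis
  obtain F where F: "F \<in> FinLO (idx A \<union> idx B)" "(cut F (idx A), F1) \<in> FinLO_arr (idx A)" "(cut F (idx B), F2) \<in> FinLO_arr (idx B)"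
    using FinLO_above_cuts pt_typed(1)[OF assms(1,3,5) y1] pt_typed(1)[OF assms(2,4,6) y2] by metis
  obtain x where x: "pt f (cut F (idx A)) (cut G (idx A')) x" using pt_up[OF assms(1,3,5) y1 F(2)] by metis
  obtain y where y: "pt g (cut F (idx B)) (cut G (idx B')) y" using pt_up[OF assms(2,4,6) y2 F(3)] by metis
  note t = pt_typed[OF assms(1,3,5) x] pt_typed[OF assms(2,4,6) y]
  have F': "F \<in> FinLO (idx B \<union> idx A)" using F by (simp add: Un_commute)
  have 1: "pt (ftensor f g) F G (x \<otimes> y)" by (rule pt_tensor[OF assms(1,2,3,5,4,6) F(1) G(2) x y])
  have 2: "pt (ftensor g f) F G (y \<otimes> x)" by (rule pt_tensor[OF assms(2,1,4,6,3,5) F' G(1) y x])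
  have 3: "pt (fbraid A B) F F (braid C (source C x) (source C y))" using pt_fnat[OF n(1), of F] F(1) t by simp
  have 4: "pt (fbraid A' B') G G (braid C (target C x) (target C y))" using pt_fnat[OF n(2), of G] G t by simp
  show "\<exists>F c. pt (fcomp (fbraid A' B') (ftensor f g)) F G c \<and> pt (fcomp (ftensor g f) (fbraid A B)) F G c"
    using pt_comp[OF fg(1) e(2) a(1,3,4) 1 4] pt_comp[OF e(1) fg(2) a(1,2,4) 3 2] braid_natural[of x y] t by auto
qed

lemma flunit_natural: assumes "f \<in> Hom A B" "aitp A" "aitp B" "s \<in> idx A" "s \<in> idx B"
  shows "fcomp (flunit s B) (ftensor (fide (diag_unit C s)) f) = fcomp f (flunit s A)"
    "fcomp (frunit s B) (ftensor f (fide (diag_unit C s))) = fcomp f (frunit s A)"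
proof -
  let ?I = "diag_unit C s"
  have a: "aitp ?I" "aitp (diag_tensor C ?I A)" "aitp (diag_tensor C ?I B)" "aitp (diag_tensor C A ?I)" "aitp (diag_tensor C B ?I)"
    using assms by auto
  note n = natural_lunit[OF assms(2,4)] natural_lunit[OF assms(3,5)] natural_runit[OF assms(2,4)] natural_runit[OF assms(3,5)]
  note e = n[THEN fnat_Hom] and i = fide_Hom[OF a(1)]
  note fg = ftensor_Hom[OF i assms(1) a(1,1) assms(2,3)] ftensor_Hom[OF assms(1) i assms(2,3) a(1,1)]
  have "\<exists>F c. pt (fcomp (flunit s B) (ftensor (fide ?I) f)) F G c \<and> pt (fcomp f (flunit s A)) F G c
      \<and> pt (fcomp (frunit s B) (ftensor f (fide ?I))) F G c \<and> pt (fcomp f (frunit s A)) F G c" if G: "G \<in> FinLO (idx B)" for G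
  proof -
    obtain F0 x0 where x0: "pt f F0 G x0" using pt_cover[OF assms(1) G] .
    define F where "F = remdups (F0 @ cut G {s})"
    have F: "(F, F0) \<in> FinLO_arr (idx A)" "set (cut G {s}) \<subseteq> set F"
      using pt_typed(1)[OF assms(1-3) x0] assms(4) unfolding F_def by (auto simp: FinLO_arr_iff FinLO_def)
    define x where "x = x0 \<cdot> prj A (F, F0)"
    have x: "pt f F G x" unfolding x_def using pt_up[OF assms(1-3) x0 F(1)] .
    note t = pt_typed[OF assms(1-3) x]
    have u: "{s} \<union> idx A = idx A" "{s} \<union> idx B = idx B" "idx A \<union> {s} = idx A" "idx B \<union> {s} = idx B" using assms by auto
    have c: "cut F (idx A) = F" "cut G (idx B) = G" using t by auto
    have "(cut F {s}, cut G {s}) \<in> FinLO_arr {s}" using F(2) t by (auto simp: FinLO_arr_iff FinLO_def)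
    then have "pt (fide ?I) (cut F {s}) (cut G {s}) (ide C 0)"
      using pt_class[OF fin_approx_of_nat[OF natural_ide[OF a(1)]], of "cut F {s}" "cut G {s}"]
      by (simp add: fide_def FinLO_arr_iff)
    then have 1: "pt (ftensor (fide ?I) f) F G x" "pt (ftensor f (fide ?I)) F G x"
      using pt_tensor[OF i assms(1) a(1,1) assms(2,3), of F G "ide C 0" x] pt_tensor[OF assms(1) i assms(2,3) a(1,1), of F G x "ide C 0"]
        u t x c by simp_all
    have 2: "pt (flunit s A) F F (ide C (ob A F))" "pt (frunit s A) F F (ide C (ob A F))"
      "pt (flunit s B) G G (ide C (ob B G))" "pt (frunit s B) G G (ide C (ob B G))"
      using pt_fnat[OF n(1), of F] pt_fnat[OF n(2), of G] pt_fnat[OF n(3), of F] pt_fnat[OF n(4), of G] u t by simp_all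
    show ?thesis
      using pt_comp[OF fg(1) e(2) a(2,3) assms(3) 1(1) 2(3)] pt_comp[OF fg(2) e(4) a(4,5) assms(3) 1(2) 2(4)]
        pt_comp[OF e(1) assms(1) a(2) assms(2,3) 2(1) x] pt_comp[OF e(3) assms(1) a(4) assms(2,3) 2(2) x] t by auto
  qed
  note q = this
  show "fcomp (flunit s B) (ftensor (fide (diag_unit C s)) f) = fcomp f (flunit s A)"
    by (rule pt_eqI[of _ "diag_tensor C ?I A" B]) (use q fcomp_Hom e fg a assms in blast)+
  show "fcomp (frunit s B) (ftensor f (fide (diag_unit C s))) = fcomp f (frunit s A)"
    by (rule pt_eqI[of _ "diag_tensor C A ?I" B]) (use q fcomp_Hom e fg a assms in blast)+
qed

text \<open>The coherence laws reduce to pointwise identities between natural transformations.\<close>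

lemma natural_comp: assumes "natural X Y \<theta>" "natural Y Z \<theta>'" shows "natural X Z (\<lambda>F. \<theta>' F \<cdot> \<theta> F)"
proof -
  have i: "aitp X" "aitp Y" "aitp Z" "idx Y = idx X" "idx Z = idx X" using naturalD[OF assms(1)] naturalD[OF assms(2)] by simp_all
  note t = naturalD(4)[OF assms(1)] naturalD(4)[OF assms(2), unfolded i] and n = naturalD(5)[OF assms(1)] naturalD(5)[OF assms(2), unfolded i]
  have "prj Z (F', F) \<cdot> (\<theta>' F' \<cdot> \<theta> F') = (\<theta>' F \<cdot> \<theta> F) \<cdot> prj X (F', F)" if a: "(F', F) \<in> FinLO_arr (idx X)" for F' F
  proof -
    have F: "F \<in> FinLO (idx X)" "F' \<in> FinLO (idx X)" using a by (auto simp: FinLO_arr_iff)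
    note s = t(1)[OF F(1)] t(1)[OF F(2)] t(2)[OF F(1)] t(2)[OF F(2)] aitp_prj[OF i(1) a] aitp_prj[OF i(2), unfolded i, OF a] aitp_prj[OF i(3), unfolded i, OF a]
    have "prj Z (F', F) \<cdot> (\<theta>' F' \<cdot> \<theta> F') = (prj Z (F', F) \<cdot> \<theta>' F') \<cdot> \<theta> F'" using s by simp
    also have "\<dots> = \<theta>' F \<cdot> (prj Y (F', F) \<cdot> \<theta> F')" unfolding n(2)[OF a] using s by simp
    also have "\<dots> = (\<theta>' F \<cdot> \<theta> F) \<cdot> prj X (F', F)" unfolding n(1)[OF a] using s by simp
    finally show ?thesis .
  qed
  then show ?thesis unfolding natural_def using i t by auto
qed

lemma fnat_cong: assumes "natural X Y \<theta>" "natural X Y \<theta>'" "\<And>F. F \<in> FinLO (idx X) \<Longrightarrow> \<theta> F = \<theta>' F"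
  shows "fnat X Y \<theta> = fnat X Y \<theta>'"
proof (rule pt_eqI[OF fnat_Hom[OF assms(1)] fnat_Hom[OF assms(2)]])
  show "aitp X" "aitp Y" using assms unfolding natural_def by auto
  fix F assume "F \<in> FinLO (idx Y)"
  then have F: "F \<in> FinLO (idx X)" using assms unfolding natural_def by auto
  show "\<exists>G c. pt (fnat X Y \<theta>) G F c \<and> pt (fnat X Y \<theta>') G F c"
    using pt_fnat[OF assms(1) F] pt_fnat[OF assms(2) F] assms(3)[OF F] by metis
qed

lemma fcomp_fnat': assumes "natural X Y \<theta>" "natural Y Z \<theta>'"
  shows "fcomp (fnat Y Z \<theta>') (fnat X Y \<theta>) = fnat X Z (\<lambda>F. \<theta>' F \<cdot> \<theta> F)"
  by (rule fcomp_fnat[OF assms natural_comp[OF assms]]) simp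

lemma ftensor_fnat': assumes "natural X Y \<theta>" "natural X' Y' \<theta>'"
  shows "ftensor (fnat X Y \<theta>) (fnat X' Y' \<theta>')
    = fnat (diag_tensor C X X') (diag_tensor C Y Y') (\<lambda>F. \<theta> (cut F (idx X)) \<otimes> \<theta>' (cut F (idx X')))"
  by (rule ftensor_fnat[OF assms natural_tensor[OF assms]]) simp

lemma disj_absorb3: "((P \<or> Q \<or> R) \<and> Q) = Q" "((P \<or> Q \<or> R) \<and> R) = R" "((P \<or> Q \<or> R) \<and> (P \<or> Q)) = (P \<or> Q)"
  "((P \<or> Q \<or> R) \<and> (Q \<or> R)) = (Q \<or> R)" by blast+

lemma expl_pentagon: assumes "aitp X" "aitp Y" "aitp Z" "aitp W"
  shows "fcomp (fassoc X Y (diag_tensor C Z W)) (fassoc (diag_tensor C X Y) Z W)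
        = fcomp (ftensor (fide X) (fassoc Y Z W)) (fcomp (fassoc X (diag_tensor C Y Z) W) (ftensor (fassoc X Y Z) (fide W)))"
proof -
  note a = aitp_tensor[OF assms(1,2)] aitp_tensor[OF assms(3,4)] aitp_tensor[OF assms(2,3)]
  note n = natural_assoc[OF assms(1,2) a(2)] natural_assoc[OF a(1) assms(3,4)] natural_assoc[OF assms(1) a(3) assms(4)]
    natural_tensor[OF natural_assoc[OF assms(1-3)] natural_ide[OF assms(4)]]
    natural_tensor[OF natural_ide[OF assms(1)] natural_assoc[OF assms(2-4)]]
  note e = ftensor_fnat'[OF natural_assoc[OF assms(1-3)] natural_ide[OF assms(4)]]
    ftensor_fnat'[OF natural_ide[OF assms(1)] natural_assoc[OF assms(2-4)]]
  show ?thesis unfolding fide_def e fcomp_fnat'[OF n(2,1)] fcomp_fnat'[OF n(4,3)] fcomp_fnat'[OF natural_comp[OF n(4,3)] n(5)]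
  proof (rule fnat_cong[OF natural_comp[OF n(2,1)] natural_comp[OF natural_comp[OF n(4,3)] n(5)]])
    fix F assume "F \<in> FinLO (idx (diag_tensor C (diag_tensor C (diag_tensor C X Y) Z) W))"
    then have F: "F \<in> FinLO (idx X \<union> idx Y \<union> idx Z \<union> idx W)" by simp
    have c: "cut F (idx X \<union> idx Y) \<in> FinLO (idx X \<union> idx Y)" "cut F (idx Z \<union> idx W) \<in> FinLO (idx Z \<union> idx W)"
      "cut F (idx Y \<union> idx Z) \<in> FinLO (idx Y \<union> idx Z)" using F unfolding FinLO_def by auto
    have o: "ob (diag_tensor C X Y) (cut F (idx X \<union> idx Y)) = ob X (cut F (idx X)) + ob Y (cut F (idx Y))"
      "ob (diag_tensor C Z W) (cut F (idx Z \<union> idx W)) = ob Z (cut F (idx Z)) + ob W (cut F (idx W))"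
      "ob (diag_tensor C Y Z) (cut F (idx Y \<union> idx Z)) = ob Y (cut F (idx Y)) + ob Z (cut F (idx Z))"
      using diag_tensor_simps(2)[OF c(1)] diag_tensor_simps(2)[OF c(2)] diag_tensor_simps(2)[OF c(3)] by (simp_all add: disj_absorb)
    show "assoc C (ob X (cut F (idx X))) (ob Y (cut F (idx Y))) (ob (diag_tensor C Z W) (cut F (idx (diag_tensor C Z W)))) \<cdot>
      assoc C (ob (diag_tensor C X Y) (cut F (idx (diag_tensor C X Y)))) (ob Z (cut F (idx Z))) (ob W (cut F (idx W))) =
      (ide C (ob X (cut F (idx X))) \<otimes> assoc C (ob Y (cut (cut F (idx (diag_tensor C (diag_tensor C Y Z) W))) (idx Y)))
          (ob Z (cut (cut F (idx (diag_tensor C (diag_tensor C Y Z) W))) (idx Z))) (ob W (cut (cut F (idx (diag_tensor C (diag_tensor C Y Z) W))) (idx W)))) \<cdot>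
      (assoc C (ob X (cut F (idx X))) (ob (diag_tensor C Y Z) (cut F (idx (diag_tensor C Y Z)))) (ob W (cut F (idx W))) \<cdot>
       (assoc C (ob X (cut (cut F (idx (diag_tensor C (diag_tensor C X Y) Z))) (idx X))) (ob Y (cut (cut F (idx (diag_tensor C (diag_tensor C X Y) Z))) (idx Y)))
          (ob Z (cut (cut F (idx (diag_tensor C (diag_tensor C X Y) Z))) (idx Z))) \<otimes> ide C (ob W (cut F (idx W)))))"
      using o by (simp add: disj_absorb disj_absorb3 add.assoc)
  qed
qed

lemma expl_triangle: assumes "aitp X" "aitp Y" "s \<in> idx X" "s \<in> idx Y"
  shows "fcomp (ftensor (fide X) (flunit s Y)) (fassoc X (diag_unit C s) Y) = ftensor (frunit s X) (fide Y)"
proof -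
  let ?I = "diag_unit C s"
  note n = natural_assoc[OF assms(1) aitp_diag_unit assms(2)]
    natural_tensor[OF natural_ide[OF assms(1)] natural_lunit[OF assms(2,4)]]
    natural_tensor[OF natural_runit[OF assms(1,3)] natural_ide[OF assms(2)]]
  note e = ftensor_fnat'[OF natural_ide[OF assms(1)] natural_lunit[OF assms(2,4)]]
    ftensor_fnat'[OF natural_runit[OF assms(1,3)] natural_ide[OF assms(2)]]
  show ?thesis unfolding fide_def e fcomp_fnat'[OF n(1,2)]
  proof (rule fnat_cong[OF natural_comp[OF n(1,2)] n(3)])
    fix F assume "F \<in> FinLO (idx (diag_tensor C (diag_tensor C X ?I) Y))"
    then have "cut F {s} \<in> FinLO {s}" by (auto simp: FinLO_def)
    moreover have "insert s (idx X) = idx X" "insert s (idx Y) = idx Y" "idx X \<union> {s} = idx X" using assms by auto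
    ultimately show "(ide C (ob X (cut F (idx X))) \<otimes> lunit C (ob Y (cut F (idx (diag_tensor C ?I Y))))) \<cdot>
       assoc C (ob X (cut F (idx X))) (ob ?I (cut F (idx ?I))) (ob Y (cut F (idx Y)))
       = runit C (ob X (cut F (idx (diag_tensor C X ?I)))) \<otimes> ide C (ob Y (cut F (idx Y)))"
      using diag_unit_simps(2)[of "cut F {s}" s] by (simp del: insert_iff Un_insert_right)
  qed
qed

lemma expl_hexagon: assumes "aitp X" "aitp Y" "aitp Z"
  shows "fcomp (fassoc Y Z X) (fcomp (fbraid X (diag_tensor C Y Z)) (fassoc X Y Z))
    = fcomp (ftensor (fide Y) (fbraid X Z)) (fcomp (fassoc Y X Z) (ftensor (fbraid X Y) (fide Z)))"
proof -
  note a = aitp_tensor[OF assms(2,3)]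
  note n = natural_assoc[OF assms] natural_braid[OF assms(1) a] natural_assoc[OF assms(2,3,1)] natural_assoc[OF assms(2,1,3)]
    natural_tensor[OF natural_braid[OF assms(1,2)] natural_ide[OF assms(3)]]
    natural_tensor[OF natural_ide[OF assms(2)] natural_braid[OF assms(1,3)]]
  note e = ftensor_fnat'[OF natural_braid[OF assms(1,2)] natural_ide[OF assms(3)]]
    ftensor_fnat'[OF natural_ide[OF assms(2)] natural_braid[OF assms(1,3)]]
  show ?thesis unfolding fide_def e fcomp_fnat'[OF n(1,2)] fcomp_fnat'[OF natural_comp[OF n(1,2)] n(3)] fcomp_fnat'[OF n(5,4)]
      fcomp_fnat'[OF natural_comp[OF n(5,4)] n(6)]
  proof (rule fnat_cong[OF natural_comp[OF natural_comp[OF n(1,2)] n(3)] natural_comp[OF natural_comp[OF n(5,4)] n(6)]])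
    fix F assume "F \<in> FinLO (idx (diag_tensor C (diag_tensor C X Y) Z))"
    then have F: "F \<in> FinLO (idx X \<union> idx Y \<union> idx Z)" by simp
    let ?x = "ob X (cut F (idx X))" and ?y = "ob Y (cut F (idx Y))" and ?z = "ob Z (cut F (idx Z))"
    have c: "cut F (idx Y \<union> idx Z) \<in> FinLO (idx Y \<union> idx Z)" using F unfolding FinLO_def by auto
    have o: "ob (diag_tensor C Y Z) (cut F (idx Y \<union> idx Z)) = ?y + ?z"
      using diag_tensor_simps(2)[OF c] by (simp add: disj_absorb)
    have "assoc C ?y ?z ?x \<cdot> (braid C ?x (?y + ?z) \<cdot> assoc C ?x ?y ?z) = (ide C ?y \<otimes> braid C ?x ?z) \<cdot> (assoc C ?y ?x ?z \<cdot> (braid C ?x ?y \<otimes> ide C ?z))"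
      using hexagon[of ?x ?y ?z] by (simp del: assoc_ide)
    then show "assoc C ?y ?z ?x \<cdot> (braid C ?x (ob (diag_tensor C Y Z) (cut F (idx (diag_tensor C Y Z)))) \<cdot> assoc C ?x ?y ?z) =
       (ide C ?y \<otimes> braid C (ob X (cut (cut F (idx (diag_tensor C X Z))) (idx X))) (ob Z (cut (cut F (idx (diag_tensor C X Z))) (idx Z)))) \<cdot>
       (assoc C ?y ?x ?z \<cdot> (braid C (ob X (cut (cut F (idx (diag_tensor C X Y))) (idx X))) (ob Y (cut (cut F (idx (diag_tensor C X Y))) (idx Y))) \<otimes> ide C ?z))"
      using o by (simp add: disj_absorb del: assoc_ide)
  qed
qed

lemma fbraid_fbraid: assumes "aitp X" "aitp Y" shows "fcomp (fbraid Y X) (fbraid X Y) = fide (diag_tensor C X Y)"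
  unfolding fcomp_fnat'[OF natural_braid[OF assms] natural_braid[OF assms(2,1)]] fide_def
  by (rule fnat_cong[OF natural_comp[OF natural_braid[OF assms] natural_braid[OF assms(2,1)]] natural_ide[OF aitp_tensor[OF assms]]])
    (simp add: braid_braid)

text \<open>All components have the unit as their target, hence are deletions.\<close>

lemma Hom_terminal: assumes "aitp X" "aitp U" "\<And>G. G \<in> FinLO (idx U) \<Longrightarrow> ob U G = 0"
  shows "\<exists>!a. a \<in> Hom X U"
proof (rule ex_ex1I)
  have p: "prj U (G', G) = ide C 0" if "(G', G) \<in> FinLO_arr (idx U)" for G' G
    using aitp_prj[OF assms(2) that] that assms(3) by (intro terminal_eq) (auto simp: FinLO_arr_iff)
  define f where "f = \<lparr>src = X, tgt = U, Lam = FinLO (idx X) \<times> FinLO (idx U), cpt = (\<lambda>(F, G). del C (ob X F))\<rparr>"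
  have "fin_approx C f"
  proof (rule fin_approxI)
    fix F G F' G' assume "(F', F) \<in> FinLO_arr (idx (src f))" "(G', G) \<in> FinLO_arr (idx (tgt f))"
    then have a: "(F', F) \<in> FinLO_arr (idx X)" "(G', G) \<in> FinLO_arr (idx U)" by (simp_all add: f_def)
    show "prj (tgt f) (G', G) \<cdot> cpt f (F', G') = cpt f (F, G) \<cdot> prj (src f) (F', F)"
      using p[OF a(2)] aitp_prj[OF assms(1) a(1)] by (intro terminal_eq) (auto simp: f_def)
  next
    show "\<exists>F. (F, G) \<in> Lam f" if "G \<in> FinLO (idx (tgt f))" for G
      using that by (auto simp: f_def FinLO_def intro!: exI[of _ "[]"])
  qed (auto simp: f_def assms(3) FinLO_arr_iff)
  then show "\<exists>a. a \<in> Hom X U" using Hom_classI[of f X U] by (auto simp: f_def)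
next
  fix a b assume ab: "a \<in> Hom X U" "b \<in> Hom X U"
  show "a = b"
  proof (rule pt_eqI[OF ab assms(1,2)])
    fix G assume G: "G \<in> FinLO (idx U)"
    obtain F c d where cd: "pt a F G c" "pt b F G d" using pt_cover2[OF ab assms(1,2,2) G G] .
    have "c = d" using pt_typed[OF ab(1) assms(1,2) cd(1)] pt_typed[OF ab(2) assms(1,2) cd(2)] assms(3)[OF G]
      by (intro terminal_eq) auto
    then show "\<exists>F c. pt a F G c \<and> pt b F G c" using cd by blast
  qed
qed

lemma expl_smc: "typed_semicartesian (expl (s :: 'j) C)"
proof -
  interpret K: typed_category "expl s C" by (rule expl_category)
  show ?thesis
  proof (unfold_locales, simp_all only: expl_simps expl_structure mem_Collect_eq)
    show "s \<in> idx (diag_unit C s) \<and> aitp (diag_unit C s)" by simp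
  next
    fix A B D :: "('j, nat, 'm) diagram" assume "s \<in> idx A \<and> aitp A" "s \<in> idx B \<and> aitp B" "s \<in> idx D \<and> aitp D"
    then have a: "aitp A" "aitp B" "aitp D" by auto
    show "iso_in (expl s C) (diag_tensor C (diag_tensor C A B) D) (diag_tensor C A (diag_tensor C B D)) (fassoc A B D)"
      by (rule fnat_iso[OF natural_assoc[OF a]])
       (use a in \<open>auto intro!: iso_ide simp: tensor3_simps Un_assoc[symmetric] simp del: diag_tensor_simps(2)\<close>)
    show "fcomp (fassoc B D A) (fcomp (fbraid A (diag_tensor C B D)) (fassoc A B D))
      = fcomp (ftensor (fide B) (fbraid A D)) (fcomp (fassoc B A D) (ftensor (fbraid A B) (fide D)))"
      by (rule expl_hexagon[OF a])
  next
    fix A :: "('j, nat, 'm) diagram" assume "s \<in> idx A \<and> aitp A"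
    then have a: "aitp A" "s \<in> idx A" by auto
    have o: "ob (diag_tensor C (diag_unit C s) A) F = ob A F" "ob (diag_tensor C A (diag_unit C s)) F = ob A F" if "F \<in> FinLO (idx A)" for F
      using that natural_lunit[OF a] natural_runit[OF a] a unfolding natural_def by (auto simp: insert_absorb)
    show "iso_in (expl s C) (diag_tensor C (diag_unit C s) A) A (flunit s A)"
      by (rule fnat_iso[OF natural_lunit[OF a]]) (use o a in \<open>auto intro!: iso_ide simp: insert_absorb\<close>)
    show "iso_in (expl s C) (diag_tensor C A (diag_unit C s)) A (frunit s A)"
      by (rule fnat_iso[OF natural_runit[OF a]]) (use o a in \<open>auto intro!: iso_ide simp: insert_absorb\<close>)
    show "\<exists>!f. f \<in> Hom A (diag_unit C s)" by (rule Hom_terminal) (use a in auto)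
  next
    fix A B :: "('j, nat, 'm) diagram" assume "s \<in> idx A \<and> aitp A" "s \<in> idx B \<and> aitp B"
    then have a: "aitp A" "aitp B" "s \<in> idx A" "s \<in> idx B" by auto
    show "fcomp (ftensor (fide A) (flunit s B)) (fassoc A (diag_unit C s) B) = ftensor (frunit s A) (fide B)"
      by (rule expl_triangle[OF a])
    show "fbraid A B \<in> Hom (diag_tensor C A B) (diag_tensor C B A)" by (rule fnat_Hom[OF natural_braid[OF a(1,2)]])
    show "ftensor (fide A) (fide B) = fide (diag_tensor C A B)" by (rule ftensor_fide[OF a(1,2)])
    show "fcomp (fbraid B A) (fbraid A B) = fide (diag_tensor C A B)" by (rule fbraid_fbraid[OF a(1,2)])
  qed ((elim conjE, rule conjI, (simp; fail), (simp; fail))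
      | (elim conjE, rule fassoc_natural flunit_natural fbraid_natural expl_pentagon ftensor_fcomp ftensor_Hom, assumption+))+
qed

section \<open>Rewirings\<close>

text \<open>A naming of the single wires of a diagram, consistent with its projections.  Morphisms given
  by names compose like partial functions, so that every coherence isomorphism built from
  permutations and deletions can be computed on names.\<close>

definition wired :: "('j, nat, 'm) diagram \<Rightarrow> ('j list \<Rightarrow> 'w list) \<Rightarrow> bool" where
  "wired X v \<longleftrightarrow> aitp X
     \<and> (\<forall>F\<in>FinLO (idx X). distinct (v F) \<and> ob X F = length (v F))
     \<and> (\<forall>F' F. (F', F) \<in> FinLO_arr (idx X) \<longrightarrow> set (v F) \<subseteq> set (v F') \<and> prj X (F', F) = wproj (v F') (v F))"

definition wset :: "('j, nat, 'm) diagram \<Rightarrow> ('j list \<Rightarrow> 'w list) \<Rightarrow> 'w set" where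
  "wset X v = (\<Union>F\<in>FinLO (idx X). set (v F))"

lemma wiredD: assumes "wired X v"
  shows "aitp X" "F \<in> FinLO (idx X) \<Longrightarrow> distinct (v F)" "F \<in> FinLO (idx X) \<Longrightarrow> ob X F = length (v F)"
    "(F', F) \<in> FinLO_arr (idx X) \<Longrightarrow> set (v F) \<subseteq> set (v F')"
    "(F', F) \<in> FinLO_arr (idx X) \<Longrightarrow> prj X (F', F) = wproj (v F') (v F)"
    "F \<in> FinLO (idx X) \<Longrightarrow> set (v F) \<subseteq> wset X v"
  using assms unfolding wired_def wset_def by blast+

text \<open>Indices are directed, so finitely many names occur together at one index.\<close>

lemma wired_cover: assumes "wired X v" "finite S" "S \<subseteq> wset X v" "F0 \<in> FinLO (idx X)"
  obtains F where "(F, F0) \<in> FinLO_arr (idx X)" "S \<subseteq> set (v F)"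
proof -
  have "\<exists>F. (F, F0) \<in> FinLO_arr (idx X) \<and> S \<subseteq> set (v F)"
    using assms(2,3)
  proof (induction S)
    case empty
    then show ?case using FinLO_arr_refl assms(4) by blast
  next
    case (insert x S)
    then obtain F G where F: "(F, F0) \<in> FinLO_arr (idx X)" "S \<subseteq> set (v F)" "G \<in> FinLO (idx X)" "x \<in> set (v G)"
      unfolding wset_def by auto
    obtain H where H: "(H, F) \<in> FinLO_arr (idx X)" "(H, G) \<in> FinLO_arr (idx X)"
      using FinLO_union F(1,3) by (metis FinLO_arr_iff)
    show ?case using F FinLO_arr_trans[OF H(1) F(1)] wiredD(4)[OF assms(1)] H by blast
  qed
  then show thesis using that by blast
qed

definition rewire_fam :: "('j, nat, 'm) diagram \<Rightarrow> ('j list \<Rightarrow> 'w list) \<Rightarrow> ('j, nat, 'm) diagram \<Rightarrow> ('j list \<Rightarrow> 'w list)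
    \<Rightarrow> ('j, nat, 'm) fam" where
  "rewire_fam X v Y w = \<lparr> src = X, tgt = Y,
     Lam = {(F, G). F \<in> FinLO (idx X) \<and> G \<in> FinLO (idx Y) \<and> set (w G) \<subseteq> set (v F)},
     cpt = (\<lambda>(F, G). wproj (v F) (w G)) \<rparr>"

definition rewire :: "('j, nat, 'm) diagram \<Rightarrow> ('j list \<Rightarrow> 'w list) \<Rightarrow> ('j, nat, 'm) diagram \<Rightarrow> ('j list \<Rightarrow> 'w list)
    \<Rightarrow> ('j, nat, 'm) fam set" where
  "rewire X v Y w = fam_class C (rewire_fam X v Y w)"

lemma fin_approx_rewire: assumes "wired X v" "wired Y w" "wset Y w \<subseteq> wset X v"
  shows "fin_approx C (rewire_fam X v Y w)"
proof (rule fin_approxI)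
  let ?f = "rewire_fam X v Y w"
  fix F G F' G' assume a: "(F, G) \<in> Lam ?f" "(F', G') \<in> Lam ?f" "(F', F) \<in> FinLO_arr (idx (src ?f))" "(G', G) \<in> FinLO_arr (idx (tgt ?f))"
  then have b: "(F', F) \<in> FinLO_arr (idx X)" "(G', G) \<in> FinLO_arr (idx Y)" "F \<in> FinLO (idx X)" "F' \<in> FinLO (idx X)" "G \<in> FinLO (idx Y)" "G' \<in> FinLO (idx Y)"
    "set (w G) \<subseteq> set (v F)" "set (w G') \<subseteq> set (v F')" by (auto simp: rewire_fam_def)
  note d = wiredD(2)[OF assms(1) b(3)] wiredD(2)[OF assms(1) b(4)] wiredD(2)[OF assms(2) b(5)] wiredD(2)[OF assms(2) b(6)]
    wiredD(4)[OF assms(1) b(1)] wiredD(4)[OF assms(2) b(2)]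
  have "wproj (w G') (w G) \<cdot> wproj (v F') (w G') = wproj (v F') (w G)" by (rule proj_comp) (use d b in auto)
  moreover have "wproj (v F) (w G) \<cdot> wproj (v F') (v F) = wproj (v F') (w G)" by (rule proj_comp) (use d b in auto)
  ultimately show "prj (tgt ?f) (G', G) \<cdot> cpt ?f (F', G') = cpt ?f (F, G) \<cdot> prj (src ?f) (F', F)"
    using wiredD(5)[OF assms(1) b(1)] wiredD(5)[OF assms(2) b(2)] by (simp add: rewire_fam_def)
next
  let ?f = "rewire_fam X v Y w"
  fix F G assume a: "(F, G) \<in> Lam ?f"
  then have b: "F \<in> FinLO (idx X)" "G \<in> FinLO (idx Y)" "set (w G) \<subseteq> set (v F)" by (auto simp: rewire_fam_def)
  then show "F \<in> FinLO (idx (src ?f)) \<and> G \<in> FinLO (idx (tgt ?f)) \<and> arr C (cpt ?f (F, G)) \<and>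
      source C (cpt ?f (F, G)) = ob (src ?f) F \<and> target C (cpt ?f (F, G)) = ob (tgt ?f) G"
    using wiredD(2,3)[OF assms(1) b(1)] wiredD(2,3)[OF assms(2) b(2)] by (simp add: rewire_fam_def)
  fix F' assume "(F', F) \<in> FinLO_arr (idx (src ?f))"
  then have "(F', F) \<in> FinLO_arr (idx X)" by (simp add: rewire_fam_def)
  then show "(F', G) \<in> Lam ?f" using b wiredD(4)[OF assms(1)] by (auto simp: rewire_fam_def FinLO_arr_iff)
next
  let ?f = "rewire_fam X v Y w"
  fix G assume "G \<in> FinLO (idx (tgt ?f))"
  then have G: "G \<in> FinLO (idx Y)" by (simp add: rewire_fam_def)
  have e: "[] \<in> FinLO (idx X)" by (simp add: FinLO_def)
  obtain F where "(F, []) \<in> FinLO_arr (idx X)" "set (w G) \<subseteq> set (v F)"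
    using wired_cover[OF assms(1) _ _ e, of "set (w G)"] wiredD(6)[OF assms(2) G] assms(3) by auto
  then show "\<exists>F. (F, G) \<in> Lam ?f" using G by (auto simp: rewire_fam_def FinLO_arr_iff)
qed

lemma rewire_Hom: "wired X v \<Longrightarrow> wired Y w \<Longrightarrow> wset Y w \<subseteq> wset X v \<Longrightarrow> rewire X v Y w \<in> Hom X Y"
  unfolding rewire_def by (rule Hom_classI[OF fin_approx_rewire]) (auto simp: rewire_fam_def)

lemma pt_rewire: assumes "wired X v" "wired Y w" "wset Y w \<subseteq> wset X v" "F \<in> FinLO (idx X)" "G \<in> FinLO (idx Y)" "set (w G) \<subseteq> set (v F)"
  shows "pt (rewire X v Y w) F G (wproj (v F) (w G))"
  using pt_class[OF fin_approx_rewire[OF assms(1-3)], of F G] assms(4-6) unfolding rewire_def by (simp add: rewire_fam_def)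

lemma rewire_eqI: assumes "wired X v" "wired Y w" "wset Y w \<subseteq> wset X v" "a \<in> Hom X Y"
   "\<And>F0 G. F0 \<in> FinLO (idx X) \<Longrightarrow> G \<in> FinLO (idx Y) \<Longrightarrow> set (w G) \<subseteq> set (v F0) \<Longrightarrow> \<exists>F. (F, F0) \<in> FinLO_arr (idx X) \<and> pt a F G (wproj (v F) (w G))"
  shows "a = rewire X v Y w"
proof (rule pt_eqI[OF assms(4) rewire_Hom[OF assms(1-3)] wiredD(1)[OF assms(1)] wiredD(1)[OF assms(2)]])
  fix G assume G: "G \<in> FinLO (idx Y)"
  have e: "[] \<in> FinLO (idx X)" by (simp add: FinLO_def)
  obtain F0 where F0: "(F0, []) \<in> FinLO_arr (idx X)" "set (w G) \<subseteq> set (v F0)"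
    using wired_cover[OF assms(1) _ _ e, of "set (w G)"] wiredD(6)[OF assms(2) G] assms(3) by auto
  obtain F where F: "(F, F0) \<in> FinLO_arr (idx X)" "pt a F G (wproj (v F) (w G))"
    using assms(5)[OF _ G F0(2)] F0(1) by (auto simp: FinLO_arr_iff)
  have "pt (rewire X v Y w) F G (wproj (v F) (w G))"
    by (rule pt_rewire[OF assms(1-3) _ G]) (use F F0 wiredD(4)[OF assms(1) F(1)] in \<open>auto simp: FinLO_arr_iff\<close>)
  then show "\<exists>F c. pt a F G c \<and> pt (rewire X v Y w) F G c" using F by blast
qed

text \<open>Components are projections between lists of names, and these compose by \<open>proj_comp\<close>.\<close>

lemma rewire_comp: assumes "wired X v" "wired Y w" "wired Z u" "wset Z u \<subseteq> wset Y w" "wset Y w \<subseteq> wset X v"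
  shows "fcomp (rewire Y w Z u) (rewire X v Y w) = rewire X v Z u"
proof (rule rewire_eqI[OF assms(1,3)])
  note X = wiredD(1)[OF assms(1)] and Y = wiredD(1)[OF assms(2)] and Z = wiredD(1)[OF assms(3)]
  note h = rewire_Hom[OF assms(1,2,5)] rewire_Hom[OF assms(2,3,4)]
  show "wset Z u \<subseteq> wset X v" using assms by auto
  show "fcomp (rewire Y w Z u) (rewire X v Y w) \<in> Hom X Z" using fcomp_Hom h X Y Z by blast
  fix F0 H assume F0: "F0 \<in> FinLO (idx X)" and H: "H \<in> FinLO (idx Z)"
  have e: "[] \<in> FinLO (idx Y)" by (simp add: FinLO_def)
  obtain G where G: "(G, []) \<in> FinLO_arr (idx Y)" "set (u H) \<subseteq> set (w G)"
    using wired_cover[OF assms(2) _ _ e, of "set (u H)"] wiredD(6)[OF assms(3) H] assms(4) by auto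
  then have G': "G \<in> FinLO (idx Y)" by (simp add: FinLO_arr_iff)
  obtain F where F: "(F, F0) \<in> FinLO_arr (idx X)" "set (w G) \<subseteq> set (v F)"
    using wired_cover[OF assms(1) _ _ F0, of "set (w G)"] wiredD(6)[OF assms(2) G'] assms(5) by auto
  then have F': "F \<in> FinLO (idx X)" by (simp add: FinLO_arr_iff)
  have "wproj (w G) (u H) \<cdot> wproj (v F) (w G) = wproj (v F) (u H)"
    by (rule proj_comp[OF G(2) F(2)]) (use wiredD(2) assms(1-3) F' G' H in blast)+
  then have "pt (fcomp (rewire Y w Z u) (rewire X v Y w)) F H (wproj (v F) (u H))"
    using pt_comp[OF h X Y Z pt_rewire[OF assms(1,2,5) F' G' F(2)] pt_rewire[OF assms(2,3,4) G' H G(2)]] by simp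
  then show "\<exists>F. (F, F0) \<in> FinLO_arr (idx X) \<and> pt (fcomp (rewire Y w Z u) (rewire X v Y w)) F H (wproj (v F) (u H))"
    using F by blast
qed

lemma rewire_ide: assumes "wired X v" shows "rewire X v X v = fide X"
proof (rule rewire_eqI[OF assms assms, symmetric])
  note X = wiredD(1)[OF assms]
  show "fide X \<in> Hom X X" by (rule fide_Hom[OF X])
  fix F G assume FG: "F \<in> FinLO (idx X)" "G \<in> FinLO (idx X)" "set (v G) \<subseteq> set (v F)"
  obtain F' where F': "(F', F) \<in> FinLO_arr (idx X)" "(F', G) \<in> FinLO_arr (idx X)" using FinLO_union FG by metis
  have "pt (fide X) F' G (wproj (v F') (v G))"
    using pt_class[OF fin_approx_of_nat[OF natural_ide[OF X]], of F' G] F' aitp_prj[OF X F'(2)] wiredD(5)[OF assms F'(2)]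
    by (simp add: fide_def)
  then show "\<exists>F'. (F', F) \<in> FinLO_arr (idx X) \<and> pt (fide X) F' G (wproj (v F') (v G))" using F' by blast
qed simp

text \<open>Only the bijection between names matters.\<close>

lemma wired_map: assumes "wired X v" "inj_on h (wset X v)" "\<And>F. F \<in> FinLO (idx X) \<Longrightarrow> v' F = map h (v F)"
  shows "wired X v'" "wset X v' = h ` wset X v"
proof -
  have i: "inj_on h (set (v F))" if "F \<in> FinLO (idx X)" for F
    using wiredD(6)[OF assms(1) that] assms(2) inj_on_subset by blast
  show "wired X v'" unfolding wired_def
  proof (intro conjI ballI allI impI)
    fix F' F assume a: "(F', F) \<in> FinLO_arr (idx X)"
    then have F: "F \<in> FinLO (idx X)" "F' \<in> FinLO (idx X)" by (auto simp: FinLO_arr_iff)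
    show "set (v' F) \<subseteq> set (v' F')" using wiredD(4)[OF assms(1) a] assms(3) F by auto
    show "prj X (F', F) = wproj (v' F') (v' F)"
      using wiredD(5)[OF assms(1) a] wproj_map[OF i[OF F(2)] wiredD(4)[OF assms(1) a]] wiredD(2)[OF assms(1)] F assms(3) by simp
  qed (use wiredD(1-3)[OF assms(1)] assms(3) i in \<open>auto simp: distinct_map\<close>)
  show "wset X v' = h ` wset X v" unfolding wset_def using assms(3) by auto
qed

lemma rewire_map: assumes "wired X v" "wired Y w" "wset Y w \<subseteq> wset X v" "inj_on h (wset X v)"
    "\<And>F. F \<in> FinLO (idx X) \<Longrightarrow> v' F = map h (v F)" "\<And>G. G \<in> FinLO (idx Y) \<Longrightarrow> w' G = map h (w G)"
  shows "rewire X v' Y w' = rewire X v Y w"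
proof (rule rewire_eqI[OF assms(1-3)])
  have i: "inj_on h (wset Y w)" using assms(3,4) inj_on_subset by blast
  note v' = wired_map[of X v h v', OF assms(1,4,5)] and w' = wired_map[of Y w h w', OF assms(2) i assms(6)]
  have s: "wset Y w' \<subseteq> wset X v'" using v' w' assms(3) by auto
  show "rewire X v' Y w' \<in> Hom X Y" by (rule rewire_Hom[OF v'(1) w'(1) s])
  fix F G assume a: "F \<in> FinLO (idx X)" "G \<in> FinLO (idx Y)" "set (w G) \<subseteq> set (v F)"
  have "pt (rewire X v' Y w') F G (wproj (v' F) (w' G))"
    by (rule pt_rewire[OF v'(1) w'(1) s a(1,2)]) (use a assms(5,6) in auto)
  moreover have "wproj (v' F) (w' G) = wproj (v F) (w G)"
    unfolding assms(5)[OF a(1)] assms(6)[OF a(2)]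
    by (rule wproj_map) (use a wiredD(2)[OF assms(1) a(1)] wiredD(2)[OF assms(2) a(2)] wiredD(6)[OF assms(1) a(1)] assms(4) inj_on_subset in blast)+
  ultimately show "\<exists>F'. (F', F) \<in> FinLO_arr (idx X) \<and> pt (rewire X v' Y w') F' G (wproj (v F') (w G))"
    using FinLO_arr_refl[OF a(1)] by metis
qed

lemma rewire_iso: assumes "wired X v" "wired Y w" "wset Y w = wset X v"
  shows "iso_in (expl s C) X Y (rewire X v Y w)"
proof -
  have "fcomp (rewire Y w X v) (rewire X v Y w) = fide X" "fcomp (rewire X v Y w) (rewire Y w X v) = fide Y"
    using rewire_comp[OF assms(1,2,1)] rewire_comp[OF assms(2,1,2)] rewire_ide[OF assms(1)] rewire_ide[OF assms(2)] assms(3) by auto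
  then show ?thesis unfolding iso_in_def inverse_in_def
    using rewire_Hom[OF assms(1,2)] rewire_Hom[OF assms(2,1)] assms(3) by (intro exI[of _ "rewire Y w X v"]) auto
qed

definition wsum :: "('j, nat, 'm) diagram \<Rightarrow> ('j list \<Rightarrow> 'w list) \<Rightarrow> ('j, nat, 'm) diagram \<Rightarrow> ('j list \<Rightarrow> 'u list) \<Rightarrow> 'j list \<Rightarrow> ('w + 'u) list"
  where "wsum X v Y w F = map Inl (v (cut F (idx X))) @ map Inr (w (cut F (idx Y)))"

lemma wproj_Plus: fixes xs xs' :: "'w list" and ys ys' :: "'u list"
  assumes "set xs' \<subseteq> set xs" "set ys' \<subseteq> set ys" "distinct xs" "distinct ys" "distinct xs'" "distinct ys'"
  shows "wproj (map Inl xs @ map Inr ys) (map Inl xs' @ map Inr ys') = wproj xs xs' \<otimes> wproj ys ys'"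
proof -
  have "wproj (map Inl xs @ map Inr ys) (map Inl xs' @ map Inr ys')
     = wproj (map Inl xs :: ('w + 'u) list) (map Inl xs') \<otimes> wproj (map Inr ys :: ('w + 'u) list) (map Inr ys')"
    by (rule proj_append) (use assms in \<open>auto simp: distinct_map\<close>)
  also have "wproj (map Inl xs :: ('w + 'u) list) (map Inl xs') = wproj xs xs'" by (rule wproj_map) (use assms in auto)
  also have "wproj (map Inr ys :: ('w + 'u) list) (map Inr ys') = wproj ys ys'" by (rule wproj_map) (use assms in auto)
  finally show ?thesis .
qed

lemma wired_wsum: assumes "wired X v" "wired Y w"
  shows "wired (diag_tensor C X Y) (wsum X v Y w)" "wset (diag_tensor C X Y) (wsum X v Y w) = wset X v <+> wset Y w"
proof -
  show "wired (diag_tensor C X Y) (wsum X v Y w)" unfolding wired_def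
  proof (intro conjI ballI allI impI)
    show "aitp (diag_tensor C X Y)" using wiredD(1)[OF assms(1)] wiredD(1)[OF assms(2)] by simp
  next
    fix F assume "F \<in> FinLO (idx (diag_tensor C X Y))"
    then have F: "F \<in> FinLO (idx X \<union> idx Y)" by simp
    note c = FinLO_cut[OF F]
    show "distinct (wsum X v Y w F)" "ob (diag_tensor C X Y) F = length (wsum X v Y w F)"
      using wiredD(2,3)[OF assms(1) c(1)] wiredD(2,3)[OF assms(2) c(2)] F by (auto simp: wsum_def distinct_map)
  next
    fix F' F assume "(F', F) \<in> FinLO_arr (idx (diag_tensor C X Y))"
    then have FF: "(F', F) \<in> FinLO_arr (idx X \<union> idx Y)" by simp
    note a = FinLO_arr_cut[OF FF]
    then have F: "cut F (idx X) \<in> FinLO (idx X)" "cut F' (idx X) \<in> FinLO (idx X)" "cut F (idx Y) \<in> FinLO (idx Y)" "cut F' (idx Y) \<in> FinLO (idx Y)"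
      by (simp_all add: FinLO_arr_iff)
    note d = wiredD(4,5)[OF assms(1) a(1)] wiredD(4,5)[OF assms(2) a(2)] wiredD(2)[OF assms(1) F(1)] wiredD(2)[OF assms(1) F(2)]
      wiredD(2)[OF assms(2) F(3)] wiredD(2)[OF assms(2) F(4)]
    show "set (wsum X v Y w F) \<subseteq> set (wsum X v Y w F')" using d(1,3) by (auto simp: wsum_def)
    show "prj (diag_tensor C X Y) (F', F) = wproj (wsum X v Y w F') (wsum X v Y w F)"
      using FF d unfolding wsum_def by (subst wproj_Plus) auto
  qed
  show "wset (diag_tensor C X Y) (wsum X v Y w) = wset X v <+> wset Y w"
  proof
    show "wset (diag_tensor C X Y) (wsum X v Y w) \<subseteq> wset X v <+> wset Y w"
    proof
      fix x assume "x \<in> wset (diag_tensor C X Y) (wsum X v Y w)"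
      then obtain F where F: "F \<in> FinLO (idx X \<union> idx Y)" "x \<in> set (wsum X v Y w F)" unfolding wset_def by auto
      then show "x \<in> wset X v <+> wset Y w"
        using wiredD(6)[OF assms(1) FinLO_cut(1)[OF F(1)]] wiredD(6)[OF assms(2) FinLO_cut(2)[OF F(1)]] by (auto simp: wsum_def)
    qed
    show "wset X v <+> wset Y w \<subseteq> wset (diag_tensor C X Y) (wsum X v Y w)"
    proof
      fix x assume "x \<in> wset X v <+> wset Y w"
      then consider a F where "x = Inl a" "F \<in> FinLO (idx X)" "a \<in> set (v F)" | b F where "x = Inr b" "F \<in> FinLO (idx Y)" "b \<in> set (w F)"
        unfolding wset_def by auto
      then show "x \<in> wset (diag_tensor C X Y) (wsum X v Y w)"
      proof cases
        case 1
        then have "F \<in> FinLO (idx X \<union> idx Y)" "cut F (idx X) = F" by (auto simp: FinLO_def intro!: filter_True)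
        moreover from this 1 have "x \<in> set (wsum X v Y w F)" by (auto simp: wsum_def)
        ultimately show ?thesis unfolding wset_def by auto
      next
        case 2
        then have "F \<in> FinLO (idx X \<union> idx Y)" "cut F (idx Y) = F" by (auto simp: FinLO_def intro!: filter_True)
        moreover from this 2 have "x \<in> set (wsum X v Y w F)" by (auto simp: wsum_def)
        ultimately show ?thesis unfolding wset_def by auto
      qed
    qed
  qed
qed

lemma rewire_tensor: assumes "wired X v" "wired Y w" "wired X' v'" "wired Y' w'" "wset Y w \<subseteq> wset X v" "wset Y' w' \<subseteq> wset X' v'"
  shows "ftensor (rewire X v Y w) (rewire X' v' Y' w') = rewire (diag_tensor C X X') (wsum X v X' v') (diag_tensor C Y Y') (wsum Y w Y' w')"
proof (rule rewire_eqI[OF wired_wsum(1)[OF assms(1,3)] wired_wsum(1)[OF assms(2,4)]])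
  show "wset (diag_tensor C Y Y') (wsum Y w Y' w') \<subseteq> wset (diag_tensor C X X') (wsum X v X' v')"
    unfolding wired_wsum(2)[OF assms(1,3)] wired_wsum(2)[OF assms(2,4)] using assms(5,6) by auto
  note h = rewire_Hom[OF assms(1,2,5)] rewire_Hom[OF assms(3,4,6)]
  note a = wiredD(1)[OF assms(1)] wiredD(1)[OF assms(2)] wiredD(1)[OF assms(3)] wiredD(1)[OF assms(4)]
  show "ftensor (rewire X v Y w) (rewire X' v' Y' w') \<in> Hom (diag_tensor C X X') (diag_tensor C Y Y')"
    by (rule ftensor_Hom[OF h a])
  fix F G assume "F \<in> FinLO (idx (diag_tensor C X X'))" "G \<in> FinLO (idx (diag_tensor C Y Y'))"
    and s: "set (wsum Y w Y' w' G) \<subseteq> set (wsum X v X' v' F)"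
  then have F: "F \<in> FinLO (idx X \<union> idx X')" and G: "G \<in> FinLO (idx Y \<union> idx Y')" by simp_all
  note c = FinLO_cut[OF F] FinLO_cut[OF G]
  note d = wiredD(2)[OF assms(1) c(1)] wiredD(2)[OF assms(3) c(2)] wiredD(2)[OF assms(2) c(3)] wiredD(2)[OF assms(4) c(4)]
  have s': "set (w (cut G (idx Y))) \<subseteq> set (v (cut F (idx X)))" "set (w' (cut G (idx Y'))) \<subseteq> set (v' (cut F (idx X')))"
    using s unfolding wsum_def by auto
  have "pt (ftensor (rewire X v Y w) (rewire X' v' Y' w')) F G
      (wproj (v (cut F (idx X))) (w (cut G (idx Y))) \<otimes> wproj (v' (cut F (idx X'))) (w' (cut G (idx Y'))))"
    by (rule pt_tensor[OF h a F G pt_rewire[OF assms(1,2,5) c(1,3) s'(1)] pt_rewire[OF assms(3,4,6) c(2,4) s'(2)]])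
  then have "pt (ftensor (rewire X v Y w) (rewire X' v' Y' w')) F G (wproj (wsum X v X' v' F) (wsum Y w Y' w' G))"
    unfolding wsum_def using wproj_Plus[OF s' d] by simp
  then show "\<exists>F'. (F', F) \<in> FinLO_arr (idx (diag_tensor C X X')) \<and> pt (ftensor (rewire X v Y w) (rewire X' v' Y' w')) F' G (wproj (wsum X v X' v' F') (wsum Y w Y' w' G))"
    using FinLO_arr_refl F by auto
qed

text \<open>It is through this lemma that the coherence isomorphisms of the explicit category become rewirings.\<close>

lemma fnat_rewire: assumes "natural X Y \<theta>" "wired X v" "wired Y w" "\<And>F. F \<in> FinLO (idx X) \<Longrightarrow> set (w F) \<subseteq> set (v F) \<and> \<theta> F = wproj (v F) (w F)"
  shows "fnat X Y \<theta> = rewire X v Y w"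
proof (rule rewire_eqI[OF assms(2,3) _ fnat_Hom[OF assms(1)]])
  have i: "idx Y = idx X" "aitp X" "aitp Y" using assms(1) unfolding natural_def by auto
  show "wset Y w \<subseteq> wset X v" unfolding wset_def i using assms(4) by blast
  fix F G assume FG: "F \<in> FinLO (idx X)" "G \<in> FinLO (idx Y)" "set (w G) \<subseteq> set (v F)"
  obtain F' where F': "(F', F) \<in> FinLO_arr (idx X)" "(F', G) \<in> FinLO_arr (idx X)" using FinLO_union FG i by metis
  then have F'X: "F' \<in> FinLO (idx X)" by (simp add: FinLO_arr_iff)
  have "pt (fnat X Y \<theta>) F' G (prj Y (F', G) \<cdot> \<theta> F')"
    using pt_class[OF fin_approx_of_nat[OF assms(1)], of F' G] F' by simp
  moreover have "prj Y (F', G) \<cdot> \<theta> F' = wproj (v F') (w G)"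
    using wiredD(5)[OF assms(3), unfolded i, OF F'(2)] assms(4)[OF F'X]
      proj_comp[of "w G" "w F'" "v F'" "\<lambda>_. 1"] wiredD(2,4)[OF assms(3), unfolded i] wiredD(2)[OF assms(2)] F' F'X FG i by simp
  ultimately show "\<exists>F'. (F', F) \<in> FinLO_arr (idx X) \<and> pt (fnat X Y \<theta>) F' G (wproj (v F') (w G))" using F' by metis
qed

fun reassoc :: "('a + 'b) + 'c \<Rightarrow> 'a + ('b + 'c)" where
  "reassoc (Inl (Inl x)) = Inl x" | "reassoc (Inl (Inr y)) = Inr (Inl y)" | "reassoc (Inr z) = Inr (Inr z)"

fun swap_sum :: "'a + 'b \<Rightarrow> 'b + 'a" where "swap_sum (Inl x) = Inr x" | "swap_sum (Inr y) = Inl y"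

lemma inj_reassoc: "inj_on reassoc A"
proof (rule inj_onI)
  fix x y :: "('a + 'b) + 'c" assume "reassoc x = reassoc y"
  then show "x = y" by (cases x rule: reassoc.cases; cases y rule: reassoc.cases) auto
qed

lemma inj_swap_sum: "inj_on swap_sum A"
proof (rule inj_onI)
  fix x y :: "'a + 'b" assume "swap_sum x = swap_sum y"
  then show "x = y" by (cases x; cases y) auto
qed

lemma fassoc_rewire: assumes "wired X v" "wired Y w" "wired Z u"
  shows "fassoc X Y Z = rewire (diag_tensor C (diag_tensor C X Y) Z) (map reassoc \<circ> wsum (diag_tensor C X Y) (wsum X v Y w) Z u)
     (diag_tensor C X (diag_tensor C Y Z)) (wsum X v (diag_tensor C Y Z) (wsum Y w Z u))"
proof (rule fnat_rewire[OF natural_assoc])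
  show "aitp X" "aitp Y" "aitp Z" using assms wiredD(1) by blast+
  show "wired (diag_tensor C (diag_tensor C X Y) Z) (map reassoc \<circ> wsum (diag_tensor C X Y) (wsum X v Y w) Z u)"
    by (rule wired_map(1)[of _ _ reassoc, OF wired_wsum(1)[OF wired_wsum(1)[OF assms(1,2)] assms(3)] inj_reassoc]) simp
  show "wired (diag_tensor C X (diag_tensor C Y Z)) (wsum X v (diag_tensor C Y Z) (wsum Y w Z u))"
    by (rule wired_wsum(1)[OF assms(1) wired_wsum(1)[OF assms(2,3)]])
  fix F assume "F \<in> FinLO (idx (diag_tensor C (diag_tensor C X Y) Z))"
  then have F: "F \<in> FinLO (idx X \<union> idx Y \<union> idx Z)" by simp
  then have c: "cut F (idx X) \<in> FinLO (idx X)" "cut F (idx Y) \<in> FinLO (idx Y)" "cut F (idx Z) \<in> FinLO (idx Z)"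
    by (auto simp: FinLO_def)
  show "set (wsum X v (diag_tensor C Y Z) (wsum Y w Z u) F) \<subseteq> set ((map reassoc \<circ> wsum (diag_tensor C X Y) (wsum X v Y w) Z u) F) \<and>
    assoc C (ob X (cut F (idx X))) (ob Y (cut F (idx Y))) (ob Z (cut F (idx Z))) =
      wproj ((map reassoc \<circ> wsum (diag_tensor C X Y) (wsum X v Y w) Z u) F) (wsum X v (diag_tensor C Y Z) (wsum Y w Z u) F)"
    using wiredD(3)[OF assms(1) c(1)] wiredD(3)[OF assms(2) c(2)] wiredD(3)[OF assms(3) c(3)]
    by (simp add: wsum_def disj_absorb o_def add.assoc)
qed

lemma fbraid_rewire: fixes v :: "'j list \<Rightarrow> 'w list" and w :: "'j list \<Rightarrow> 'u list"
  assumes "wired X v" "wired Y w"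
  shows "fbraid X Y = rewire (diag_tensor C X Y) (map swap_sum \<circ> wsum X v Y w) (diag_tensor C Y X) (wsum Y w X v)"
proof (rule fnat_rewire[OF natural_braid])
  show "aitp X" "aitp Y" using assms wiredD(1) by blast+
  show "wired (diag_tensor C X Y) (map swap_sum \<circ> wsum X v Y w)"
    by (rule wired_map(1)[of _ _ swap_sum, OF wired_wsum(1)[OF assms(1,2)] inj_swap_sum]) simp
  show "wired (diag_tensor C Y X) (wsum Y w X v)" by (rule wired_wsum(1)[OF assms(2,1)])
  fix F assume "F \<in> FinLO (idx (diag_tensor C X Y))"
  then have F: "F \<in> FinLO (idx X \<union> idx Y)" by simp
  note c = FinLO_cut[OF F]
  let ?x = "map Inr (v (cut F (idx X))) :: ('u + 'w) list" and ?y = "map Inl (w (cut F (idx Y))) :: ('u + 'w) list"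
  have "wproj (?x @ ?y) (?y @ ?x) = braid C (size_of (\<lambda>_. 1) ?x) (size_of (\<lambda>_. 1) ?y)"
    by (rule proj_swap) (use wiredD(2)[OF assms(1) c(1)] wiredD(2)[OF assms(2) c(2)] in \<open>auto simp: distinct_map\<close>)
  then have b: "wproj (?x @ ?y) (?y @ ?x) = braid C (ob X (cut F (idx X))) (ob Y (cut F (idx Y)))"
    unfolding size_of_1 using wiredD(3)[OF assms(1) c(1)] wiredD(3)[OF assms(2) c(2)] by simp
  have e: "(map swap_sum \<circ> wsum X v Y w) F = ?x @ ?y" "wsum Y w X v F = ?y @ ?x" by (simp_all add: wsum_def o_def)
  show "set (wsum Y w X v F) \<subseteq> set ((map swap_sum \<circ> wsum X v Y w) F) \<and>
    braid C (ob X (cut F (idx X))) (ob Y (cut F (idx Y))) = wproj ((map swap_sum \<circ> wsum X v Y w) F) (wsum Y w X v F)"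
    unfolding e b by auto
qed

lemma wired_unit: "wired (diag_unit C s) (\<lambda>_. [])"
  unfolding wired_def by (auto simp: FinLO_arr_iff)

lemma wset_unit: "wset (diag_unit C s) (\<lambda>_. []) = {}"
  by (simp add: wset_def)

lemma funit_rewire: assumes "wired X v" "s \<in> idx X"
  shows "flunit s X = rewire (diag_tensor C (diag_unit C s) X) (wsum (diag_unit C s) (\<lambda>_. [] :: 'u list) X v) X (map Inr \<circ> v)"
    "frunit s X = rewire (diag_tensor C X (diag_unit C s)) (wsum X v (diag_unit C s) (\<lambda>_. [] :: 'u list)) X (map Inl \<circ> v)"
proof -
  have u: "{s} \<union> idx X = idx X" "idx X \<union> {s} = idx X" using assms by auto
  have X: "aitp X" using wiredD(1)[OF assms(1)] .
  show "flunit s X = rewire (diag_tensor C (diag_unit C s) X) (wsum (diag_unit C s) (\<lambda>_. [] :: 'u list) X v) X (map Inr \<circ> v)"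
  proof (rule fnat_rewire[OF natural_lunit[OF X assms(2)] wired_wsum(1)[OF wired_unit assms(1)]])
    show "wired X (map Inr \<circ> v :: _ \<Rightarrow> ('u + _) list)" by (rule wired_map(1)[of _ _ Inr, OF assms(1)]) auto
    fix F assume "F \<in> FinLO (idx (diag_tensor C (diag_unit C s) X))"
    then have F: "F \<in> FinLO (idx X)" using u by simp
    then have "wsum (diag_unit C s) (\<lambda>_. [] :: 'u list) X v F = map Inr (v F)" by (simp add: wsum_def)
    then show "set ((map Inr \<circ> v) F) \<subseteq> set (wsum (diag_unit C s) (\<lambda>_. [] :: 'u list) X v F) \<and> lunit C (ob X F)
      = wproj (wsum (diag_unit C s) (\<lambda>_. [] :: 'u list) X v F) ((map Inr \<circ> v) F)"
      using wiredD(3)[OF assms(1) F] by (simp add: o_def)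
  qed
  show "frunit s X = rewire (diag_tensor C X (diag_unit C s)) (wsum X v (diag_unit C s) (\<lambda>_. [] :: 'u list)) X (map Inl \<circ> v)"
  proof (rule fnat_rewire[OF natural_runit[OF X assms(2)] wired_wsum(1)[OF assms(1) wired_unit]])
    show "wired X (map Inl \<circ> v :: _ \<Rightarrow> (_ + 'u) list)" by (rule wired_map(1)[of _ _ Inl, OF assms(1)]) auto
    fix F assume "F \<in> FinLO (idx (diag_tensor C X (diag_unit C s)))"
    then have F: "F \<in> FinLO (idx X)" using u by simp
    then have "wsum X v (diag_unit C s) (\<lambda>_. [] :: 'u list) F = map Inl (v F)" by (simp add: wsum_def)
    then show "set ((map Inl \<circ> v) F) \<subseteq> set (wsum X v (diag_unit C s) (\<lambda>_. [] :: 'u list) F) \<and> runit C (ob X F)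
      = wproj (wsum X v (diag_unit C s) (\<lambda>_. [] :: 'u list) F) ((map Inl \<circ> v) F)"
      using wiredD(3)[OF assms(1) F] by (simp add: o_def)
  qed
qed

lemma wired_std_itp: assumes "countable J"
  shows "wired (std_itp C J n) (wires_of n)" "wset (std_itp C J n) (wires_of n) = Sigma J (\<lambda>j. {..<n j})"
proof -
  show "wired (std_itp C J n) (wires_of n)" unfolding wired_def
  proof (intro conjI ballI allI impI)
    show "aitp (std_itp C J n)" by (rule aitp_std_itp[OF assms])
  next
    fix F' F assume "(F', F) \<in> FinLO_arr (idx (std_itp C J n))"
    then have a: "(F', F) \<in> FinLO_arr J" "set F \<subseteq> set F'" "distinct F" "distinct F'"
      using FinLO_distinct by (auto simp: std_itp_prj FinLO_arr_iff)
    show "set (wires_of n F) \<subseteq> set (wires_of n F')" using a by (auto simp: set_wires_of)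
    show "prj (std_itp C J n) (F', F) = wproj (wires_of n F') (wires_of n F)"
      using a proj_wires[of F F' n] by (simp add: std_itp_prj)
  qed (auto simp: std_itp_prj distinct_wires_of FinLO_def)
  show "wset (std_itp C J n) (wires_of n) = Sigma J (\<lambda>j. {..<n j})"
  proof
    show "Sigma J (\<lambda>j. {..<n j}) \<subseteq> wset (std_itp C J n) (wires_of n)"
    proof
      fix x assume "x \<in> Sigma J (\<lambda>j. {..<n j})"
      then obtain j i where "x = (j, i)" "j \<in> J" "i < n j" by auto
      then have "[j] \<in> FinLO J" "x \<in> set (wires_of n [j])" by (auto simp: FinLO_def)
      then show "x \<in> wset (std_itp C J n) (wires_of n)" unfolding wset_def std_itp_prj by blast
    qed
  qed (auto simp: wset_def std_itp_prj set_wires_of FinLO_def)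
qed

end

section \<open>The free prop of a symmetric monoidal theory\<close>

lemma wt_id_tm: "wt \<Sigma> (id_tm n) n n"
proof (induction n)
  case (Suc n)
  then have "wt \<Sigma> (Par Id1 (id_tm n)) (1 + n) (1 + n)" by (intro wt.intros)
  then show ?case by simp
qed (simp add: wt.intros(4))

lemma wt_swap1_tm: "wt \<Sigma> (swap1_tm n) (Suc n) (Suc n)"
proof (induction n)
  case (Suc n)
  have "wt \<Sigma> (Par Swap (id_tm n)) (2 + n) (2 + n)" by (intro wt.intros wt_id_tm)
  moreover have "wt \<Sigma> (Par Id1 (swap1_tm n)) (1 + Suc n) (1 + Suc n)" by (intro wt.intros Suc)
  ultimately show ?case using wt.intros(5)[of \<Sigma> "Par Swap (id_tm n)" "Suc (Suc n)" "Suc (Suc n)"] by simp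
qed (use wt.intros(2)[of \<Sigma>] in simp)

lemma wt_swap_tm: "wt \<Sigma> (swap_tm m n) (m + n) (m + n)"
proof (induction m)
  case (Suc m)
  have "wt \<Sigma> (Par Id1 (swap_tm m n)) (1 + (m + n)) (1 + (m + n))" by (intro wt.intros Suc)
  moreover have "wt \<Sigma> (Par (swap1_tm n) (id_tm m)) (Suc n + m) (Suc n + m)" by (intro wt.intros wt_id_tm wt_swap1_tm)
  ultimately show ?case using wt.intros(5)[of \<Sigma> "Par Id1 (swap_tm m n)" "Suc (m + n)" "Suc (m + n)"] by (simp add: add.commute)
qed (use wt_id_tm[of \<Sigma> n] in simp)

lemma wt_unique: "wt \<Sigma> s m n \<Longrightarrow> wt \<Sigma> s m' n' \<Longrightarrow> m' = m \<and> n' = n"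
proof (induction arbitrary: m' n' rule: wt.induct)
  case (1 c m n)
  from 1(2) show ?case by cases (use 1(1) in auto)
next
  case (5 s l m t n)
  from 5(5) show ?case by cases (use 5(3,4) in metis)
next
  case (6 s m n t k l)
  from 6(5) show ?case by cases (use 6(3,4) in metis)
next
  case 2
  then show ?case by cases auto
next
  case 3
  then show ?case by cases auto
next
  case 4
  then show ?case by cases auto
qed

lemma tm_eq_wt: "tm_eq \<Sigma> E s t \<Longrightarrow> \<exists>m n. wt \<Sigma> s m n \<and> wt \<Sigma> t m n"
proof (induction rule: tm_eq.induct)
  case (trans s t u)
  then show ?case using wt_unique by metis
next
  case (seq_cong s l m t n s' t')
  then show ?case using wt_unique wt.intros(5) by metis
next
  case (swap_nat s m n t m' n')
  have p: "wt \<Sigma> (Par s t) (m + m') (n + n')" "wt \<Sigma> (Par t s) (m' + m) (n' + n)" by (intro wt.intros swap_nat)+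
  have "wt \<Sigma> (Seq (Par s t) (swap_tm n n')) (m + m') (n + n')" by (rule wt.intros(5)[OF p(1) wt_swap_tm])
  moreover have "wt \<Sigma> (Seq (swap_tm m m') (Par t s)) (m + m') (n + n')"
    by (rule wt.intros(5)[OF wt_swap_tm]) (use p(2) in \<open>simp add: add.commute\<close>)
  ultimately show ?case by blast
next
  case (swap_swap m n)
  have "wt \<Sigma> (Seq (swap_tm m n) (swap_tm n m)) (m + n) (m + n)"
    by (rule wt.intros(5)[OF wt_swap_tm]) (use wt_swap_tm[of \<Sigma> n m] in \<open>simp add: add.commute\<close>)
  then show ?case using wt_id_tm by blast
next
  case (swap_hexagon m n k)
  have p: "wt \<Sigma> (Par (swap_tm m n) (id_tm k)) (m + n + k) (m + n + k)" "wt \<Sigma> (Par (id_tm n) (swap_tm m k)) (n + (m + k)) (n + (m + k))"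
    by (intro wt.intros wt_swap_tm wt_id_tm)+
  have "wt \<Sigma> (Seq (Par (swap_tm m n) (id_tm k)) (Par (id_tm n) (swap_tm m k))) (m + n + k) (m + n + k)"
    by (rule wt.intros(5)[OF p(1)]) (use p(2) in \<open>simp add: add_ac\<close>)
  moreover have "wt \<Sigma> (swap_tm m (n + k)) (m + n + k) (m + n + k)" using wt_swap_tm[of \<Sigma> m "n + k"] by (simp add: add.assoc)
  ultimately show ?case by blast
next
  case (par_assoc s m n t m' n' u m'' n'')
  then have "wt \<Sigma> (Par (Par s t) u) (m + m' + m'') (n + n' + n'')" "wt \<Sigma> (Par s (Par t u)) (m + (m' + m'')) (n + (n' + n''))"
    by (auto intro: wt.intros)
  then show ?case unfolding add.assoc by blast
next
  case (par_emp_left s m n)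
  then have "wt \<Sigma> (Par Emp s) (0 + m) (0 + n)" by (intro wt.intros)
  then show ?case using par_emp_left by auto
next
  case (par_emp_right s m n)
  then have "wt \<Sigma> (Par s Emp) (m + 0) (n + 0)" by (intro wt.intros)
  then show ?case using par_emp_right by auto
qed (blast intro: wt.intros wt_id_tm)+

lemma Free_simps: "obj (Free \<Sigma> E) = UNIV" "munit (Free \<Sigma> E) = 0" "tenO (Free \<Sigma> E) = (+)"
  "hom (Free \<Sigma> E) m n = {tm_class \<Sigma> E s | s. wt \<Sigma> s m n}"
  "assoc (Free \<Sigma> E) l m n = ide (Free \<Sigma> E) (l + m + n)" "lunit (Free \<Sigma> E) n = ide (Free \<Sigma> E) n" "runit (Free \<Sigma> E) n = ide (Free \<Sigma> E) n"
  by (simp_all add: Free_def)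

lemma semicartesian_prop_Free: assumes "semicartesian (Free \<Sigma> E)" "cancellative_deletions (Free \<Sigma> E)"
  shows "semicartesian_prop (Free \<Sigma> E)"
proof -
  interpret semicartesian "Free \<Sigma> E" by fact
  have "m = m' \<and> n = n'" if "f \<in> hom (Free \<Sigma> E) m n" "f \<in> hom (Free \<Sigma> E) m' n'" for f m n m' n'
  proof -
    obtain s s' where s: "f = tm_class \<Sigma> E s" "wt \<Sigma> s m n" "f = tm_class \<Sigma> E s'" "wt \<Sigma> s' m' n'"
      using \<open>f \<in> hom (Free \<Sigma> E) m n\<close> \<open>f \<in> hom (Free \<Sigma> E) m' n'\<close> by (auto simp: Free_simps)
    then have "tm_eq \<Sigma> E s s'" using tm_eq.refl[OF s(4)] unfolding tm_class_def by blast
    then show ?thesis using tm_eq_wt wt_unique s by metis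
  qed
  then show ?thesis by unfold_locales (auto simp: Free_simps assms(2))
qed

section \<open>Possibly infinite string diagrams\<close>

locale string_theory =
  fixes \<Sigma> :: "'g signature" and E :: "('g tm \<times> 'g tm) set" and split :: "enat \<Rightarrow> enat \<Rightarrow> nat \<Rightarrow> nat + nat"
  assumes semicartesian_Free: "semicartesian (Free \<Sigma> E)"
    and cancellative_Free: "cancellative_deletions (Free \<Sigma> E)"
    and wire_splitting: "wire_splitting split"
begin

sublocale semicartesian_prop "Free \<Sigma> E"
  by (rule semicartesian_prop_Free[OF semicartesian_Free cancellative_Free])

abbreviation X :: "enat \<Rightarrow> (nat, nat, 'g tm set) diagram" where "X \<equiv> inf_ob \<Sigma> E"

abbreviation K :: "((nat, nat, 'g tm set) diagram, (nat, nat, 'g tm set) fam set) smc" where "K \<equiv> expl 0 (Free \<Sigma> E)"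

sublocale K: typed_semicartesian K by (rule expl_smc)

lemmas K_simps = expl_simps[where s = "0 :: nat"]

lemma wires_simps [simp]: "wires (enat n) = {..<n}" "wires \<infinity> = UNIV" "wires 0 = {}"
  by (auto simp: wires_def zero_enat_def)

lemma X_wired: assumes "inj_on v (wires N)"
  shows "wired (X N) (map v \<circ> wire_list N)" "wset (X N) (map v \<circ> wire_list N) = v ` wires N"
    "aitp (X N)" "0 \<in> idx (X N)"
proof -
  have "wired (X N) (map id \<circ> wire_list N) \<and> wset (X N) (map id \<circ> wire_list N) = wires N \<and> 0 \<in> idx (X N)"
  proof (cases N)
    case (enat n)
    have c: "countable {0 :: nat}" by simp
    have X: "X N = std_itp (Free \<Sigma> E) {0} (\<lambda>_. n)" using enat by (simp add: inf_ob_def)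
    have l: "(map id \<circ> wire_list N) F = map snd (wires_of (\<lambda>_. n) F)" if "F \<in> FinLO {0}" for F
    proof -
      have "F = [] \<or> F = [0]"
        using that by (cases F rule: remdups_adj.cases) (auto simp: FinLO_def)
      then show ?thesis using enat by (auto simp: wire_list_def o_def)
    qed
    have i: "inj_on snd (wset (X N) (wires_of (\<lambda>_. n)))" unfolding X wired_std_itp(2)[OF c] by (auto simp: inj_on_def)
    note w = wired_map[of "X N" "wires_of (\<lambda>_. n)" snd "map id \<circ> wire_list N"]
    show ?thesis using w[OF _ i] l wired_std_itp[OF c, of "\<lambda>_. n"] unfolding X
      by (auto simp: std_itp_prj enat image_iff)
  next
    case infinity
    have c: "countable (UNIV :: nat set)" by simp
    have X: "X N = std_itp (Free \<Sigma> E) UNIV (\<lambda>_. 1)" using infinity by (simp add: inf_ob_def)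
    have l: "(map id \<circ> wire_list N) F = map fst (wires_of (\<lambda>_. 1) F)" for F
      using infinity by (induction F) (auto simp: wire_list_def)
    have i: "inj_on fst (wset (X N) (wires_of (\<lambda>_. 1)))" unfolding X wired_std_itp(2)[OF c] by (auto simp: inj_on_def)
    have w: "wired (X N) (map id \<circ> wire_list N)" "wset (X N) (map id \<circ> wire_list N) = fst ` wset (X N) (wires_of (\<lambda>_. 1))"
      using wired_map[of "X N" "wires_of (\<lambda>_. 1)" fst "map id \<circ> wire_list N", OF _ i] l wired_std_itp(1)[OF c, of "\<lambda>_. 1"] unfolding X by blast+
    have "fst ` wset (X N) (wires_of (\<lambda>_. 1)) = UNIV" unfolding X wired_std_itp(2)[OF c] by force
    then show ?thesis using w infinity X by (simp add: std_itp_prj)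
  qed
  then have w: "wired (X N) (map id \<circ> wire_list N)" "wset (X N) (map id \<circ> wire_list N) = wires N" "0 \<in> idx (X N)" by auto
  show "wired (X N) (map v \<circ> wire_list N)" "wset (X N) (map v \<circ> wire_list N) = v ` wires N"
    using wired_map[OF w(1), of v "map v \<circ> wire_list N"] assms w by auto
  show "aitp (X N)" "0 \<in> idx (X N)" using wiredD(1)[OF w(1)] w(3) by auto
qed

lemma X_aitp [simp]: "aitp (X N)" "0 \<in> idx (X N)"
  using X_wired(3,4)[of id N] by auto

lemma wire_list_wires: "F \<in> FinLO (idx (X N)) \<Longrightarrow> set (wire_list N F) \<subseteq> wires N"
  using wiredD(6)[OF X_wired(1)[of id N]] X_wired(2)[of id N] by auto

lemma wire_list_wired: "wired (X N) (wire_list N)" "wset (X N) (wire_list N) = wires N"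
proof -
  have "map id \<circ> wire_list N = wire_list N" by (simp add: fun_eq_iff)
  then show "wired (X N) (wire_list N)" "wset (X N) (wire_list N) = wires N" using X_wired(1,2)[of id N] by auto
qed

lemma reindex_rewire: "reindex \<Sigma> E Y v Z w = rewire Y v Z w"
  by (simp add: reindex_def rewire_def rewire_fam_def)

lemma pair_ob_eq: "pair_ob \<Sigma> E M N = diag_tensor (Free \<Sigma> E) (X M) (X N)"
  by (simp add: pair_ob_def)

lemma split_bij: "bij_betw (split M N) (wires (M + N)) (wires M <+> wires N)"
proof (cases "M = \<infinity> \<or> N = \<infinity>")
  case True
  then show ?thesis using wire_splitting unfolding wire_splitting_def by blast
next
  case False
  then obtain m n where mn: "M = enat m" "N = enat n" by auto
  have s: "split (enat m) (enat n) i = (if i < m then Inl i else Inr (i - m))" for i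
    using wire_splitting unfolding wire_splitting_def by blast
  have "inj_on (split M N) {..<m + n}" unfolding mn by (auto simp: inj_on_def s split: if_splits)
  moreover have "split M N ` {..<m + n} = {..<m} <+> {..<n}"
  proof
    show "split M N ` {..<m + n} \<subseteq> {..<m} <+> {..<n}" unfolding mn by (auto simp: s)
    have "Inl x \<in> split M N ` {..<m + n}" if "x < m" for x unfolding mn using that by (intro image_eqI[of _ _ x]) (auto simp: s)
    moreover have "Inr x \<in> split M N ` {..<m + n}" if "x < n" for x unfolding mn using that by (intro image_eqI[of _ _ "m + x"]) (auto simp: s)
    ultimately show "{..<m} <+> {..<n} \<subseteq> split M N ` {..<m + n}" by auto
  qed
  ultimately show ?thesis unfolding bij_betw_def mn by simp
qed

text \<open>The names which a sum of objects inherits from its summands.\<close>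

definition lsum :: "enat \<Rightarrow> (nat \<Rightarrow> 'v) \<Rightarrow> enat \<Rightarrow> (nat \<Rightarrow> 'w) \<Rightarrow> nat \<Rightarrow> 'v + 'w" where
  "lsum M v N w i = map_sum v w (split M N i)"

lemma lsum_image: "lsum M v N w ` wires (M + N) = v ` wires M <+> w ` wires N"
proof -
  have "lsum M v N w ` wires (M + N) = map_sum v w ` split M N ` wires (M + N)" by (auto simp: lsum_def image_image)
  also have "split M N ` wires (M + N) = wires M <+> wires N" using split_bij[of M N] by (simp add: bij_betw_def)
  also have "map_sum v w ` (wires M <+> wires N) = v ` wires M <+> w ` wires N" by (simp add: Plus_def image_Un image_image)
  finally show ?thesis .
qed

lemma inj_map_sum: "inj_on v A \<Longrightarrow> inj_on w B \<Longrightarrow> inj_on (map_sum v w) (A <+> B)"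
  by (rule inj_onI) (auto dest: inj_onD)

lemma lsum_inj: assumes "inj_on v (wires M)" "inj_on w (wires N)" shows "inj_on (lsum M v N w) (wires (M + N))"
proof -
  have "inj_on (map_sum v w) (wires M <+> wires N)" using assms by (rule inj_map_sum)
  then have "inj_on (map_sum v w \<circ> split M N) (wires (M + N))"
    using split_bij[of M N] by (intro comp_inj_on) (auto simp: bij_betw_def)
  moreover have "map_sum v w \<circ> split M N = lsum M v N w" by (auto simp: lsum_def)
  ultimately show ?thesis by metis
qed

lemma lsum_id: "lsum M id N id = split M N"
  by (auto simp: lsum_def sum.map_id)

lemma wsum_map: "wsum Y (map v \<circ> l) Z (map w \<circ> l') = map (map_sum v w) \<circ> wsum Y l Z l'"
  by (auto simp: wsum_def)

lemma join_rewire: assumes "inj_on v (wires M)" "inj_on w (wires N)"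
  shows "join split \<Sigma> E M N = rewire (diag_tensor (Free \<Sigma> E) (X M) (X N)) (wsum (X M) (map v \<circ> wire_list M) (X N) (map w \<circ> wire_list N))
      (X (M + N)) (map (lsum M v N w) \<circ> wire_list (M + N))"
    "unjoin split \<Sigma> E M N = rewire (X (M + N)) (map (lsum M v N w) \<circ> wire_list (M + N)) (diag_tensor (Free \<Sigma> E) (X M) (X N))
      (wsum (X M) (map v \<circ> wire_list M) (X N) (map w \<circ> wire_list N))"
proof -
  let ?P = "diag_tensor (Free \<Sigma> E) (X M) (X N)"
  note p = wired_wsum[OF wire_list_wired(1) wire_list_wired(1), of M N, unfolded wire_list_wired(2)]
  have q: "wired (X (M + N)) (map (split M N) \<circ> wire_list (M + N))" "wset (X (M + N)) (map (split M N) \<circ> wire_list (M + N)) = wires M <+> wires N"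
    using X_wired(1,2)[of "split M N" "M + N"] split_bij[of M N] by (auto simp: bij_betw_def)
  have pw: "pair_wires \<Sigma> E M N = wsum (X M) (wire_list M) (X N) (wire_list N)" by (auto simp: pair_wires_def wsum_def)
  have i: "inj_on (map_sum v w) (wires M <+> wires N)" using assms by (rule inj_map_sum)
  have e: "map (lsum M v N w) (wire_list (M + N) F) = map (map_sum v w) (map (split M N) (wire_list (M + N) F))" for F
    by (simp add: lsum_def)
  show "join split \<Sigma> E M N = rewire ?P (wsum (X M) (map v \<circ> wire_list M) (X N) (map w \<circ> wire_list N))
      (X (M + N)) (map (lsum M v N w) \<circ> wire_list (M + N))"
    unfolding join_def reindex_rewire pw pair_ob_eq wsum_map
    by (rule rewire_map[where h = "map_sum v w", symmetric]) (use p q i e in \<open>simp_all add: o_def\<close>)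
  show "unjoin split \<Sigma> E M N = rewire (X (M + N)) (map (lsum M v N w) \<circ> wire_list (M + N)) ?P
      (wsum (X M) (map v \<circ> wire_list M) (X N) (map w \<circ> wire_list N))"
    unfolding unjoin_def reindex_rewire pw pair_ob_eq wsum_map
    by (rule rewire_map[where h = "map_sum v w", symmetric]) (use p q i e in \<open>simp_all add: o_def\<close>)
qed

abbreviation wX where "wX N v \<equiv> map v \<circ> wire_list N"
abbreviation wXX where "wXX M v N w \<equiv> wsum (X M) (map v \<circ> wire_list M) (X N) (map w \<circ> wire_list N)"
abbreviation XX where "XX M N \<equiv> diag_tensor (Free \<Sigma> E) (X M) (X N)"

lemma XX_wired: assumes "inj_on v (wires M)" "inj_on w (wires N)"
  shows "wired (XX M N) (wXX M v N w)" "wset (XX M N) (wXX M v N w) = v ` wires M <+> w ` wires N"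
  using wired_wsum[OF X_wired(1)[OF assms(1)] X_wired(1)[OF assms(2)]] X_wired(2)[OF assms(1)] X_wired(2)[OF assms(2)] by auto

lemma X_wired_sum: assumes "inj_on v (wires M)" "inj_on w (wires N)"
  shows "wired (X (M + N)) (wX (M + N) (lsum M v N w))" "wset (X (M + N)) (wX (M + N) (lsum M v N w)) = v ` wires M <+> w ` wires N"
  using X_wired(1,2)[OF lsum_inj[OF assms]] by (simp_all add: lsum_image)

text \<open>Relabelings form a subcategory which contains all structural isomorphisms.\<close>

abbreviation R :: "enat \<Rightarrow> (nat \<Rightarrow> 'w) \<Rightarrow> enat \<Rightarrow> (nat \<Rightarrow> 'w) \<Rightarrow> 'g inf_mor" where "R \<equiv> relabel \<Sigma> E"
abbreviation FI :: "(enat, 'g inf_mor) smc" where "FI \<equiv> Free_inf split \<Sigma> E"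

lemma R_rewire: "R M v N w = (M, N, rewire (X M) (wX M v) (X N) (wX N w))"
  by (simp add: relabel_def reindex_rewire)

lemma FI_simps: "obj FI = UNIV" "hom FI M N = {(M, N, a) | a. a \<in> Hom (X M) (X N)}" "ide FI N = (N, N, fide (X N))"
  "comp FI (L, N, b) (M, L', a) = (M, N, fcomp b a)" "munit FI = 0" "tenO FI = (+)"
  "tenM FI (M, N, a) (M', N', a') = (M + M', N + N', fcomp (join split \<Sigma> E N N') (fcomp (ftensor a a') (unjoin split \<Sigma> E M M')))"
  by (simp_all add: Free_inf_def Let_def)

lemma R_hom: assumes "inj_on v (wires M)" "inj_on w (wires N)" "w ` wires N \<subseteq> v ` wires M" shows "R M v N w \<in> hom FI M N"
  unfolding R_rewire FI_simps using rewire_Hom[OF X_wired(1)[OF assms(1)] X_wired(1)[OF assms(2)]] X_wired(2)[OF assms(1)] X_wired(2)[OF assms(2)] assms by auto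

lemma R_comp: assumes "inj_on v (wires M)" "inj_on w (wires N)" "inj_on u (wires L)" "w ` wires N \<subseteq> v ` wires M" "u ` wires L \<subseteq> w ` wires N"
  shows "comp FI (R N w L u) (R M v N w) = R M v L u"
  unfolding R_rewire FI_simps
  using rewire_comp[OF X_wired(1)[OF assms(1)] X_wired(1)[OF assms(2)] X_wired(1)[OF assms(3)]]
    X_wired(2)[OF assms(1)] X_wired(2)[OF assms(2)] X_wired(2)[OF assms(3)] assms by simp

lemma R_ide: assumes "inj_on v (wires N)" shows "R N v N v = ide FI N"
  unfolding R_rewire FI_simps using rewire_ide[OF X_wired(1)[OF assms]] by simp

lemma R_map: assumes "inj_on v (wires M)" "inj_on w (wires N)" "w ` wires N \<subseteq> v ` wires M" "inj_on h (v ` wires M)"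
    "\<And>i. i \<in> wires M \<Longrightarrow> v' i = h (v i)" "\<And>i. i \<in> wires N \<Longrightarrow> w' i = h (w i)"
  shows "R M v' N w' = R M v N w"
proof -
  have "rewire (X M) (wX M v') (X N) (wX N w') = rewire (X M) (wX M v) (X N) (wX N w)"
    by (rule rewire_map[where h = h, OF X_wired(1)[OF assms(1)] X_wired(1)[OF assms(2)]])
      (use assms X_wired(2)[OF assms(1)] X_wired(2)[OF assms(2)] wire_list_wires in \<open>auto simp: subset_iff\<close>)
  then show ?thesis unfolding R_rewire by simp
qed

lemma R_tensor: assumes "inj_on v (wires M)" "inj_on w (wires N)" "w ` wires N \<subseteq> v ` wires M"
    "inj_on v' (wires M')" "inj_on w' (wires N')" "w' ` wires N' \<subseteq> v' ` wires M'"
  shows "tenM FI (R M v N w) (R M' v' N' w') = R (M + M') (lsum M v M' v') (N + N') (lsum N w N' w')"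
proof -
  note a = X_wired(1)[OF assms(1)] X_wired(1)[OF assms(2)] X_wired(1)[OF assms(4)] X_wired(1)[OF assms(5)]
  note b = X_wired(2)[OF assms(1)] X_wired(2)[OF assms(2)] X_wired(2)[OF assms(4)] X_wired(2)[OF assms(5)]
  note p = XX_wired[OF assms(1,4)] XX_wired[OF assms(2,5)] X_wired_sum[OF assms(1,4)] X_wired_sum[OF assms(2,5)]
  have "ftensor (rewire (X M) (wX M v) (X N) (wX N w)) (rewire (X M') (wX M' v') (X N') (wX N' w'))
     = rewire (XX M M') (wXX M v M' v') (XX N N') (wXX N w N' w')"
    by (rule rewire_tensor[OF a]) (use b assms in auto)
  moreover have "fcomp (rewire (XX M M') (wXX M v M' v') (XX N N') (wXX N w N' w')) (unjoin split \<Sigma> E M M')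
     = rewire (X (M + M')) (wX (M + M') (lsum M v M' v')) (XX N N') (wXX N w N' w')"
    unfolding join_rewire(2)[OF assms(1,4)] by (rule rewire_comp[OF p(5,1,3)]) (use p assms in auto)
  moreover have "fcomp (join split \<Sigma> E N N') (rewire (X (M + M')) (wX (M + M') (lsum M v M' v')) (XX N N') (wXX N w N' w'))
     = rewire (X (M + M')) (wX (M + M') (lsum M v M' v')) (X (N + N')) (wX (N + N') (lsum N w N' w'))"
    unfolding join_rewire(1)[OF assms(2,5)] by (rule rewire_comp[OF p(5,3,7)]) (use p assms in auto)
  ultimately show ?thesis unfolding R_rewire FI_simps by simp
qed

lemma R_iso: assumes "inj_on v (wires M)" "inj_on w (wires N)" "w ` wires N = v ` wires M" shows "inverse_in FI M N (R M v N w) (R N w M v)"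
  unfolding inverse_in_def using R_hom[of v M w N] R_hom[of w N v M] R_comp[of v M w N v M] R_comp[of w N v M w N]
    R_ide[OF assms(1)] R_ide[OF assms(2)] assms by auto

lemma reassoc_image: "reassoc ` ((A <+> B) <+> C) = A <+> (B <+> C)"
  by (simp add: Plus_def image_Un image_image Un_assoc)

lemma swap_sum_image: "swap_sum ` (A <+> B) = B <+> A"
  by (simp add: Plus_def image_Un image_image Un_commute)

lemma map_sum_image: "map_sum f g ` (A <+> B) = f ` A <+> g ` B"
  by (simp add: Plus_def image_Un image_image)

lemma reassoc_map_sum: "map_sum f (map_sum g h) (reassoc x) = reassoc (map_sum (map_sum f g) h x)"
  by (cases x rule: reassoc.cases) auto

lemma swap_sum_map_sum: "map_sum f g (swap_sum x) = swap_sum (map_sum g f x)"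
  by (cases x) auto

lemma inj_on_comp_reassoc: "inj_on v A \<Longrightarrow> inj_on (reassoc \<circ> v) A" "inj_on v A \<Longrightarrow> inj_on (\<lambda>i. reassoc (v i)) A"
  using comp_inj_on[OF _ inj_reassoc] by (auto simp: o_def)

lemma inj_on_comp_swap_sum: "inj_on v A \<Longrightarrow> inj_on (swap_sum \<circ> v) A" "inj_on v A \<Longrightarrow> inj_on (\<lambda>i. swap_sum (v i)) A"
  using comp_inj_on[OF _ inj_swap_sum] by (auto simp: o_def)

lemma lsum_0: "inj_on w (wires N) \<Longrightarrow> inj_on (lsum 0 v N w) (wires N)" "lsum 0 v N w ` wires N = {} <+> w ` wires N"
   "inj_on w (wires N) \<Longrightarrow> inj_on (lsum N w 0 v) (wires N)" "lsum N w 0 v ` wires N = w ` wires N <+> {}"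
  using lsum_inj[of v 0 w N] lsum_image[of 0 v N w] lsum_inj[of w N v 0] lsum_image[of N w 0 v] by simp_all

lemma image_labels:
  "v ` A = (P <+> Q) <+> T \<Longrightarrow> (\<lambda>x. reassoc (v x)) ` A = P <+> (Q <+> T)"
  "w ` A = P' <+> Q' \<Longrightarrow> (\<lambda>x. swap_sum (w x)) ` A = Q' <+> P'"
  "u ` A = S <+> S' \<Longrightarrow> (\<lambda>x. map_sum f g (u x)) ` A = f ` S <+> g ` S'"
  using image_image[of reassoc v A] image_image[of swap_sum w A] image_image[of "map_sum f g" u A]
  by (simp_all add: reassoc_image swap_sum_image map_sum_image del: image_image)

lemma image_labels':
  "v ` A = (P <+> Q) <+> T \<Longrightarrow> (reassoc \<circ> v) ` A = P <+> (Q <+> T)"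
  "w ` A = P' <+> Q' \<Longrightarrow> (swap_sum \<circ> w) ` A = Q' <+> P'"
  "u ` A = S <+> S' \<Longrightarrow> (map_sum f g \<circ> u) ` A = f ` S <+> g ` S'"
  using image_labels(1)[of v A P Q T] image_labels(2)[of w A P' Q'] image_labels(3)[of u A S S' f g] by (simp_all add: o_def)

lemma inj_on_comp_map_sum: assumes "inj_on v A" "inj g"
  shows "inj_on (map_sum id g \<circ> v) A" "inj_on (\<lambda>i. map_sum id g (v i)) A"
proof -
  have "inj (map_sum id g)" using assms(2) by (simp add: sum.inj_map)
  then show "inj_on (map_sum id g \<circ> v) A" using assms(1) by (intro comp_inj_on) (auto intro: inj_on_subset)
  then show "inj_on (\<lambda>i. map_sum id g (v i)) A" by (simp add: o_def)
qed

lemma inj_map_sum_id: "inj g \<Longrightarrow> inj_on (map_sum id g) A"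
  using sum.inj_map[of id g] inj_on_subset by auto

lemma Inl_Inr_image_Plus: "Inr ` B \<subseteq> {} <+> B" "Inl ` B \<subseteq> B <+> {}" by auto

lemma Plus_subset_iff: "A <+> B \<subseteq> A' <+> B' \<longleftrightarrow> A \<subseteq> A' \<and> B \<subseteq> B'" by auto

lemmas labels = Plus_subset_iff Inl_Inr_image_Plus lsum_0 lsum_inj lsum_image image_labels image_labels' reassoc_image swap_sum_image map_sum_image inj_on_comp_map_sum inj_map_sum_id
  inj_on_comp_reassoc inj_on_comp_swap_sum inj_reassoc inj_swap_sum inj_map_sum

lemma FI_assoc: assumes "inj_on a (wires L)" "inj_on b (wires M)" "inj_on c (wires N)"
  shows "assoc FI L M N = R (L + M + N) (reassoc \<circ> lsum (L + M) (lsum L a M b) N c) (L + (M + N)) (lsum L a (M + N) (lsum M b N c))"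
proof -
  have 1: "(case split (L + M) N i of Inl u \<Rightarrow> (case split L M u of Inl x \<Rightarrow> Inl x | Inr y \<Rightarrow> Inr (Inl y)) | Inr z \<Rightarrow> Inr (Inr z))
     = (reassoc \<circ> lsum (L + M) (lsum L id M id) N id) i" for i
    by (auto simp: lsum_def split: sum.split)
  have 2: "map_sum id (split M N) (split L (M + N) i) = lsum L id (M + N) (lsum M id N id) i" for i
    unfolding lsum_id by (simp add: lsum_def)
  have "assoc FI L M N = R (L + M + N) (reassoc \<circ> lsum (L + M) (lsum L id M id) N id) (L + (M + N)) (lsum L id (M + N) (lsum M id N id))"
    unfolding 1[symmetric, abs_def] 2[symmetric, abs_def] by (simp add: Free_inf_def Let_def)
  also have "\<dots> = R (L + M + N) (reassoc \<circ> lsum (L + M) (lsum L a M b) N c) (L + (M + N)) (lsum L a (M + N) (lsum M b N c))"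
  proof (rule R_map[where h = "map_sum a (map_sum b c)", symmetric])
    show "(reassoc \<circ> lsum (L + M) (lsum L a M b) N c) i = map_sum a (map_sum b c) ((reassoc \<circ> lsum (L + M) (lsum L id M id) N id) i)" for i
      by (simp add: reassoc_map_sum lsum_def[abs_def] sum.map_comp o_def)
    show "lsum L a (M + N) (lsum M b N c) i = map_sum a (map_sum b c) (lsum L id (M + N) (lsum M id N id) i)" for i
      by (simp add: lsum_def[abs_def] sum.map_comp o_def)
  qed (use assms in \<open>simp_all add: labels\<close>)
  finally show ?thesis .
qed

lemma FI_lunit: assumes "inj_on a (wires N)" shows "lunit FI N = R (0 + N) (lsum 0 e N a) N (Inr \<circ> a)"
proof -
  have "lunit FI N = R (0 + N) (lsum 0 id N id) N Inr" by (simp add: Free_inf_def Let_def lsum_id)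
  also have "\<dots> = R (0 + N) (lsum 0 e N a) N (Inr \<circ> a)"
  proof (rule R_map[where h = "map_sum e a", symmetric])
    show "lsum 0 e N a i = map_sum e a (lsum 0 id N id i)" for i by (simp add: lsum_def sum.map_comp)
  qed (use assms in \<open>simp_all add: labels\<close>)
  finally show ?thesis .
qed

lemma FI_runit: assumes "inj_on a (wires N)" shows "runit FI N = R (N + 0) (lsum N a 0 e) N (Inl \<circ> a)"
proof -
  have "runit FI N = R (N + 0) (lsum N id 0 id) N Inl" by (simp add: Free_inf_def Let_def lsum_id)
  also have "\<dots> = R (N + 0) (lsum N a 0 e) N (Inl \<circ> a)"
  proof (rule R_map[where h = "map_sum a e", symmetric])
    show "lsum N a 0 e i = map_sum a e (lsum N id 0 id i)" for i by (simp add: lsum_def sum.map_comp)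
  qed (use assms in \<open>simp_all add: labels\<close>)
  finally show ?thesis .
qed

lemma FI_braid: assumes "inj_on a (wires M)" "inj_on b (wires N)"
  shows "braid FI M N = R (M + N) (lsum M a N b) (N + M) (swap_sum \<circ> lsum N b M a)"
proof -
  have 1: "(case split N M i of Inl y \<Rightarrow> Inr y | Inr x \<Rightarrow> Inl x) = (swap_sum \<circ> lsum N id M id) i" for i
    by (auto simp: lsum_def split: sum.split)
  have "braid FI M N = R (M + N) (lsum M id N id) (N + M) (swap_sum \<circ> lsum N id M id)"
    unfolding 1[symmetric, abs_def] by (simp add: Free_inf_def Let_def lsum_id)
  also have "\<dots> = R (M + N) (lsum M a N b) (N + M) (swap_sum \<circ> lsum N b M a)"
  proof (rule R_map[where h = "map_sum a b", symmetric])
    show "lsum M a N b i = map_sum a b (lsum M id N id i)"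
      "(swap_sum \<circ> lsum N b M a) i = map_sum a b ((swap_sum \<circ> lsum N id M id) i)" for i
      by (simp_all add: lsum_def sum.map_comp swap_sum_map_sum)
  qed (use assms in \<open>simp_all add: labels\<close>)
  finally show ?thesis .
qed

text \<open>Both composites are relabelings, so it suffices to see that they give the same names to the wires of
their source and of their target.\<close>

lemma FI_pentagon: "comp FI (assoc FI A B (D + N)) (assoc FI (A + B) D N)
   = comp FI (tenM FI (ide FI A) (assoc FI B D N)) (comp FI (assoc FI A (B + D) N) (tenM FI (assoc FI A B D) (ide FI N)))"
proof -
  let ?AB = "lsum A id B id" and ?BD = "lsum B id D id" and ?DN = "lsum D id N id"
  let ?t = "lsum A id (B + (D + N)) (lsum B id (D + N) ?DN)"
  have i: "inj_on id (wires N)" for N by simp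
  have 1: "assoc FI (A + B) D N = R (A + B + D + N) (reassoc \<circ> (reassoc \<circ> lsum (A + B + D) (lsum (A + B) ?AB D id) N id))
       (A + B + (D + N)) (reassoc \<circ> lsum (A + B) ?AB (D + N) ?DN)"
    unfolding FI_assoc[OF lsum_inj[OF i i] i i, of A B D N]
    by (rule R_map[where h = reassoc, symmetric]) (simp_all add: labels)
  have 2: "assoc FI A B (D + N) = R (A + B + (D + N)) (reassoc \<circ> lsum (A + B) ?AB (D + N) ?DN) (A + (B + (D + N))) ?t"
    by (rule FI_assoc[OF i i lsum_inj[OF i i]])
  have L: "comp FI (assoc FI A B (D + N)) (assoc FI (A + B) D N)
     = R (A + B + D + N) (reassoc \<circ> (reassoc \<circ> lsum (A + B + D) (lsum (A + B) ?AB D id) N id)) (A + (B + (D + N))) ?t"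
    unfolding 1 2 by (rule R_comp) (simp_all add: labels)
  have 3: "tenM FI (assoc FI A B D) (ide FI N)
     = R (A + B + D + N) (lsum (A + B + D) (reassoc \<circ> lsum (A + B) ?AB D id) N id) (A + (B + D) + N) (lsum (A + (B + D)) (lsum A id (B + D) ?BD) N id)"
    unfolding FI_assoc[OF i i i, of A B D] R_ide[OF i, of N, symmetric] by (rule R_tensor) (simp_all add: labels)
  have 3: "tenM FI (assoc FI A B D) (ide FI N)
     = R (A + B + D + N) (map_sum id reassoc \<circ> (reassoc \<circ> lsum (A + B + D) (reassoc \<circ> lsum (A + B) ?AB D id) N id))
       (A + (B + D) + N) (map_sum id reassoc \<circ> (reassoc \<circ> lsum (A + (B + D)) (lsum A id (B + D) ?BD) N id))"
    unfolding 3 by (rule R_map[where h = "map_sum id reassoc \<circ> reassoc", symmetric])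
      (simp_all add: labels)
  have 4: "assoc FI A (B + D) N = R (A + (B + D) + N) (map_sum id reassoc \<circ> (reassoc \<circ> lsum (A + (B + D)) (lsum A id (B + D) ?BD) N id))
       (A + (B + D + N)) (map_sum id reassoc \<circ> lsum A id (B + D + N) (lsum (B + D) ?BD N id))"
    unfolding FI_assoc[OF i lsum_inj[OF i i] i, of A B D N]
    by (rule R_map[where h = "map_sum id reassoc", symmetric]) (simp_all add: labels)
  have 5: "tenM FI (ide FI A) (assoc FI B D N) = R (A + (B + D + N)) (lsum A id (B + D + N) (reassoc \<circ> lsum (B + D) ?BD N id)) (A + (B + (D + N))) ?t"
    unfolding FI_assoc[OF i i i, of B D N] R_ide[OF i, of A, symmetric] by (rule R_tensor) (simp_all add: labels)
  have e: "map_sum id reassoc \<circ> lsum A id (B + D + N) (lsum (B + D) ?BD N id) = lsum A id (B + D + N) (reassoc \<circ> lsum (B + D) ?BD N id)"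
    by (simp add: lsum_def[abs_def] fun_eq_iff sum.map_comp o_def id_def)
  have p: "map_sum id reassoc (reassoc (map_sum (reassoc \<circ> f) g x)) = reassoc (reassoc (map_sum f g x))" for f :: "nat \<Rightarrow> ((nat + nat) + nat)" and g :: "nat \<Rightarrow> nat" and x
  proof (cases x)
    case (Inl y)
    then show ?thesis by (cases "f y" rule: reassoc.cases) auto
  qed auto
  have f: "map_sum id reassoc \<circ> (reassoc \<circ> lsum (A + B + D) (reassoc \<circ> lsum (A + B) ?AB D id) N id)
     = reassoc \<circ> (reassoc \<circ> lsum (A + B + D) (lsum (A + B) ?AB D id) N id)"
    by (simp add: fun_eq_iff lsum_def[of "A + B + D"] p)
  have "comp FI (assoc FI A (B + D) N) (tenM FI (assoc FI A B D) (ide FI N))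
     = R (A + B + D + N) (reassoc \<circ> (reassoc \<circ> lsum (A + B + D) (lsum (A + B) ?AB D id) N id))
        (A + (B + D + N)) (lsum A id (B + D + N) (reassoc \<circ> lsum (B + D) ?BD N id))"
    unfolding 3 4 f e by (rule R_comp) (simp_all add: labels)
  then have "comp FI (tenM FI (ide FI A) (assoc FI B D N)) (comp FI (assoc FI A (B + D) N) (tenM FI (assoc FI A B D) (ide FI N)))
     = R (A + B + D + N) (reassoc \<circ> (reassoc \<circ> lsum (A + B + D) (lsum (A + B) ?AB D id) N id)) (A + (B + (D + N))) ?t"
    unfolding 5 by (simp only:) (rule R_comp; simp add: labels)
  then show ?thesis using L by simp
qed

lemma FI_triangle: "comp FI (tenM FI (ide FI A) (lunit FI B)) (assoc FI A 0 B) = tenM FI (runit FI A) (ide FI B)"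
proof -
  have i: "inj_on id (wires N)" for N by simp
  let ?e = "id :: nat \<Rightarrow> nat"
  have 1: "tenM FI (ide FI A) (lunit FI B) = R (A + (0 + B)) (lsum A id (0 + B) (lsum 0 ?e B id)) (A + B) (lsum A id B (Inr \<circ> id))"
    unfolding FI_lunit[OF i, of B ?e] R_ide[OF i, of A, symmetric] by (rule R_tensor) (simp_all add: labels)
  have 2: "assoc FI A 0 B = R (A + 0 + B) (reassoc \<circ> lsum (A + 0) (lsum A id 0 ?e) B id) (A + (0 + B)) (lsum A id (0 + B) (lsum 0 ?e B id))"
    by (rule FI_assoc[OF i i i])
  have 3: "comp FI (tenM FI (ide FI A) (lunit FI B)) (assoc FI A 0 B) = R (A + 0 + B) (reassoc \<circ> lsum (A + 0) (lsum A id 0 ?e) B id) (A + B) (lsum A id B (Inr \<circ> id))"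
    unfolding 1 2 by (rule R_comp) (simp_all add: labels)
  have "tenM FI (runit FI A) (ide FI B) = R (A + 0 + B) (lsum (A + 0) (lsum A id 0 ?e) B id) (A + B) (lsum A (Inl \<circ> id) B id)"
    unfolding FI_runit[OF i, of A ?e] R_ide[OF i, of B, symmetric] by (rule R_tensor) (simp_all add: labels)
  also have "\<dots> = R (A + 0 + B) (reassoc \<circ> lsum (A + 0) (lsum A id 0 ?e) B id) (A + B) (lsum A id B (Inr \<circ> id))"
  proof (rule R_map[where h = reassoc, symmetric])
    show "lsum A id B (Inr \<circ> id) j = reassoc (lsum A (Inl \<circ> id) B id j)" for j :: nat
      by (cases "split A B j") (auto simp: lsum_def)
  qed (simp_all add: labels)
  finally show ?thesis using 3 by simp
qed

lemma FI_hexagon: "comp FI (assoc FI B D A) (comp FI (braid FI A (B + D)) (assoc FI A B D))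
   = comp FI (tenM FI (ide FI B) (braid FI A D)) (comp FI (assoc FI B A D) (tenM FI (braid FI A B) (ide FI D)))"
proof -
  have i: "inj_on id (wires N)" for N by simp
  let ?AB = "lsum A id B id" and ?BD = "lsum B id D id" and ?BA = "lsum B id A id" and ?DA = "lsum D id A id" and ?AD = "lsum A id D id"
  \<comment> \<open>All names are brought to the form \<open>b + (d + a)\<close>, that of the target.\<close>
  let ?t = "lsum B id (D + A) ?DA"
  have 1: "assoc FI A B D = R (A + B + D) (reassoc \<circ> (swap_sum \<circ> (reassoc \<circ> lsum (A + B) ?AB D id))) (A + (B + D)) (reassoc \<circ> (swap_sum \<circ> lsum A id (B + D) ?BD))"
    unfolding FI_assoc[OF i i i, of A B D]
    by (rule R_map[where h = "reassoc \<circ> swap_sum", symmetric]) (simp_all add: labels)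
  have 2: "braid FI A (B + D) = R (A + (B + D)) (reassoc \<circ> (swap_sum \<circ> lsum A id (B + D) ?BD)) (B + D + A) (reassoc \<circ> lsum (B + D) ?BD A id)"
    unfolding FI_braid[OF i lsum_inj[OF i i], of A B D]
  proof (rule R_map[where h = "reassoc \<circ> swap_sum", symmetric])
    have s: "swap_sum (swap_sum x) = x" for x :: "'a + 'b" by (cases x) auto
    show "(reassoc \<circ> lsum (B + D) ?BD A id) j = (reassoc \<circ> swap_sum) ((swap_sum \<circ> lsum (B + D) ?BD A id) j)" for j by (simp add: s)
  qed (simp_all add: labels)
  have 3: "assoc FI B D A = R (B + D + A) (reassoc \<circ> lsum (B + D) ?BD A id) (B + (D + A)) ?t"
    by (rule FI_assoc[OF i i i])
  have "comp FI (braid FI A (B + D)) (assoc FI A B D) = R (A + B + D) (reassoc \<circ> (swap_sum \<circ> (reassoc \<circ> lsum (A + B) ?AB D id))) (B + D + A) (reassoc \<circ> lsum (B + D) ?BD A id)"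
    unfolding 1 2 by (rule R_comp) (simp_all add: labels)
  then have L: "comp FI (assoc FI B D A) (comp FI (braid FI A (B + D)) (assoc FI A B D))
      = R (A + B + D) (reassoc \<circ> (swap_sum \<circ> (reassoc \<circ> lsum (A + B) ?AB D id))) (B + (D + A)) ?t"
    unfolding 3 by (simp only:) (rule R_comp; simp add: labels)
  have 4: "tenM FI (braid FI A B) (ide FI D) = R (A + B + D) (lsum (A + B) ?AB D id) (B + A + D) (lsum (B + A) (swap_sum \<circ> ?BA) D id)"
    unfolding FI_braid[OF i i, of A B] R_ide[OF i, of D, symmetric] by (rule R_tensor) (simp_all add: labels)
  have 4: "tenM FI (braid FI A B) (ide FI D) = R (A + B + D) (reassoc \<circ> (swap_sum \<circ> (reassoc \<circ> lsum (A + B) ?AB D id)))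
       (B + A + D) (map_sum id swap_sum \<circ> (reassoc \<circ> lsum (B + A) ?BA D id))"
    unfolding 4
  proof (rule R_map[where h = "reassoc \<circ> (swap_sum \<circ> reassoc)", symmetric])
    have s: "map_sum id swap_sum (reassoc x) = reassoc (swap_sum (reassoc (map_sum swap_sum id x)))" for x :: "(nat + nat) + nat"
      by (cases x rule: reassoc.cases) auto
    show "(map_sum id swap_sum \<circ> (reassoc \<circ> lsum (B + A) ?BA D id)) j = (reassoc \<circ> (swap_sum \<circ> reassoc)) (lsum (B + A) (swap_sum \<circ> ?BA) D id j)" for j
      by (simp add: s lsum_def[of "B + A"] sum.map_comp)
  qed (simp_all add: labels)
  have 5: "assoc FI B A D = R (B + A + D) (map_sum id swap_sum \<circ> (reassoc \<circ> lsum (B + A) ?BA D id)) (B + (A + D)) (map_sum id swap_sum \<circ> lsum B id (A + D) ?AD)"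
    unfolding FI_assoc[OF i i i, of B A D]
    by (rule R_map[where h = "map_sum id swap_sum", symmetric]) (simp_all add: labels)
  have 6: "tenM FI (ide FI B) (braid FI A D) = R (B + (A + D)) (lsum B id (A + D) ?AD) (B + (D + A)) (lsum B id (D + A) (swap_sum \<circ> ?DA))"
    unfolding FI_braid[OF i i, of A D] R_ide[OF i, of B, symmetric] by (rule R_tensor) (simp_all add: labels)
  have 6: "tenM FI (ide FI B) (braid FI A D) = R (B + (A + D)) (map_sum id swap_sum \<circ> lsum B id (A + D) ?AD) (B + (D + A)) ?t"
    unfolding 6
  proof (rule R_map[where h = "map_sum id swap_sum", symmetric])
    have s: "map_sum id swap_sum (map_sum f (swap_sum \<circ> g) x) = map_sum f g x" for f :: "nat \<Rightarrow> nat" and g :: "nat \<Rightarrow> nat + nat" and x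
    proof (cases x)
      case (Inr y)
      then show ?thesis by (cases "g y") auto
    qed auto
    show "?t j = map_sum id swap_sum (lsum B id (D + A) (swap_sum \<circ> ?DA) j)" for j
      by (simp add: s lsum_def[of B])
  qed (simp_all add: labels)
  have "comp FI (assoc FI B A D) (tenM FI (braid FI A B) (ide FI D))
      = R (A + B + D) (reassoc \<circ> (swap_sum \<circ> (reassoc \<circ> lsum (A + B) ?AB D id))) (B + (A + D)) (map_sum id swap_sum \<circ> lsum B id (A + D) ?AD)"
    unfolding 4 5 by (rule R_comp) (simp_all add: labels)
  then have "comp FI (tenM FI (ide FI B) (braid FI A D)) (comp FI (assoc FI B A D) (tenM FI (braid FI A B) (ide FI D)))
     = R (A + B + D) (reassoc \<circ> (swap_sum \<circ> (reassoc \<circ> lsum (A + B) ?AB D id))) (B + (D + A)) ?t"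
    unfolding 6 by (simp only:) (rule R_comp; simp add: labels)
  then show ?thesis using L by simp
qed

declare expl_simps [simp del]

lemma K_obj [simp]: "X N \<in> obj K" "munit K \<in> obj K"
  by (simp_all add: K_simps)

abbreviation J where "J \<equiv> join split \<Sigma> E"
abbreviation U where "U \<equiv> unjoin split \<Sigma> E"

lemma join_typed [simp]: "arr K (J M N)" "source K (J M N) = tenO K (X M) (X N)" "target K (J M N) = X (M + N)"
   "arr K (U M N)" "source K (U M N) = X (M + N)" "target K (U M N) = tenO K (X M) (X N)"
   "comp K (U M N) (J M N) = ide K (tenO K (X M) (X N))" "comp K (J M N) (U M N) = ide K (X (M + N))"
proof -
  have i: "inj_on id (wires N)" for N by simp
  note w = XX_wired[OF i i, of M N] X_wired_sum[OF i i, of M N]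
  have "J M N \<in> hom K (tenO K (X M) (X N)) (X (M + N))" "U M N \<in> hom K (X (M + N)) (tenO K (X M) (X N))"
    unfolding join_rewire[OF i i] K_simps using rewire_Hom[OF w(1,3)] rewire_Hom[OF w(3,1)] w by auto
  then show "arr K (J M N)" "source K (J M N) = tenO K (X M) (X N)" "target K (J M N) = X (M + N)"
   "arr K (U M N)" "source K (U M N) = X (M + N)" "target K (U M N) = tenO K (X M) (X N)"
    by (simp_all add: K.hom_iff)
  show "comp K (U M N) (J M N) = ide K (tenO K (X M) (X N))" "comp K (J M N) (U M N) = ide K (X (M + N))"
    unfolding join_rewire[OF i i] K_simps
    using rewire_comp[OF w(1,3,1)] rewire_comp[OF w(3,1,3)] rewire_ide[OF w(1)] rewire_ide[OF w(3)] w by simp_all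
qed

lemma UJ_tail [simp]: "arr K k \<Longrightarrow> target K k = tenO K (X M) (X N) \<Longrightarrow> comp K (U M N) (comp K (J M N) k) = k"
  "arr K k \<Longrightarrow> target K k = X (M + N) \<Longrightarrow> comp K (J M N) (comp K (U M N) k) = k"
  using K.comp_assoc'[of k "J M N" "U M N"] K.comp_assoc'[of k "U M N" "J M N"] by simp_all

text \<open>The unit of the explicit category and the object \<open>0\<close> have no wires at all.\<close>

definition V where "V = rewire (diag_unit (Free \<Sigma> E) 0) (\<lambda>_. [] :: nat list) (X 0) (wX 0 id)"
definition V' where "V' = rewire (X 0) (wX 0 id) (diag_unit (Free \<Sigma> E) 0) (\<lambda>_. [] :: nat list)"

lemma V_typed [simp]: "arr K V" "source K V = munit K" "target K V = X 0" "arr K V'" "source K V' = X 0" "target K V' = munit K"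
  "comp K V' V = ide K (munit K)" "comp K V V' = ide K (X 0)"
proof -
  have i: "inj_on id (wires N)" for N by simp
  note w = X_wired(1,2)[OF i, of 0] wired_unit[of 0] wset_unit[of 0]
  have "V \<in> hom K (munit K) (X 0)" "V' \<in> hom K (X 0) (munit K)"
    unfolding K_simps V_def V'_def using rewire_Hom[OF w(3,1)] rewire_Hom[OF w(1,3)] w by auto
  then show "arr K V" "source K V = munit K" "target K V = X 0" "arr K V'" "source K V' = X 0" "target K V' = munit K"
    by (simp_all add: K.hom_iff)
  have "fcomp V' V = rewire (diag_unit (Free \<Sigma> E) 0) (\<lambda>_. [] :: nat list) (diag_unit (Free \<Sigma> E) 0) (\<lambda>_. [])"
    unfolding V_def V'_def by (rule rewire_comp[OF w(3,1,3)]) (simp_all only: w(2,4) wires_simps image_empty order_refl)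
  then show "comp K V' V = ide K (munit K)" unfolding K_simps rewire_ide[OF w(3)] .
  have "fcomp V V' = rewire (X 0) (wX 0 id) (X 0) (wX 0 id)"
    unfolding V_def V'_def by (rule rewire_comp[OF w(1,3,1)]) (simp_all only: w(2,4) wires_simps image_empty order_refl)
  then show "comp K V V' = ide K (X 0)" unfolding K_simps rewire_ide[OF w(1)] .
qed

abbreviation mor :: "'g inf_mor \<Rightarrow> (nat, nat, 'g tm set) fam set" where "mor f \<equiv> snd (snd f)"

lemma mor_R: "mor (R M v N w) = rewire (X M) (wX M v) (X N) (wX N w)"
  by (simp add: R_rewire)

text \<open>The three coherence conditions on a symmetric monoidal functor, for the inclusion of \<open>Free_inf\<close> in the
explicit category with the reindexings \<open>J\<close> as comparison.  All morphisms involved are rewirings, and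
both sides connect the same names.\<close>

lemma mor_assoc: "comp K (mor (assoc FI L M N)) (comp K (J (L + M) N) (tenM K (J L M) (ide K (X N))))
   = comp K (J L (M + N)) (comp K (tenM K (ide K (X L)) (J M N)) (assoc K (X L) (X M) (X N)))"
proof -
  have i: "inj_on id (wires N)" for N by simp
  let ?l = "wX L id" and ?m = "wX M id" and ?n = "wX N id"
  let ?LM = "lsum L id M id" and ?MN = "lsum M id N id"
  let ?L = "diag_tensor (Free \<Sigma> E) (XX L M) (X N)" and ?R = "diag_tensor (Free \<Sigma> E) (X L) (XX M N)"
  note x = X_wired(1)[OF i] and s = X_wired(2)[OF i]
  note lm = XX_wired[OF i i, of L M] and mn = XX_wired[OF i i, of M N]
  note LM = X_wired_sum[OF i i, of L M] and MN = X_wired_sum[OF i i, of M N]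
  note a = wired_wsum[OF lm(1) x, of N, unfolded lm(2) s] and b = wired_wsum[OF x mn(1), of L, unfolded mn(2) s]
  note a' = wired_wsum[OF LM(1) x, of N, unfolded LM(2) s] and b' = wired_wsum[OF x MN(1), of L, unfolded MN(2) s]
  note c = X_wired_sum[OF lsum_inj[OF i i] i, of L M N, unfolded lsum_image] and d = X_wired_sum[OF i lsum_inj[OF i i], of L M N, unfolded lsum_image]
  have ra: "wired ?L (map reassoc \<circ> wsum (XX L M) (wXX L id M id) (X N) ?n)" "wset ?L (map reassoc \<circ> wsum (XX L M) (wXX L id M id) (X N) ?n) = wset ?R (wsum (X L) ?l (XX M N) (wXX M id N id))"
    using wired_map[of _ _ reassoc "map reassoc \<circ> wsum (XX L M) (wXX L id M id) (X N) ?n", OF a(1) inj_reassoc] a(2) b(2) by (simp_all add: reassoc_image)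
  have rc: "wired (X (L + M + N)) (wX (L + M + N) (reassoc \<circ> lsum (L + M) ?LM N id))" "wset (X (L + M + N)) (wX (L + M + N) (reassoc \<circ> lsum (L + M) ?LM N id)) = wset ?R (wsum (X L) ?l (XX M N) (wXX M id N id))"
    using X_wired[of "reassoc \<circ> lsum (L + M) ?LM N id" "L + M + N"] b(2) by (simp_all add: labels)
  have 1: "tenM K (J L M) (ide K (X N)) = rewire ?L (wsum (XX L M) (wXX L id M id) (X N) ?n) (diag_tensor (Free \<Sigma> E) (X (L + M)) (X N)) (wsum (X (L + M)) (wX (L + M) ?LM) (X N) ?n)"
    unfolding K_simps join_rewire(1)[OF i i] rewire_ide[OF x, of N, symmetric] by (rule rewire_tensor[OF lm(1) LM(1) x x]) (use lm LM in auto)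
  have 2: "comp K (J (L + M) N) (tenM K (J L M) (ide K (X N))) = rewire ?L (wsum (XX L M) (wXX L id M id) (X N) ?n) (X (L + M + N)) (wX (L + M + N) (lsum (L + M) ?LM N id))"
    unfolding 1 unfolding K_simps join_rewire(1)[OF lsum_inj[OF i i] i] by (rule rewire_comp[OF a(1) a'(1) c(1)]) (use a a' c in auto)
  have 3: "comp K (J (L + M) N) (tenM K (J L M) (ide K (X N))) = rewire ?L (map reassoc \<circ> wsum (XX L M) (wXX L id M id) (X N) ?n) (X (L + M + N)) (wX (L + M + N) (reassoc \<circ> lsum (L + M) ?LM N id))"
    unfolding 2 by (rule rewire_map[where h = reassoc, OF a(1) c(1), symmetric]) (use a c inj_reassoc in auto)
  have 4: "comp K (mor (assoc FI L M N)) (comp K (J (L + M) N) (tenM K (J L M) (ide K (X N)))) = rewire ?L (map reassoc \<circ> wsum (XX L M) (wXX L id M id) (X N) ?n) (X (L + (M + N))) (wX (L + (M + N)) (lsum L id (M + N) ?MN))"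
    unfolding 3 unfolding mor_R FI_assoc[OF i i i] K_simps by (rule rewire_comp[OF ra(1) rc(1) d(1)]) (use ra rc b d in auto)
  have 5: "tenM K (ide K (X L)) (J M N) = rewire ?R (wsum (X L) ?l (XX M N) (wXX M id N id)) (diag_tensor (Free \<Sigma> E) (X L) (X (M + N))) (wsum (X L) ?l (X (M + N)) (wX (M + N) ?MN))"
    unfolding K_simps join_rewire(1)[OF i i] rewire_ide[OF x, of L, symmetric] by (rule rewire_tensor[OF x x mn(1) MN(1)]) (use mn MN in auto)
  have 6: "comp K (tenM K (ide K (X L)) (J M N)) (assoc K (X L) (X M) (X N)) = rewire ?L (map reassoc \<circ> wsum (XX L M) (wXX L id M id) (X N) ?n) (diag_tensor (Free \<Sigma> E) (X L) (X (M + N))) (wsum (X L) ?l (X (M + N)) (wX (M + N) ?MN))"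
    unfolding 5 expl_structure fassoc_rewire[OF x x x] unfolding K_simps by (rule rewire_comp[OF ra(1) b(1) b'(1)]) (use ra b b' in auto)
  have 7: "comp K (J L (M + N)) (comp K (tenM K (ide K (X L)) (J M N)) (assoc K (X L) (X M) (X N))) = rewire ?L (map reassoc \<circ> wsum (XX L M) (wXX L id M id) (X N) ?n) (X (L + (M + N))) (wX (L + (M + N)) (lsum L id (M + N) ?MN))"
    unfolding 6 unfolding K_simps join_rewire(1)[OF i lsum_inj[OF i i]] by (rule rewire_comp[OF ra(1) b'(1) d(1)]) (use ra b b' d in auto)
  show ?thesis using 4 7 by simp
qed

lemma mor_braid: "comp K (mor (braid FI M N)) (J M N) = comp K (J N M) (braid K (X M) (X N))"
proof -
  have i: "inj_on id (wires N)" for N by simp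
  note x = X_wired(1)[OF i] and s = X_wired(2)[OF i]
  note mn = XX_wired[OF i i, of M N] and nm = XX_wired[OF i i, of N M] and MN = X_wired_sum[OF i i, of M N] and NM = X_wired_sum[OF i i, of N M]
  have w: "wired (XX M N) (map swap_sum \<circ> wXX M id N id)" "wset (XX M N) (map swap_sum \<circ> wXX M id N id) = wires N <+> wires M"
    using wired_map[of _ _ swap_sum "map swap_sum \<circ> wXX M id N id", OF mn(1) inj_swap_sum] mn(2) by (simp_all add: swap_sum_image)
  have w': "wired (X (M + N)) (wX (M + N) (swap_sum \<circ> lsum M id N id))" "wset (X (M + N)) (wX (M + N) (swap_sum \<circ> lsum M id N id)) = wires N <+> wires M"
    using X_wired[of "swap_sum \<circ> lsum M id N id" "M + N"] by (simp_all add: labels)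
  have b: "mor (braid FI M N) = rewire (X (M + N)) (wX (M + N) (swap_sum \<circ> lsum M id N id)) (X (N + M)) (wX (N + M) (lsum N id M id))"
  proof -
    have ss: "swap_sum (swap_sum y) = y" for y :: "'a + 'b" by (cases y) auto
    have "braid FI M N = R (M + N) (swap_sum \<circ> lsum M id N id) (N + M) (lsum N id M id)"
      unfolding FI_braid[OF i i] by (rule R_map[where h = swap_sum]) (simp_all add: labels ss)
    then show ?thesis by (simp add: mor_R)
  qed
  have "J M N = rewire (XX M N) (map swap_sum \<circ> wXX M id N id) (X (M + N)) (wX (M + N) (swap_sum \<circ> lsum M id N id))"
    unfolding join_rewire(1)[OF i i] by (rule rewire_map[where h = swap_sum, OF mn(1) MN(1), symmetric]) (use mn MN inj_swap_sum in auto)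
  then have "comp K (mor (braid FI M N)) (J M N) = rewire (XX M N) (map swap_sum \<circ> wXX M id N id) (X (N + M)) (wX (N + M) (lsum N id M id))"
    unfolding b K_simps using rewire_comp[OF w(1) w'(1) NM(1)] w w' NM by simp
  moreover have "comp K (J N M) (braid K (X M) (X N)) = rewire (XX M N) (map swap_sum \<circ> wXX M id N id) (X (N + M)) (wX (N + M) (lsum N id M id))"
    unfolding expl_structure fbraid_rewire[OF x x] K_simps join_rewire(1)[OF i i] by (rule rewire_comp[OF w(1) nm(1) NM(1)]) (use w nm NM in auto)
  ultimately show ?thesis by simp
qed

lemma mor_unit: "comp K (mor (lunit FI N)) (comp K (J 0 N) (tenM K V (ide K (X N)))) = lunit K (X N)"
   "comp K (mor (runit FI N)) (comp K (J N 0) (tenM K (ide K (X N)) V)) = runit K (X N)"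
proof -
  have i: "inj_on id (wires N)" for N by simp
  let ?I = "diag_unit (Free \<Sigma> E) 0" and ?e = "\<lambda>_. [] :: nat list"
  note x = X_wired(1)[OF i] and s = X_wired(2)[OF i]
  note u = wired_unit[where s = "0 :: nat" and 'b = nat] wset_unit[where s = "0 :: nat" and 'b = nat]
  note a = wired_wsum[OF u(1) x[of N], unfolded u(2) s] and a' = wired_wsum[OF x[of N] u(1), unfolded u(2) s]
  note b = XX_wired[OF i i, of 0 N] XX_wired[OF i i, of N 0] and B = X_wired_sum[OF i i, of 0 N] X_wired_sum[OF i i, of N 0]
  have r: "wired (X N) (wX N (Inr \<circ> id :: _ \<Rightarrow> nat + nat))" "wset (X N) (wX N (Inr \<circ> id :: _ \<Rightarrow> nat + nat)) = {} <+> wires N"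
    using X_wired[of "Inr \<circ> id :: _ \<Rightarrow> nat + nat" N] by auto
  have l: "wired (X N) (wX N (Inl \<circ> id :: _ \<Rightarrow> nat + nat))" "wset (X N) (wX N (Inl \<circ> id :: _ \<Rightarrow> nat + nat)) = wires N <+> {}"
    using X_wired[of "Inl \<circ> id :: _ \<Rightarrow> nat + nat" N] by auto
  have 1: "tenM K V (ide K (X N)) = rewire (diag_tensor (Free \<Sigma> E) ?I (X N)) (wsum ?I ?e (X N) (wX N id)) (XX 0 N) (wXX 0 id N id)"
    unfolding K_simps V_def rewire_ide[OF x, of N, symmetric] by (rule rewire_tensor[OF u(1) x x x]) (use u s in auto)
  have 2: "comp K (J 0 N) (tenM K V (ide K (X N))) = rewire (diag_tensor (Free \<Sigma> E) ?I (X N)) (wsum ?I ?e (X N) (wX N id)) (X (0 + N)) (wX (0 + N) (lsum 0 id N id))"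
    unfolding 1 unfolding K_simps join_rewire(1)[OF i i] by (rule rewire_comp[OF a(1) b(1) B(1)]) (use a b B in auto)
  have "comp K (mor (lunit FI N)) (comp K (J 0 N) (tenM K V (ide K (X N)))) = rewire (diag_tensor (Free \<Sigma> E) ?I (X N)) (wsum ?I ?e (X N) (wX N id)) (X N) (wX N (Inr \<circ> id))"
    unfolding 2 unfolding FI_lunit[OF i, of N id] mor_R K_simps by (rule rewire_comp[OF a(1) B(1) r(1)]) (use a B r in auto)
  moreover have "lunit K (X N) = rewire (diag_tensor (Free \<Sigma> E) ?I (X N)) (wsum ?I ?e (X N) (wX N id)) (X N) (map Inr \<circ> wX N id)"
    unfolding expl_structure by (rule funit_rewire(1)[OF x X_aitp(2)])
  ultimately show "comp K (mor (lunit FI N)) (comp K (J 0 N) (tenM K V (ide K (X N)))) = lunit K (X N)" by (simp add: o_def)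
  have 3: "tenM K (ide K (X N)) V = rewire (diag_tensor (Free \<Sigma> E) (X N) ?I) (wsum (X N) (wX N id) ?I ?e) (XX N 0) (wXX N id 0 id)"
    unfolding K_simps V_def rewire_ide[OF x, of N, symmetric] by (rule rewire_tensor[OF x x u(1) x]) (use u s in auto)
  have 4: "comp K (J N 0) (tenM K (ide K (X N)) V) = rewire (diag_tensor (Free \<Sigma> E) (X N) ?I) (wsum (X N) (wX N id) ?I ?e) (X (N + 0)) (wX (N + 0) (lsum N id 0 id))"
    unfolding 3 unfolding K_simps join_rewire(1)[OF i i] by (rule rewire_comp[OF a'(1) b(3) B(3)]) (use a' b B in auto)
  have "comp K (mor (runit FI N)) (comp K (J N 0) (tenM K (ide K (X N)) V)) = rewire (diag_tensor (Free \<Sigma> E) (X N) ?I) (wsum (X N) (wX N id) ?I ?e) (X N) (wX N (Inl \<circ> id))"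
    unfolding 4 unfolding FI_runit[OF i, of N id] mor_R K_simps by (rule rewire_comp[OF a'(1) B(3) l(1)]) (use a' B l in auto)
  moreover have "runit K (X N) = rewire (diag_tensor (Free \<Sigma> E) (X N) ?I) (wsum (X N) (wX N id) ?I ?e) (X N) (map Inl \<circ> wX N id)"
    unfolding expl_structure by (rule funit_rewire(2)[OF x X_aitp(2)])
  ultimately show "comp K (mor (runit FI N)) (comp K (J N 0) (tenM K (ide K (X N)) V)) = runit K (X N)" by (simp add: o_def)
qed

lemma FI_homE: assumes "f \<in> hom FI M N"
  obtains a where "f = (M, N, a)" "arr K a" "source K a = X M" "target K a = X N"
proof -
  obtain a where "f = (M, N, a)" "a \<in> hom K (X M) (X N)" using assms by (auto simp: FI_simps K_simps)
  then show thesis using that by (simp add: K.hom_iff)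
qed

lemma FI_hom: "(M, N, a) \<in> hom FI M' N' \<longleftrightarrow> M' = M \<and> N' = N \<and> arr K a \<and> source K a = X M \<and> target K a = X N"
  using K.hom_iff[of "X M" "X N" a] by (auto simp: FI_simps K_simps)

lemma FI_comp: "comp FI (L, N, b) (M, L', a) = (M, N, comp K b a)"
  "ide FI N = (N, N, ide K (X N))"
  "tenM FI (M, N, a) (M', N', a') = (M + M', N + N', comp K (J N N') (comp K (tenM K a a') (U M M')))"
  by (simp_all add: FI_simps K_simps)

lemma mor_typed: "arr K (mor (assoc FI L M N))" "source K (mor (assoc FI L M N)) = X (L + M + N)" "target K (mor (assoc FI L M N)) = X (L + (M + N))"
  "arr K (mor (braid FI M N))" "source K (mor (braid FI M N)) = X (M + N)" "target K (mor (braid FI M N)) = X (N + M)"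
  "arr K (mor (lunit FI N))" "source K (mor (lunit FI N)) = X (0 + N)" "target K (mor (lunit FI N)) = X N"
  "arr K (mor (runit FI N))" "source K (mor (runit FI N)) = X (N + 0)" "target K (mor (runit FI N)) = X N"
  and structure_eq: "assoc FI L M N = (L + M + N, L + (M + N), mor (assoc FI L M N))" "braid FI M N = (M + N, N + M, mor (braid FI M N))"
   "lunit FI N = (0 + N, N, mor (lunit FI N))" "runit FI N = (N + 0, N, mor (runit FI N))"
proof -
  have i: "inj_on id (wires N)" for N by simp
  have h: "assoc FI L M N \<in> hom FI (L + M + N) (L + (M + N))" "braid FI M N \<in> hom FI (M + N) (N + M)"
    "lunit FI N \<in> hom FI (0 + N) N" "runit FI N \<in> hom FI (N + 0) N"
    unfolding FI_assoc[OF i i i] FI_braid[OF i i] FI_lunit[OF i, of N id] FI_runit[OF i, of N id]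
    by (rule R_hom; simp add: labels)+
  obtain a where a: "assoc FI L M N = (L + M + N, L + (M + N), a)" "arr K a" "source K a = X (L + M + N)" "target K a = X (L + (M + N))"
    by (rule FI_homE[OF h(1)])
  obtain b where b: "braid FI M N = (M + N, N + M, b)" "arr K b" "source K b = X (M + N)" "target K b = X (N + M)"
    by (rule FI_homE[OF h(2)])
  obtain l where l: "lunit FI N = (0 + N, N, l)" "arr K l" "source K l = X (0 + N)" "target K l = X N"
    by (rule FI_homE[OF h(3)])
  obtain r where r: "runit FI N = (N + 0, N, r)" "arr K r" "source K r = X (N + 0)" "target K r = X N"
    by (rule FI_homE[OF h(4)])
  show "arr K (mor (assoc FI L M N))" "source K (mor (assoc FI L M N)) = X (L + M + N)" "target K (mor (assoc FI L M N)) = X (L + (M + N))"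
    "arr K (mor (braid FI M N))" "source K (mor (braid FI M N)) = X (M + N)" "target K (mor (braid FI M N)) = X (N + M)"
    "arr K (mor (lunit FI N))" "source K (mor (lunit FI N)) = X (0 + N)" "target K (mor (lunit FI N)) = X N"
    "arr K (mor (runit FI N))" "source K (mor (runit FI N)) = X (N + 0)" "target K (mor (runit FI N)) = X N"
    "assoc FI L M N = (L + M + N, L + (M + N), mor (assoc FI L M N))" "braid FI M N = (M + N, N + M, mor (braid FI M N))"
    "lunit FI N = (0 + N, N, mor (lunit FI N))" "runit FI N = (N + 0, N, mor (runit FI N))"
    using a b l r by simp_all
qed

declare mor_typed [simp]

lemma FI_structure_comp:
  "comp FI (assoc FI L M N) (A, B, f) = (A, L + (M + N), comp K (mor (assoc FI L M N)) f)"
  "comp FI (A, B, f) (assoc FI L M N) = (L + M + N, B, comp K f (mor (assoc FI L M N)))"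
  "comp FI (braid FI M N) (A, B, f) = (A, N + M, comp K (mor (braid FI M N)) f)"
  "comp FI (A, B, f) (braid FI M N) = (M + N, B, comp K f (mor (braid FI M N)))"
  "comp FI (lunit FI N) (A, B, f) = (A, N, comp K (mor (lunit FI N)) f)"
  "comp FI (A, B, f) (lunit FI N) = (0 + N, B, comp K f (mor (lunit FI N)))"
  "comp FI (runit FI N) (A, B, f) = (A, N, comp K (mor (runit FI N)) f)"
  "comp FI (A, B, f) (runit FI N) = (N + 0, B, comp K f (mor (runit FI N)))"
  by (subst structure_eq, rule FI_comp(1))+

lemma K_cancel: assumes "arr K f" "arr K g" "arr K i" "arr K j" "source K f = target K i" "source K g = target K i" "source K i = target K j" "target K i = source K j"
    "comp K i j = ide K (target K i)" "comp K f i = comp K g i"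
  shows "f = g"
proof -
  have "f = comp K f (comp K i j)" using assms(1,5,9) by simp
  also have "\<dots> = comp K (comp K f i) j" by (rule K.comp_assoc'[symmetric]) (use assms(1-8) in auto)
  also have "\<dots> = comp K g (comp K i j)" unfolding assms(10) by (rule K.comp_assoc') (use assms(1-8) in auto)
  finally show ?thesis using assms(2,6,9) by simp
qed

text \<open>Conjugated by the reindexings, a structural isomorphism becomes that of the explicit category, whose
naturality therefore carries over; the same goes for the symmetry and the unitors.\<close>

lemma FI_assoc_natural: assumes "f \<in> hom FI L L'" "g \<in> hom FI M M'" "h \<in> hom FI N N'"
  shows "comp FI (assoc FI L' M' N') (tenM FI (tenM FI f g) h) = comp FI (tenM FI f (tenM FI g h)) (assoc FI L M N)"
proof -
  obtain a where a: "f = (L, L', a)" "arr K a" "source K a = X L" "target K a = X L'" using FI_homE[OF assms(1)] .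
  obtain b where b: "g = (M, M', b)" "arr K b" "source K b = X M" "target K b = X M'" using FI_homE[OF assms(2)] .
  obtain c where c: "h = (N, N', c)" "arr K c" "source K c = X N" "target K c = X N'" using FI_homE[OF assms(3)] .
  note t = a(2-4) b(2-4) c(2-4)
  define ab where "ab = comp K (J L' M') (comp K (tenM K a b) (U L M))"
  define bc where "bc = comp K (J M' N') (comp K (tenM K b c) (U M N))"
  have ab: "arr K ab" "source K ab = X (L + M)" "target K ab = X (L' + M')" "comp K ab (J L M) = comp K (J L' M') (tenM K a b)"
    and bc: "arr K bc" "source K bc = X (M + N)" "target K bc = X (M' + N')" "comp K bc (J M N) = comp K (J M' N') (tenM K b c)"
    unfolding ab_def bc_def using t by simp_all
  define abc where "abc = comp K (J (L' + M') N') (comp K (tenM K ab c) (U (L + M) N))"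
  define abc' where "abc' = comp K (J L' (M' + N')) (comp K (tenM K a bc) (U L (M + N)))"
  have abc: "arr K abc" "source K abc = X (L + M + N)" "target K abc = X (L' + M' + N')" "comp K abc (J (L + M) N) = comp K (J (L' + M') N') (tenM K ab c)"
    and abc': "arr K abc'" "source K abc' = X (L + (M + N))" "target K abc' = X (L' + (M' + N'))" "comp K abc' (J L (M + N)) = comp K (J L' (M' + N')) (tenM K a bc)"
    unfolding abc_def abc'_def using t ab(1-3) bc(1-3) by simp_all
  let ?al = "mor (assoc FI L M N)" and ?al' = "mor (assoc FI L' M' N')"
  let ?i = "comp K (J (L + M) N) (tenM K (J L M) (ide K (X N)))" and ?j = "comp K (tenM K (U L M) (ide K (X N))) (U (L + M) N)"
  have "comp K ?al' abc = comp K abc' ?al"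
  proof (rule K_cancel[of _ _ ?i ?j])
    have "comp K (comp K ?al' abc) ?i = comp K ?al' (comp K (comp K abc (J (L + M) N)) (tenM K (J L M) (ide K (X N))))"
      using t abc(1-3) by simp
    also have "\<dots> = comp K ?al' (comp K (J (L' + M') N') (comp K (tenM K ab c) (tenM K (J L M) (ide K (X N)))))"
      unfolding abc(4) using t ab(1-3) by simp
    also have "comp K (tenM K ab c) (tenM K (J L M) (ide K (X N))) = tenM K (comp K (J L' M') (tenM K a b)) (comp K (ide K (X N')) c)"
      using t ab by (simp add: K.interchange)
    also have "\<dots> = comp K (tenM K (J L' M') (ide K (X N'))) (tenM K (tenM K a b) c)"
      by (rule K.interchange[symmetric]) (use t in auto)
    also have "comp K ?al' (comp K (J (L' + M') N') (comp K (tenM K (J L' M') (ide K (X N'))) (tenM K (tenM K a b) c)))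
       = comp K (comp K ?al' (comp K (J (L' + M') N') (tenM K (J L' M') (ide K (X N'))))) (tenM K (tenM K a b) c)"
      using t by simp
    also have "\<dots> = comp K (comp K (J L' (M' + N')) (comp K (tenM K (ide K (X L')) (J M' N')) (assoc K (X L') (X M') (X N')))) (tenM K (tenM K a b) c)"
      unfolding mor_assoc ..
    also have "\<dots> = comp K (J L' (M' + N')) (comp K (tenM K (ide K (X L')) (J M' N')) (comp K (assoc K (X L') (X M') (X N')) (tenM K (tenM K a b) c)))"
      using t by (simp del: expl_structure)
    also have "comp K (assoc K (X L') (X M') (X N')) (tenM K (tenM K a b) c) = comp K (tenM K a (tenM K b c)) (assoc K (X L) (X M) (X N))"
      using K.assoc_natural[of a b c] t by (simp del: expl_structure)
    also have "comp K (tenM K (ide K (X L')) (J M' N')) (comp K (tenM K a (tenM K b c)) (assoc K (X L) (X M) (X N)))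
       = comp K (tenM K a (comp K bc (J M N))) (assoc K (X L) (X M) (X N))"
      unfolding bc(4) using t by (simp del: expl_structure add: K.interchange_tail)
    also have "tenM K a (comp K bc (J M N)) = comp K (tenM K a bc) (tenM K (ide K (X L)) (J M N))"
      using t bc(1-3) by (simp add: K.interchange)
    also have "comp K (J L' (M' + N')) (comp K (comp K (tenM K a bc) (tenM K (ide K (X L)) (J M N))) (assoc K (X L) (X M) (X N)))
       = comp K (comp K (J L' (M' + N')) (tenM K a bc)) (comp K (tenM K (ide K (X L)) (J M N)) (assoc K (X L) (X M) (X N)))"
      using t bc(1-3) by (simp del: expl_structure)
    also have "\<dots> = comp K abc' (comp K (J L (M + N)) (comp K (tenM K (ide K (X L)) (J M N)) (assoc K (X L) (X M) (X N))))"
      unfolding abc'(4)[symmetric] using t abc'(1-3) by (simp del: expl_structure)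
    also have "\<dots> = comp K abc' (comp K ?al ?i)" unfolding mor_assoc ..
    also have "\<dots> = comp K (comp K abc' ?al) ?i" using t abc'(1-3) by simp
    finally show "comp K (comp K ?al' abc) ?i = comp K (comp K abc' ?al) ?i" .
    show "comp K ?i ?j = ide K (target K ?i)" by (simp add: K.interchange_tail)
  qed (use t abc(1-3) abc'(1-3) in simp_all)
  then show ?thesis unfolding a(1) b(1) c(1) FI_comp FI_structure_comp
    using abc_def abc'_def ab_def bc_def by simp
qed

lemma FI_braid_natural: assumes "f \<in> hom FI M M'" "g \<in> hom FI N N'"
  shows "comp FI (braid FI M' N') (tenM FI f g) = comp FI (tenM FI g f) (braid FI M N)"
proof -
  obtain a where a: "f = (M, M', a)" "arr K a" "source K a = X M" "target K a = X M'" using FI_homE[OF assms(1)] .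
  obtain b where b: "g = (N, N', b)" "arr K b" "source K b = X N" "target K b = X N'" using FI_homE[OF assms(2)] .
  note t = a(2-4) b(2-4)
  define ab where "ab = comp K (J M' N') (comp K (tenM K a b) (U M N))"
  define ba where "ba = comp K (J N' M') (comp K (tenM K b a) (U N M))"
  have ab: "arr K ab" "source K ab = X (M + N)" "target K ab = X (M' + N')" "comp K ab (J M N) = comp K (J M' N') (tenM K a b)"
    and ba: "arr K ba" "source K ba = X (N + M)" "target K ba = X (N' + M')" "comp K ba (J N M) = comp K (J N' M') (tenM K b a)"
    unfolding ab_def ba_def using t by simp_all
  have "comp K (mor (braid FI M' N')) ab = comp K ba (mor (braid FI M N))"
  proof (rule K_cancel[of _ _ "J M N" "U M N"])
    have "comp K (comp K (mor (braid FI M' N')) ab) (J M N) = comp K (mor (braid FI M' N')) (comp K (J M' N') (tenM K a b))"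
      unfolding ab(4)[symmetric] using t ab(1-3) by simp
    also have "\<dots> = comp K (comp K (mor (braid FI M' N')) (J M' N')) (tenM K a b)" using t by simp
    also have "\<dots> = comp K (J N' M') (comp K (braid K (X M') (X N')) (tenM K a b))"
      unfolding mor_braid using t by (simp del: expl_structure)
    also have "comp K (braid K (X M') (X N')) (tenM K a b) = comp K (tenM K b a) (braid K (X M) (X N))"
      using K.braid_natural[of a b] t by (simp del: expl_structure)
    also have "comp K (J N' M') (comp K (tenM K b a) (braid K (X M) (X N))) = comp K (comp K ba (J N M)) (braid K (X M) (X N))"
      unfolding ba(4) using t by (simp del: expl_structure)
    also have "\<dots> = comp K ba (comp K (mor (braid FI M N)) (J M N))" unfolding mor_braid using ba(1-3) by (simp del: expl_structure)
    also have "\<dots> = comp K (comp K ba (mor (braid FI M N))) (J M N)" using ba(1-3) by simp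
    finally show "comp K (comp K (mor (braid FI M' N')) ab) (J M N) = comp K (comp K ba (mor (braid FI M N))) (J M N)" .
  qed (use ab(1-3) ba(1-3) in simp_all)
  then show ?thesis unfolding a(1) b(1) FI_comp FI_structure_comp
    using ab_def ba_def by simp
qed

lemma FI_unit_natural: assumes "f \<in> hom FI M N"
  shows "comp FI (lunit FI N) (tenM FI (ide FI 0) f) = comp FI f (lunit FI M)"
    "comp FI (runit FI N) (tenM FI f (ide FI 0)) = comp FI f (runit FI M)"
proof -
  obtain a where a: "f = (M, N, a)" "arr K a" "source K a = X M" "target K a = X N" using FI_homE[OF assms(1)] .
  note t = a(2-4)
  define l where "l = comp K (J 0 N) (comp K (tenM K (ide K (X 0)) a) (U 0 M))"
  define r where "r = comp K (J N 0) (comp K (tenM K a (ide K (X 0))) (U M 0))"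
  have l: "arr K l" "source K l = X M" "target K l = X N" "comp K l (J 0 M) = comp K (J 0 N) (tenM K (ide K (X 0)) a)"
    and r: "arr K r" "source K r = X M" "target K r = X N" "comp K r (J M 0) = comp K (J N 0) (tenM K a (ide K (X 0)))"
    unfolding l_def r_def using t by simp_all
  have "comp K (mor (lunit FI N)) l = comp K a (mor (lunit FI M))"
  proof (rule K_cancel[of _ _ "comp K (J 0 M) (tenM K V (ide K (X M)))" "comp K (tenM K V' (ide K (X M))) (U 0 M)"])
    have "comp K (comp K (mor (lunit FI N)) l) (comp K (J 0 M) (tenM K V (ide K (X M))))
      = comp K (mor (lunit FI N)) (comp K (comp K l (J 0 M)) (tenM K V (ide K (X M))))" using t l(1-3) by simp
    also have "\<dots> = comp K (mor (lunit FI N)) (comp K (J 0 N) (comp K (tenM K (ide K (X 0)) a) (tenM K V (ide K (X M)))))"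
      unfolding l(4) using t by simp
    also have "comp K (tenM K (ide K (X 0)) a) (tenM K V (ide K (X M))) = comp K (tenM K V (ide K (X N))) (tenM K (ide K (munit K)) a)"
      using t by (simp add: K.interchange)
    also have "comp K (mor (lunit FI N)) (comp K (J 0 N) (comp K (tenM K V (ide K (X N))) (tenM K (ide K (munit K)) a)))
      = comp K (comp K (mor (lunit FI N)) (comp K (J 0 N) (tenM K V (ide K (X N))))) (tenM K (ide K (munit K)) a)"
      using t by simp
    also have "\<dots> = comp K a (lunit K (X M))"
      unfolding mor_unit using K.lunit_nat[of "X M" "X N" a] t K.arr_typed(1)[of a] by (simp del: expl_structure)
    also have "\<dots> = comp K (comp K a (mor (lunit FI M))) (comp K (J 0 M) (tenM K V (ide K (X M))))"
      unfolding mor_unit[symmetric] using t by simp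
    finally show "comp K (comp K (mor (lunit FI N)) l) (comp K (J 0 M) (tenM K V (ide K (X M))))
      = comp K (comp K a (mor (lunit FI M))) (comp K (J 0 M) (tenM K V (ide K (X M))))" .
  qed (use t l(1-3) in \<open>simp_all add: K.interchange_tail\<close>)
  then show "comp FI (lunit FI N) (tenM FI (ide FI 0) f) = comp FI f (lunit FI M)"
    unfolding a(1) FI_comp FI_structure_comp using l_def by simp
  have "comp K (mor (runit FI N)) r = comp K a (mor (runit FI M))"
  proof (rule K_cancel[of _ _ "comp K (J M 0) (tenM K (ide K (X M)) V)" "comp K (tenM K (ide K (X M)) V') (U M 0)"])
    have "comp K (comp K (mor (runit FI N)) r) (comp K (J M 0) (tenM K (ide K (X M)) V))
      = comp K (mor (runit FI N)) (comp K (comp K r (J M 0)) (tenM K (ide K (X M)) V))" using t r(1-3) by simp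
    also have "\<dots> = comp K (mor (runit FI N)) (comp K (J N 0) (comp K (tenM K a (ide K (X 0))) (tenM K (ide K (X M)) V)))"
      unfolding r(4) using t by simp
    also have "comp K (tenM K a (ide K (X 0))) (tenM K (ide K (X M)) V) = comp K (tenM K (ide K (X N)) V) (tenM K a (ide K (munit K)))"
      using t by (simp add: K.interchange)
    also have "comp K (mor (runit FI N)) (comp K (J N 0) (comp K (tenM K (ide K (X N)) V) (tenM K a (ide K (munit K)))))
      = comp K (comp K (mor (runit FI N)) (comp K (J N 0) (tenM K (ide K (X N)) V))) (tenM K a (ide K (munit K)))"
      using t by simp
    also have "\<dots> = comp K a (runit K (X M))"
      unfolding mor_unit using K.runit_nat[of "X M" "X N" a] t K.arr_typed(1)[of a] by (simp del: expl_structure)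
    also have "\<dots> = comp K (comp K a (mor (runit FI M))) (comp K (J M 0) (tenM K (ide K (X M)) V))"
      unfolding mor_unit[symmetric] using t by simp
    finally show "comp K (comp K (mor (runit FI N)) r) (comp K (J M 0) (tenM K (ide K (X M)) V))
      = comp K (comp K a (mor (runit FI M))) (comp K (J M 0) (tenM K (ide K (X M)) V))" .
  qed (use t r(1-3) in \<open>simp_all add: K.interchange_tail\<close>)
  then show "comp FI (runit FI N) (tenM FI f (ide FI 0)) = comp FI f (runit FI M)"
    unfolding a(1) FI_comp FI_structure_comp using r_def by simp
qed

lemma FI_category: "typed_category FI"
proof
  fix A B D f g assume "f \<in> hom FI A B" "g \<in> hom FI B D"
  then show "comp FI g f \<in> hom FI A D" by (elim FI_homE) (simp add: FI_comp FI_hom)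
next
  fix A B D N f g h assume "f \<in> hom FI A B" "g \<in> hom FI B D" "h \<in> hom FI D N"
  then show "comp FI (comp FI h g) f = comp FI h (comp FI g f)" by (elim FI_homE) (simp add: FI_comp)
next
  fix A B f assume "f \<in> hom FI A B"
  then show "comp FI (ide FI B) f = f" "comp FI f (ide FI A) = f" by (elim FI_homE, simp add: FI_comp)+
qed (auto simp: FI_comp FI_hom elim!: FI_homE)

lemma FI_smc: "typed_semicartesian FI"
proof -
  interpret FI: typed_category FI by (rule FI_category)
  have i: "inj_on id (wires N)" for N by simp
  show ?thesis
  proof (unfold_locales, simp_all only: FI_simps(1,5,6) UNIV_I)
    fix A B A' B' f g assume "f \<in> hom FI A B" "g \<in> hom FI A' B'"
    then show "tenM FI f g \<in> hom FI (A + A') (B + B')" by (elim FI_homE) (simp add: FI_comp FI_hom)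
  next
    fix A B show "tenM FI (ide FI A) (ide FI B) = ide FI (A + B)"
      using R_tensor[OF i i _ i i, of A A B B] R_ide[OF i, of A] R_ide[OF i, of B] R_ide[OF lsum_inj[OF i i], of A B] by simp
    show "comp FI (braid FI B A) (braid FI A B) = ide FI (A + B)"
    proof -
      have s: "swap_sum (swap_sum y) = y" for y :: "'a + 'b" by (cases y) auto
      have b: "braid FI B A = R (B + A) (swap_sum \<circ> lsum B id A id) (A + B) (lsum A id B id)"
        unfolding FI_braid[OF i i] by (rule R_map[where h = swap_sum]) (simp_all add: labels s)
      have "comp FI (braid FI B A) (braid FI A B) = R (A + B) (lsum A id B id) (A + B) (lsum A id B id)"
        unfolding b FI_braid[OF i i, of A B] by (rule R_comp) (simp_all add: labels)
      then show ?thesis using R_ide[OF lsum_inj[OF i i], of A B] by simp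
    qed
    show "braid FI A B \<in> hom FI (A + B) (B + A)" by (subst structure_eq(2)) (simp add: FI_hom)
    show "comp FI (tenM FI (ide FI A) (lunit FI B)) (assoc FI A 0 B) = tenM FI (runit FI A) (ide FI B)" by (rule FI_triangle)
    show "\<exists>!f. f \<in> hom FI A 0"
    proof -
      have "\<exists>!a. a \<in> Hom (X A) (X 0)"
      proof (rule Hom_terminal[OF X_aitp(1) X_aitp(1)])
        fix G assume G: "G \<in> FinLO (idx (X 0))"
        show "ob (X 0) G = 0"
          using wiredD(3)[OF wire_list_wired(1) G] wire_list_wires[OF G] by simp
      qed
      then show ?thesis by (auto simp: FI_simps)
    qed
  next
    fix A B D assume True
    show "iso_in FI (A + B + D) (A + (B + D)) (assoc FI A B D)"
      unfolding FI_assoc[OF i i i] iso_in_def by (rule exI, rule R_iso) (simp_all add: labels)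
    show "comp FI (assoc FI B D A) (comp FI (braid FI A (B + D)) (assoc FI A B D)) =
       comp FI (tenM FI (ide FI B) (braid FI A D)) (comp FI (assoc FI B A D) (tenM FI (braid FI A B) (ide FI D)))"
      by (rule FI_hexagon)
  next
    fix A
    have "inverse_in FI (0 + A) A (lunit FI A) (R A (Inr \<circ> id) (0 + A) (lsum 0 id A id))"
      "inverse_in FI (A + 0) A (runit FI A) (R A (Inl \<circ> id) (A + 0) (lsum A id 0 id))"
      unfolding FI_lunit[OF i, of A id] FI_runit[OF i, of A id] by (rule R_iso; auto simp: labels)+
    then show "iso_in FI (0 + A) A (lunit FI A)" "iso_in FI (A + 0) A (runit FI A)" unfolding iso_in_def by blast+
  next
    fix A B D A' B' D' f g f' g' assume "f \<in> hom FI A B" "g \<in> hom FI B D" "f' \<in> hom FI A' B'" "g' \<in> hom FI B' D'"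
    then show "tenM FI (comp FI g f) (comp FI g' f') = comp FI (tenM FI g g') (tenM FI f f')"
      by (elim FI_homE) (simp add: FI_comp K.interchange_tail)
  qed (simp_all only: FI_assoc_natural FI_braid_natural FI_unit_natural FI_pentagon)
qed

end

section \<open>Infinite tensor products of string diagrams\<close>

context string_theory begin

sublocale FI: typed_semicartesian FI by (rule FI_smc)

lemma FI_obj [simp]: "N \<in> obj FI" by (simp add: FI_simps)

lemma FI_munit [simp]: "munit FI = 0" and FI_tenO [simp]: "tenO FI = (+)" by (simp_all add: FI_simps)

text \<open>When the wires of two objects carry disjoint names, their sum can keep these names untagged; in a tensor
product of many factors this avoids names that depend on the bracketing.\<close>

definition flat :: "enat \<Rightarrow> (nat \<Rightarrow> 'w) \<Rightarrow> enat \<Rightarrow> (nat \<Rightarrow> 'w) \<Rightarrow> nat \<Rightarrow> 'w" where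
  "flat M v N w i = case_sum v w (split M N i)"

lemma flat_lsum: "flat M v N w i = case_sum id id (lsum M v N w i)"
  by (cases "split M N i") (auto simp: flat_def lsum_def)

lemma case_sum_image: "case_sum f g ` (A <+> B) = f ` A \<union> g ` B"
  by (simp add: Plus_def image_Un image_image)

lemma inj_on_case_sum: "inj_on f A \<Longrightarrow> inj_on g B \<Longrightarrow> f ` A \<inter> g ` B = {} \<Longrightarrow> inj_on (case_sum f g) (A <+> B)"
proof (rule inj_onI)
  fix x y assume a: "inj_on f A" "inj_on g B" "f ` A \<inter> g ` B = {}" "x \<in> A <+> B" "y \<in> A <+> B" "case_sum f g x = case_sum f g y"
  have n: "f a \<noteq> g b" if "a \<in> A" "b \<in> B" for a b using a(3) that by blast
  show "x = y" using a(4-6) n inj_onD[OF a(1)] inj_onD[OF a(2)] by (elim PlusE) (simp_all, metis+)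
qed

lemma flat_image: "flat M v N w ` wires (M + N) = v ` wires M \<union> w ` wires N"
proof -
  have "flat M v N w ` wires (M + N) = case_sum id id ` lsum M v N w ` wires (M + N)" by (simp add: flat_lsum image_image)
  then show ?thesis by (simp add: lsum_image case_sum_image)
qed

lemma flat_inj: assumes "inj_on v (wires M)" "inj_on w (wires N)" "v ` wires M \<inter> w ` wires N = {}"
  shows "inj_on (flat M v N w) (wires (M + N))"
proof -
  have "inj_on (case_sum id id) (v ` wires M <+> w ` wires N)" by (rule inj_on_case_sum) (use assms in auto)
  then have "inj_on (case_sum id id \<circ> lsum M v N w) (wires (M + N))" by (intro comp_inj_on lsum_inj assms) (simp add: lsum_image)
  moreover have "case_sum id id \<circ> lsum M v N w = flat M v N w" by (simp add: fun_eq_iff flat_lsum)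
  ultimately show ?thesis by simp
qed

lemma R_tensor_flat: assumes "inj_on v (wires M)" "inj_on w (wires N)" "w ` wires N \<subseteq> v ` wires M"
    "inj_on v' (wires M')" "inj_on w' (wires N')" "w' ` wires N' \<subseteq> v' ` wires M'" "v ` wires M \<inter> v' ` wires M' = {}"
  shows "tenM FI (R M v N w) (R M' v' N' w') = R (M + M') (flat M v M' v') (N + N') (flat N w N' w')"
  unfolding R_tensor[OF assms(1-6)]
proof (rule R_map[where h = "case_sum id id", symmetric])
  show "inj_on (case_sum id id) (lsum M v M' v' ` wires (M + M'))"
    unfolding lsum_image by (rule inj_on_case_sum) (use assms in auto)
qed (use assms in \<open>simp_all add: labels flat_lsum\<close>)

lemma FI_assoc_flat: assumes "inj_on a (wires L)" "inj_on b (wires M)" "inj_on c (wires N)"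
    "a ` wires L \<inter> b ` wires M = {}" "a ` wires L \<inter> c ` wires N = {}" "b ` wires M \<inter> c ` wires N = {}"
  shows "assoc FI L M N = R (L + M + N) (flat (L + M) (flat L a M b) N c) (L + (M + N)) (flat L a (M + N) (flat M b N c))"
  unfolding FI_assoc[OF assms(1-3)]
proof (rule R_map[where h = "case_sum id (case_sum id id)", symmetric])
  have r: "case_sum id (case_sum id id) (reassoc (map_sum f g y)) = case_sum (case_sum id id \<circ> f) g y"
    for f :: "nat \<Rightarrow> 'a + 'a" and g :: "nat \<Rightarrow> 'a" and y
  proof (cases y)
    case (Inl u)
    then show ?thesis by (cases "f u") auto
  qed auto
  have f: "flat L a M b = case_sum id id \<circ> lsum L a M b" "flat M b N c = case_sum id id \<circ> lsum M b N c"
    by (simp_all add: fun_eq_iff flat_lsum)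
  show "flat (L + M) (flat L a M b) N c i = case_sum id (case_sum id id) ((reassoc \<circ> lsum (L + M) (lsum L a M b) N c) i)" for i
    by (simp add: f flat_def[of "L + M"] lsum_def[of "L + M"] r)
  show "flat L a (M + N) (flat M b N c) i = case_sum id (case_sum id id) (lsum L a (M + N) (lsum M b N c) i)" for i
    by (cases "split L (M + N) i") (simp_all add: f flat_def[of L] lsum_def[of L])
  have "inj_on (case_sum id (case_sum id id)) (a ` wires L <+> (b ` wires M <+> c ` wires N))"
    by (intro inj_on_case_sum) (use assms in \<open>auto simp: case_sum_image\<close>)
  then show "inj_on (case_sum id (case_sum id id)) ((reassoc \<circ> lsum (L + M) (lsum L a M b) N c) ` wires (L + M + N))"
    by (simp add: labels)
qed (use assms in \<open>simp_all add: labels\<close>)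

lemma FI_braid_flat: assumes "inj_on a (wires M)" "inj_on b (wires N)" "a ` wires M \<inter> b ` wires N = {}"
  shows "braid FI M N = R (M + N) (flat M a N b) (N + M) (flat N b M a)"
  unfolding FI_braid[OF assms(1,2)]
proof (rule R_map[where h = "case_sum id id", symmetric])
  show "inj_on (case_sum id id) (lsum M a N b ` wires (M + N))"
    unfolding lsum_image by (rule inj_on_case_sum) (use assms in auto)
  have "case_sum id id (swap_sum y) = case_sum id id y" for y :: "'a + 'a" by (cases y) auto
  then show "flat N b M a i = case_sum id id ((swap_sum \<circ> lsum N b M a) i)" for i by (simp add: flat_lsum)
qed (use assms in \<open>simp_all add: labels flat_lsum\<close>)

text \<open>The wires of a finite tensor product are named by pairs of a factor and a wire of that factor;
  in terms of these names all projections are relabelings.\<close>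

fun tlab :: "('j \<Rightarrow> enat) \<Rightarrow> 'j list \<Rightarrow> nat \<Rightarrow> 'j \<times> nat" where
  "tlab Y [] = undefined"
| "tlab Y (j # F) = flat (Y j) (Pair j) (big_tensor FI Y F) (tlab Y F)"

lemma tlab: assumes "distinct F"
  shows "inj_on (tlab Y F) (wires (big_tensor FI Y F))" "tlab Y F ` wires (big_tensor FI Y F) = Sigma (set F) (\<lambda>j. wires (Y j))"
  using assms
proof (induction F)
  case (Cons j F)
  {
    case 1
    have F: "distinct F" "j \<notin> set F" using 1 by auto
    have "Pair j ` wires (Y j) \<inter> tlab Y F ` wires (big_tensor FI Y F) = {}" unfolding Cons.IH(2)[OF F(1)] using F(2) by auto
    then show ?case using Cons.IH(1)[OF F(1)] by (simp add: flat_inj inj_on_def[of "Pair j"])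
  next
    case 2
    show ?case using Cons 2 by (auto simp: flat_image)
  }
qed auto

lemma R_inv: assumes "inj_on v (wires M)" "inj_on w (wires N)" "w ` wires N = v ` wires M"
  shows "inv_of FI M N (R M v N w) = R N w M v"
  using R_iso[OF assms] unfolding inverse_in_def by (intro FI.inv_of_eqI) (auto simp: FI.hom_iff)

lemma tlab_Cons: "tlab Y (i # F) = flat (Y i) (Pair i) (big_tensor FI Y F) (tlab Y F)" "inj_on (Pair i) A"
  by (auto simp: inj_on_def)

text \<open>By induction on \<open>F\<close>: associators, symmetries and tensor products of relabelings are relabelings.\<close>

lemma to_front_R: assumes "distinct F" "j \<in> set F"
  shows "to_front FI Y j F = R (big_tensor FI Y F) (tlab Y F) (big_tensor FI Y (j # remove1 j F)) (tlab Y (j # remove1 j F))"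
  using assms
proof (induction F)
  case (Cons i F)
  show ?case
  proof (cases "i = j")
    case True
    then show ?thesis using R_ide[OF tlab(1)[OF Cons.prems(1), of Y]] by (simp add: to_front.simps(2))
  next
    case False
    then have F: "distinct F" "j \<in> set F" "i \<notin> set F" "distinct (remove1 j F)" using Cons.prems by auto
    let ?B = "big_tensor FI Y (remove1 j F)" and ?b = "tlab Y (remove1 j F)"
    note t = tlab[OF F(1), of Y] tlab[OF F(4), of Y]
    have p: "inj_on (Pair k) (wires (Y k))" for k by (simp add: inj_on_def)
    have d: "Pair i ` wires (Y i) \<inter> Pair j ` wires (Y j) = {}" "Pair i ` wires (Y i) \<inter> ?b ` wires ?B = {}"
      "Pair j ` wires (Y j) \<inter> ?b ` wires ?B = {}" "Pair i ` wires (Y i) \<inter> tlab Y F ` wires (big_tensor FI Y F) = {}"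
      unfolding t(2,4) using False F by auto
    have u: "tlab Y F ` wires (big_tensor FI Y F) = Pair j ` wires (Y j) \<union> ?b ` wires ?B" unfolding t(2,4) using F by auto
    let ?f = "flat (Y j) (Pair j) ?B ?b"
    have f: "inj_on ?f (wires (Y j + ?B))" "?f ` wires (Y j + ?B) = Pair j ` wires (Y j) \<union> ?b ` wires ?B"
      by (rule flat_inj[OF p t(3) d(3)], rule flat_image)
    note ij = flat_inj[OF p p d(1)] flat_image[of "Y i" "Pair i" "Y j" "Pair j"] and ji = flat_inj[OF p p, of j i] flat_image[of "Y j" "Pair j" "Y i" "Pair i"]
    have d': "Pair j ` wires (Y j) \<inter> Pair i ` wires (Y i) = {}" using d by auto
    have g: "inj_on (flat (Y i) (Pair i) ?B ?b) (wires (Y i + ?B))" using flat_inj[OF p t(3) d(2)] .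
    have inj: "inj_on (tlab Y (i # F)) (wires (Y i + big_tensor FI Y F))" "inj_on (flat (Y i) (Pair i) (Y j + ?B) ?f) (wires (Y i + (Y j + ?B)))"
       "inj_on (flat (Y i + Y j) (flat (Y i) (Pair i) (Y j) (Pair j)) ?B ?b) (wires (Y i + Y j + ?B))"
       "inj_on (flat (Y j + Y i) (flat (Y j) (Pair j) (Y i) (Pair i)) ?B ?b) (wires (Y j + Y i + ?B))"
       "inj_on (flat (Y j) (Pair j) (Y i + ?B) (flat (Y i) (Pair i) ?B ?b)) (wires (Y j + (Y i + ?B)))"
    proof -
      show "inj_on (tlab Y (i # F)) (wires (Y i + big_tensor FI Y F))" using tlab(1)[OF Cons.prems(1), of Y] by simp
      show "inj_on (flat (Y i) (Pair i) (Y j + ?B) ?f) (wires (Y i + (Y j + ?B)))"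
        by (rule flat_inj[OF p f(1)]) (unfold f(2), use d in blast)
      show "inj_on (flat (Y i + Y j) (flat (Y i) (Pair i) (Y j) (Pair j)) ?B ?b) (wires (Y i + Y j + ?B))"
        by (rule flat_inj[OF ij(1) t(3)]) (unfold ij(2), use d in blast)
      show "inj_on (flat (Y j + Y i) (flat (Y j) (Pair j) (Y i) (Pair i)) ?B ?b) (wires (Y j + Y i + ?B))"
        by (rule flat_inj[OF flat_inj[OF p p d'] t(3)]) (unfold flat_image, use d in blast)
      show "inj_on (flat (Y j) (Pair j) (Y i + ?B) (flat (Y i) (Pair i) ?B ?b)) (wires (Y j + (Y i + ?B)))"
        by (rule flat_inj[OF p g]) (unfold flat_image, use d d' in blast)
    qed
    have im: "tlab Y (i # F) ` wires (Y i + big_tensor FI Y F) = Pair i ` wires (Y i) \<union> (Pair j ` wires (Y j) \<union> ?b ` wires ?B)"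
       "flat (Y i) (Pair i) (Y j + ?B) ?f ` (wires (Y i + (Y j + ?B))) = Pair i ` wires (Y i) \<union> (Pair j ` wires (Y j) \<union> ?b ` wires ?B)"
       "flat (Y i + Y j) (flat (Y i) (Pair i) (Y j) (Pair j)) ?B ?b ` (wires (Y i + Y j + ?B)) = Pair i ` wires (Y i) \<union> (Pair j ` wires (Y j) \<union> ?b ` wires ?B)"
       "flat (Y j + Y i) (flat (Y j) (Pair j) (Y i) (Pair i)) ?B ?b ` (wires (Y j + Y i + ?B)) = Pair i ` wires (Y i) \<union> (Pair j ` wires (Y j) \<union> ?b ` wires ?B)"
       "flat (Y j) (Pair j) (Y i + ?B) (flat (Y i) (Pair i) ?B ?b) ` (wires (Y j + (Y i + ?B))) = Pair i ` wires (Y i) \<union> (Pair j ` wires (Y j) \<union> ?b ` wires ?B)"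
      by (simp_all add: flat_image u Un_ac)
    have 1: "tenM FI (ide FI (Y i)) (to_front FI Y j F) = R (Y i + big_tensor FI Y F) (tlab Y (i # F)) (Y i + (Y j + ?B)) (flat (Y i) (Pair i) (Y j + ?B) ?f)"
      unfolding Cons.IH[OF F(1,2)] R_ide[OF p, of i, symmetric] tlab.simps big_tensor.simps FI_tenO
      by (rule R_tensor_flat[OF p p order_refl t(1) f(1)]) (use f u d in auto)
    have 2: "inv_of FI (Y i + Y j + ?B) (Y i + (Y j + ?B)) (assoc FI (Y i) (Y j) ?B)
       = R (Y i + (Y j + ?B)) (flat (Y i) (Pair i) (Y j + ?B) ?f) (Y i + Y j + ?B) (flat (Y i + Y j) (flat (Y i) (Pair i) (Y j) (Pair j)) ?B ?b)"
      unfolding FI_assoc_flat[OF p p t(3) d(1-3)]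
      by (rule R_inv[OF inj(3,2)]) (simp only: im)
    have 3: "tenM FI (braid FI (Y i) (Y j)) (ide FI ?B) = R (Y i + Y j + ?B) (flat (Y i + Y j) (flat (Y i) (Pair i) (Y j) (Pair j)) ?B ?b)
        (Y j + Y i + ?B) (flat (Y j + Y i) (flat (Y j) (Pair j) (Y i) (Pair i)) ?B ?b)"
      unfolding FI_braid_flat[OF p p d(1)] R_ide[OF t(3), symmetric]
      by (rule R_tensor_flat[OF ij(1) _ _ t(3) t(3)]) (use d ij ji in auto)
    have 4: "assoc FI (Y j) (Y i) ?B = R (Y j + Y i + ?B) (flat (Y j + Y i) (flat (Y j) (Pair j) (Y i) (Pair i)) ?B ?b)
        (Y j + (Y i + ?B)) (flat (Y j) (Pair j) (Y i + ?B) (flat (Y i) (Pair i) ?B ?b))"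
      by (rule FI_assoc_flat[OF p p t(3) d' d(3,2)])
    have 5: "comp FI (inv_of FI (Y i + Y j + ?B) (Y i + (Y j + ?B)) (assoc FI (Y i) (Y j) ?B)) (tenM FI (ide FI (Y i)) (to_front FI Y j F))
       = R (Y i + big_tensor FI Y F) (tlab Y (i # F)) (Y i + Y j + ?B) (flat (Y i + Y j) (flat (Y i) (Pair i) (Y j) (Pair j)) ?B ?b)"
      unfolding 1 2 by (rule R_comp[OF inj(1,2,3)]; simp only: im order_refl)
    have 6: "comp FI (tenM FI (braid FI (Y i) (Y j)) (ide FI ?B)) \<dots> = R (Y i + big_tensor FI Y F) (tlab Y (i # F)) (Y j + Y i + ?B) (flat (Y j + Y i) (flat (Y j) (Pair j) (Y i) (Pair i)) ?B ?b)"
      unfolding 3 by (rule R_comp[OF inj(1,3,4)]; simp only: im order_refl)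
    have 7: "comp FI (assoc FI (Y j) (Y i) ?B) \<dots> = R (Y i + big_tensor FI Y F) (tlab Y (i # F)) (Y j + (Y i + ?B)) (flat (Y j) (Pair j) (Y i + ?B) (flat (Y i) (Pair i) ?B ?b))"
      unfolding 4 by (rule R_comp[OF inj(1,4,5)]; simp only: im order_refl)
    show ?thesis using False 5 6 7 by (simp add: Let_def to_front.simps(2))
  qed
qed simp

lemma proj_R: assumes "distinct F" "distinct F'" "set F \<subseteq> set F'"
  shows "proj FI Y F' F = R (big_tensor FI Y F') (tlab Y F') (big_tensor FI Y F) (tlab Y F)"
  using assms
proof (induction F arbitrary: F')
  case Nil
  have "R (big_tensor FI Y F') (tlab Y F') 0 (tlab Y []) \<in> hom FI (big_tensor FI Y F') 0"
    by (rule R_hom) (use tlab[OF Nil(2)] in auto)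
  then show ?case by (auto intro!: FI.terminal_eq simp: FI.hom_iff proj.simps)
next
  case (Cons j F)
  let ?F = "remove1 j F'"
  have F: "distinct F" "distinct ?F" "set F \<subseteq> set ?F" "j \<in> set F'" "distinct F'" "j \<notin> set F" "distinct (j # F)" "distinct (j # ?F)" using Cons.prems by auto
  note t = tlab[OF F(1), of Y] tlab[OF F(2), of Y] tlab[OF F(5), of Y] and s = tlab[OF F(7), of Y] tlab[OF F(8), of Y]
  have p: "inj_on (Pair j) (wires (Y j))" by (simp add: inj_on_def)
  have 1: "tenM FI (ide FI (Y j)) (proj FI Y ?F F) = R (big_tensor FI Y (j # ?F)) (tlab Y (j # ?F)) (big_tensor FI Y (j # F)) (tlab Y (j # F))"
    unfolding Cons.IH[OF F(1,2,3)] R_ide[OF p, symmetric] tlab.simps big_tensor.simps FI_tenO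
    by (rule R_tensor_flat[OF p p order_refl t(3,1)]) (use t F in auto)
  show ?case unfolding proj.simps 1 to_front_R[OF F(5,4)]
    by (rule R_comp[OF t(5) s(3) s(1)]; simp only: s t) (use F in auto)
qed

text \<open>Every component of a family into \<open>L\<close> goes to a finite list of wires of \<open>L\<close>.  Therefore a morphism into
\<open>L\<close> is the same as a compatible family of morphisms into such lists.\<close>

abbreviation pick :: "enat \<Rightarrow> (nat \<Rightarrow> 'w) \<Rightarrow> 'w list \<Rightarrow> 'g inf_mor" where "pick L v g \<equiv> R L v (enat (length g)) (nth g)"

lemma list_labels: "distinct g \<Longrightarrow> inj_on (nth g) (wires (enat (length g)))" "nth g ` wires (enat (length g)) = set g"
  by (auto simp: inj_on_def nth_eq_iff_index_eq set_conv_nth)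

lemma enat_eqI: assumes "a \<in> Hom Y (X (enat n))" "b \<in> Hom Y (X (enat n))" "aitp Y" "pt a F [0] c" "pt b F [0] c"
  shows "a = b"
proof (rule pt_eqI[OF assms(1-3) X_aitp(1)])
  fix G assume G: "G \<in> FinLO (idx (X (enat n)))"
  show "\<exists>F c. pt a F G c \<and> pt b F G c"
  proof (cases "G = [0]")
    case False
    then have "ob (X (enat n)) G = 0" using wiredD(3)[OF wire_list_wired(1) G] G
      by (cases G rule: remdups_adj.cases) (auto simp: wire_list_def inf_ob_def std_itp_def FinLO_def)
    moreover obtain F c d where cd: "pt a F G c" "pt b F G d" using pt_cover2[OF assms(1-3) X_aitp(1) X_aitp(1) G G] .
    ultimately have "c = d" using pt_typed[OF assms(1,3) X_aitp(1) cd(1)] pt_typed[OF assms(2,3) X_aitp(1) cd(2)]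
      by (intro terminal_eq) auto
    then show ?thesis using cd by blast
  qed (use assms in blast)
qed

lemma idx_X: "idx (X (enat n)) = {0}" "idx (X \<infinity>) = UNIV"
  by (auto simp: inf_ob_def std_itp_def)

lemma finlo_0: "[0] \<in> FinLO {0 :: nat}" "[] \<in> FinLO {0 :: nat}" by (auto simp: FinLO_def)

lemma pt_pick: assumes "inj v" "distinct G"
  shows "pt (mor (pick \<infinity> v (map v G))) G [0] (ide (Free \<Sigma> E) (length G))"
proof -
  have d: "distinct (map v G)" using assms inj_on_subset[OF assms(1)] by (simp add: distinct_map)
  note l = list_labels[of "map v G"]
  have w: "map (nth (map v G)) (wire_list (enat (length (map v G))) [0]) = map v G"
    unfolding wire_list_def by (simp add: map_nth flip: map_map) (metis length_map map_nth)
  have "pt (rewire (X \<infinity>) (wX \<infinity> v) (X (enat (length (map v G)))) (wX (enat (length (map v G))) (nth (map v G)))) G [0]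
      (wproj ((wX \<infinity> v) G) ((wX (enat (length (map v G))) (nth (map v G))) [0]))"
  proof (rule pt_rewire)
    show "wired (X \<infinity>) (wX \<infinity> v)" "wired (X (enat (length (map v G)))) (wX (enat (length (map v G))) (nth (map v G)))"
      using X_wired(1)[of v \<infinity>] X_wired(1)[OF l(1)[OF d]] assms by auto
    show "wset (X (enat (length (map v G)))) (wX (enat (length (map v G))) (nth (map v G))) \<subseteq> wset (X \<infinity>) (wX \<infinity> v)"
      unfolding X_wired(2)[OF l(1)[OF d]] l(2) using X_wired(2)[of v \<infinity>] assms by auto
    show "set ((wX (enat (length (map v G))) (nth (map v G))) [0]) \<subseteq> set ((wX \<infinity> v) G)" unfolding comp_apply w by (simp add: wire_list_def)
  qed (use assms in \<open>auto simp: idx_X FinLO_def\<close>)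
  moreover have "wproj ((wX \<infinity> v) G) ((wX (enat (length (map v G))) (nth (map v G))) [0]) = ide (Free \<Sigma> E) (length G)"
    unfolding comp_apply w by (simp add: wire_list_def o_def)
  ultimately show ?thesis by (simp only: mor_R)
qed

lemma mor_comp: "f \<in> hom FI M N \<Longrightarrow> g \<in> hom FI N L \<Longrightarrow> mor (comp FI g f) = fcomp (mor g) (mor f)"
  "f \<in> hom FI M N \<Longrightarrow> mor f \<in> Hom (X M) (X N)" "f \<in> hom FI M N \<Longrightarrow> f = (M, N, mor f)"
  by (auto simp: FI_simps)

lemma pick_hom: assumes "inj_on v (wires L)" "distinct g" "set g \<subseteq> v ` wires L" shows "pick L v g \<in> hom FI L (enat (length g))"
  by (rule R_hom[OF assms(1) list_labels(1)[OF assms(2)]]) (use assms(3) list_labels(2)[of g] in simp)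

lemma pick_all: assumes "inj_on v (wires (enat n))" shows "pick (enat n) v (map v [0..<n]) = ide FI (enat n)"
proof -
  have "R (enat n) v (enat n) (nth (map v [0..<n])) = R (enat n) v (enat n) v"
    by (rule R_map[where h = id]) (use assms in auto)
  then show ?thesis using R_ide[OF assms] by simp
qed

lemma picks_faithful: assumes v: "inj_on v (wires L)" and u: "u \<in> hom FI A L" "u' \<in> hom FI A L"
    and e: "\<And>g. distinct g \<Longrightarrow> set g \<subseteq> v ` wires L \<Longrightarrow> comp FI (pick L v g) u = comp FI (pick L v g) u'"
  shows "u = u'"
proof (cases L)
  case (enat n)
  have "comp FI (ide FI L) u = comp FI (ide FI L) u'"
    using e[of "map v [0..<n]"] pick_all[of v n] v unfolding enat by (auto simp: distinct_map atLeast0LessThan)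
  then show ?thesis using u by (simp add: FI.hom_iff)
next
  case infinity
  then have v': "inj v" using v by simp
  have h: "mor u \<in> Hom (X A) (X \<infinity>)" "mor u' \<in> Hom (X A) (X \<infinity>)" using mor_comp(2) u infinity by auto
  have "mor u = mor u'"
  proof (rule pt_eqI[OF h X_aitp(1) X_aitp(1)])
    fix G assume G: "G \<in> FinLO (idx (X \<infinity>))"
    then have d: "distinct G" by (rule FinLO_distinct)
    obtain F c d' where cd: "pt (mor u) F G c" "pt (mor u') F G d'" using pt_cover2[OF h X_aitp(1) X_aitp(1) X_aitp(1) G G] .
    let ?g = "map v G"
    have dg: "distinct ?g" using d v' by (simp add: distinct_map inj_on_subset[OF v'])
    have g: "pick \<infinity> v ?g \<in> hom FI \<infinity> (enat (length ?g))" by (rule pick_hom[OF _ dg]) (use v' in auto)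
    note p = mor_comp(2)[OF g]
    have "mor (comp FI (pick \<infinity> v ?g) u) = fcomp (mor (pick \<infinity> v ?g)) (mor u)" "mor (comp FI (pick \<infinity> v ?g) u') = fcomp (mor (pick \<infinity> v ?g)) (mor u')"
      using mor_comp(1)[OF _ g] u infinity by auto
    moreover have "comp FI (pick \<infinity> v ?g) u = comp FI (pick \<infinity> v ?g) u'" using e[OF dg] infinity by auto
    ultimately have eq: "fcomp (mor (pick \<infinity> v ?g)) (mor u) = fcomp (mor (pick \<infinity> v ?g)) (mor u')" by simp
    note q = pt_pick[OF v' d]
    note t = pt_typed[OF h(1) X_aitp(1) X_aitp(1) cd(1)] pt_typed[OF h(2) X_aitp(1) X_aitp(1) cd(2)]
    have o: "ob (X \<infinity>) G = length G" using wiredD(3)[OF wire_list_wired(1) G] by (simp add: wire_list_def)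
    have "pt (fcomp (mor (pick \<infinity> v ?g)) (mor u)) F [0] c" "pt (fcomp (mor (pick \<infinity> v ?g)) (mor u)) F [0] d'"
      using pt_comp[OF h(1) p X_aitp(1) X_aitp(1) X_aitp(1) cd(1) q] pt_comp[OF h(2) p X_aitp(1) X_aitp(1) X_aitp(1) cd(2) q] t o eq by auto
    then have "c = d'" by (rule pt_unique[OF fcomp_Hom[OF h(1) p X_aitp(1) X_aitp(1) X_aitp(1)] X_aitp(1) X_aitp(1)])
    then show "\<exists>F c. pt (mor u) F G c \<and> pt (mor u') F G c" using cd by blast
  qed
  then show ?thesis using mor_comp(3)[OF u(1)] mor_comp(3)[OF u(2)] by simp
qed

lemma pt_R_lists: assumes "distinct g" "distinct g'" "set g' \<subseteq> set g"
  shows "pt (mor (R (enat (length g)) (nth g) (enat (length g')) (nth g'))) [0] [0] (wproj g g')"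
proof -
  note l = list_labels[of g] and l' = list_labels[of g']
  have w: "map (nth h) (wire_list (enat (length h)) [0]) = h" for h :: "'a list"
    by (simp add: wire_list_def map_nth)
  have "pt (rewire (X (enat (length g))) (wX (enat (length g)) (nth g)) (X (enat (length g'))) (wX (enat (length g')) (nth g'))) [0] [0]
     (wproj ((wX (enat (length g)) (nth g)) [0]) ((wX (enat (length g')) (nth g')) [0]))"
    by (rule pt_rewire[OF X_wired(1)[OF l(1)[OF assms(1)]] X_wired(1)[OF l'(1)[OF assms(2)]]])
      (unfold X_wired(2)[OF l(1)[OF assms(1)]] X_wired(2)[OF l'(1)[OF assms(2)]] l(2) l'(2) idx_X comp_apply w, use assms finlo_0 in auto)
  then show ?thesis by (simp only: comp_apply w mor_R)
qed

text \<open>For finite \<open>L\<close> the morphism is the member of the family at the list of all wires.  For infinite \<open>L\<close>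
the glued family is assembled from the components of all members.\<close>

lemma picks_glue: assumes v: "inj_on v (wires L)"
    and a: "\<And>g. distinct g \<Longrightarrow> set g \<subseteq> v ` wires L \<Longrightarrow> a g \<in> hom FI A (enat (length g))"
    and compatible: "\<And>g g'. distinct g \<Longrightarrow> distinct g' \<Longrightarrow> set g' \<subseteq> set g \<Longrightarrow> set g \<subseteq> v ` wires L \<Longrightarrow>
      comp FI (R (enat (length g)) (nth g) (enat (length g')) (nth g')) (a g) = a g'"
  obtains u where "u \<in> hom FI A L" "\<And>g. distinct g \<Longrightarrow> set g \<subseteq> v ` wires L \<Longrightarrow> comp FI (pick L v g) u = a g"
proof (cases L)
  case (enat n)
  let ?g = "map v [0..<n]"
  have g: "distinct ?g" "set ?g = v ` wires L" using v enat by (auto simp: distinct_map atLeast0LessThan)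
  show thesis
  proof (rule that[of "a ?g"])
    show "a ?g \<in> hom FI A L" using a[of ?g] g enat by simp
    fix g assume h: "distinct g" "set g \<subseteq> v ` wires L"
    have "pick L v g = R (enat (length ?g)) (nth ?g) (enat (length g)) (nth g)"
      unfolding enat length_map length_upt diff_zero
      by (rule R_map[where h = id]) (use v h g enat list_labels(1)[OF g(1)] list_labels(1)[OF h(1)] list_labels(2)[of g] in auto)
    then show "comp FI (pick L v g) (a ?g) = a g" using compatible[OF g(1) h(1)] g(2) h(2) by simp
  qed
next
  case infinity
  then have v': "inj v" using v by simp
  have d: "distinct (map v G)" if "distinct G" for G using that inj_on_subset[OF v'] by (simp add: distinct_map)
  have va: "set (map v G) \<subseteq> v ` wires L" for G using infinity by auto
  have ah: "mor (a (map v G)) \<in> Hom (X A) (X (enat (length G)))" if "distinct G" for G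
    using mor_comp(2)[OF a[OF d[OF that] va]] by simp
  define P where "P H G c \<longleftrightarrow> pt (mor (a (map v G))) H [0] c" for H G c
  have P_typed: "H \<in> FinLO (idx (X A)) \<and> arr (Free \<Sigma> E) c \<and> source (Free \<Sigma> E) c = ob (X A) H \<and> target (Free \<Sigma> E) c = length G"
    if "P H G c" "distinct G" for H G c
  proof -
    have "ob (X (enat (length G))) [0] = length G" using finlo_0 by (simp add: inf_ob_def std_itp_prj)
    then show ?thesis using pt_typed[OF ah[OF that(2)] X_aitp(1) X_aitp(1)] that(1) unfolding P_def by metis
  qed
  have P_unique: "c = c'" if "P H G c" "P H G c'" "distinct G" for H G c c'
    using pt_unique[OF ah[OF that(3)] X_aitp(1) X_aitp(1)] that unfolding P_def by blast
  have P_up: "P H' G (c \<cdot>\<^bsub>Free \<Sigma> E\<^esub> prj (X A) (H', H))" if "P H G c" "distinct G" "(H', H) \<in> FinLO_arr (idx (X A))" for H H' G c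
    using pt_up[OF ah[OF that(2)] X_aitp(1) X_aitp(1) _ that(3)] that unfolding P_def by blast
  have P_down: "P H G (wproj G' G \<cdot>\<^bsub>Free \<Sigma> E\<^esub> c)" if "P H G' c" "distinct G" "distinct G'" "set G \<subseteq> set G'" for H G G' c
  proof -
    let ?r = "R (enat (length (map v G'))) (nth (map v G')) (enat (length (map v G))) (nth (map v G))"
    have s: "set (map v G) \<subseteq> set (map v G')" using that by auto
    have r: "?r \<in> hom FI (enat (length G')) (enat (length G))"
      using R_hom[OF list_labels(1)[OF d[OF that(3)]] list_labels(1)[OF d[OF that(2)]]] s unfolding list_labels(2) by simp
    have "comp FI ?r (a (map v G')) = a (map v G)" by (rule compatible) (use d that s infinity in auto)
    moreover have "mor (comp FI ?r (a (map v G'))) = fcomp (mor ?r) (mor (a (map v G')))"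
      using mor_comp(1)[OF a[OF d[OF that(3)] va], of ?r "enat (length G)"] r by simp
    ultimately have "fcomp (mor ?r) (mor (a (map v G'))) = mor (a (map v G))" by simp
    moreover have "wproj (map v G') (map v G) = wproj G' G" by (rule wproj_map) (use that inj_on_subset[OF v'] in auto)
    ultimately show ?thesis
      using pt_comp[OF ah[OF that(3)] mor_comp(2)[OF r] X_aitp(1) X_aitp(1) X_aitp(1) _ pt_R_lists[OF d[OF that(3)] d[OF that(2)] s]] that(1)
      unfolding P_def by metis
  qed
  define f where "f = \<lparr>src = X A, tgt = X \<infinity>, Lam = {(H, G). distinct G \<and> (\<exists>c. P H G c)}, cpt = (\<lambda>(H, G). THE c. P H G c)\<rparr>"
  have cpt: "cpt f (H, G) = c" if "P H G c" "distinct G" for H G c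
  proof -
    have "(THE c. P H G c) = c" by (rule the_equality[where P = "P H G"]) (use P_unique that in blast)+
    then show ?thesis by (simp add: f_def)
  qed
  have o: "ob (X \<infinity>) G = length G" if "distinct G" for G
    using wiredD(3)[OF wire_list_wired(1), of G \<infinity>] that by (simp add: wire_list_def idx_X FinLO_def)
  have f: "fin_approx (Free \<Sigma> E) f"
  proof (rule fin_approxI)
    fix H G assume "(H, G) \<in> Lam f"
    then obtain c where c: "distinct G" "P H G c" by (auto simp: f_def)
    show "H \<in> FinLO (idx (src f)) \<and> G \<in> FinLO (idx (tgt f)) \<and> arr (Free \<Sigma> E) (cpt f (H, G)) \<and>
        source (Free \<Sigma> E) (cpt f (H, G)) = ob (src f) H \<and> target (Free \<Sigma> E) (cpt f (H, G)) = ob (tgt f) G"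
      using P_typed[OF c(2,1)] cpt[OF c(2,1)] o[OF c(1)] c(1) by (simp add: f_def idx_X FinLO_def)
    fix H' assume "(H', H) \<in> FinLO_arr (idx (src f))"
    then show "(H', G) \<in> Lam f" using P_up[OF c(2,1)] c(1) by (auto simp: f_def)
  next
    fix G assume "G \<in> FinLO (idx (tgt f))"
    then have G: "distinct G" by (rule FinLO_distinct)
    have "[0] \<in> FinLO (idx (X (enat (length G))))" using finlo_0 by (simp add: idx_X)
    then obtain H c where "pt (mor (a (map v G))) H [0] c" using pt_cover[OF ah[OF G]] by metis
    then show "\<exists>F. (F, G) \<in> Lam f" using G unfolding f_def P_def by auto
  next
    fix H G H' G' assume l: "(H, G) \<in> Lam f" "(H', G') \<in> Lam f" "(H', H) \<in> FinLO_arr (idx (src f))" "(G', G) \<in> FinLO_arr (idx (tgt f))"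
    then obtain c c' where c: "distinct G" "P H G c" "distinct G'" "P H' G' c'" by (auto simp: f_def)
    have HH: "(H', H) \<in> FinLO_arr (idx (X A))" and GG: "(G', G) \<in> FinLO_arr (idx (X \<infinity>))" using l by (simp_all add: f_def)
    have s: "set G \<subseteq> set G'" using GG by (simp add: FinLO_arr_iff)
    have "prj (X \<infinity>) (G', G) = wproj G' G" using wiredD(5)[OF wire_list_wired(1) GG] by (simp add: wire_list_def)
    then show "prj (tgt f) (G', G) \<cdot>\<^bsub>Free \<Sigma> E\<^esub> cpt f (H', G') = cpt f (H, G) \<cdot>\<^bsub>Free \<Sigma> E\<^esub> prj (src f) (H', H)"
      using P_unique[OF P_down[OF c(4,1,3) s] P_up[OF c(2,1) HH] c(1)] cpt[OF c(2,1)] cpt[OF c(4,3)] by (simp add: f_def)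
  qed
  let ?u = "fam_class (Free \<Sigma> E) f"
  have uH: "?u \<in> Hom (X A) (X \<infinity>)" by (rule Hom_classI[OF f]) (simp_all add: f_def)
  then have u: "(A, \<infinity>, ?u) \<in> hom FI A \<infinity>" by (simp add: FI_simps)
  show thesis
  proof (rule that[of "(A, \<infinity>, ?u)"])
    show "(A, \<infinity>, ?u) \<in> hom FI A L" using u infinity by simp
    fix g assume g: "distinct g" "set g \<subseteq> v ` wires L"
    define G where "G = map (inv v) g"
    have gG: "g = map v G" "distinct G" using g infinity v' unfolding G_def
      by (auto simp: map_idI f_inv_into_f subset_iff distinct_map intro!: inj_on_inv_into)
    have p: "pick \<infinity> v g \<in> hom FI \<infinity> (enat (length g))" by (rule pick_hom[OF _ g(1)]) (use v' g infinity in auto)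
    have "[0] \<in> FinLO (idx (X (enat (length G))))" using finlo_0 by (simp add: idx_X)
    then obtain H c where c: "P H G c" using pt_cover[OF ah[OF gG(2)]] unfolding P_def by metis
    have l: "(H, G) \<in> Lam f" "cpt f (H, G) = c" using c gG(2) cpt[OF c gG(2)] by (auto simp: f_def)
    have "pt ?u H G c" using pt_class[OF f l(1)] l(2) by simp
    then have "pt (fcomp (mor (pick \<infinity> v g)) ?u) H [0] (ide (Free \<Sigma> E) (length G) \<cdot>\<^bsub>Free \<Sigma> E\<^esub> c)"
      using pt_comp[OF uH mor_comp(2)[OF p] X_aitp(1) X_aitp(1) X_aitp(1)] pt_pick[OF v' gG(2)] gG(1) by metis
    then have 1: "pt (fcomp (mor (pick \<infinity> v g)) ?u) H [0] c" using P_typed[OF c gG(2)] by simp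
    have 2: "pt (mor (a g)) H [0] c" using c unfolding P_def gG(1) .
    have "mor (a g) \<in> Hom (X A) (X (enat (length g)))" using mor_comp(2)[OF a[OF g]] .
    then have "fcomp (mor (pick \<infinity> v g)) ?u = mor (a g)"
      by (rule enat_eqI[OF fcomp_Hom[OF uH mor_comp(2)[OF p] X_aitp(1) X_aitp(1) X_aitp(1)] _ X_aitp(1) 1 2])
    then have "mor (comp FI (pick \<infinity> v g) (A, \<infinity>, ?u)) = mor (a g)" using mor_comp(1)[OF u p] by simp
    moreover have "comp FI (pick \<infinity> v g) (A, \<infinity>, ?u) \<in> hom FI A (enat (length g))" by (rule FI.comp_hom[OF _ _ _ u p]) simp_all
    ultimately have "comp FI (pick \<infinity> v g) (A, \<infinity>, ?u) = a g" using mor_comp(3)[OF a[OF g]] mor_comp(3) by metis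
    then show "comp FI (pick L v g) (A, \<infinity>, ?u) = a g" using infinity by simp
  qed
qed

text \<open>By \<open>picks_faithful\<close> and \<open>picks_glue\<close> a morphism into the limit is given on finite lists of wires, each of
which is already contained in an object of the directed system.\<close>

lemma relabel_limit: fixes T :: "'j list \<Rightarrow> enat" and l :: "'j list \<Rightarrow> nat \<Rightarrow> 'w"
  assumes l: "\<And>F. F \<in> FinLO Js \<Longrightarrow> inj_on (l F) (wires (T F))"
    and mono: "\<And>F' F. (F', F) \<in> FinLO_arr Js \<Longrightarrow> l F ` wires (T F) \<subseteq> l F' ` wires (T F')"
    and v: "inj_on v (wires L)" "v ` wires L = (\<Union>F\<in>FinLO Js. l F ` wires (T F))"
    and D: "idx D = Js" "\<And>F. F \<in> FinLO Js \<Longrightarrow> ob D F = T F" "\<And>F' F. (F', F) \<in> FinLO_arr Js \<Longrightarrow> prj D (F', F) = R (T F') (l F') (T F) (l F)"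
    and p: "\<And>F. F \<in> FinLO Js \<Longrightarrow> p F = R L v (T F) (l F)"
  shows "is_limit FI D L p"
proof -
  have sub: "l F ` wires (T F) \<subseteq> v ` wires L" if "F \<in> FinLO Js" for F using v(2) that by auto
  have p_hom: "p F \<in> hom FI L (T F)" if "F \<in> FinLO Js" for F
    unfolding p[OF that] by (rule R_hom[OF v(1) l[OF that] sub[OF that]])
  have "is_cone FI D L p" unfolding is_cone_def D(1)
  proof (intro conjI ballI)
    fix x assume "x \<in> FinLO_arr Js"
    then obtain F' F where x: "x = (F', F)" "(F', F) \<in> FinLO_arr Js" by (cases x) auto
    then have F: "F \<in> FinLO Js" "F' \<in> FinLO Js" by (auto simp: FinLO_arr_iff)
    have "comp FI (prj D (F', F)) (p F') = p F"
      unfolding D(3)[OF x(2)] p[OF F(1)] p[OF F(2)] by (rule R_comp[OF v(1) l[OF F(2)] l[OF F(1)] sub[OF F(2)] mono[OF x(2)]])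
    then show "case x of (F', F) \<Rightarrow> comp FI (prj D (F', F)) (p F') = p F" using x by simp
  qed (use p_hom D(2) in auto)
  moreover have "\<exists>!u. u \<in> hom FI A L \<and> (\<forall>F\<in>FinLO Js. comp FI (p F) u = q F)" if q: "is_cone FI D A q" for A q
  proof -
    have qh: "q F \<in> hom FI A (T F)" if "F \<in> FinLO Js" for F using q that D(1,2) unfolding is_cone_def by auto
    have qn: "comp FI (R (T F') (l F') (T F) (l F)) (q F') = q F" if "(F', F) \<in> FinLO_arr Js" for F' F
      using q that D(3)[OF that] unfolding is_cone_def D(1) by auto
    have cover: "\<exists>F\<in>FinLO Js. S \<subseteq> l F ` wires (T F)" if "finite S" "S \<subseteq> v ` wires L" for S
      using that
    proof (induction S)
      case empty
      then show ?case by (intro bexI[of _ "[]"]) (auto simp: FinLO_def)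
    next
      case (insert x S)
      then obtain F G where F: "F \<in> FinLO Js" "S \<subseteq> l F ` wires (T F)" "G \<in> FinLO Js" "x \<in> l G ` wires (T G)"
        unfolding v(2) by auto
      obtain H where H: "(H, F) \<in> FinLO_arr Js" "(H, G) \<in> FinLO_arr Js" using FinLO_union F by metis
      then have "H \<in> FinLO Js" by (simp add: FinLO_arr_iff)
      then show ?case using mono[OF H(1)] mono[OF H(2)] F(2,4) by (intro bexI[of _ H]) auto
    qed
    define r where "r F g = R (T F) (l F) (enat (length g)) (nth g)" for F and g :: "'w list"
    have r_hom: "r F g \<in> hom FI (T F) (enat (length g))" if "F \<in> FinLO Js" "distinct g" "set g \<subseteq> l F ` wires (T F)" for F g
      unfolding r_def by (rule R_hom[OF l[OF that(1)] list_labels(1)[OF that(2)]]) (use that(3) list_labels(2)[of g] in simp)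
    have rq: "comp FI (r F' g) (q F') = comp FI (r F g) (q F)" if "(F', F) \<in> FinLO_arr Js" "distinct g" "set g \<subseteq> l F ` wires (T F)" for F' F g
    proof -
      have F: "F \<in> FinLO Js" "F' \<in> FinLO Js" using that by (auto simp: FinLO_arr_iff)
      have m: "R (T F') (l F') (T F) (l F) \<in> hom FI (T F') (T F)" by (rule R_hom[OF l[OF F(2)] l[OF F(1)] mono[OF that(1)]])
      have "comp FI (r F g) (R (T F') (l F') (T F) (l F)) = r F' g"
        unfolding r_def by (rule R_comp[OF l[OF F(2)] l[OF F(1)] list_labels(1)[OF that(2)] mono[OF that(1)]]) (use that(3) list_labels(2)[of g] in simp)
      then have "comp FI (r F' g) (q F') = comp FI (comp FI (r F g) (R (T F') (l F') (T F) (l F))) (q F')" by simp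
      also have "\<dots> = comp FI (r F g) (comp FI (R (T F') (l F') (T F) (l F)) (q F'))"
        using r_hom[OF F(1) that(2,3)] m qh[OF F(2)] by (simp add: FI.hom_iff)
      finally show ?thesis using qn[OF that(1)] by simp
    qed
    define a where "a g = (let F = (SOME F. F \<in> FinLO Js \<and> set g \<subseteq> l F ` wires (T F)) in comp FI (r F g) (q F))" for g :: "'w list"
    have a: "a g = comp FI (r F g) (q F)" if g: "distinct g" "F \<in> FinLO Js" "set g \<subseteq> l F ` wires (T F)" for F g
    proof -
      define G where "G = (SOME F. F \<in> FinLO Js \<and> set g \<subseteq> l F ` wires (T F))"
      have G: "G \<in> FinLO Js" "set g \<subseteq> l G ` wires (T G)"
        using someI[of "\<lambda>F. F \<in> FinLO Js \<and> set g \<subseteq> l F ` wires (T F)" F] g unfolding G_def by auto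
      obtain H where H: "(H, F) \<in> FinLO_arr Js" "(H, G) \<in> FinLO_arr Js" using FinLO_union g(2) G(1) by metis
      have "a g = comp FI (r G g) (q G)" unfolding a_def G_def Let_def ..
      then show ?thesis using rq[OF H(1) g(1,3)] rq[OF H(2) g(1) G(2)] by simp
    qed
    have a_hom: "a g \<in> hom FI A (enat (length g))" if g: "distinct g" "set g \<subseteq> v ` wires L" for g
    proof -
      obtain F where F: "F \<in> FinLO Js" "set g \<subseteq> l F ` wires (T F)" using cover[of "set g"] g(2) by auto
      then show ?thesis unfolding a[OF g(1) F] using r_hom[OF F(1) g(1) F(2)] qh[OF F(1)] by (simp add: FI.hom_iff)
    qed
    have a_comp: "comp FI (R (enat (length g)) (nth g) (enat (length g')) (nth g')) (a g) = a g'"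
      if g: "distinct g" "distinct g'" "set g' \<subseteq> set g" "set g \<subseteq> v ` wires L" for g g'
    proof -
      obtain F where F: "F \<in> FinLO Js" "set g \<subseteq> l F ` wires (T F)" using cover[of "set g"] g(4) by auto
      have F': "set g' \<subseteq> l F ` wires (T F)" using F g by auto
      let ?r = "R (enat (length g)) (nth g) (enat (length g')) (nth g')"
      have m: "?r \<in> hom FI (enat (length g)) (enat (length g'))"
        by (rule R_hom[OF list_labels(1)[OF g(1)] list_labels(1)[OF g(2)]]) (use g(3) in \<open>simp only: list_labels(2)\<close>)
      have "comp FI ?r (r F g) = r F g'" unfolding r_def
        by (rule R_comp[OF l[OF F(1)] list_labels(1)[OF g(1)] list_labels(1)[OF g(2)]]) (use g(3) F(2) in \<open>simp_all only: list_labels(2)\<close>)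
      then have "a g' = comp FI (comp FI ?r (r F g)) (q F)" unfolding a[OF g(2) F(1) F'] by simp
      also have "\<dots> = comp FI ?r (a g)" unfolding a[OF g(1) F]
        using m r_hom[OF F(1) g(1) F(2)] qh[OF F(1)] by (simp add: FI.hom_iff)
      finally show ?thesis by simp
    qed
    have pr: "comp FI (r F g) (p F) = pick L v g" if "distinct g" "F \<in> FinLO Js" "set g \<subseteq> l F ` wires (T F)" for F g
      unfolding p[OF that(2)] r_def by (rule R_comp[OF v(1) l[OF that(2)] list_labels(1)[OF that(1)] sub[OF that(2)]]) (use that(3) list_labels(2)[of g] in simp)
    obtain u where u: "u \<in> hom FI A L" "\<And>g. distinct g \<Longrightarrow> set g \<subseteq> v ` wires L \<Longrightarrow> comp FI (pick L v g) u = a g"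
      using picks_glue[OF v(1), of a A] a_hom a_comp by blast
    show ?thesis
    proof (rule ex1I[of _ u])
      have "comp FI (p F) u = q F" if F: "F \<in> FinLO Js" for F
      proof (rule picks_faithful[OF l[OF F] _ qh[OF F]])
        show "comp FI (p F) u \<in> hom FI A (T F)" using p_hom[OF F] u(1) by (simp add: FI.hom_iff)
        fix g assume g: "distinct g" "set g \<subseteq> l F ` wires (T F)"
        have "comp FI (pick (T F) (l F) g) (comp FI (p F) u) = comp FI (comp FI (r F g) (p F)) u"
          unfolding r_def[symmetric] using r_hom[OF F g] p_hom[OF F] u(1) by (simp add: FI.hom_iff)
        also have "\<dots> = comp FI (pick L v g) u" unfolding pr[OF g(1) F g(2)] ..
        also have "\<dots> = a g" by (rule u(2)[OF g(1)]) (use g(2) sub[OF F] in auto)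
        also have "\<dots> = comp FI (pick (T F) (l F) g) (q F)" unfolding a[OF g(1) F g(2)] r_def ..
        finally show "comp FI (pick (T F) (l F) g) (comp FI (p F) u) = comp FI (pick (T F) (l F) g) (q F)" .
      qed
      then show "u \<in> hom FI A L \<and> (\<forall>F\<in>FinLO Js. comp FI (p F) u = q F)" using u by blast
    next
      fix u' assume u': "u' \<in> hom FI A L \<and> (\<forall>F\<in>FinLO Js. comp FI (p F) u' = q F)"
      show "u' = u"
      proof (rule picks_faithful[OF v(1) _ u(1)])
        show "u' \<in> hom FI A L" using u' by simp
        fix g assume g: "distinct g" "set g \<subseteq> v ` wires L"
        obtain F where F: "F \<in> FinLO Js" "set g \<subseteq> l F ` wires (T F)" using cover[of "set g"] g(2) by auto
        have "comp FI (pick L v g) u' = comp FI (r F g) (comp FI (p F) u')"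
          unfolding pr[OF g(1) F, symmetric] using r_hom[OF F(1) g(1) F(2)] p_hom[OF F(1)] u' by (simp add: FI.hom_iff)
        also have "\<dots> = a g" using u' F(1) unfolding a[OF g(1) F] by simp
        finally show "comp FI (pick L v g) u' = comp FI (pick L v g) u" using u(2)[OF g] by simp
      qed
    qed
  qed
  ultimately show ?thesis unfolding is_limit_def D(1) by blast
qed

lemma wires_label: assumes "countable S" obtains L :: enat and v where "inj_on v (wires L)" "v ` wires L = S"
proof (cases "finite S")
  case True
  then obtain v :: "nat \<Rightarrow> 'a" and n where "bij_betw v {0..<n} S" using ex_bij_betw_nat_finite by blast
  then show thesis using that[of v "enat n"] by (auto simp: bij_betw_def atLeast0LessThan)
next
  case False
  then have "bij_betw (from_nat_into S) UNIV S" using assms bij_betw_from_nat_into by blast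
  then show thesis using that[of "from_nat_into S" \<infinity>] by (auto simp: bij_betw_def)
qed

text \<open>The wires of the factors are countably many, hence they number the wires of some object \<open>L\<close>; tensoring
with \<open>Z\<close> adds the wires of \<open>Z\<close> to \<open>L\<close> and to each finite stage.\<close>

lemma FI_itp: assumes "countable Js" shows "\<exists>L p. is_itp FI (Js :: 'j set) Y L p"
proof -
  have "countable (Sigma Js (\<lambda>j. wires (Y j)))" by (rule countable_SIGMA[OF assms countableI_type])
  then obtain L :: enat and v where v: "inj_on v (wires L)" "v ` wires L = Sigma Js (\<lambda>j. wires (Y j))" by (rule wires_label)
  define p where "p F = R L v (big_tensor FI Y F) (tlab Y F)" for F
  have t: "inj_on (tlab Y F) (wires (big_tensor FI Y F))" "tlab Y F ` wires (big_tensor FI Y F) = Sigma (set F) (\<lambda>j. wires (Y j))"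
    if "F \<in> FinLO Js" for F using tlab[OF FinLO_distinct[OF that]] by auto
  have mono: "tlab Y F ` wires (big_tensor FI Y F) \<subseteq> tlab Y F' ` wires (big_tensor FI Y F')" if "(F', F) \<in> FinLO_arr Js" for F' F
    using that t(2) by (auto simp: FinLO_arr_iff)
  have union: "v ` wires L = (\<Union>F\<in>FinLO Js. tlab Y F ` wires (big_tensor FI Y F))"
  proof -
    have "Sigma Js (\<lambda>j. wires (Y j)) = (\<Union>F\<in>FinLO Js. Sigma (set F) (\<lambda>j. wires (Y j)))"
    proof
      show "Sigma Js (\<lambda>j. wires (Y j)) \<subseteq> (\<Union>F\<in>FinLO Js. Sigma (set F) (\<lambda>j. wires (Y j)))"
      proof
        fix x assume "x \<in> Sigma Js (\<lambda>j. wires (Y j))"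
        then have "[fst x] \<in> FinLO Js" "x \<in> Sigma (set [fst x]) (\<lambda>j. wires (Y j))" by (auto simp: FinLO_def)
        then show "x \<in> (\<Union>F\<in>FinLO Js. Sigma (set F) (\<lambda>j. wires (Y j)))" by blast
      qed
    qed (auto simp: FinLO_def)
    then show ?thesis using v(2) t(2) by simp
  qed
  have pr: "proj FI Y F' F = R (big_tensor FI Y F') (tlab Y F') (big_tensor FI Y F) (tlab Y F)" if "(F', F) \<in> FinLO_arr Js" for F' F
    by (rule proj_R) (use that FinLO_distinct[of F Js] FinLO_distinct[of F' Js] in \<open>auto simp: FinLO_arr_iff\<close>)
  have lim: "is_limit FI (std_itp FI Js Y) L p"
    by (rule relabel_limit[where T = "big_tensor FI Y" and l = "tlab Y", OF t(1) mono v(1) union])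
      (use pr in \<open>auto simp: std_itp_def p_def\<close>)
  have "is_limit FI (tensor_right FI (std_itp FI Js Y) Z) (L + Z) (\<lambda>F. tenM FI (p F) (ide FI Z))" for Z
  proof (rule relabel_limit[where T = "\<lambda>F. big_tensor FI Y F + Z" and l = "\<lambda>F. lsum (big_tensor FI Y F) (tlab Y F) Z id" and v = "lsum L v Z id" and Js = Js])
    have i: "inj_on id (wires Z)" by simp
    fix F assume F: "F \<in> FinLO Js"
    show "inj_on (lsum (big_tensor FI Y F) (tlab Y F) Z id) (wires (big_tensor FI Y F + Z))"
      by (rule lsum_inj[OF t(1)[OF F] i])
    show "ob (tensor_right FI (std_itp FI Js Y) Z) F = big_tensor FI Y F + Z" using F by (simp add: tensor_right_def std_itp_def)
    have s: "tlab Y F ` wires (big_tensor FI Y F) \<subseteq> v ` wires L" using union F by auto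
    show "tenM FI (p F) (ide FI Z) = R (L + Z) (lsum L v Z id) (big_tensor FI Y F + Z) (lsum (big_tensor FI Y F) (tlab Y F) Z id)"
      unfolding p_def R_ide[OF i, symmetric] by (rule R_tensor[OF v(1) t(1)[OF F] s i i order_refl])
  next
    have i: "inj_on id (wires Z)" by simp
    fix F' F assume a: "(F', F) \<in> FinLO_arr Js"
    then have F: "F \<in> FinLO Js" "F' \<in> FinLO Js" by (auto simp: FinLO_arr_iff)
    show "lsum (big_tensor FI Y F) (tlab Y F) Z id ` wires (big_tensor FI Y F + Z) \<subseteq> lsum (big_tensor FI Y F') (tlab Y F') Z id ` wires (big_tensor FI Y F' + Z)"
      unfolding lsum_image using mono[OF a] by auto
    have "prj (tensor_right FI (std_itp FI Js Y) Z) (F', F) = tenM FI (proj FI Y F' F) (ide FI Z)"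
      using a by (simp add: tensor_right_def std_itp_def)
    also have "\<dots> = R (big_tensor FI Y F' + Z) (lsum (big_tensor FI Y F') (tlab Y F') Z id) (big_tensor FI Y F + Z) (lsum (big_tensor FI Y F) (tlab Y F) Z id)"
      unfolding pr[OF a] R_ide[OF i, symmetric] by (rule R_tensor[OF t(1)[OF F(2)] t(1)[OF F(1)] mono[OF a] i i order_refl])
    finally show "prj (tensor_right FI (std_itp FI Js Y) Z) (F', F) = \<dots>" .
  next
    show "inj_on (lsum L v Z id) (wires (L + Z))" by (rule lsum_inj[OF v(1)]) simp
    have "[] \<in> FinLO Js" by (simp add: FinLO_def)
    then show "lsum L v Z id ` wires (L + Z) = (\<Union>F\<in>FinLO Js. lsum (big_tensor FI Y F) (tlab Y F) Z id ` wires (big_tensor FI Y F + Z))"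
      unfolding lsum_image union by (auto simp: Plus_def)
  qed (auto simp: tensor_right_def std_itp_def)
  then show ?thesis using lim unfolding is_itp_def by auto
qed

lemma FI_has_itps: "has_itps TYPE('j) FI"
  unfolding has_itps_def using FI_itp FI.semicartesian_axioms by blast

end

section \<open>Transport along a symmetric monoidal equivalence\<close>

locale full_faithful_functor = C: typed_category C + D: typed_category D
  for C :: "('o, 'm, 'x) category_scheme" and D :: "('p, 'n, 'y) category_scheme" (structure) +
  fixes Fo :: "'o \<Rightarrow> 'p" and Fm :: "'m \<Rightarrow> 'n"
  assumes is_fun: "is_functor C D Fo Fm"
    and full: "\<lbrakk>A \<in> obj C; B \<in> obj C; g \<in> hom D (Fo A) (Fo B)\<rbrakk> \<Longrightarrow> \<exists>f\<in>hom C A B. Fm f = g"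
    and faithful: "\<lbrakk>A \<in> obj C; B \<in> obj C; f \<in> hom C A B; f' \<in> hom C A B; Fm f = Fm f'\<rbrakk> \<Longrightarrow> f = f'"
    and surjective: "P \<in> obj D \<Longrightarrow> \<exists>A\<in>obj C. \<exists>e. iso_in D P (Fo A) e"
begin

lemma Fo_obj [simp]: "A \<in> obj C \<Longrightarrow> Fo A \<in> obj D"
  using is_fun by (simp add: is_functor_def)

lemma Fm_typed [simp]: assumes "arr C f"
  shows "arr D (Fm f)" "source D (Fm f) = Fo (source C f)" "target D (Fm f) = Fo (target C f)"
proof -
  have "Fm f \<in> hom D (Fo (source C f)) (Fo (target C f))"
    using is_fun C.arr_typed[OF assms] unfolding is_functor_def by blast
  then show "arr D (Fm f)" "source D (Fm f) = Fo (source C f)" "target D (Fm f) = Fo (target C f)"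
    using assms by (simp_all add: D.hom_iff)
qed

lemma Fm_ide: "A \<in> obj C \<Longrightarrow> Fm (ide C A) = ide D (Fo A)"
  using is_fun by (simp add: is_functor_def)

lemma Fm_comp: assumes "arr C f" "arr C g" "target C f = source C g" shows "Fm (g \<cdot>\<^bsub>C\<^esub> f) = Fm g \<cdot> Fm f"
  using is_fun C.arr_typed[OF assms(1)] C.arr_typed[OF assms(2)] assms(3) unfolding is_functor_def by metis

lemma lift: assumes "arr D g" "source D g = Fo A" "target D g = Fo B" "A \<in> obj C" "B \<in> obj C"
  obtains f where "arr C f" "source C f = A" "target C f = B" "Fm f = g"
proof -
  have "g \<in> hom D (Fo A) (Fo B)" using assms by (simp add: D.hom_iff)
  then obtain f where "f \<in> hom C A B" "Fm f = g" using full assms by blast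
  then have "arr C f" "source C f = A" "target C f = B" "Fm f = g" using assms by (simp_all add: C.hom_iff)
  then show thesis by (rule that)
qed

lemma Fm_eqD: assumes "Fm f = Fm f'" "arr C f" "arr C f'" "source C f = source C f'" "target C f = target C f'" shows "f = f'"
  using faithful[of "source C f" "target C f" f f'] assms C.arr_typed[OF assms(2)] C.arr_typed[OF assms(3)] by simp

lemma iso_inE: assumes "iso_in D A B e" "A \<in> obj D" "B \<in> obj D"
  obtains e' where "arr D e" "source D e = A" "target D e = B" "arr D e'" "source D e' = B" "target D e' = A"
    "e' \<cdot> e = ide D A" "e \<cdot> e' = ide D B"
  using D.iso_in_typed[OF assms] that by blast

text \<open>The inverse sends an object to a chosen preimage up to isomorphism, and a morphism to the preimage of its
conjugate by the chosen isomorphisms.\<close>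

lemma full_faithful_equivalence: "is_equivalence C D Fo Fm"
proof -
  have "\<forall>B\<in>obj D. \<exists>A e. A \<in> obj C \<and> iso_in D B (Fo A) e" using surjective by blast
  then obtain G e where G: "\<And>B. B \<in> obj D \<Longrightarrow> G B \<in> obj C" and e: "\<And>B. B \<in> obj D \<Longrightarrow> iso_in D B (Fo (G B)) (e B)" by metis
  define e' where "e' B = inv_of D B (Fo (G B)) (e B)" for B
  have t: "arr D (e B)" "source D (e B) = B" "target D (e B) = Fo (G B)" "arr D (e' B)" "source D (e' B) = Fo (G B)"
    "target D (e' B) = B" "e' B \<cdot> e B = ide D B" "e B \<cdot> e' B = ide D (Fo (G B))" if "B \<in> obj D" for B
    using D.iso_in_typed[OF e[OF that]] that G by (auto simp: e'_def)
  have t': "arr D k \<Longrightarrow> target D k = B \<Longrightarrow> e' B \<cdot> (e B \<cdot> k) = k"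
     "arr D k \<Longrightarrow> target D k = Fo (G B) \<Longrightarrow> e B \<cdot> (e' B \<cdot> k) = k" if "B \<in> obj D" for B k
    using t[OF that] D.comp_assoc'[of k "e B" "e' B"] D.comp_assoc'[of k "e' B" "e B"] by simp_all
  define Gm where "Gm g = (SOME f. arr C f \<and> source C f = G (source D g) \<and> target C f = G (target D g)
     \<and> Fm f = e (target D g) \<cdot> (g \<cdot> e' (source D g)))" for g
  have Gm: "arr C (Gm g)" "source C (Gm g) = G (source D g)" "target C (Gm g) = G (target D g)"
    "Fm (Gm g) = e (target D g) \<cdot> (g \<cdot> e' (source D g))" if g: "arr D g" for g
  proof -
    have o: "source D g \<in> obj D" "target D g \<in> obj D" using g by auto
    obtain f where "arr C f \<and> source C f = G (source D g) \<and> target C f = G (target D g)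
      \<and> Fm f = e (target D g) \<cdot> (g \<cdot> e' (source D g))"
      using lift[of "e (target D g) \<cdot> (g \<cdot> e' (source D g))" "G (source D g)" "G (target D g)"] g o t[OF o(1)] t[OF o(2)] G by auto
    then have "arr C (Gm g) \<and> source C (Gm g) = G (source D g) \<and> target C (Gm g) = G (target D g)
      \<and> Fm (Gm g) = e (target D g) \<cdot> (g \<cdot> e' (source D g))" unfolding Gm_def by (rule someI)
    then show "arr C (Gm g)" "source C (Gm g) = G (source D g)" "target C (Gm g) = G (target D g)"
      "Fm (Gm g) = e (target D g) \<cdot> (g \<cdot> e' (source D g))" by auto
  qed
  have "is_functor D C G Gm" unfolding is_functor_def
  proof (intro conjI ballI)
    show "category D" "category C" by unfold_locales
    show "G A \<in> obj C" if "A \<in> obj D" for A using G that .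
    show "Gm f \<in> hom C (G A) (G B)" if "A \<in> obj D" "B \<in> obj D" "f \<in> hom D A B" for A B f
      using that G Gm[of f] by (simp add: D.hom_iff C.hom_iff)
    show "Gm (ide D A) = ide C (G A)" if "A \<in> obj D" for A
      by (rule Fm_eqD) (use that Gm[of "ide D A"] G t[OF that] in \<open>simp_all add: Fm_ide\<close>)
    show "Gm (g \<cdot> f) = Gm g \<cdot>\<^bsub>C\<^esub> Gm f" if "A \<in> obj D" "B \<in> obj D" "K \<in> obj D" "f \<in> hom D A B" "g \<in> hom D B K" for A B K f g
    proof -
      have fg: "arr D f" "source D f = A" "target D f = B" "arr D g" "source D g = B" "target D g = K" using that by (auto simp: D.hom_iff)
      have gf: "arr D (g \<cdot> f)" using fg by simp
      show ?thesis
        by (rule Fm_eqD) (use that(1-3) fg Gm[OF fg(1)] Gm[OF fg(4)] Gm[OF gf] t t' in \<open>simp_all add: Fm_comp\<close>)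
    qed
  qed
  moreover define \<eta> where "\<eta> A = (SOME f. arr C f \<and> source C f = A \<and> target C f = G (Fo A) \<and> Fm f = e (Fo A))" for A
  have \<eta>: "arr C (\<eta> A) \<and> source C (\<eta> A) = A \<and> target C (\<eta> A) = G (Fo A) \<and> Fm (\<eta> A) = e (Fo A)" if A: "A \<in> obj C" for A
  proof -
    obtain f where "arr C f \<and> source C f = A \<and> target C f = G (Fo A) \<and> Fm f = e (Fo A)"
      using lift[OF t(1-3)[OF Fo_obj[OF A]] A G[OF Fo_obj[OF A]]] by metis
    then show ?thesis unfolding \<eta>_def by (rule someI)
  qed
  have "nat_iso C C id id (G \<circ> Fo) (Gm \<circ> Fm) \<eta>" unfolding nat_iso_def
  proof (intro conjI ballI)
    fix A assume A: "A \<in> obj C"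
    then have FA: "Fo A \<in> obj D" by simp
    obtain f where f: "arr C f" "source C f = G (Fo A)" "target C f = A" "Fm f = e' (Fo A)"
      using lift[of "e' (Fo A)" "G (Fo A)" A] A t[OF FA] G[OF FA] by auto
    have "f \<cdot>\<^bsub>C\<^esub> \<eta> A = ide C A" "\<eta> A \<cdot>\<^bsub>C\<^esub> f = ide C (G (Fo A))"
      by (rule Fm_eqD; use f \<eta>[OF A] A t[OF FA] G[OF FA] in \<open>simp add: Fm_comp Fm_ide\<close>)+
    then show "iso_in C (id A) ((G \<circ> Fo) A) (\<eta> A)" using f \<eta>[OF A] by (auto intro!: C.iso_inI[of _ f])
  next
    fix A B f assume "A \<in> obj C" "B \<in> obj C" "f \<in> hom C A B"
    then have f: "A \<in> obj C" "B \<in> obj C" "arr C f" "source C f = A" "target C f = B" by (auto simp: C.hom_iff)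
    have "\<eta> B \<cdot>\<^bsub>C\<^esub> f = Gm (Fm f) \<cdot>\<^bsub>C\<^esub> \<eta> A"
      by (rule Fm_eqD) (use f \<eta>[OF f(1)] \<eta>[OF f(2)] Gm[of "Fm f"] t[of "Fo A"] t[of "Fo B"] t'[of "Fo A"] in \<open>simp_all add: Fm_comp\<close>)
    then show "\<eta> B \<cdot>\<^bsub>C\<^esub> id f = (Gm \<circ> Fm) f \<cdot>\<^bsub>C\<^esub> \<eta> A" by simp
  qed
  moreover have "nat_iso D D (Fo \<circ> G) (Fm \<circ> Gm) id id e'" unfolding nat_iso_def
  proof (intro conjI ballI)
    fix A assume A: "A \<in> obj D"
    show "iso_in D ((Fo \<circ> G) A) (id A) (e' A)" using t[OF A] by (auto intro!: D.iso_inI[of _ "e A"])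
  next
    fix A B f assume "A \<in> obj D" "B \<in> obj D" "f \<in> hom D A B"
    then have f: "A \<in> obj D" "B \<in> obj D" "arr D f" "source D f = A" "target D f = B" by (auto simp: D.hom_iff)
    show "e' B \<cdot> (Fm \<circ> Gm) f = id f \<cdot> e' A"
      using f Gm[OF f(3)] t[OF f(1)] t[OF f(2)] t'[OF f(2)] by simp
  qed
  ultimately show ?thesis unfolding is_equivalence_def using is_fun by blast
qed

text \<open>A cone over \<open>Z\<close> has, up to isomorphism, the image of an object of \<open>C\<close> as its vertex, so it comes from a
cone over \<open>Y\<close>; \<open>l\<close> and \<open>\<mu>\<close> identify \<open>Z\<close> and its candidate limit with the images of \<open>Y\<close> and \<open>L\<close>.\<close>

lemma limit_transport:
  assumes T: "\<And>F. F \<in> FinLO (idx Y) \<Longrightarrow> ob Y F \<in> obj C"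
      "\<And>F' F. (F', F) \<in> FinLO_arr (idx Y) \<Longrightarrow> arr C (prj Y (F', F)) \<and> source C (prj Y (F', F)) = ob Y F' \<and> target C (prj Y (F', F)) = ob Y F"
    and L: "is_limit C Y L p" and idx: "idx Z = idx Y"
    and \<mu>: "\<And>F. F \<in> FinLO (idx Y) \<Longrightarrow> ob Z F \<in> obj D" "\<And>F. F \<in> FinLO (idx Y) \<Longrightarrow> iso_in D (ob Z F) (Fo (ob Y F)) (\<mu> F)"
      "\<And>F' F. (F', F) \<in> FinLO_arr (idx Y) \<Longrightarrow> arr D (prj Z (F', F)) \<and> source D (prj Z (F', F)) = ob Z F' \<and> target D (prj Z (F', F)) = ob Z F
         \<and> \<mu> F \<cdot> prj Z (F', F) = Fm (prj Y (F', F)) \<cdot> \<mu> F'"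
    and M: "M \<in> obj D" "iso_in D M (Fo L) l"
      "\<And>F. F \<in> FinLO (idx Y) \<Longrightarrow> arr D (q F) \<and> source D (q F) = M \<and> target D (q F) = ob Z F \<and> \<mu> F \<cdot> q F = Fm (p F) \<cdot> l"
  shows "is_limit D Z M q"
proof -
  have Lo: "L \<in> obj C" and p: "\<And>F. F \<in> FinLO (idx Y) \<Longrightarrow> arr C (p F) \<and> source C (p F) = L \<and> target C (p F) = ob Y F"
    and pn: "\<And>F' F. (F', F) \<in> FinLO_arr (idx Y) \<Longrightarrow> prj Y (F', F) \<cdot>\<^bsub>C\<^esub> p F' = p F"
    using L T(1) unfolding is_limit_def is_cone_def by (auto simp: C.hom_iff)
  define \<mu>' where "\<mu>' F = inv_of D (ob Z F) (Fo (ob Y F)) (\<mu> F)" for F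
  have m: "arr D (\<mu> F)" "source D (\<mu> F) = ob Z F" "target D (\<mu> F) = Fo (ob Y F)" "arr D (\<mu>' F)" "source D (\<mu>' F) = Fo (ob Y F)" "target D (\<mu>' F) = ob Z F"
     "\<mu>' F \<cdot> \<mu> F = ide D (ob Z F)" "\<mu> F \<cdot> \<mu>' F = ide D (Fo (ob Y F))" if "F \<in> FinLO (idx Y)" for F
    using D.iso_in_typed[OF \<mu>(2)[OF that] \<mu>(1)[OF that] Fo_obj[OF T(1)[OF that]]] by (simp_all add: \<mu>'_def)
  have mono: "f = g" if "F \<in> FinLO (idx Y)" "arr D f" "arr D g" "target D f = ob Z F" "target D g = ob Z F" "source D f = source D g" "\<mu> F \<cdot> f = \<mu> F \<cdot> g" for F f g
  proof -
    have "f = (\<mu>' F \<cdot> \<mu> F) \<cdot> f" using that m[OF that(1)] by simp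
    also have "\<dots> = \<mu>' F \<cdot> (\<mu> F \<cdot> f)" by (rule D.comp_assoc') (use that(1-6) m[OF that(1)] in auto)
    also have "\<dots> = (\<mu>' F \<cdot> \<mu> F) \<cdot> g" unfolding that(7) by (rule D.comp_assoc'[symmetric]) (use that(1-6) m[OF that(1)] in auto)
    finally show ?thesis using that(1-6) m[OF that(1)] by simp
  qed
  obtain l' where l: "arr D l" "source D l = M" "target D l = Fo L" "arr D l'" "source D l' = Fo L" "target D l' = M" "l' \<cdot> l = ide D M" "l \<cdot> l' = ide D (Fo L)"
    by (rule iso_inE[OF M(2,1) Fo_obj[OF Lo]])
  have ll: "l \<cdot> (l' \<cdot> k) = k" if "arr D k" "target D k = Fo L" for k
    using D.comp_assoc'[of k l' l] l that by simp
  have cone: "is_cone D Z M q" unfolding is_cone_def idx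
  proof (intro conjI ballI)
    show "M \<in> obj D" by fact
    show "q F \<in> hom D M (ob Z F)" if "F \<in> FinLO (idx Y)" for F using M(1,3) that \<mu>(1) by (simp add: D.hom_iff)
    fix x assume "x \<in> FinLO_arr (idx Y)"
    then obtain F' F where x: "x = (F', F)" "(F', F) \<in> FinLO_arr (idx Y)" by (cases x) auto
    then have F: "F \<in> FinLO (idx Y)" "F' \<in> FinLO (idx Y)" by (auto simp: FinLO_arr_iff)
    note a = \<mu>(3)[OF x(2)] M(3)[OF F(1)] M(3)[OF F(2)] T(2)[OF x(2)] p[OF F(1)] p[OF F(2)]
    have "prj Z (F', F) \<cdot> q F' = q F"
    proof (rule mono[OF F(1)])
      have "\<mu> F \<cdot> (prj Z (F', F) \<cdot> q F') = (\<mu> F \<cdot> prj Z (F', F)) \<cdot> q F'"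
        by (rule D.comp_assoc'[symmetric]) (use a m[OF F(1)] in auto)
      also have "\<dots> = Fm (prj Y (F', F)) \<cdot> (\<mu> F' \<cdot> q F')"
        using a m[OF F(2)] by simp
      also have "\<dots> = (Fm (prj Y (F', F)) \<cdot> Fm (p F')) \<cdot> l" using a l by simp
      also have "Fm (prj Y (F', F)) \<cdot> Fm (p F') = Fm (p F)" using a pn[OF x(2)] Fm_comp[of "p F'" "prj Y (F', F)"] by simp
      finally show "\<mu> F \<cdot> (prj Z (F', F) \<cdot> q F') = \<mu> F \<cdot> q F" using a by simp
    qed (use a m[OF F(1)] in auto)
    then show "case x of (F', F) \<Rightarrow> prj Z (F', F) \<cdot> q F' = q F" using x by simp
  qed
  moreover have "\<exists>!u. u \<in> hom D A M \<and> (\<forall>F\<in>FinLO (idx Y). q F \<cdot> u = r F)" if r: "is_cone D Z A r" for A r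
  proof -
    have A: "A \<in> obj D" and rt: "\<And>F. F \<in> FinLO (idx Y) \<Longrightarrow> arr D (r F) \<and> source D (r F) = A \<and> target D (r F) = ob Z F"
      and rn: "\<And>F' F. (F', F) \<in> FinLO_arr (idx Y) \<Longrightarrow> prj Z (F', F) \<cdot> r F' = r F"
      using r \<mu>(1) unfolding is_cone_def idx by (auto simp: D.hom_iff)
    obtain B e where B: "B \<in> obj C" "iso_in D A (Fo B) e" using surjective[OF A] by blast
    obtain e' where e: "arr D e" "source D e = A" "target D e = Fo B" "arr D e'" "source D e' = Fo B" "target D e' = A" "e' \<cdot> e = ide D A" "e \<cdot> e' = ide D (Fo B)"
      by (rule iso_inE[OF B(2) A Fo_obj[OF B(1)]])
    have ee: "e' \<cdot> (e \<cdot> k) = k" if "arr D k" "target D k = A" for k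
      using D.comp_assoc'[of k e e'] e that by simp
    have "\<exists>c. arr C c \<and> source C c = B \<and> target C c = ob Y F \<and> Fm c = \<mu> F \<cdot> (r F \<cdot> e')" if F: "F \<in> FinLO (idx Y)" for F
      using lift[of "\<mu> F \<cdot> (r F \<cdot> e')" B "ob Y F"] rt[OF F] m[OF F] e B(1) T(1)[OF F] by auto
    then obtain c where c: "\<And>F. F \<in> FinLO (idx Y) \<Longrightarrow> arr C (c F) \<and> source C (c F) = B \<and> target C (c F) = ob Y F \<and> Fm (c F) = \<mu> F \<cdot> (r F \<cdot> e')"
      by metis
    have "is_cone C Y B c" unfolding is_cone_def
    proof (intro conjI ballI)
      show "B \<in> obj C" by fact
      show "c F \<in> hom C B (ob Y F)" if "F \<in> FinLO (idx Y)" for F using c[OF that] T(1)[OF that] B(1) by (simp add: C.hom_iff)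
      fix x assume "x \<in> FinLO_arr (idx Y)"
      then obtain F' F where x: "x = (F', F)" "(F', F) \<in> FinLO_arr (idx Y)" by (cases x) auto
      then have F: "F \<in> FinLO (idx Y)" "F' \<in> FinLO (idx Y)" by (auto simp: FinLO_arr_iff)
      note a = \<mu>(3)[OF x(2)] rt[OF F(1)] rt[OF F(2)] T(2)[OF x(2)] c[OF F(1)] c[OF F(2)] m[OF F(1)] m[OF F(2)] e
      have "prj Y (F', F) \<cdot>\<^bsub>C\<^esub> c F' = c F"
      proof (rule Fm_eqD)
        have "Fm (prj Y (F', F) \<cdot>\<^bsub>C\<^esub> c F') = Fm (prj Y (F', F)) \<cdot> (\<mu> F' \<cdot> (r F' \<cdot> e'))" using a by (simp add: Fm_comp)
        also have "\<dots> = (\<mu> F \<cdot> prj Z (F', F)) \<cdot> (r F' \<cdot> e')"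
        proof -
          have "Fm (prj Y (F', F)) \<cdot> (\<mu> F' \<cdot> (r F' \<cdot> e')) = (Fm (prj Y (F', F)) \<cdot> \<mu> F') \<cdot> (r F' \<cdot> e')"
            by (rule D.comp_assoc'[symmetric]) (use a in auto)
          then show ?thesis using a by simp
        qed
        also have "\<dots> = \<mu> F \<cdot> ((prj Z (F', F) \<cdot> r F') \<cdot> e')"
          using conjunct1[OF a(1)] conjunct1[OF conjunct2[OF a(1)]] conjunct1[OF conjunct2[OF conjunct2[OF a(1)]]] a(2-) by simp
        finally show "Fm (prj Y (F', F) \<cdot>\<^bsub>C\<^esub> c F') = Fm (c F)" using rn[OF x(2)] a by simp
      qed (use a in auto)
      then show "case x of (F', F) \<Rightarrow> prj Y (F', F) \<cdot>\<^bsub>C\<^esub> c F' = c F" using x by simp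
    qed
    then have ex: "\<exists>!u. u \<in> hom C B L \<and> (\<forall>F\<in>FinLO (idx Y). p F \<cdot>\<^bsub>C\<^esub> u = c F)" using L unfolding is_limit_def by blast
    then obtain u where u: "u \<in> hom C B L" "\<And>F. F \<in> FinLO (idx Y) \<Longrightarrow> p F \<cdot>\<^bsub>C\<^esub> u = c F" by blast
    then have ut: "arr C u" "source C u = B" "target C u = L" using B(1) Lo by (auto simp: C.hom_iff)
    define w where "w = l' \<cdot> (Fm u \<cdot> e)"
    have wt: "arr D w" "source D w = A" "target D w = M" unfolding w_def using l e ut by auto
    show ?thesis
    proof (rule ex1I[of _ w])
      have "q F \<cdot> w = r F" if F: "F \<in> FinLO (idx Y)" for F
      proof (rule mono[OF F])
        note a = M(3)[OF F] rt[OF F] p[OF F] c[OF F] m[OF F] wt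
        have "\<mu> F \<cdot> (q F \<cdot> w) = (\<mu> F \<cdot> q F) \<cdot> w" by (rule D.comp_assoc'[symmetric]) (use a in auto)
        also have "\<dots> = Fm (p F) \<cdot> (l \<cdot> w)" using a l(1-3) by simp
        also have "\<dots> = Fm (p F) \<cdot> (Fm u \<cdot> e)" unfolding w_def using ll ut e by simp
        also have "\<dots> = (Fm (p F) \<cdot> Fm u) \<cdot> e" by (rule D.comp_assoc'[symmetric]) (use a ut e in auto)
        also have "\<dots> = Fm (c F) \<cdot> e" using u(2)[OF F] Fm_comp[of u "p F"] a ut by simp
        also have "\<dots> = \<mu> F \<cdot> r F" using a e by simp
        finally show "\<mu> F \<cdot> (q F \<cdot> w) = \<mu> F \<cdot> r F" .
      qed (use M(3)[OF F] rt[OF F] wt in auto)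
      then show "w \<in> hom D A M \<and> (\<forall>F\<in>FinLO (idx Y). q F \<cdot> w = r F)" using wt A M(1) by (simp add: D.hom_iff)
    next
      fix w' assume w': "w' \<in> hom D A M \<and> (\<forall>F\<in>FinLO (idx Y). q F \<cdot> w' = r F)"
      then have wt': "arr D w'" "source D w' = A" "target D w' = M" using A M(1) by (auto simp: D.hom_iff)
      obtain v where v: "arr C v" "source C v = B" "target C v = L" "Fm v = l \<cdot> (w' \<cdot> e')"
        using lift[of "l \<cdot> (w' \<cdot> e')" B L] wt' l e B(1) Lo by auto
      have "p F \<cdot>\<^bsub>C\<^esub> v = c F" if F: "F \<in> FinLO (idx Y)" for F
      proof (rule Fm_eqD)
        note a = M(3)[OF F] rt[OF F] p[OF F] c[OF F] m[OF F] wt'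
        have "Fm (p F \<cdot>\<^bsub>C\<^esub> v) = (Fm (p F) \<cdot> l) \<cdot> (w' \<cdot> e')" using a v l(1-3) e(4-6) by (simp add: Fm_comp)
        also have "\<dots> = (\<mu> F \<cdot> q F) \<cdot> (w' \<cdot> e')" using a by simp
        also have "\<dots> = \<mu> F \<cdot> ((q F \<cdot> w') \<cdot> e')"
        proof -
          have q: "arr D (q F)" "source D (q F) = M" "target D (q F) = ob Z F" using a by auto
          show ?thesis using q m(1-3)[OF F] wt' e(4-6) by simp
        qed
        also have "q F \<cdot> w' = r F" using w' F by blast
        also have "\<mu> F \<cdot> (r F \<cdot> e') = Fm (c F)" using c[OF F] by simp
        finally show "Fm (p F \<cdot>\<^bsub>C\<^esub> v) = Fm (c F)" .
      qed (use p[OF F] c[OF F] v in auto)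
      moreover have "v \<in> hom C B L" using v(1-3) Lo B(1) by (simp add: C.hom_iff)
      ultimately have "v = u" using ex u by blast
      then have "w = l' \<cdot> ((l \<cdot> (w' \<cdot> e')) \<cdot> e)" unfolding w_def using v by simp
      also have "\<dots> = (l' \<cdot> l) \<cdot> (w' \<cdot> (e' \<cdot> e))" using l(1-6) e(1-6) wt' by simp
      also have "\<dots> = w'" using l e wt' by simp
      finally show "w' = w" by simp
    qed
  qed
  ultimately show ?thesis unfolding is_limit_def idx by blast
qed

end

context typed_category
begin

lemma iso_in_ide: "A \<in> obj C \<Longrightarrow> iso_in C A A (ide C A)"
  by (rule iso_inI[of _ "ide C A"]) simp_all

lemma iso_in_comp: assumes "iso_in C A B f" "iso_in C B D g" "A \<in> obj C" "B \<in> obj C" "D \<in> obj C"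
  shows "iso_in C A D (g \<cdot> f)"
proof -
  let ?f = "inv_of C A B f" and ?g = "inv_of C B D g"
  note t = iso_in_typed[OF assms(1,3,4)] iso_in_typed[OF assms(2,4,5)]
  have "?g \<cdot> (g \<cdot> f) = (?g \<cdot> g) \<cdot> f" "f \<cdot> (?f \<cdot> ?g) = (f \<cdot> ?f) \<cdot> ?g"
    by (rule comp_assoc'[symmetric]; use t in simp)+
  then show ?thesis by (intro iso_inI[of _ "?f \<cdot> ?g"]) (use t in simp_all)
qed

end

context typed_smc
begin

lemma iso_in_tensor: assumes "iso_in C A B f" "iso_in C A' B' g" "A \<in> obj C" "B \<in> obj C" "A' \<in> obj C" "B' \<in> obj C"
  shows "iso_in C (A \<odot> A') (B \<odot> B') (f \<otimes> g)"
  by (rule iso_inI[of _ "inv_of C A B f \<otimes> inv_of C A' B' g"])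
    (use iso_in_typed[OF assms(1,3,4)] iso_in_typed[OF assms(2,5,6)] assms in \<open>simp_all add: interchange\<close>)

lemma assoc_inv_natural: assumes "arr C f" "arr C g" "arr C h"
  shows "assoc_inv (target C f) (target C g) (target C h) \<cdot> (f \<otimes> (g \<otimes> h))
    = ((f \<otimes> g) \<otimes> h) \<cdot> assoc_inv (source C f) (source C g) (source C h)"
proof -
  let ?s = "assoc C (source C f) (source C g) (source C h)" and ?t = "assoc C (target C f) (target C g) (target C h)"
  let ?s' = "assoc_inv (source C f) (source C g) (source C h)" and ?t' = "assoc_inv (target C f) (target C g) (target C h)"
  have "?t' \<cdot> (f \<otimes> (g \<otimes> h)) = ?t' \<cdot> (((f \<otimes> (g \<otimes> h)) \<cdot> ?s) \<cdot> ?s')" using assms by simp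
  also have "\<dots> = ?t' \<cdot> ((?t \<cdot> ((f \<otimes> g) \<otimes> h)) \<cdot> ?s')" using assoc_natural[OF assms] by simp
  also have "\<dots> = (?t' \<cdot> ?t) \<cdot> (((f \<otimes> g) \<otimes> h) \<cdot> ?s')"
  proof -
    have "(?t' \<cdot> ?t) \<cdot> (((f \<otimes> g) \<otimes> h) \<cdot> ?s') = ?t' \<cdot> (?t \<cdot> (((f \<otimes> g) \<otimes> h) \<cdot> ?s'))"
      by (rule comp_assoc') (use assms in simp_all)
    then show ?thesis using assms by simp
  qed
  finally show ?thesis using assms by simp
qed

text \<open>The exchange of the first two factors of \<open>A \<odot> (B \<odot> R)\<close>, from which the permutations
  \<open>to_front\<close> are built.\<close>

definition exchange where "exchange A B R = assoc C B A R \<cdot> (braid C A B \<otimes> ide C R) \<cdot> assoc_inv A B R"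

lemma exchange_typed [simp]: assumes "A \<in> obj C" "B \<in> obj C" "R \<in> obj C"
  shows "arr C (exchange A B R)" "source C (exchange A B R) = A \<odot> (B \<odot> R)" "target C (exchange A B R) = B \<odot> (A \<odot> R)"
  unfolding exchange_def using assms by simp_all

lemma exchange_natural: assumes "arr C a" "arr C b" "arr C r"
  shows "exchange (target C a) (target C b) (target C r) \<cdot> (a \<otimes> (b \<otimes> r))
    = (b \<otimes> (a \<otimes> r)) \<cdot> exchange (source C a) (source C b) (source C r)"
proof -
  let ?x = "braid C (target C a) (target C b) \<otimes> ide C (target C r)"
  let ?y = "braid C (source C a) (source C b) \<otimes> ide C (source C r)"
  let ?i = "assoc_inv (source C a) (source C b) (source C r)"
  let ?p = "assoc C (target C b) (target C a) (target C r)" and ?q = "assoc C (source C b) (source C a) (source C r)"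
  have "exchange (target C a) (target C b) (target C r) \<cdot> (a \<otimes> (b \<otimes> r)) = ?p \<cdot> (?x \<cdot> (((a \<otimes> b) \<otimes> r) \<cdot> ?i))"
    unfolding exchange_def using assms by (simp add: assoc_inv_natural)
  also have "?x \<cdot> (((a \<otimes> b) \<otimes> r) \<cdot> ?i) = ((b \<otimes> a) \<otimes> r) \<cdot> (?y \<cdot> ?i)"
    using assms by (simp add: interchange_tail braid_natural)
  also have "?p \<cdot> (((b \<otimes> a) \<otimes> r) \<cdot> (?y \<cdot> ?i)) = (?p \<cdot> ((b \<otimes> a) \<otimes> r)) \<cdot> (?y \<cdot> ?i)"
    by (rule comp_assoc'[symmetric]) (use assms in simp_all)
  also have "\<dots> = (b \<otimes> (a \<otimes> r)) \<cdot> (?q \<cdot> (?y \<cdot> ?i))"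
    unfolding assoc_natural[OF assms(2,1,3)] using assms by simp
  finally show ?thesis unfolding exchange_def .
qed

lemma big_tensor_obj [simp]: "\<forall>j\<in>set F. X j \<in> obj C \<Longrightarrow> big_tensor C X F \<in> obj C"
  by (induction F) auto

lemma to_front_Cons:
  assumes "i \<noteq> j" "\<forall>k\<in>set (i # F). X k \<in> obj C" "j \<in> set F"
    "arr C (to_front C X j F)" "target C (to_front C X j F) = X j \<odot> big_tensor C X (remove1 j F)"
  shows "to_front C X j (i # F) = exchange (X i) (X j) (big_tensor C X (remove1 j F)) \<cdot> (ide C (X i) \<otimes> to_front C X j F)"
proof -
  have "big_tensor C X (remove1 j F) \<in> obj C" using assms(2) set_remove1_subset[of j F] by (intro big_tensor_obj) auto
  then show ?thesis using assms unfolding exchange_def by (auto simp: Let_def)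
qed

lemma to_front_typed: assumes "j \<in> set F" "\<forall>k\<in>set F. X k \<in> obj C"
  shows "arr C (to_front C X j F) \<and> source C (to_front C X j F) = big_tensor C X F
    \<and> target C (to_front C X j F) = X j \<odot> big_tensor C X (remove1 j F)"
  using assms
proof (induction F)
  case (Cons i F)
  show ?case
  proof (cases "i = j")
    case True then show ?thesis using Cons.prems by simp
  next
    case False
    then have j: "j \<in> set F" using Cons.prems by auto
    note IH = Cons.IH[OF j]
    have "\<forall>k\<in>set (remove1 j F). X k \<in> obj C" using Cons.prems set_remove1_subset[of j F] by auto
    then have o: "X i \<in> obj C" "X j \<in> obj C" "big_tensor C X (remove1 j F) \<in> obj C"
      using Cons.prems j by auto
    show ?thesis using to_front_Cons[of i j F X] IH Cons.prems j False o by simp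
  qed
qed simp

end

context typed_semicartesian
begin

lemma proj_typed: assumes "set G \<subseteq> set F" "distinct G" "\<forall>k\<in>set F. X k \<in> obj C"
  shows "arr C (proj C X F G) \<and> source C (proj C X F G) = big_tensor C X F \<and> target C (proj C X F G) = big_tensor C X G"
  using assms
proof (induction G arbitrary: F)
  case (Cons j G)
  have G: "set G \<subseteq> set (remove1 j F)"
  proof
    fix x assume "x \<in> set G"
    then have "x \<noteq> j" "x \<in> set F" using Cons.prems by auto
    then show "x \<in> set (remove1 j F)" by simp
  qed
  have X: "\<forall>k\<in>set (remove1 j F). X k \<in> obj C" using Cons.prems set_remove1_subset[of j F] by blast
  have "j \<in> set F" "X j \<in> obj C" using Cons.prems by auto
  then show ?case using Cons.IH[OF G _ X] Cons.prems(2) to_front_typed[of j F X] Cons.prems(3) by simp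
qed simp

end

locale smc_equivalence = full_faithful_functor C D "fobj \<phi>" "fmor \<phi>" + symmetric_monoidal_functor C D \<phi>
    + C: typed_semicartesian C + D: typed_semicartesian D
  for C :: "('o, 'm, 'x) smc_scheme" and D :: "('p, 'n, 'y) smc_scheme" (structure) and \<phi> :: "('o, 'm, 'p, 'n) smfunctor"
begin

abbreviation "\<mu> \<equiv> fmul \<phi>"
abbreviation "\<Phi> \<equiv> fobj \<phi>"
abbreviation "\<Psi> \<equiv> fmor \<phi>"

lemma \<mu>_typed [simp]: assumes "A \<in> obj C" "B \<in> obj C"
  shows "arr D (\<mu> A B)" "source D (\<mu> A B) = \<Phi> A \<odot> \<Phi> B" "target D (\<mu> A B) = \<Phi> (A \<odot>\<^bsub>C\<^esub> B)"
  using D.iso_in_typed[OF fmul_iso[OF assms]] assms by simp_all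

lemma \<mu>_natural: assumes "arr C f" "arr C g"
  shows "\<mu> (target C f) (target C g) \<cdot> (\<Psi> f \<otimes> \<Psi> g) = \<Psi> (f \<otimes>\<^bsub>C\<^esub> g) \<cdot> \<mu> (source C f) (source C g)"
  using fmul_nat C.arr_typed[OF assms(1)] C.arr_typed[OF assms(2)] by simp

lemma \<mu>_assoc_inv: assumes "A \<in> obj C" "B \<in> obj C" "R \<in> obj C"
  shows "\<mu> A (B \<odot>\<^bsub>C\<^esub> R) \<cdot> (ide D (\<Phi> A) \<otimes> \<mu> B R)
    = \<Psi> (assoc C A B R) \<cdot> \<mu> (A \<odot>\<^bsub>C\<^esub> B) R \<cdot> (\<mu> A B \<otimes> ide D (\<Phi> R)) \<cdot> D.assoc_inv (\<Phi> A) (\<Phi> B) (\<Phi> R)"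
proof -
  have "\<mu> A (B \<odot>\<^bsub>C\<^esub> R) \<cdot> (ide D (\<Phi> A) \<otimes> \<mu> B R)
      = (\<mu> A (B \<odot>\<^bsub>C\<^esub> R) \<cdot> (ide D (\<Phi> A) \<otimes> \<mu> B R) \<cdot> assoc D (\<Phi> A) (\<Phi> B) (\<Phi> R)) \<cdot> D.assoc_inv (\<Phi> A) (\<Phi> B) (\<Phi> R)"
    using assms by simp
  then show ?thesis unfolding fmul_assoc[OF assms, symmetric] using assms by simp
qed

text \<open>By \<open>\<mu>_assoc_inv\<close> the left-hand side factors through \<open>\<mu> (A \<odot> B) R\<close>, where compatibility with the
symmetry applies; compatibility with the associator then leads back.\<close>

lemma \<mu>_exchange: assumes "A \<in> obj C" "B \<in> obj C" "R \<in> obj C"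
  shows "\<Psi> (C.exchange A B R) \<cdot> \<mu> A (B \<odot>\<^bsub>C\<^esub> R) \<cdot> (ide D (\<Phi> A) \<otimes> \<mu> B R)
    = \<mu> B (A \<odot>\<^bsub>C\<^esub> R) \<cdot> (ide D (\<Phi> B) \<otimes> \<mu> A R) \<cdot> D.exchange (\<Phi> A) (\<Phi> B) (\<Phi> R)" (is "?l = ?r")
proof -
  let ?i = "D.assoc_inv (\<Phi> A) (\<Phi> B) (\<Phi> R)" and ?e = "ide D (\<Phi> R)"
  have 1: "\<Psi> (C.assoc_inv A B R) \<cdot> (\<Psi> (assoc C A B R) \<cdot> k) = k" if "arr D k" "target D k = \<Phi> ((A \<odot>\<^bsub>C\<^esub> B) \<odot>\<^bsub>C\<^esub> R)" for k
    using that assms D.comp_assoc'[of k "\<Psi> (assoc C A B R)" "\<Psi> (C.assoc_inv A B R)"]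
      Fm_comp[of "assoc C A B R" "C.assoc_inv A B R", symmetric] by (simp add: Fm_ide)
  have 2: "\<Psi> (braid C A B \<otimes>\<^bsub>C\<^esub> ide C R) \<cdot> (\<mu> (A \<odot>\<^bsub>C\<^esub> B) R \<cdot> k) = \<mu> (B \<odot>\<^bsub>C\<^esub> A) R \<cdot> ((\<Psi> (braid C A B) \<otimes> ?e) \<cdot> k)"
    if "arr D k" "target D k = \<Phi> (A \<odot>\<^bsub>C\<^esub> B) \<odot> \<Phi> R" for k
    using that assms \<mu>_natural[of "braid C A B" "ide C R"]
      D.comp_assoc'[of k "\<mu> (A \<odot>\<^bsub>C\<^esub> B) R" "\<Psi> (braid C A B \<otimes>\<^bsub>C\<^esub> ide C R)"]
      D.comp_assoc'[of k "\<Psi> (braid C A B) \<otimes> ?e" "\<mu> (B \<odot>\<^bsub>C\<^esub> A) R"] by (simp add: Fm_ide)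
  have "?l = \<Psi> (assoc C B A R) \<cdot> \<mu> (B \<odot>\<^bsub>C\<^esub> A) R \<cdot> (\<Psi> (braid C A B) \<otimes> ?e) \<cdot> (\<mu> A B \<otimes> ?e) \<cdot> ?i"
    unfolding C.exchange_def \<mu>_assoc_inv[OF assms] using assms by (simp add: Fm_comp 1 2)
  also have "(\<Psi> (braid C A B) \<otimes> ?e) \<cdot> (\<mu> A B \<otimes> ?e) \<cdot> ?i
      = (\<mu> B A \<otimes> ?e) \<cdot> (braid D (\<Phi> A) (\<Phi> B) \<otimes> ?e) \<cdot> ?i"
    using assms by (simp add: D.interchange_tail fmul_braid)
  also have "\<Psi> (assoc C B A R) \<cdot> \<mu> (B \<odot>\<^bsub>C\<^esub> A) R \<cdot> (\<mu> B A \<otimes> ?e) \<cdot> (braid D (\<Phi> A) (\<Phi> B) \<otimes> ?e) \<cdot> ?i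
      = (\<Psi> (assoc C B A R) \<cdot> \<mu> (B \<odot>\<^bsub>C\<^esub> A) R \<cdot> (\<mu> B A \<otimes> ?e)) \<cdot> (braid D (\<Phi> A) (\<Phi> B) \<otimes> ?e) \<cdot> ?i"
    using assms by simp
  also have "\<dots> = ?r"
    unfolding fmul_assoc[OF assms(2,1,3)] D.exchange_def using assms by simp
  finally show ?thesis .
qed

text \<open>The comparison between the tensor product of the \<open>Y j\<close> and the image of that of the \<open>X j\<close>,
  given isomorphisms \<open>y j\<close> from \<open>Y j\<close> to the image of \<open>X j\<close>.\<close>

fun compare :: "('j \<Rightarrow> 'o) \<Rightarrow> ('j \<Rightarrow> 'n) \<Rightarrow> 'j list \<Rightarrow> 'n" where
  "compare X y [] = funit \<phi>"
| "compare X y (j # F) = \<mu> (X j) (big_tensor C X F) \<cdot> (y j \<otimes> compare X y F)"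

lemma compare_iso: assumes "\<forall>j\<in>set F. X j \<in> obj C \<and> Y j \<in> obj D \<and> iso_in D (Y j) (\<Phi> (X j)) (y j)"
  shows "iso_in D (big_tensor D Y F) (\<Phi> (big_tensor C X F)) (compare X y F)"
  using assms
proof (induction F)
  case Nil show ?case using funit_iso by simp
next
  case (Cons j F)
  have o: "big_tensor C X F \<in> obj C" "big_tensor D Y F \<in> obj D" using Cons.prems by simp_all
  then show ?case using Cons by (auto intro!: D.iso_in_comp[OF D.iso_in_tensor fmul_iso])
qed

lemma compare_typed: assumes "\<forall>j\<in>set F. X j \<in> obj C \<and> Y j \<in> obj D \<and> iso_in D (Y j) (\<Phi> (X j)) (y j)"
  shows "arr D (compare X y F)" "source D (compare X y F) = big_tensor D Y F" "target D (compare X y F) = \<Phi> (big_tensor C X F)"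
  using D.iso_in_typed[OF compare_iso[OF assms]] assms by simp_all

lemma compare_two: assumes "a \<in> hom D A' (\<Phi> A)" "b \<in> hom D B' (\<Phi> B)" "r \<in> hom D R' (\<Phi> R)"
   "A \<in> obj C" "B \<in> obj C" "R \<in> obj C" "A' \<in> obj D" "B' \<in> obj D" "R' \<in> obj D"
  shows "\<Psi> (C.exchange A B R) \<cdot> \<mu> A (B \<odot>\<^bsub>C\<^esub> R) \<cdot> (a \<otimes> (\<mu> B R \<cdot> (b \<otimes> r)))
    = \<mu> B (A \<odot>\<^bsub>C\<^esub> R) \<cdot> (b \<otimes> (\<mu> A R \<cdot> (a \<otimes> r))) \<cdot> D.exchange A' B' R'"
proof -
  have t: "arr D a" "source D a = A'" "target D a = \<Phi> A" "arr D b" "source D b = B'" "target D b = \<Phi> B"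
    "arr D r" "source D r = R'" "target D r = \<Phi> R" using assms by (auto simp: D.hom_iff)
  have 1: "a \<otimes> (\<mu> B R \<cdot> (b \<otimes> r)) = (ide D (\<Phi> A) \<otimes> \<mu> B R) \<cdot> (a \<otimes> (b \<otimes> r))"
    "b \<otimes> (\<mu> A R \<cdot> (a \<otimes> r)) = (ide D (\<Phi> B) \<otimes> \<mu> A R) \<cdot> (b \<otimes> (a \<otimes> r))"
    using t assms by (simp_all add: D.interchange)
  have "\<Psi> (C.exchange A B R) \<cdot> \<mu> A (B \<odot>\<^bsub>C\<^esub> R) \<cdot> (a \<otimes> (\<mu> B R \<cdot> (b \<otimes> r)))
     = (\<Psi> (C.exchange A B R) \<cdot> \<mu> A (B \<odot>\<^bsub>C\<^esub> R) \<cdot> (ide D (\<Phi> A) \<otimes> \<mu> B R)) \<cdot> (a \<otimes> (b \<otimes> r))"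
    unfolding 1 using t assms by simp
  also have "\<dots> = \<mu> B (A \<odot>\<^bsub>C\<^esub> R) \<cdot> (ide D (\<Phi> B) \<otimes> \<mu> A R) \<cdot> (D.exchange (\<Phi> A) (\<Phi> B) (\<Phi> R) \<cdot> (a \<otimes> (b \<otimes> r)))"
    unfolding \<mu>_exchange[OF assms(4-6)] using t assms by simp
  also have "D.exchange (\<Phi> A) (\<Phi> B) (\<Phi> R) \<cdot> (a \<otimes> (b \<otimes> r)) = (b \<otimes> (a \<otimes> r)) \<cdot> D.exchange A' B' R'"
    using D.exchange_natural[of a b r] t by simp
  finally show ?thesis unfolding 1 using t assms by simp
qed

lemma \<mu>_right: assumes "arr C g" "arr D a" "target D a = \<Phi> A" "A \<in> obj C" "arr D r" "target D r = \<Phi> (source C g)"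
  shows "\<mu> A (target C g) \<cdot> (a \<otimes> (\<Psi> g \<cdot> r)) = \<Psi> (ide C A \<otimes>\<^bsub>C\<^esub> g) \<cdot> \<mu> A (source C g) \<cdot> (a \<otimes> r)"
proof -
  have 1: "a \<otimes> (\<Psi> g \<cdot> r) = (\<Psi> (ide C A) \<otimes> \<Psi> g) \<cdot> (a \<otimes> r)" using assms by (simp add: D.interchange Fm_ide)
  have 2: "\<mu> A (target C g) \<cdot> ((\<Psi> (ide C A) \<otimes> \<Psi> g) \<cdot> (a \<otimes> r))
     = (\<mu> A (target C g) \<cdot> (\<Psi> (ide C A) \<otimes> \<Psi> g)) \<cdot> (a \<otimes> r)"
    by (rule D.comp_assoc'[symmetric]) (use assms in simp_all)
  have 3: "\<mu> A (target C g) \<cdot> (\<Psi> (ide C A) \<otimes> \<Psi> g) = \<Psi> (ide C A \<otimes>\<^bsub>C\<^esub> g) \<cdot> \<mu> A (source C g)"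
    using \<mu>_natural[of "ide C A" g] assms by simp
  show ?thesis unfolding 1 2 3 by (rule D.comp_assoc') (use assms in simp_all)
qed

lemma \<mu>_left: assumes "arr C g" "arr D a" "target D a = \<Phi> A" "A \<in> obj C" "arr D r" "target D r = \<Phi> (source C g)"
  shows "\<mu> (target C g) A \<cdot> ((\<Psi> g \<cdot> r) \<otimes> a) = \<Psi> (g \<otimes>\<^bsub>C\<^esub> ide C A) \<cdot> \<mu> (source C g) A \<cdot> (r \<otimes> a)"
proof -
  have 1: "(\<Psi> g \<cdot> r) \<otimes> a = (\<Psi> g \<otimes> \<Psi> (ide C A)) \<cdot> (r \<otimes> a)" using assms by (simp add: D.interchange Fm_ide)
  have 2: "\<mu> (target C g) A \<cdot> ((\<Psi> g \<otimes> \<Psi> (ide C A)) \<cdot> (r \<otimes> a))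
     = (\<mu> (target C g) A \<cdot> (\<Psi> g \<otimes> \<Psi> (ide C A))) \<cdot> (r \<otimes> a)"
    by (rule D.comp_assoc'[symmetric]) (use assms in simp_all)
  have 3: "\<mu> (target C g) A \<cdot> (\<Psi> g \<otimes> \<Psi> (ide C A)) = \<Psi> (g \<otimes>\<^bsub>C\<^esub> ide C A) \<cdot> \<mu> (source C g) A"
    using \<mu>_natural[of g "ide C A"] assms by simp
  show ?thesis unfolding 1 2 3 by (rule D.comp_assoc') (use assms in simp_all)
qed

text \<open>The permutation is a composite of exchanges, each of which passes through the comparison by
\<open>compare_two\<close>.\<close>

lemma compare_to_front:
  assumes "\<forall>j\<in>set F. X j \<in> obj C \<and> Y j \<in> obj D \<and> iso_in D (Y j) (\<Phi> (X j)) (y j)" "j \<in> set F"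
  shows "compare X y (j # remove1 j F) \<cdot> to_front D Y j F = \<Psi> (to_front C X j F) \<cdot> compare X y F"
  using assms
proof (induction F)
  case (Cons i F)
  note t = compare_typed[OF Cons.prems(1)]
  show ?case
  proof (cases "i = j")
    case True
    show ?thesis using t True Cons.prems(1) by (simp add: Fm_ide)
  next
    case False
    then have j: "j \<in> set F" using Cons.prems by auto
    define R where "R = remove1 j F"
    have FX: "\<forall>j\<in>set F. X j \<in> obj C \<and> Y j \<in> obj D \<and> iso_in D (Y j) (\<Phi> (X j)) (y j)" using Cons.prems by simp
    have RX: "\<forall>j\<in>set R. X j \<in> obj C \<and> Y j \<in> obj D \<and> iso_in D (Y j) (\<Phi> (X j)) (y j)"
      using FX set_remove1_subset[of j F] unfolding R_def by blast
    have o: "X i \<in> obj C" "X j \<in> obj C" "Y i \<in> obj D" "Y j \<in> obj D" "iso_in D (Y i) (\<Phi> (X i)) (y i)" "iso_in D (Y j) (\<Phi> (X j)) (y j)"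
      "big_tensor C X R \<in> obj C" "big_tensor D Y R \<in> obj D" "big_tensor C X F \<in> obj C" "big_tensor D Y F \<in> obj D"
      using Cons.prems j RX by auto
    note y = D.iso_in_typed(1-3)[OF o(5)] D.iso_in_typed(1-3)[OF o(6)]
    note tc = C.to_front_typed[OF j, of X] and td = D.to_front_typed[OF j, of Y]
    note c = compare_typed[OF FX] compare_typed[OF RX]
    have "compare X y (j # remove1 j (i # F)) \<cdot> to_front D Y j (i # F)
      = compare X y (j # i # R) \<cdot> D.exchange (Y i) (Y j) (big_tensor D Y R) \<cdot> (ide D (Y i) \<otimes> to_front D Y j F)"
      using False D.to_front_Cons[of i j F Y] td Cons.prems(1) j by (simp add: R_def del: to_front.simps)
    also have "\<dots> = (\<mu> (X j) (X i \<odot>\<^bsub>C\<^esub> big_tensor C X R) \<cdot> (y j \<otimes> (\<mu> (X i) (big_tensor C X R) \<cdot> (y i \<otimes> compare X y R)))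
        \<cdot> D.exchange (Y i) (Y j) (big_tensor D Y R)) \<cdot> (ide D (Y i) \<otimes> to_front D Y j F)"
      using o y c td FX by (simp add: R_def[symmetric])
    also have "\<dots> = (\<Psi> (C.exchange (X i) (X j) (big_tensor C X R)) \<cdot> \<mu> (X i) (X j \<odot>\<^bsub>C\<^esub> big_tensor C X R)
        \<cdot> (y i \<otimes> compare X y (j # R))) \<cdot> (ide D (Y i) \<otimes> to_front D Y j F)"
      using compare_two[of "y i" "Y i" "X i" "y j" "Y j" "X j" "compare X y R" "big_tensor D Y R" "big_tensor C X R"] o y c by (simp add: D.hom_iff)
    also have "\<dots> = \<Psi> (C.exchange (X i) (X j) (big_tensor C X R)) \<cdot> (\<mu> (X i) (X j \<odot>\<^bsub>C\<^esub> big_tensor C X R)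
        \<cdot> (y i \<otimes> (compare X y (j # R) \<cdot> to_front D Y j F)))"
      using o y c td FX by (simp add: R_def[symmetric] D.interchange)
    also have "compare X y (j # R) \<cdot> to_front D Y j F = \<Psi> (to_front C X j F) \<cdot> compare X y F"
      using Cons.IH[OF FX j] by (simp add: R_def)
    also have "\<mu> (X i) (X j \<odot>\<^bsub>C\<^esub> big_tensor C X R) \<cdot> (y i \<otimes> (\<Psi> (to_front C X j F) \<cdot> compare X y F))
        = \<Psi> (ide C (X i) \<otimes>\<^bsub>C\<^esub> to_front C X j F) \<cdot> compare X y (i # F)"
      using \<mu>_right[of "to_front C X j F" "y i" "X i" "compare X y F"] o y c tc FX by (simp add: R_def)
    also have "\<Psi> (C.exchange (X i) (X j) (big_tensor C X R)) \<cdot> (\<Psi> (ide C (X i) \<otimes>\<^bsub>C\<^esub> to_front C X j F) \<cdot> compare X y (i # F))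
        = (\<Psi> (C.exchange (X i) (X j) (big_tensor C X R)) \<cdot> \<Psi> (ide C (X i) \<otimes>\<^bsub>C\<^esub> to_front C X j F)) \<cdot> compare X y (i # F)"
      by (rule D.comp_assoc'[symmetric]) (use o y c tc FX in \<open>simp_all add: R_def\<close>)
    also have "\<Psi> (C.exchange (X i) (X j) (big_tensor C X R)) \<cdot> \<Psi> (ide C (X i) \<otimes>\<^bsub>C\<^esub> to_front C X j F) = \<Psi> (to_front C X j (i # F))"
      using False C.to_front_Cons[of i j F X] tc FX o j Fm_comp[of "ide C (X i) \<otimes>\<^bsub>C\<^esub> to_front C X j F" "C.exchange (X i) (X j) (big_tensor C X R)"]
      by (simp add: R_def del: to_front.simps)
    finally show ?thesis .
  qed
qed simp

lemma compare_proj: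
  assumes "\<forall>j\<in>set F. X j \<in> obj C \<and> Y j \<in> obj D \<and> iso_in D (Y j) (\<Phi> (X j)) (y j)" "distinct G" "set G \<subseteq> set F"
  shows "compare X y G \<cdot> proj D Y F G = \<Psi> (proj C X F G) \<cdot> compare X y F"
  using assms
proof (induction G arbitrary: F)
  case Nil
  note t = compare_typed[OF Nil(1)]
  have o: "big_tensor C X F \<in> obj C" "big_tensor D Y F \<in> obj D" using Nil by simp_all
  note u = D.iso_in_typed[OF funit_iso D.tensor_obj(2) Fo_obj[OF C.tensor_obj(2)]]
  let ?u = "inv_of D (munit D) (\<Phi> (munit C)) (funit \<phi>)" and ?k = "\<Psi> (del C (big_tensor C X F)) \<cdot> compare X y F"
  have "?k = (funit \<phi> \<cdot> ?u) \<cdot> ?k" unfolding u(8) using t o by simp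
  also have "\<dots> = funit \<phi> \<cdot> (?u \<cdot> ?k)" by (rule D.comp_assoc') (use t o u(1-6) in simp_all)
  also have "?u \<cdot> ?k = del D (big_tensor D Y F)" by (rule D.terminal_eq) (use t o u(1-6) in simp_all)
  finally show ?case by simp
next
  case (Cons j G)
  define R where "R = remove1 j F"
  have FX: "\<forall>k\<in>set F. X k \<in> obj C" "\<forall>k\<in>set F. Y k \<in> obj D" using Cons.prems by auto
  have RX: "\<forall>j\<in>set R. X j \<in> obj C \<and> Y j \<in> obj D \<and> iso_in D (Y j) (\<Phi> (X j)) (y j)"
    using Cons.prems set_remove1_subset[of j F] unfolding R_def by blast
  have G: "set G \<subseteq> set R" "distinct G"
  proof -
    have "x \<noteq> j \<and> x \<in> set F" if "x \<in> set G" for x using Cons.prems that by auto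
    then show "set G \<subseteq> set R" by (auto simp: R_def)
  qed (use Cons.prems in simp)
  have RX': "\<forall>k\<in>set R. X k \<in> obj C" "\<forall>k\<in>set R. Y k \<in> obj D" using RX by auto
  have GX: "\<forall>j\<in>set G. X j \<in> obj C \<and> Y j \<in> obj D \<and> iso_in D (Y j) (\<Phi> (X j)) (y j)" using RX G by blast
  have j: "j \<in> set F" using Cons.prems by auto
  have o: "X j \<in> obj C" "Y j \<in> obj D" "iso_in D (Y j) (\<Phi> (X j)) (y j)"
    "big_tensor C X R \<in> obj C" "big_tensor D Y R \<in> obj D" "big_tensor C X F \<in> obj C" "big_tensor D Y F \<in> obj D" "big_tensor C X G \<in> obj C" "big_tensor D Y G \<in> obj D"
    using Cons.prems j RX GX by auto
  note y = D.iso_in_typed(1-3)[OF o(3)]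
  note tc = C.to_front_typed[OF j FX(1), folded R_def] and td = D.to_front_typed[OF j FX(2), folded R_def]
  note pc = C.proj_typed[OF G RX'(1)] and pd = D.proj_typed[OF G RX'(2)]
  note c = compare_typed[OF Cons.prems(1)] compare_typed[OF RX] compare_typed[OF GX]
  have "compare X y (j # G) \<cdot> proj D Y F (j # G)
    = (\<mu> (X j) (big_tensor C X G) \<cdot> (y j \<otimes> (compare X y G \<cdot> proj D Y R G))) \<cdot> to_front D Y j F"
    using o y td pd c by (simp add: R_def[symmetric] D.interchange_tail)
  also have "compare X y G \<cdot> proj D Y R G = \<Psi> (proj C X R G) \<cdot> compare X y R"
    by (rule Cons.IH[OF RX G(2,1)])
  also have "\<mu> (X j) (big_tensor C X G) \<cdot> (y j \<otimes> (\<Psi> (proj C X R G) \<cdot> compare X y R))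
     = \<Psi> (ide C (X j) \<otimes>\<^bsub>C\<^esub> proj C X R G) \<cdot> compare X y (j # R)"
    using \<mu>_right[of "proj C X R G" "y j" "X j" "compare X y R"] o y c pc by simp
  also have "(\<Psi> (ide C (X j) \<otimes>\<^bsub>C\<^esub> proj C X R G) \<cdot> compare X y (j # R)) \<cdot> to_front D Y j F
     = \<Psi> (ide C (X j) \<otimes>\<^bsub>C\<^esub> proj C X R G) \<cdot> (compare X y (j # R) \<cdot> to_front D Y j F)"
    by (rule D.comp_assoc') (use o y td pc c in simp_all)
  also have "compare X y (j # R) \<cdot> to_front D Y j F = \<Psi> (to_front C X j F) \<cdot> compare X y F"
    unfolding R_def by (rule compare_to_front[OF Cons.prems(1) j])
  also have "\<Psi> (ide C (X j) \<otimes>\<^bsub>C\<^esub> proj C X R G) \<cdot> (\<Psi> (to_front C X j F) \<cdot> compare X y F)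
     = \<Psi> (proj C X F (j # G)) \<cdot> compare X y F"
    using o tc pc c by (simp add: R_def[symmetric] Fm_comp)
  finally show ?case .
qed

text \<open>The comparison is an isomorphism of diagrams by \<open>compare_proj\<close>, so limits are transported.  For a tensor
product with an object \<open>Y'\<close> of the target category, \<open>Y'\<close> is first replaced by an isomorphic image.\<close>

lemma itp_transfer:
  assumes L: "is_itp C J X L p"
    and XY: "\<forall>j\<in>J. X j \<in> obj C \<and> Y j \<in> obj D \<and> iso_in D (Y j) (\<Phi> (X j)) (y j)"
    and q: "\<And>F. F \<in> FinLO J \<Longrightarrow> arr D (q F) \<and> source D (q F) = \<Phi> L \<and> target D (q F) = big_tensor D Y F \<and> compare X y F \<cdot> q F = \<Psi> (p F)"
  shows "is_itp D J Y (\<Phi> L) q"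
proof -
  let ?S = "std_itp C J X" and ?T = "std_itp D J Y"
  have lim: "is_limit C ?S L p" and limt: "\<And>Z. Z \<in> obj C \<Longrightarrow> is_limit C (tensor_right C ?S Z) (L \<odot>\<^bsub>C\<^esub> Z) (\<lambda>F. p F \<otimes>\<^bsub>C\<^esub> ide C Z)"
    using L by (auto simp: is_itp_def)
  have Xo: "\<forall>j\<in>J. X j \<in> obj C" and Yo: "\<forall>j\<in>J. Y j \<in> obj D" using XY by auto
  have i: "idx ?S = J" "idx ?T = J" "\<And>Z. idx (tensor_right C ?S Z) = J" "\<And>Z. idx (tensor_right D ?T Z) = J" by (simp_all add: std_itp_def tensor_right_def)
  have S: "ob ?S F = big_tensor C X F" "ob ?T F = big_tensor D Y F" if "F \<in> FinLO J" for F using that by (simp_all add: std_itp_def)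
  have P: "prj ?S (F', F) = proj C X F' F" "prj ?T (F', F) = proj D Y F' F" if "(F', F) \<in> FinLO_arr J" for F' F using that by (simp_all add: std_itp_def)
  have FF: "F \<in> FinLO J" "F' \<in> FinLO J" "set F \<subseteq> set F'" "distinct F" if "(F', F) \<in> FinLO_arr J" for F' F using that by (auto simp: FinLO_arr_def FinLO_def)
  have XF: "\<forall>j\<in>set F. X j \<in> obj C \<and> Y j \<in> obj D \<and> iso_in D (Y j) (\<Phi> (X j)) (y j)" if "F \<in> FinLO J" for F
    using that XY by (auto simp: FinLO_def)
  have o: "big_tensor C X F \<in> obj C" "big_tensor D Y F \<in> obj D" if "F \<in> FinLO J" for F using XF[OF that] by simp_all
  have pS: "arr C (proj C X F' F)" "source C (proj C X F' F) = big_tensor C X F'" "target C (proj C X F' F) = big_tensor C X F"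
     "arr D (proj D Y F' F)" "source D (proj D Y F' F) = big_tensor D Y F'" "target D (proj D Y F' F) = big_tensor D Y F" if "(F', F) \<in> FinLO_arr J" for F' F
    using C.proj_typed[OF FF(3,4)[OF that], of X] D.proj_typed[OF FF(3,4)[OF that], of Y] XF[OF FF(2)[OF that]] by auto
  have Lo: "L \<in> obj C" and pt: "\<And>F. F \<in> FinLO J \<Longrightarrow> arr C (p F) \<and> source C (p F) = L \<and> target C (p F) = big_tensor C X F"
    using lim o S unfolding is_limit_def is_cone_def i by (auto simp: C.hom_iff)
  note c = compare_typed[OF XF]
  have nat: "compare X y F \<cdot> proj D Y F' F = \<Psi> (proj C X F' F) \<cdot> compare X y F'" if "(F', F) \<in> FinLO_arr J" for F' F
    by (rule compare_proj[OF XF[OF FF(2)] FF(4,3)]) (fact that)+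
  have 1: "is_limit D ?T (\<Phi> L) q"
  proof (rule limit_transport[OF _ _ lim, where \<mu> = "compare X y" and l = "ide D (\<Phi> L)"], unfold i)
    show "iso_in D (\<Phi> L) (\<Phi> L) (ide D (\<Phi> L))" using Lo by (simp add: D.iso_in_ide)
    show "iso_in D (ob ?T F) (\<Phi> (ob ?S F)) (compare X y F)" if "F \<in> FinLO J" for F using compare_iso[OF XF[OF that]] S[OF that] by simp
  qed (use o S P FF pS nat c pt q Lo in simp_all)
  have 2: "is_limit D (tensor_right D ?T Y') (\<Phi> L \<odot> Y') (\<lambda>F. q F \<otimes> ide D Y')" if Y': "Y' \<in> obj D" for Y'
  proof -
    obtain Z z where Z: "Z \<in> obj C" "iso_in D Y' (\<Phi> Z) z" using surjective[OF Y'] by blast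
    note z = D.iso_in_typed(1-3)[OF Z(2) Y' Fo_obj[OF Z(1)]]
    have tS: "ob (tensor_right C ?S Z) F = big_tensor C X F \<odot>\<^bsub>C\<^esub> Z" "ob (tensor_right D ?T Y') F = big_tensor D Y F \<odot> Y'" if "F \<in> FinLO J" for F
      using that S[OF that] by (simp_all add: tensor_right_def i)
    have tP: "prj (tensor_right C ?S Z) (F', F) = proj C X F' F \<otimes>\<^bsub>C\<^esub> ide C Z" "prj (tensor_right D ?T Y') (F', F) = proj D Y F' F \<otimes> ide D Y'"
      if "(F', F) \<in> FinLO_arr J" for F' F using that P[OF that] by (simp_all add: tensor_right_def i)
    have tnat: "(\<mu> (big_tensor C X F) Z \<cdot> (compare X y F \<otimes> z)) \<cdot> (proj D Y F' F \<otimes> ide D Y')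
        = \<Psi> (proj C X F' F \<otimes>\<^bsub>C\<^esub> ide C Z) \<cdot> (\<mu> (big_tensor C X F') Z \<cdot> (compare X y F' \<otimes> z))" if "(F', F) \<in> FinLO_arr J" for F' F
    proof -
      note f = FF(1,2)[OF that]
      show ?thesis using \<mu>_left[of "proj C X F' F" z Z "compare X y F'"] nat[OF that] pS[OF that] c[OF f(1)] c[OF f(2)] o[OF f(1)] o[OF f(2)] z Z(1) Y'
        by (simp add: D.interchange)
    qed
    have tcone: "(\<mu> (big_tensor C X F) Z \<cdot> (compare X y F \<otimes> z)) \<cdot> (q F \<otimes> ide D Y')
        = \<Psi> (p F \<otimes>\<^bsub>C\<^esub> ide C Z) \<cdot> (\<mu> L Z \<cdot> (ide D (\<Phi> L) \<otimes> z))" if F: "F \<in> FinLO J" for F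
      using \<mu>_left[of "p F" z Z "ide D (\<Phi> L)"] q[OF F] pt[OF F] c[OF F] o[OF F] z Z(1) Y' Lo by (simp add: D.interchange)
    show ?thesis
    proof (rule limit_transport[OF _ _ limt[OF Z(1)], where \<mu> = "\<lambda>F. \<mu> (big_tensor C X F) Z \<cdot> (compare X y F \<otimes> z)"
          and l = "\<mu> L Z \<cdot> (ide D (\<Phi> L) \<otimes> z)"], unfold i)
      show "iso_in D (\<Phi> L \<odot> Y') (\<Phi> (L \<odot>\<^bsub>C\<^esub> Z)) (\<mu> L Z \<cdot> (ide D (\<Phi> L) \<otimes> z))"
        using Lo Z Y' by (auto intro!: D.iso_in_comp[OF D.iso_in_tensor fmul_iso] D.iso_in_ide)
      show "iso_in D (ob (tensor_right D ?T Y') F) (\<Phi> (ob (tensor_right C ?S Z) F)) (\<mu> (big_tensor C X F) Z \<cdot> (compare X y F \<otimes> z))"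
        if "F \<in> FinLO J" for F
        unfolding tS[OF that] using o[OF that] Z Y' compare_iso[OF XF[OF that]] by (auto intro!: D.iso_in_comp[OF D.iso_in_tensor fmul_iso])
    qed (use o tS tP FF pS tnat tcone pt q Lo Z(1) Y' in simp_all)
  qed
  show ?thesis unfolding is_itp_def using 1 2 by blast
qed

lemma itp_transfer_exists:
  assumes L: "is_itp C J X L p"
    and XY: "\<forall>j\<in>J. X j \<in> obj C \<and> Y j \<in> obj D \<and> iso_in D (Y j) (\<Phi> (X j)) (y j)"
  shows "\<exists>q. is_itp D J Y (\<Phi> L) q \<and> (\<forall>F\<in>FinLO J. compare X y F \<cdot> q F = \<Psi> (p F))"
proof -
  define q where "q F = inv_of D (big_tensor D Y F) (\<Phi> (big_tensor C X F)) (compare X y F) \<cdot> \<Psi> (p F)" for F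
  have q: "arr D (q F) \<and> source D (q F) = \<Phi> L \<and> target D (q F) = big_tensor D Y F \<and> compare X y F \<cdot> q F = \<Psi> (p F)" if F: "F \<in> FinLO J" for F
  proof -
    have XF: "\<forall>j\<in>set F. X j \<in> obj C \<and> Y j \<in> obj D \<and> iso_in D (Y j) (\<Phi> (X j)) (y j)" using F XY by (auto simp: FinLO_def)
    then have o: "big_tensor C X F \<in> obj C" "big_tensor D Y F \<in> obj D" by simp_all
    have "L \<in> obj C" "p F \<in> hom C L (big_tensor C X F)"
      using L F unfolding is_itp_def is_limit_def is_cone_def by (auto simp: std_itp_def)
    then have p: "arr C (p F)" "source C (p F) = L" "target C (p F) = big_tensor C X F" using o by (simp_all add: C.hom_iff)
    note c = D.iso_in_typed[OF compare_iso[OF XF] o(2) Fo_obj[OF o(1)]]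
    let ?i = "inv_of D (big_tensor D Y F) (\<Phi> (big_tensor C X F)) (compare X y F)"
    have "compare X y F \<cdot> (?i \<cdot> \<Psi> (p F)) = (compare X y F \<cdot> ?i) \<cdot> \<Psi> (p F)"
      by (rule D.comp_assoc'[symmetric]) (use c(1-6) p in simp_all)
    then show ?thesis unfolding q_def using c p by simp
  qed
  then show ?thesis using itp_transfer[OF L XY q] by blast
qed

lemma has_itps_transfer: assumes "has_itps TYPE('j) C" shows "has_itps TYPE('j) D"
  unfolding has_itps_def
proof (intro conjI allI impI)
  show "semicartesian D" by unfold_locales
  fix J :: "'j set" and Y assume J: "countable J \<and> (\<forall>j\<in>J. Y j \<in> obj D)"
  then have "\<forall>j\<in>J. \<exists>A e. A \<in> obj C \<and> iso_in D (Y j) (\<Phi> A) e" using surjective by blast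
  then obtain X y where XY: "\<forall>j\<in>J. X j \<in> obj C \<and> iso_in D (Y j) (\<Phi> (X j)) (y j)" by metis
  then obtain L p where "is_itp C J X L p" using assms J unfolding has_itps_def by blast
  then show "\<exists>L p. is_itp D J Y L p" using itp_transfer_exists[of J X L p Y y] XY J by blast
qed

lemma itp_preserving: "itp_preserving TYPE('j) C D \<phi>"
  unfolding itp_preserving_def
proof (intro allI impI)
  fix J :: "'j set" and X L p assume a: "countable J \<and> (\<forall>j\<in>J. X j \<in> obj C) \<and> is_itp C J X L p"
  have "fmul_list C D \<phi> X F = compare X (\<lambda>j. ide D (\<Phi> (X j))) F" for F by (induction F) auto
  moreover have "\<forall>j\<in>J. X j \<in> obj C \<and> (\<Phi> \<circ> X) j \<in> obj D \<and> iso_in D ((\<Phi> \<circ> X) j) (\<Phi> (X j)) (ide D (\<Phi> (X j)))"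
    using a by (auto intro!: D.iso_in_ide)
  ultimately show "\<exists>q. is_itp D J (\<Phi> \<circ> X) (\<Phi> L) q \<and> (\<forall>F\<in>FinLO J. fmul_list C D \<phi> X F \<cdot> q F = \<Psi> (p F))"
    using itp_transfer_exists[of J X L p "\<Phi> \<circ> X" "\<lambda>j. ide D (\<Phi> (X j))"] a by simp
qed

end

section \<open>Renaming indices\<close>

text \<open>An injection of index types extends to diagrams and families, since no lists over the image of an index
set involve any other indices.  The result is full, faithful and strictly symmetric monoidal.\<close>

locale index_renaming = semicartesian_prop C
  for C :: "(nat, 'm, 'x) smc_scheme" (structure) +
  fixes \<iota> :: "'i \<Rightarrow> 'j"
  assumes inj: "inj \<iota>"
begin

abbreviation m where "m \<equiv> map \<iota>"
abbreviation m' where "m' \<equiv> map (inv \<iota>)"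

lemma inv_\<iota> [simp]: "inv \<iota> \<circ> \<iota> = id" using inj by (simp add: fun_eq_iff)

lemma m_inject [simp]: "m F = m G \<longleftrightarrow> F = G" using inj by (simp add: inj_map_eq_map)

lemma FinLO_m [simp]: "m F \<in> FinLO (\<iota> ` J) \<longleftrightarrow> F \<in> FinLO J"
  using inj by (auto simp: FinLO_def distinct_map inj_image_subset_iff intro: inj_on_subset)

lemma FinLO_arr_m [simp]: "(m F', m F) \<in> FinLO_arr (\<iota> ` J) \<longleftrightarrow> (F', F) \<in> FinLO_arr J"
  using inj by (simp add: FinLO_arr_iff inj_image_subset_iff)

lemma FinLO_imageE: assumes "F \<in> FinLO (\<iota> ` J)" obtains F0 where "F = m F0" "F0 \<in> FinLO J"
proof -
  have "m (m' F) = map id F" unfolding map_map using assms by (intro map_cong) (auto simp: FinLO_def f_inv_into_f)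
  then show thesis using that[of "m' F"] assms FinLO_m[of "m' F" J] by simp
qed

lemma FinLO_arr_imageE: assumes "(F', F) \<in> FinLO_arr (\<iota> ` J)"
  obtains F0' F0 where "F' = m F0'" "F = m F0" "(F0', F0) \<in> FinLO_arr J"
proof -
  obtain F0' F0 where "F' = m F0'" "F = m F0" using FinLO_imageE assms by (metis FinLO_arr_iff)
  then show thesis using that assms by simp
qed

lemma cut_m [simp]: "cut (m F) (\<iota> ` J) = m (cut F J)"
  using inj by (simp add: filter_map o_def inj_image_mem_iff)

definition ren :: "('i, nat, 'm) diagram \<Rightarrow> ('j, nat, 'm) diagram" where
  "ren D = \<lparr> idx = \<iota> ` idx D, ob = (\<lambda>F\<in>FinLO (\<iota> ` idx D). ob D (m' F)),
     prj = (\<lambda>(F', F)\<in>FinLO_arr (\<iota> ` idx D). prj D (m' F', m' F)) \<rparr>"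

lemma ren_simps [simp]: "idx (ren D) = \<iota> ` idx D" "F \<in> FinLO (idx D) \<Longrightarrow> ob (ren D) (m F) = ob D F"
   "(F', F) \<in> FinLO_arr (idx D) \<Longrightarrow> prj (ren D) (m F', m F) = prj D (F', F)"
  by (simp_all add: ren_def)

lemma diagram_eqI: fixes A B :: "('j, nat, 'm) diagram"
  assumes "idx A = J" "idx B = J" "ob A \<in> extensional (FinLO J)" "ob B \<in> extensional (FinLO J)"
    "prj A \<in> extensional (FinLO_arr J)" "prj B \<in> extensional (FinLO_arr J)"
    "\<And>F. F \<in> FinLO J \<Longrightarrow> ob A F = ob B F" "\<And>F' F. (F', F) \<in> FinLO_arr J \<Longrightarrow> prj A (F', F) = prj B (F', F)"
  shows "A = B"
proof -
  have "ob A = ob B" "prj A = prj B" using assms by (auto intro!: extensionalityI)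
  then show ?thesis using assms(1,2) by simp
qed

lemma ren_tensor: "ren (diag_tensor C X Y) = diag_tensor C (ren X) (ren Y)"
proof (rule diagram_eqI[where J = "\<iota> ` (idx X \<union> idx Y)"])
  fix F assume "F \<in> FinLO (\<iota> ` (idx X \<union> idx Y))"
  then obtain F0 where F: "F = m F0" "F0 \<in> FinLO (idx X \<union> idx Y)" by (rule FinLO_imageE)
  then have "m F0 \<in> FinLO (idx (ren X) \<union> idx (ren Y))" by (simp flip: image_Un)
  then show "ob (ren (diag_tensor C X Y)) F = ob (diag_tensor C (ren X) (ren Y)) F"
    using F FinLO_cut[OF F(2)] by simp
next
  fix F' F assume "(F', F) \<in> FinLO_arr (\<iota> ` (idx X \<union> idx Y))"
  then obtain F0' F0 where F: "F' = m F0'" "F = m F0" "(F0', F0) \<in> FinLO_arr (idx X \<union> idx Y)" by (rule FinLO_arr_imageE)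
  then have "(m F0', m F0) \<in> FinLO_arr (idx (ren X) \<union> idx (ren Y))" by (simp flip: image_Un)
  then show "prj (ren (diag_tensor C X Y)) (F', F) = prj (diag_tensor C (ren X) (ren Y)) (F', F)"
    using F FinLO_arr_cut[of F0' F0 "idx X" "idx Y"] FinLO_arr_cut[of F0' F0 "idx Y" "idx X"] by (simp add: Un_commute)
qed (auto simp: ren_def diag_tensor_def image_Un)

lemma ren_unit: "ren (diag_unit C s) = diag_unit C (\<iota> s)"
proof (rule diagram_eqI[where J = "\<iota> ` {s}"])
  fix F assume "F \<in> FinLO (\<iota> ` {s})"
  then obtain F0 where F: "F = m F0" "F0 \<in> FinLO {s}" by (rule FinLO_imageE)
  then show "ob (ren (diag_unit C s)) F = ob (diag_unit C (\<iota> s)) F" using FinLO_m[of F0 "{s}"] by simp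
next
  fix F' F assume "(F', F) \<in> FinLO_arr (\<iota> ` {s})"
  then obtain F0' F0 where F: "F' = m F0'" "F = m F0" "(F0', F0) \<in> FinLO_arr {s}" by (rule FinLO_arr_imageE)
  then show "prj (ren (diag_unit C s)) (F', F) = prj (diag_unit C (\<iota> s)) (F', F)"
    using FinLO_arr_m[of F0' F0 "{s}"] by (simp add: diag_unit_def)
qed (auto simp: ren_def diag_unit_def)

lemma aitp_ren: assumes "aitp X" shows "aitp (ren X)"
proof -
  obtain n \<theta> \<tau> where c: "countable (idx X)" and h: "standard_iso X n \<theta> \<tau>" by (rule aitpE[OF assms])
  note t = standard_isoD(1-3)[OF h] and nat = standard_isoD(4)[OF h]
  let ?n = "n \<circ> inv \<iota>"
  have s: "size_of ?n (m F) = size_of n F" for F by (induction F) (simp_all add: inj)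
  show ?thesis
  proof (rule aitpI[where n = ?n and \<theta> = "\<theta> \<circ> m'"])
    fix F' F assume "(F', F) \<in> FinLO_arr (idx (ren X))"
    then obtain G' G where F: "F' = m G'" "F = m G" and G: "(G', G) \<in> FinLO_arr (idx X)" unfolding ren_simps by (rule FinLO_arr_imageE)
    then show "arr C (prj (ren X) (F', F)) \<and> source C (prj (ren X) (F', F)) = ob (ren X) F' \<and> target C (prj (ren X) (F', F)) = ob (ren X) F"
      using aitp_prj[OF assms G] by (simp add: FinLO_arr_iff)
    have "proj C ?n (m G') (m G) = proj C n G' G"
      by (rule proj_map) (use G inj in \<open>auto simp: FinLO_arr_iff FinLO_def intro: inj_on_subset\<close>)
    then show "(\<theta> \<circ> m') F \<cdot> prj (ren X) (F', F) = proj C ?n F' F \<cdot> (\<theta> \<circ> m') F'" using nat[OF G] F G by simp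
  next
    fix F assume "F \<in> FinLO (idx (ren X))"
    then obtain G where F: "F = m G" and G: "G \<in> FinLO (idx X)" unfolding ren_simps by (rule FinLO_imageE)
    show "iso_in C (ob (ren X) F) (size_of ?n F) ((\<theta> \<circ> m') F)"
      using t[OF G] F G s by (auto intro!: iso_inI[of _ "\<tau> G"])
  qed (use c in \<open>simp_all add: ren_def\<close>)
qed

definition ren_fam :: "('i, nat, 'm) fam \<Rightarrow> ('j, nat, 'm) fam" where
  "ren_fam f = \<lparr> src = ren (src f), tgt = ren (tgt f), Lam = map_prod m m ` Lam f, cpt = (\<lambda>(F, G). cpt f (m' F, m' G)) \<rparr>"

lemma ren_fam_simps [simp]: "src (ren_fam f) = ren (src f)" "tgt (ren_fam f) = ren (tgt f)" "cpt (ren_fam f) (m F, m G) = cpt f (F, G)"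
  "(m F, m G) \<in> Lam (ren_fam f) \<longleftrightarrow> (F, G) \<in> Lam f"
  by (auto simp: ren_fam_def)

lemma ren_fam_LamE: assumes "(F', G') \<in> Lam (ren_fam f)" obtains F G where "F' = m F" "G' = m G" "(F, G) \<in> Lam f"
  using assms by (auto simp: ren_fam_def)

lemma fin_approx_ren: assumes f: "fin_approx C f" shows "fin_approx C (ren_fam f)"
proof (rule fin_approxI)
  fix F G assume "(F, G) \<in> Lam (ren_fam f)"
  then obtain F0 G0 where F: "F = m F0" "G = m G0" and l: "(F0, G0) \<in> Lam f" by (rule ren_fam_LamE)
  show "F \<in> FinLO (idx (src (ren_fam f))) \<and> G \<in> FinLO (idx (tgt (ren_fam f))) \<and> arr C (cpt (ren_fam f) (F, G))
     \<and> source C (cpt (ren_fam f) (F, G)) = ob (src (ren_fam f)) F \<and> target C (cpt (ren_fam f) (F, G)) = ob (tgt (ren_fam f)) G"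
    using fam_typed[OF f l] F by simp
  {
    fix F' G' assume a: "(F', G') \<in> Lam (ren_fam f)" "(F', F) \<in> FinLO_arr (idx (src (ren_fam f)))" "(G', G) \<in> FinLO_arr (idx (tgt (ren_fam f)))"
    from a(1) obtain F0' G0' where F': "F' = m F0'" "G' = m G0'" and l': "(F0', G0') \<in> Lam f" by (rule ren_fam_LamE)
    then show "prj (tgt (ren_fam f)) (G', G) \<cdot> cpt (ren_fam f) (F', G') = cpt (ren_fam f) (F, G) \<cdot> prj (src (ren_fam f)) (F', F)"
      using fam_natural[OF f l l'] F a by simp
  }
  {
    fix F' assume a: "(F', F) \<in> FinLO_arr (idx (src (ren_fam f)))"
    then obtain F0' F1 where "F' = m F0'" "F = m F1" unfolding ren_fam_simps ren_simps by (elim FinLO_arr_imageE)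
    then show "(F', G) \<in> Lam (ren_fam f)" using fam_upward[OF f l, of F0'] a F by simp
  }
next
  fix G assume "G \<in> FinLO (idx (tgt (ren_fam f)))"
  then obtain G0 where "G = m G0" "G0 \<in> FinLO (idx (tgt f))" unfolding ren_fam_simps ren_simps by (rule FinLO_imageE)
  then show "\<exists>F. (F, G) \<in> Lam (ren_fam f)" using fam_cover[OF f] ren_fam_simps(4) by metis
qed

lemma fam_equiv_ren: assumes "fam_equiv C f g" shows "fam_equiv C (ren_fam f) (ren_fam g)"
proof -
  have h: "fin_approx C f" "fin_approx C g" "src f = src g" "tgt f = tgt g" "\<And>x. x \<in> Lam f \<Longrightarrow> x \<in> Lam g \<Longrightarrow> cpt f x = cpt g x"
    using assms unfolding fam_equiv_def by auto
  have "cpt (ren_fam f) x = cpt (ren_fam g) x" if x: "x \<in> Lam (ren_fam f) \<inter> Lam (ren_fam g)" for x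
  proof -
    obtain F G where "x = (m F, m G)" "(F, G) \<in> Lam f" using x by (auto simp: ren_fam_def)
    then show ?thesis using h(5)[of "(F, G)"] x by simp
  qed
  then show ?thesis unfolding fam_equiv_def using h fin_approx_ren by simp
qed

text \<open>By \<open>fam_equiv_ren\<close> it does not matter which representative is chosen.\<close>

definition renM :: "('i, nat, 'm) fam set \<Rightarrow> ('j, nat, 'm) fam set" where
  "renM a = fam_class C (ren_fam (SOME f. f \<in> a))"

lemma renM_Hom: assumes "a \<in> Hom X Y" "aitp X" "aitp Y" shows "renM a \<in> Hom (ren X) (ren Y)"
proof -
  obtain f0 where "f0 \<in> a" by (rule Hom_nonempty[OF assms(1)])
  then have "(SOME f. f \<in> a) \<in> a" by (rule someI)
  note h = Hom_mem[OF assms this]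
  have "src (ren_fam (SOME f. f \<in> a)) = ren X" "tgt (ren_fam (SOME f. f \<in> a)) = ren Y" using h(3,4) by (simp_all only: ren_fam_simps)
  then show ?thesis unfolding renM_def by (rule Hom_classI[OF fin_approx_ren[OF h(2)]])
qed

lemma pt_renM: assumes "a \<in> Hom X Y" "aitp X" "aitp Y" "pt a F G c" shows "pt (renM a) (m F) (m G) c"
proof -
  obtain f where f: "f \<in> a" "(F, G) \<in> Lam f" "cpt f (F, G) = c" using assms(4) by (auto simp: pt_def)
  then have "(SOME f. f \<in> a) \<in> a" by (intro someI)
  from Hom_mem(1)[OF assms(1-3) this] f(1) have "fam_equiv C (SOME f. f \<in> a) f" unfolding fam_class_def by blast
  then have "ren_fam f \<in> renM a" unfolding renM_def fam_class_def using fam_equiv_ren by blast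
  then show ?thesis unfolding pt_def using f by (intro bexI[of _ "ren_fam f"]) auto
qed

text \<open>Components at indices of the form \<open>m F\<close> determine a morphism between renamed diagrams.\<close>

lemma renM_eqI: assumes "a \<in> Hom X Y" "aitp X" "aitp Y" "b \<in> Hom (ren X) (ren Y)"
    "\<And>G. G \<in> FinLO (idx Y) \<Longrightarrow> \<exists>F c. pt a F G c \<and> pt b (m F) (m G) c"
  shows "renM a = b"
proof (rule pt_eqI[OF renM_Hom[OF assms(1-3)] assms(4)])
  show "aitp (ren X)" "aitp (ren Y)" using assms by (auto intro: aitp_ren)
  fix G assume "G \<in> FinLO (idx (ren Y))"
  then obtain G0 where G: "G = m G0" "G0 \<in> FinLO (idx Y)" unfolding ren_simps by (rule FinLO_imageE)
  then obtain F c where "pt a F G0 c" "pt b (m F) (m G0) c" using assms(5) by blast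
  then show "\<exists>F c. pt (renM a) F G c \<and> pt b F G c" using pt_renM[OF assms(1-3)] G by blast
qed

lemma renM_faithful: assumes "a \<in> Hom X Y" "b \<in> Hom X Y" "aitp X" "aitp Y" "renM a = renM b" shows "a = b"
proof (rule pt_eqI[OF assms(1-4)])
  fix G assume "G \<in> FinLO (idx Y)"
  then obtain F c d where h: "pt a F G c" "pt b F G d" using pt_cover2[OF assms(1,2,3,4,4)] by metis
  then have "c = d" using pt_unique[OF renM_Hom[OF assms(1,3,4)] aitp_ren[OF assms(3)] aitp_ren[OF assms(4)]]
      pt_renM[OF assms(1,3,4)] pt_renM[OF assms(2,3,4)] assms(5) by metis
  then show "\<exists>F c. pt a F G c \<and> pt b F G c" using h by blast
qed

text \<open>Every index of a renamed diagram is a renamed index, so families between renamed diagrams can be read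
back.\<close>

lemma renM_full: assumes g: "g \<in> Hom (ren X) (ren Y)" and X: "aitp X" and Y: "aitp Y" shows "\<exists>a\<in>Hom X Y. renM a = g"
proof -
  obtain h where h: "h \<in> g" "fin_approx C h" "src h = ren X" "tgt h = ren Y" using Hom_nonempty[OF g] by metis
  define f where "f = \<lparr> src = X, tgt = Y, Lam = {(F, G). (m F, m G) \<in> Lam h}, cpt = (\<lambda>(F, G). cpt h (m F, m G)) \<rparr>"
  have fs [simp]: "src f = X" "tgt f = Y" "(F, G) \<in> Lam f \<longleftrightarrow> (m F, m G) \<in> Lam h" "cpt f (F, G) = cpt h (m F, m G)" for F G
    by (simp_all add: f_def)
  have cov: "\<exists>F. (m F, m G) \<in> Lam h" if G: "G \<in> FinLO (idx Y)" for G
  proof -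
    obtain F where F: "(F, m G) \<in> Lam h" using fam_cover[OF h(2), of "m G"] h G by auto
    then obtain F0 where "F = m F0" using fam_typed(1)[OF h(2) F] h by (auto elim: FinLO_imageE)
    then show ?thesis using F by blast
  qed
  have f: "fin_approx C f"
  proof (rule fin_approxI)
    fix F G assume "(F, G) \<in> Lam f"
    then have l: "(m F, m G) \<in> Lam h" by simp
    note t = fam_typed[OF h(2) l, unfolded h]
    then show "F \<in> FinLO (idx (src f)) \<and> G \<in> FinLO (idx (tgt f)) \<and> arr C (cpt f (F, G)) \<and> source C (cpt f (F, G)) = ob (src f) F
      \<and> target C (cpt f (F, G)) = ob (tgt f) G" by simp
    {
      fix F' G' assume "(F', G') \<in> Lam f" "(F', F) \<in> FinLO_arr (idx (src f))" "(G', G) \<in> FinLO_arr (idx (tgt f))"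
      then show "prj (tgt f) (G', G) \<cdot> cpt f (F', G') = cpt f (F, G) \<cdot> prj (src f) (F', F)"
        using fam_natural[OF h(2) l, of "m F'" "m G'"] h by simp
    }
    {
      fix F' assume "(F', F) \<in> FinLO_arr (idx (src f))"
      then show "(F', G) \<in> Lam f" using fam_upward[OF h(2) l, of "m F'"] h by simp
    }
  qed (use cov in simp)
  have a: "fam_class C f \<in> Hom X Y" by (rule Hom_classI[OF f]) simp_all
  have "renM (fam_class C f) = g"
  proof (rule renM_eqI[OF a X Y g])
    fix G assume "G \<in> FinLO (idx Y)"
    then obtain F where F: "(m F, m G) \<in> Lam h" using cov by blast
    then show "\<exists>F c. pt (fam_class C f) F G c \<and> pt g (m F) (m G) c" using pt_class[OF f, of F G] h(1) unfolding pt_def by force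
  qed
  then show ?thesis using a by blast
qed

lemma renM_comp: assumes a: "a \<in> Hom X Y" and b: "b \<in> Hom Y Z" and X: "aitp X" and Y: "aitp Y" and Z: "aitp Z"
  shows "renM (fcomp b a) = fcomp (renM b) (renM a)"
proof (rule renM_eqI[OF fcomp_Hom[OF assms] X Z])
  note r = renM_Hom[OF a X Y] renM_Hom[OF b Y Z] aitp_ren[OF X] aitp_ren[OF Y] aitp_ren[OF Z]
  show "fcomp (renM b) (renM a) \<in> Hom (ren X) (ren Z)" by (rule fcomp_Hom[OF r])
  fix H assume "H \<in> FinLO (idx Z)"
  then obtain G d where d: "pt b G H d" using pt_cover[OF b] by metis
  then obtain F c where c: "pt a F G c" using pt_cover[OF a] pt_typed(1)[OF b Y Z d] by metis
  show "\<exists>F c. pt (fcomp b a) F H c \<and> pt (fcomp (renM b) (renM a)) (m F) (m H) c"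
    using pt_comp[OF assms c d] pt_comp[OF r pt_renM[OF a X Y c] pt_renM[OF b Y Z d]] by blast
qed

lemma natural_ren: assumes "natural X Y \<theta>" shows "natural (ren X) (ren Y) (\<theta> \<circ> m')"
  unfolding natural_def
proof (intro conjI ballI allI impI)
  note X = naturalD(1)[OF assms] and Y = naturalD(2)[OF assms] and i = naturalD(3)[OF assms] and t = naturalD(4)[OF assms] and n = naturalD(5)[OF assms]
  show "aitp (ren X)" "aitp (ren Y)" "idx (ren X) = idx (ren Y)" using X Y i by (auto intro: aitp_ren)
  {
    fix F assume "F \<in> FinLO (idx (ren X))"
    then obtain G where "F = m G" "G \<in> FinLO (idx X)" unfolding ren_simps by (rule FinLO_imageE)
    then show "arr C ((\<theta> \<circ> m') F)" "source C ((\<theta> \<circ> m') F) = ob (ren X) F" "target C ((\<theta> \<circ> m') F) = ob (ren Y) F"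
      using t[of G] i by simp_all
  }
  fix F' F assume "(F', F) \<in> FinLO_arr (idx (ren X))"
  then obtain G' G where "F' = m G'" "F = m G" "(G', G) \<in> FinLO_arr (idx X)" unfolding ren_simps by (rule FinLO_arr_imageE)
  then show "prj (ren Y) (F', F) \<cdot> (\<theta> \<circ> m') F' = (\<theta> \<circ> m') F \<cdot> prj (ren X) (F', F)" using n[of G' G] i by simp
qed

lemma renM_fnat: assumes "natural X Y \<theta>" "\<And>F. F \<in> FinLO (idx X) \<Longrightarrow> \<theta>' (m F) = \<theta> F"
  shows "renM (fnat X Y \<theta>) = fnat (ren X) (ren Y) \<theta>'"
proof -
  have X: "aitp X" and Y: "aitp Y" and i: "idx Y = idx X" using naturalD[OF assms(1)] by auto
  have e: "\<And>F. F \<in> FinLO (idx (ren X)) \<Longrightarrow> \<theta>' F = (\<theta> \<circ> m') F" using assms(2) by (auto elim!: FinLO_imageE)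
  have n: "natural (ren X) (ren Y) \<theta>'" using natural_ren[OF assms(1)] e unfolding natural_def FinLO_arr_iff by metis
  show ?thesis
  proof (rule renM_eqI[OF fnat_Hom[OF assms(1)] X Y fnat_Hom[OF n]])
    fix G assume G: "G \<in> FinLO (idx Y)"
    then show "\<exists>F c. pt (fnat X Y \<theta>) F G c \<and> pt (fnat (ren X) (ren Y) \<theta>') (m F) (m G) c"
      using pt_fnat[OF assms(1), of G] pt_fnat[OF n, of "m G"] assms(2)[of G] i by (intro exI[of _ G] exI[of _ "\<theta> G"]) simp
  qed
qed

lemma renM_ide: "aitp X \<Longrightarrow> renM (fide X) = fide (ren X)"
  unfolding fide_def by (rule renM_fnat[OF natural_ide]) simp_all

lemma renM_tensor: assumes a: "a \<in> Hom X Y" and b: "b \<in> Hom X' Y'" and X: "aitp X" and Y: "aitp Y" and X': "aitp X'" and Y': "aitp Y'"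
  shows "renM (ftensor a b) = ftensor (renM a) (renM b)"
proof (rule renM_eqI[OF ftensor_Hom[OF assms] aitp_tensor[OF X X'] aitp_tensor[OF Y Y']])
  note r = renM_Hom[OF a X Y] renM_Hom[OF b X' Y'] aitp_ren[OF X] aitp_ren[OF Y] aitp_ren[OF X'] aitp_ren[OF Y']
  show "ftensor (renM a) (renM b) \<in> Hom (ren (diag_tensor C X X')) (ren (diag_tensor C Y Y'))"
    unfolding ren_tensor by (rule ftensor_Hom[OF r])
  fix G assume "G \<in> FinLO (idx (diag_tensor C Y Y'))"
  then have G: "G \<in> FinLO (idx Y \<union> idx Y')" by simp
  obtain F1 c1 where c1: "pt a F1 (cut G (idx Y)) c1" using pt_cover[OF a FinLO_cut(1)[OF G]] by metis
  obtain F2 c2 where c2: "pt b F2 (cut G (idx Y')) c2" using pt_cover[OF b FinLO_cut(2)[OF G]] by metis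
  note f1 = pt_typed(1)[OF a X Y c1] and f2 = pt_typed(1)[OF b X' Y' c2]
  obtain F where F: "F \<in> FinLO (idx X \<union> idx X')" "(cut F (idx X), F1) \<in> FinLO_arr (idx X)" "(cut F (idx X'), F2) \<in> FinLO_arr (idx X')"
    using FinLO_above_cuts[OF f1 f2] by metis
  define c d where "c = c1 \<cdot> prj X (cut F (idx X), F1)" and "d = c2 \<cdot> prj X' (cut F (idx X'), F2)"
  have cd: "pt a (cut F (idx X)) (cut G (idx Y)) c" "pt b (cut F (idx X')) (cut G (idx Y')) d"
    unfolding c_def d_def using pt_up[OF a X Y c1 F(2)] pt_up[OF b X' Y' c2 F(3)] by auto
  have mF: "m F \<in> FinLO (idx (ren X) \<union> idx (ren X'))" "m G \<in> FinLO (idx (ren Y) \<union> idx (ren Y'))" using F(1) G by (simp_all flip: image_Un)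
  show "\<exists>F c. pt (ftensor a b) F G c \<and> pt (ftensor (renM a) (renM b)) (m F) (m G) c"
    using pt_tensor[OF assms F(1) G cd] pt_tensor[OF r mF, of c d] pt_renM[OF a X Y cd(1)] pt_renM[OF b X' Y' cd(2)] by auto
qed

lemma renM_assoc: assumes "aitp X" "aitp Y" "aitp Z" shows "renM (fassoc X Y Z) = fassoc (ren X) (ren Y) (ren Z)"
proof -
  have "ob X (cut F (idx X)) = ob (ren X) (m (cut F (idx X))) \<and> ob Y (cut F (idx Y)) = ob (ren Y) (m (cut F (idx Y)))
     \<and> ob Z (cut F (idx Z)) = ob (ren Z) (m (cut F (idx Z)))" if "F \<in> FinLO (idx X \<union> idx Y \<union> idx Z)" for F
    using that by (auto simp: FinLO_def intro!: ren_simps(2)[symmetric])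
  then show ?thesis using renM_fnat[OF natural_assoc[OF assms]] by (simp add: ren_tensor)
qed

lemma renM_braid: assumes "aitp X" "aitp Y" shows "renM (fbraid X Y) = fbraid (ren X) (ren Y)"
proof -
  have "ob X (cut F (idx X)) = ob (ren X) (m (cut F (idx X))) \<and> ob Y (cut F (idx Y)) = ob (ren Y) (m (cut F (idx Y)))" if "F \<in> FinLO (idx X \<union> idx Y)" for F
    using that by (auto simp: FinLO_def intro!: ren_simps(2)[symmetric])
  then show ?thesis using renM_fnat[OF natural_braid[OF assms]] by (simp add: ren_tensor)
qed

lemma renM_unit: assumes "aitp X" "s \<in> idx X" shows "renM (flunit s X) = flunit (\<iota> s) (ren X)" "renM (frunit s X) = frunit (\<iota> s) (ren X)"
  using assms renM_fnat[OF natural_lunit[OF assms], of "\<lambda>F. lunit C (ob (ren X) F)"]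
    renM_fnat[OF natural_runit[OF assms], of "\<lambda>F. runit C (ob (ren X) F)"]
  by (simp_all add: ren_tensor ren_unit insert_absorb)

lemma wired_ren: assumes "wired X v" shows "wired (ren X) (v \<circ> m')" "wset (ren X) (v \<circ> m') = wset X v"
proof -
  show "wired (ren X) (v \<circ> m')" unfolding wired_def
  proof (intro conjI ballI allI impI)
    show "aitp (ren X)" by (rule aitp_ren[OF wiredD(1)[OF assms]])
    {
      fix F assume "F \<in> FinLO (idx (ren X))"
      then obtain G where "F = m G" "G \<in> FinLO (idx X)" unfolding ren_simps by (rule FinLO_imageE)
      then show "distinct ((v \<circ> m') F)" "ob (ren X) F = length ((v \<circ> m') F)" using wiredD[OF assms] by simp_all
    }
    fix F' F assume "(F', F) \<in> FinLO_arr (idx (ren X))"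
    then obtain G' G where "F' = m G'" "F = m G" "(G', G) \<in> FinLO_arr (idx X)" unfolding ren_simps by (rule FinLO_arr_imageE)
    then show "set ((v \<circ> m') F) \<subseteq> set ((v \<circ> m') F')" "prj (ren X) (F', F) = wproj ((v \<circ> m') F') ((v \<circ> m') F)"
      using wiredD(4,5)[OF assms] by simp_all
  qed
  have "FinLO (\<iota> ` idx X) = m ` FinLO (idx X)" by (auto elim: FinLO_imageE)
  then show "wset (ren X) (v \<circ> m') = wset X v" unfolding wset_def by simp
qed

end

section \<open>The comparison functor\<close>

locale string_theory_renaming = string_theory \<Sigma> E split + index_renaming "Free \<Sigma> E" \<iota>
  for \<Sigma> :: "'g signature" and E split and \<iota> :: "nat \<Rightarrow> 'j"
begin

declare expl_simps [simp del] expl_structure [simp del]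

abbreviation K' :: "(('j, nat, 'g tm set) diagram, ('j, nat, 'g tm set) fam set) smc" where "K' \<equiv> expl (\<iota> 0) (Free \<Sigma> E)"

sublocale K': typed_semicartesian K' by (rule expl_smc)

lemmas K'_simps = expl_simps[where s = "\<iota> 0"]

lemma K_obj_iff: "A \<in> obj K \<longleftrightarrow> 0 \<in> idx A \<and> aitp A" by (simp add: K_simps)

lemma K_arrD: assumes "arr K a"
  shows "a \<in> Hom (source K a) (target K a)" "aitp (source K a)" "aitp (target K a)" "0 \<in> idx (source K a)" "0 \<in> idx (target K a)"
  using K.arr_typed[OF assms] by (simp_all add: K_simps)

lemma ren_obj [simp]: "A \<in> obj K \<Longrightarrow> ren A \<in> obj K'"
  by (simp add: K_simps K'_simps aitp_ren)

lemma renM_typed [simp]: assumes "arr K a"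
  shows "arr K' (renM a)" "source K' (renM a) = ren (source K a)" "target K' (renM a) = ren (target K a)"
proof -
  have "renM a \<in> hom K' (ren (source K a)) (ren (target K a))"
    unfolding K'_simps using renM_Hom K_arrD[OF assms] by blast
  then show "arr K' (renM a)" "source K' (renM a) = ren (source K a)" "target K' (renM a) = ren (target K a)"
    using assms by (simp_all add: K'.hom_iff)
qed

lemma renM_K:
  "arr K a \<Longrightarrow> arr K b \<Longrightarrow> target K a = source K b \<Longrightarrow> renM (comp K b a) = comp K' (renM b) (renM a)"
  "A \<in> obj K \<Longrightarrow> renM (ide K A) = ide K' (ren A)"
  "arr K a \<Longrightarrow> arr K b \<Longrightarrow> renM (tenM K a b) = tenM K' (renM a) (renM b)"
  "A \<in> obj K \<Longrightarrow> B \<in> obj K \<Longrightarrow> ren (tenO K A B) = tenO K' (ren A) (ren B)"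
  "ren (munit K) = munit K'"
  unfolding K_simps K'_simps mem_Collect_eq
  using renM_comp[of a _ _ b] renM_tensor[of a _ _ b] renM_ide K_arrD[of a] K_arrD[of b] by (auto simp: ren_tensor ren_unit)

lemma renM_K_structure:
  "A \<in> obj K \<Longrightarrow> B \<in> obj K \<Longrightarrow> D \<in> obj K \<Longrightarrow> renM (assoc K A B D) = assoc K' (ren A) (ren B) (ren D)"
  "A \<in> obj K \<Longrightarrow> B \<in> obj K \<Longrightarrow> renM (braid K A B) = braid K' (ren A) (ren B)"
  "A \<in> obj K \<Longrightarrow> renM (lunit K A) = lunit K' (ren A)" "A \<in> obj K \<Longrightarrow> renM (runit K A) = runit K' (ren A)"
  by (simp_all only: K_obj_iff expl_structure renM_assoc renM_braid renM_unit)

definition \<phi> :: "(enat, 'g inf_mor, ('j, nat, 'g tm set) diagram, ('j, nat, 'g tm set) fam set) smfunctor" where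
  "\<phi> = \<lparr> fobj = (\<lambda>N. ren (X N)), fmor = (\<lambda>f. renM (mor f)), fmul = (\<lambda>M N. renM (J M N)), funit = renM V \<rparr>"

lemma \<phi>_simps [simp]: "fobj \<phi> N = ren (X N)" "fmor \<phi> f = renM (mor f)" "fmul \<phi> M N = renM (J M N)" "funit \<phi> = renM V"
  by (simp_all add: \<phi>_def)

lemma renM_iso: assumes "arr K a" "arr K b" "source K a = A" "target K a = B" "source K b = B" "target K b = A"
    "comp K b a = ide K A" "comp K a b = ide K B"
  shows "iso_in K' (ren A) (ren B) (renM a)"
proof -
  have o: "A \<in> obj K" "B \<in> obj K" using assms by auto
  show ?thesis
    using renM_K(1)[of a b] renM_K(1)[of b a] assms o by (auto intro!: K'.iso_inI[of _ "renM b"] simp: renM_K(2))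
qed

lemma \<phi>_is_functor: "is_functor FI K' (fobj \<phi>) (fmor \<phi>)"
  unfolding is_functor_def
proof (intro conjI ballI)
  show "category FI" "category K'" by unfold_locales
  show "fobj \<phi> A \<in> obj K'" for A by simp
  show "fmor \<phi> f \<in> hom K' (fobj \<phi> A) (fobj \<phi> B)" if "f \<in> hom FI A B" for A B f
    using that by (elim FI_homE) (simp add: K'.hom_iff)
  show "fmor \<phi> (ide FI A) = ide K' (fobj \<phi> A)" for A by (simp add: FI_comp renM_K)
  show "fmor \<phi> (comp FI g f) = comp K' (fmor \<phi> g) (fmor \<phi> f)" if "f \<in> hom FI A B" "g \<in> hom FI B D" for A B D f g
    using that by (elim FI_homE) (simp add: FI_comp renM_K)
qed

lemma \<phi>_monoidal: "symmetric_monoidal_functor FI K' \<phi>"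
proof (intro symmetric_monoidal_functor.intro FI.symmetric_monoidal_axioms K'.symmetric_monoidal_axioms,
    unfold symmetric_monoidal_functor_axioms_def, intro conjI allI impI)
  show "is_functor FI K' (fobj \<phi>) (fmor \<phi>)" by (rule \<phi>_is_functor)
  show "iso_in K' (munit K') (fobj \<phi> (munit FI)) (funit \<phi>)"
    using renM_iso[of V V' "munit K" "X 0"] by (simp add: renM_K)
  show "iso_in K' (tenO K' (fobj \<phi> A) (fobj \<phi> B)) (fobj \<phi> (tenO FI A B)) (fmul \<phi> A B)" for A B
    using renM_iso[of "J A B" "U A B" "tenO K (X A) (X B)" "X (A + B)"] by (simp add: renM_K)
  show "comp K' (fmul \<phi> A' B') (tenM K' (fmor \<phi> f) (fmor \<phi> g)) = comp K' (fmor \<phi> (tenM FI f g)) (fmul \<phi> A B)"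
    if fg: "f \<in> hom FI A A'" "g \<in> hom FI B B'" for A A' B B' f g
  proof -
    obtain a where a: "f = (A, A', a)" "arr K a" "source K a = X A" "target K a = X A'" by (rule FI_homE[OF fg(1)])
    obtain b where b: "g = (B, B', b)" "arr K b" "source K b = X B" "target K b = X B'" by (rule FI_homE[OF fg(2)])
    have "comp K' (renM (U A B)) (renM (J A B)) = ide K' (tenO K' (ren (X A)) (ren (X B)))"
      using renM_K(1)[of "J A B" "U A B"] by (simp add: renM_K(2,4))
    then show ?thesis using a b by (simp add: FI_comp renM_K)
  qed
  show "comp K' (fmor \<phi> (assoc FI A B D)) (comp K' (fmul \<phi> (tenO FI A B) D) (tenM K' (fmul \<phi> A B) (ide K' (fobj \<phi> D))))
    = comp K' (fmul \<phi> A (tenO FI B D)) (comp K' (tenM K' (ide K' (fobj \<phi> A)) (fmul \<phi> B D)) (assoc K' (fobj \<phi> A) (fobj \<phi> B) (fobj \<phi> D)))" for A B D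
    using arg_cong[OF mor_assoc[of A B D], of renM] by (simp add: renM_K renM_K_structure mor_typed)
  show "comp K' (fmor \<phi> (lunit FI A)) (comp K' (fmul \<phi> (munit FI) A) (tenM K' (funit \<phi>) (ide K' (fobj \<phi> A)))) = lunit K' (fobj \<phi> A)" for A
    using arg_cong[OF mor_unit(1)[of A], of renM] mor_typed(7-9)[of A] by (simp add: renM_K renM_K_structure)
  show "comp K' (fmor \<phi> (runit FI A)) (comp K' (fmul \<phi> A (munit FI)) (tenM K' (ide K' (fobj \<phi> A)) (funit \<phi>))) = runit K' (fobj \<phi> A)" for A
    using arg_cong[OF mor_unit(2)[of A], of renM] mor_typed(10-12)[of A] by (simp add: renM_K renM_K_structure)
  show "comp K' (fmor \<phi> (braid FI A B)) (fmul \<phi> A B) = comp K' (fmul \<phi> B A) (braid K' (fobj \<phi> A) (fobj \<phi> B))" for A B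
    using arg_cong[OF mor_braid[of A B], of renM] by (simp add: renM_K renM_K_structure mor_typed)
qed

text \<open>Every abstract infinite tensor product consists of countably many wires, and these can be numbered.\<close>

lemma \<phi>_surjective: assumes P: "P \<in> obj K'" shows "\<exists>N e. iso_in K' P (fobj \<phi> N) e"
proof -
  have a: "aitp P" and s: "\<iota> 0 \<in> idx P" using P by (simp_all add: K'_simps)
  obtain n \<theta> \<tau> where c: "countable (idx P)" and h: "standard_iso P n \<theta> \<tau>" by (rule aitpE[OF a])
  note t = standard_isoD(1-3)[OF h] and nat = standard_isoD(4)[OF h]
  let ?S = "std_itp (Free \<Sigma> E) (idx P) n"
  have "natural P ?S \<theta>"
    unfolding natural_def using a aitp_std_itp[OF c] t nat by (auto simp: std_itp_prj)
  moreover have "iso_in (Free \<Sigma> E) (ob P F) (ob ?S F) (\<theta> F)" if "F \<in> FinLO (idx P)" for F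
    using t[OF that] that by (auto intro!: iso_inI[of _ "\<tau> F"] simp: std_itp_prj)
  ultimately have 1: "iso_in K' P ?S (fnat P ?S \<theta>)" by (rule fnat_iso)
  note w = wired_std_itp[OF c, of n]
  have "countable (wset ?S (wires_of n))" unfolding w(2) using c by (intro countable_SIGMA) auto
  then obtain N v where v: "inj_on v (wires N)" "v ` wires N = wset ?S (wires_of n)" by (rule wires_label)
  note x = wired_ren[OF X_wired(1)[OF v(1)]]
  have "wset (ren (X N)) ((map v \<circ> wire_list N) \<circ> m') = wset ?S (wires_of n)" using x(2) X_wired(2)[OF v(1)] v(2) by simp
  from rewire_iso[OF w(1) x(1) this, of "\<iota> 0"]
  have 2: "iso_in K' ?S (ren (X N)) (rewire ?S (wires_of n) (ren (X N)) ((map v \<circ> wire_list N) \<circ> m'))" .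
  have "?S \<in> obj K'" using s aitp_std_itp[OF c] by (simp add: K'_simps std_itp_prj)
  then show ?thesis using K'.iso_in_comp[OF 1 2 P] by auto
qed

sublocale equivalence: smc_equivalence FI K' \<phi>
proof (intro smc_equivalence.intro full_faithful_functor.intro full_faithful_functor_axioms.intro \<phi>_monoidal \<phi>_is_functor)
  show "typed_category FI" "typed_category K'" "typed_semicartesian FI" "typed_semicartesian K'" by unfold_locales
  show "\<exists>f\<in>hom FI A B. fmor \<phi> f = g" if "g \<in> hom K' (fobj \<phi> A) (fobj \<phi> B)" for A B g
  proof -
    have "g \<in> Hom (ren (X A)) (ren (X B))" using that by (simp add: K'_simps)
    then obtain a where "a \<in> Hom (X A) (X B)" "renM a = g" using renM_full X_aitp(1) by blast
    then show ?thesis by (intro bexI[of _ "(A, B, a)"]) (simp_all add: FI_simps)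
  qed
  show "f = f'" if ff: "f \<in> hom FI A B" "f' \<in> hom FI A B" "fmor \<phi> f = fmor \<phi> f'" for A B f f'
  proof -
    obtain a where a: "f = (A, B, a)" "a \<in> Hom (X A) (X B)" using ff(1) by (auto simp: FI_simps)
    obtain a' where a': "f' = (A, B, a')" "a' \<in> Hom (X A) (X B)" using ff(2) by (auto simp: FI_simps)
    show ?thesis using renM_faithful[OF a(2) a'(2) X_aitp(1) X_aitp(1)] a a' ff(3) by simp
  qed
  show "\<exists>A\<in>obj FI. \<exists>e. iso_in K' P (fobj \<phi> A) e" if "P \<in> obj K'" for P
    using \<phi>_surjective[OF that] FI_obj by blast
qed

end

theorem proposition5p4:
  fixes \<Sigma> :: "'g signature" and E :: "('g tm \<times> 'g tm) set"
    and split :: "enat \<Rightarrow> enat \<Rightarrow> nat \<Rightarrow> nat + nat"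
    and star :: 'j
  assumes "smt \<Sigma> E"
    and "semicartesian (Free \<Sigma> E)"
    and "cancellative_deletions (Free \<Sigma> E)"
    and "wire_splitting split"
    and "infinite (UNIV :: 'j set)"
  shows "has_itps TYPE('j) (Free_inf split \<Sigma> E)
    \<and> has_itps TYPE('j) (expl star (Free \<Sigma> E))
    \<and> (\<exists>\<phi>. symmetric_monoidal_functor (Free_inf split \<Sigma> E) (expl star (Free \<Sigma> E)) \<phi>
         \<and> is_equivalence (Free_inf split \<Sigma> E) (expl star (Free \<Sigma> E)) (fobj \<phi>) (fmor \<phi>)
         \<and> itp_preserving TYPE('j) (Free_inf split \<Sigma> E) (expl star (Free \<Sigma> E)) \<phi>)"
proof -
  have "infinite (UNIV - {star})" using assms(5) by simp
  then obtain g :: "nat \<Rightarrow> 'j" where g: "inj g" "range g \<subseteq> UNIV - {star}"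
    by (meson infinite_countable_subset)
  \<comment> \<open>The distinguished index \<open>0\<close> has to go to \<open>star\<close>; the remaining indices go anywhere else.\<close>
  define \<iota> where "\<iota> i = (case i of 0 \<Rightarrow> star | Suc k \<Rightarrow> g k)" for i
  have "inj \<iota>"
  proof (rule injI)
    fix x y assume "\<iota> x = \<iota> y"
    then show "x = y" using g by (cases x; cases y) (auto simp: \<iota>_def inj_eq)
  qed
  interpret string_theory_renaming \<Sigma> E split \<iota>
  proof -
    interpret string_theory \<Sigma> E split by (rule string_theory.intro) (fact assms)+
    show "string_theory_renaming \<Sigma> E split \<iota>" by unfold_locales (fact \<open>inj \<iota>\<close>)
  qed
  have star: "\<iota> 0 = star" by (simp add: \<iota>_def)
  have "has_itps TYPE('j) (Free_inf split \<Sigma> E)" by (rule FI_has_itps)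
  moreover have "has_itps TYPE('j) (expl star (Free \<Sigma> E))"
    using equivalence.has_itps_transfer[OF FI_has_itps] unfolding star .
  ultimately show ?thesis
    using \<phi>_monoidal equivalence.full_faithful_equivalence equivalence.itp_preserving unfolding star by blast
qed

end
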